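(* Let $\mathcal{C}$ be an $A$-coring with group-like element $\mathbf{x}$, $B=A^{co\mathcal{C}}$, and assume that ${}_A\mathcal{C}$ is locally projective. Then the following are equivalent: (1) $\mathcal{M}^{\mathcal{C}}$ satisfies the weak structure theorem; (2) ${}_BA$ is flat and $A/B$ is $\mathcal{C}$-Galois; (3) ${}_BA$ is flat and $\beta':=\Psi'_{\mathcal{C}}$ is an isomorphism; (4) ${}_BA$ is flat and for every $A$-generated $M\in\mathcal{M}^{\mathcal{C}}$, $\Psi'_M$ is bijective; (5) for every $M\in\mathcal{M}^{\mathcal{C}}=\sigma[\mathcal{C}_{{}^{*}\mathcal{C}}]$, the $\mathcal{C}$-colinear morphism $\Psi'_M$ is bijective; (6) $\sigma[\mathcal{C}_{{}^{*}\mathcal{C}}]=\mathrm{Gen}(A_{{}^{*}\mathcal{C}})$; (7) ${}_BA$ is flat, $\sigma[\mathcal{C}_{{}^{*}\mathcal{C}}]=\sigma[A_{{}^{*}\mathcal{C}}]$ and $\mathrm{Hom}_{-{}^{*}\mathcal{C}}(A,-):\mathrm{Gen}(A_{{}^{*}\mathcal{C}})\to\mathcal{M}_B$ is fully faithful; (8) $\mathrm{Hom}^{\mathcal{C}}(A,-):\mathcal{M}^{\mathcal{C}}\to\mathcal{M}_B$ is faithful; (9) $A$ is a generator in $\mathcal{M}^{\mathcal{C}}$.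
   Context: Rings are associative with unit and modules are unital. $A$ is a not necessarily commutative ring with $1_A\neq 0$. An $A$-coring is an $A$-bimodule $\mathcal{C}$ with $A$-bilinear coassociative $\Delta_{\mathcal{C}}:\mathcal{C}\to\mathcal{C}\otimes_A\mathcal{C}$, $c\mapsto\sum c_1\otimes_A c_2$, and $A$-bilinear counit $\varepsilon_{\mathcal{C}}:\mathcal{C}\to A$; $\mathbf{x}\in\mathcal{C}$ is group-like if $\Delta_{\mathcal{C}}(\mathbf{x})=\mathbf{x}\otimes_A\mathbf{x}$ and $\varepsilon_{\mathcal{C}}(\mathbf{x})=1_A$. $\mathcal{M}^{\mathcal{C}}$ is the category of right $\mathcal{C}$-comodules: right $A$-modules $M$ with a right $A$-linear coassociative counital coaction $\varrho_M:M\to M\otimes_A\mathcal{C}$, $m\mapsto\sum m_{<0>}\otimes_A m_{<1>}$; morphisms ($\mathcal{C}$-colinear maps) form $\mathrm{Hom}^{\mathcal{C}}(-,-)$. $A$ is a right $\mathcal{C}$-comodule via $a\mapsto\mathbf{x}a\in\mathcal{C}\simeq A\otimes_A\mathcal{C}$. ${}^{*}\mathcal{C}:=\mathrm{Hom}_{A-}(\mathcal{C},A)$ (left $A$-linear maps) is a ring with product $(f\cdot g)(c)=\sum g(c_1f(c_2))$ and unit $\varepsilon_{\mathcal{C}}$. Every right $\mathcal{C}$-comodule is a right ${}^{*}\mathcal{C}$-module by $mg=\sum m_{<0>}g(m_{<1>})$; in particular $a\leftharpoonup g=g(\mathbf{x}a)$ on $A$. For $M\in\mathcal{M}^{\mathcal{C}}$,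 $M^{co\mathcal{C}}:=\{m\in M\mid\varrho_M(m)=m\otimes_A\mathbf{x}\}$, a right module over the subring $B:=A^{co\mathcal{C}}=\{b\in A\mid b\mathbf{x}=\mathbf{x}b\}$ of $A$. Put $\Psi_M:M^{co\mathcal{C}}\otimes_BA\to M$, $m\otimes a\mapsto ma$, and $\Psi'_M:\mathrm{Hom}^{\mathcal{C}}(A,M)\otimes_BA\to M$, $f\otimes a\mapsto f(a)$. $\mathcal{M}^{\mathcal{C}}$ satisfies the weak structure theorem if $\Psi_M$ is an isomorphism for all $M\in\mathcal{M}^{\mathcal{C}}$. $A/B$ is $\mathcal{C}$-Galois if $\beta:A\otimes_BA\to\mathcal{C}$, $\widetilde{a}\otimes a\mapsto\widetilde{a}\mathbf{x}a$, is bijective. For a right module $W$ over a ring $T$, $\mathrm{Gen}(W_T)$ is the class (full subcategory) of $W$-generated modules (quotients of direct sums of copies of $W$), and $\sigma[W_T]$ is the full subcategory of $W$-subgenerated modules (isomorphic to submodules of $W$-generated modules). A left $A$-module $W$ is locally projective (Zimmermann-Huisgen) if for every surjective $A$-linear $\pi:L\to N$, every $A$-linear $g:W\to N$ and every finitely generated submodule $\iota:F_0\hookrightarrow W$ there is an $A$-linear $g':W\to L$ with $\pi g'\iota=g\iota$. When ${}_A\mathcal{C}$ is locally projective, $\mathcal{M}^{\mathcal{C}}$ is identified with the full subcategory $\sigma[\mathcal{C}_{{}^{*}\mathcal{C}}]$ of the category of right ${}^{*}\mathcal{C}$-modules. $\mathcal{M}_B$ is the category of right $B$-modules.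
   Formalization: In (4), "A-generated" is read as generated by A as a right A-module, which holds for every M; read as generated by the comodule A, (4) does not imply (2): take A = k a field, C = k{e,g} with e, g group-like, x = e. *)

theory Defs
  imports "HOL-Algebra.Module" "HOL-Algebra.Free_Abelian_Groups" "HOL-Library.Equipollence"
begin

section \<open>One-sided modules over noncommutative rings\<close>

text \<open>
  Left and right modules over a ring \<open>R\<close> are both records of type \<^type>\<open>module\<close>; the fields
  \<^const>\<open>monoid.mult\<close> and \<^const>\<open>one\<close> of such a record carry no meaning.  For a right module \<open>M\<close>
  the term \<open>r \<odot>\<^bsub>M\<^esub> m\<close> stands for the product \<open>m r\<close>, which is written \<open>m \<triangleleft>\<^bsub>M\<^esub> r\<close> below.
\<close>

abbreviation (input) ract :: "('r, 'm, 'x) module_scheme \<Rightarrow> 'm \<Rightarrow> 'r \<Rightarrow> 'm"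
    (infixl \<open>\<triangleleft>\<index>\<close> 70) where
  "m \<triangleleft>\<^bsub>M\<^esub> r \<equiv> r \<odot>\<^bsub>M\<^esub> m"

locale left_module = R?: ring R + M?: abelian_group M for R (structure) and M (structure) +
  assumes lact_closed: "\<lbrakk>r \<in> carrier R; m \<in> carrier M\<rbrakk> \<Longrightarrow> r \<odot>\<^bsub>M\<^esub> m \<in> carrier M"
    and lact_l_distr: "\<lbrakk>r \<in> carrier R; s \<in> carrier R; m \<in> carrier M\<rbrakk>
          \<Longrightarrow> (r \<oplus> s) \<odot>\<^bsub>M\<^esub> m = r \<odot>\<^bsub>M\<^esub> m \<oplus>\<^bsub>M\<^esub> s \<odot>\<^bsub>M\<^esub> m"
    and lact_r_distr: "\<lbrakk>r \<in> carrier R; m \<in> carrier M; n \<in> carrier M\<rbrakk>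
          \<Longrightarrow> r \<odot>\<^bsub>M\<^esub> (m \<oplus>\<^bsub>M\<^esub> n) = r \<odot>\<^bsub>M\<^esub> m \<oplus>\<^bsub>M\<^esub> r \<odot>\<^bsub>M\<^esub> n"
    and lact_assoc: "\<lbrakk>r \<in> carrier R; s \<in> carrier R; m \<in> carrier M\<rbrakk>
          \<Longrightarrow> (r \<otimes> s) \<odot>\<^bsub>M\<^esub> m = r \<odot>\<^bsub>M\<^esub> (s \<odot>\<^bsub>M\<^esub> m)"
    and lact_one: "m \<in> carrier M \<Longrightarrow> \<one> \<odot>\<^bsub>M\<^esub> m = m"

locale right_module = R?: ring R + M?: abelian_group M for R (structure) and M (structure) +
  assumes ract_closed: "\<lbrakk>r \<in> carrier R; m \<in> carrier M\<rbrakk> \<Longrightarrow> m \<triangleleft>\<^bsub>M\<^esub> r \<in> carrier M"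
    and ract_l_distr: "\<lbrakk>r \<in> carrier R; m \<in> carrier M; n \<in> carrier M\<rbrakk>
          \<Longrightarrow> (m \<oplus>\<^bsub>M\<^esub> n) \<triangleleft>\<^bsub>M\<^esub> r = m \<triangleleft>\<^bsub>M\<^esub> r \<oplus>\<^bsub>M\<^esub> n \<triangleleft>\<^bsub>M\<^esub> r"
    and ract_r_distr: "\<lbrakk>r \<in> carrier R; s \<in> carrier R; m \<in> carrier M\<rbrakk>
          \<Longrightarrow> m \<triangleleft>\<^bsub>M\<^esub> (r \<oplus> s) = m \<triangleleft>\<^bsub>M\<^esub> r \<oplus>\<^bsub>M\<^esub> m \<triangleleft>\<^bsub>M\<^esub> s"
    and ract_assoc: "\<lbrakk>r \<in> carrier R; s \<in> carrier R; m \<in> carrier M\<rbrakk>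
          \<Longrightarrow> m \<triangleleft>\<^bsub>M\<^esub> (r \<otimes> s) = (m \<triangleleft>\<^bsub>M\<^esub> r) \<triangleleft>\<^bsub>M\<^esub> s"
    and ract_one: "m \<in> carrier M \<Longrightarrow> m \<triangleleft>\<^bsub>M\<^esub> \<one> = m"

definition with_smult :: "('m, 'x) ring_scheme \<Rightarrow> ('r \<Rightarrow> 'm \<Rightarrow> 'm) \<Rightarrow> ('r, 'm) module" where
  "with_smult G act =
     \<lparr>carrier = carrier G, monoid.mult = monoid.mult G, one = one G,
      ring.zero = ring.zero G, add = add G, smult = act\<rparr>"

definition left_regular :: "('a, 'x) ring_scheme \<Rightarrow> ('a, 'a) module" where
  "left_regular A = with_smult A (\<lambda>r a. r \<otimes>\<^bsub>A\<^esub> a)"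

definition right_regular :: "('a, 'x) ring_scheme \<Rightarrow> ('a, 'a) module" where
  "right_regular A = with_smult A (\<lambda>r a. a \<otimes>\<^bsub>A\<^esub> r)"

text \<open>
  Linear maps, for left and for right modules alike.  Maps are extensional, so that equality
  of maps is equality of functions; composition is \<^const>\<open>compose\<close>.
\<close>

definition lin_hom ::
    "('r, 'x) ring_scheme \<Rightarrow> ('r, 'm, 'y) module_scheme \<Rightarrow> ('r, 'n, 'z) module_scheme \<Rightarrow> ('m \<Rightarrow> 'n) set"
  where
  "lin_hom R M N = {f \<in> carrier M \<rightarrow>\<^sub>E carrier N.
     (\<forall>m\<in>carrier M. \<forall>m'\<in>carrier M. f (m \<oplus>\<^bsub>M\<^esub> m') = f m \<oplus>\<^bsub>N\<^esub> f m') \<and>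
     (\<forall>r\<in>carrier R. \<forall>m\<in>carrier M. f (r \<odot>\<^bsub>M\<^esub> m) = r \<odot>\<^bsub>N\<^esub> f m)}"


section \<open>Tensor products\<close>

text \<open>
  \<open>M \<otimes>\<^sub>R N\<close> for a right module \<open>M\<close> and a left module \<open>N\<close>: the free abelian group on
  \<open>M \<times> N\<close> modulo the usual relations.  Its elements are cosets of formal integer combinations.
\<close>

definition tensor_relations ::
    "('r, 'x) ring_scheme \<Rightarrow> ('r, 'm, 'y) module_scheme \<Rightarrow> ('r, 'n, 'z) module_scheme
     \<Rightarrow> ('m \<times> 'n \<Rightarrow>\<^sub>0 int) set" where
  "tensor_relations R M N =
     {frag_of (m \<oplus>\<^bsub>M\<^esub> m', n) - frag_of (m, n) - frag_of (m', n) | m m' n.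
        m \<in> carrier M \<and> m' \<in> carrier M \<and> n \<in> carrier N} \<union>
     {frag_of (m, n \<oplus>\<^bsub>N\<^esub> n') - frag_of (m, n) - frag_of (m, n') | m n n'.
        m \<in> carrier M \<and> n \<in> carrier N \<and> n' \<in> carrier N} \<union>
     {frag_of (m \<triangleleft>\<^bsub>M\<^esub> r, n) - frag_of (m, r \<odot>\<^bsub>N\<^esub> n) | m r n.
        m \<in> carrier M \<and> r \<in> carrier R \<and> n \<in> carrier N}"

definition tensor_kernel ::
    "('r, 'x) ring_scheme \<Rightarrow> ('r, 'm, 'y) module_scheme \<Rightarrow> ('r, 'n, 'z) module_scheme
     \<Rightarrow> ('m \<times> 'n \<Rightarrow>\<^sub>0 int) set" where
  "tensor_kernel R M N =
     generate (free_Abelian_group (carrier M \<times> carrier N)) (tensor_relations R M N)"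

definition tensor ::
    "('r, 'x) ring_scheme \<Rightarrow> ('r, 'm, 'y) module_scheme \<Rightarrow> ('r, 'n, 'z) module_scheme
     \<Rightarrow> ('m \<times> 'n \<Rightarrow>\<^sub>0 int) set ring" where
  "tensor R M N =
     (let Q = free_Abelian_group (carrier M \<times> carrier N) Mod tensor_kernel R M N
      in \<lparr>carrier = carrier Q, monoid.mult = undefined, one = undefined,
          ring.zero = \<one>\<^bsub>Q\<^esub>, add = (\<otimes>\<^bsub>Q\<^esub>)\<rparr>)"

definition tens ::
    "('r, 'x) ring_scheme \<Rightarrow> ('r, 'm, 'y) module_scheme \<Rightarrow> ('r, 'n, 'z) module_scheme
     \<Rightarrow> 'm \<Rightarrow> 'n \<Rightarrow> ('m \<times> 'n \<Rightarrow>\<^sub>0 int) set" where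
  "tens R M N m n =
     tensor_kernel R M N #>\<^bsub>free_Abelian_group (carrier M \<times> carrier N)\<^esub> frag_of (m, n)"

text \<open>
  The map \<open>\<Sum> m\<^sub>i \<otimes> n\<^sub>i \<mapsto> \<Sum> \<phi> m\<^sub>i n\<^sub>i\<close> into the abelian group \<open>G\<close>.  It does not depend on the chosen
  representative whenever \<open>\<phi>\<close> is biadditive and balanced, and is only used in such cases.
\<close>

definition tensor_lift ::
    "('g, 'x) ring_scheme \<Rightarrow> ('m \<Rightarrow> 'n \<Rightarrow> 'g) \<Rightarrow> ('m \<times> 'n \<Rightarrow>\<^sub>0 int) set \<Rightarrow> 'g" where
  "tensor_lift G \<phi> X =
     (let t = (SOME t. t \<in> X)
      in \<Oplus>\<^bsub>G\<^esub>p\<in>Poly_Mapping.keys t. [Poly_Mapping.lookup t p] \<cdot>\<^bsub>G\<^esub> \<phi> (fst p) (snd p))"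

text \<open>
  If \<open>N\<close> is a bimodule, with left module \<open>N\<close> and right module \<open>N'\<close>, then \<open>M \<otimes>\<^sub>R N\<close> is a right module
  via \<open>(m \<otimes> n) s = m \<otimes> n s\<close>.  Dually \<open>s (m \<otimes> n) = s m \<otimes> n\<close> if \<open>M\<close> is a bimodule with left module \<open>M'\<close>.
\<close>

definition tensor_rmod ::
    "('r, 'x) ring_scheme \<Rightarrow> ('r, 'm, 'y) module_scheme \<Rightarrow> ('r, 'n, 'z) module_scheme
     \<Rightarrow> ('s, 'n, 'w) module_scheme \<Rightarrow> ('s, ('m \<times> 'n \<Rightarrow>\<^sub>0 int) set) module" where
  "tensor_rmod R M N N' = with_smult (tensor R M N)
     (\<lambda>s. tensor_lift (tensor R M N) (\<lambda>m n. tens R M N m (n \<triangleleft>\<^bsub>N'\<^esub> s)))"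

definition tensor_lmod ::
    "('r, 'x) ring_scheme \<Rightarrow> ('s, 'm, 'w) module_scheme \<Rightarrow> ('r, 'm, 'y) module_scheme
     \<Rightarrow> ('r, 'n, 'z) module_scheme \<Rightarrow> ('s, ('m \<times> 'n \<Rightarrow>\<^sub>0 int) set) module" where
  "tensor_lmod R M' M N = with_smult (tensor R M N)
     (\<lambda>s. tensor_lift (tensor R M N) (\<lambda>m n. tens R M N (s \<odot>\<^bsub>M'\<^esub> m) n))"


section \<open>Flatness, local projectivity, generation\<close>

text \<open>
  Notions that quantify over all modules do so over all modules carried by subsets of a
  type \<open>'u\<close>, the universe.  If \<open>'u\<close> is infinite and at least as large as the ring, flatness
  is independent of \<open>'u\<close> (it can be tested on right ideals); if \<open>'u\<close> is moreover at least as large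
  as \<open>W\<close>, so is local projectivity (it can be tested on a free cover of \<open>W\<close>).
\<close>

definition flat :: "'u itself \<Rightarrow> ('r, 'x) ring_scheme \<Rightarrow> ('r, 'm, 'y) module_scheme \<Rightarrow> bool" where
  "flat _ R M \<longleftrightarrow> left_module R M \<and>
     (\<forall>(K :: ('r, 'u) module) (L :: ('r, 'u) module). \<forall>j\<in>lin_hom R K L.
        right_module R K \<and> right_module R L \<and> inj_on j (carrier K) \<longrightarrow>
        inj_on (tensor_lift (tensor R L M) (\<lambda>k m. tens R L M (j k) m)) (carrier (tensor R K M)))"

definition span :: "('r, 'x) ring_scheme \<Rightarrow> ('r, 'm, 'y) module_scheme \<Rightarrow> 'm set \<Rightarrow> 'm set" where
  "span R M S = \<Inter>{H. submodule H R M \<and> S \<subseteq> H}"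

definition locally_projective ::
    "'u itself \<Rightarrow> ('r, 'x) ring_scheme \<Rightarrow> ('r, 'm, 'y) module_scheme \<Rightarrow> bool" where
  "locally_projective _ R W \<longleftrightarrow> left_module R W \<and>
     (\<forall>(L :: ('r, 'u) module) (N :: ('r, 'u) module). \<forall>\<pi>\<in>lin_hom R L N. \<forall>g\<in>lin_hom R W N. \<forall>S.
        left_module R L \<and> left_module R N \<and> \<pi> ` carrier L = carrier N \<and>
        finite S \<and> S \<subseteq> carrier W \<longrightarrow>
        (\<exists>g'\<in>lin_hom R W L. \<forall>w\<in>span R W S. \<pi> (g' w) = g w))"

definition direct_power :: "'i set \<Rightarrow> ('t, 'w, 'x) module_scheme \<Rightarrow> ('t, 'i \<Rightarrow> 'w) module" where
  "direct_power I W =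
     \<lparr>carrier = carrier (sum_group I (\<lambda>_. add_monoid W)), monoid.mult = undefined, one = undefined,
      ring.zero = \<one>\<^bsub>sum_group I (\<lambda>_. add_monoid W)\<^esub>,
      add = (\<otimes>\<^bsub>sum_group I (\<lambda>_. add_monoid W)\<^esub>),
      smult = (\<lambda>t w. \<lambda>i\<in>I. t \<odot>\<^bsub>W\<^esub> w i)\<rparr>"

text \<open>
  The index type \<open>'w \<Rightarrow> 'm\<close> is large enough for arbitrary index sets: of several copies of \<open>W\<close>
  that are mapped to \<open>M\<close> in the same way, all but one can be dropped.
\<close>

definition generated ::
    "('t, 'x) ring_scheme \<Rightarrow> ('t, 'w, 'y) module_scheme \<Rightarrow> ('t, 'm, 'z) module_scheme \<Rightarrow> bool" where
  "generated T W M \<longleftrightarrow> right_module T M \<and>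
     (\<exists>I :: ('w \<Rightarrow> 'm) set. \<exists>p\<in>lin_hom T (direct_power I W) M.
        p ` carrier (direct_power I W) = carrier M)"

text \<open>
  The carrier type of the ambient module \<open>N\<close> is no restriction: every element of \<open>M\<close> lies in the sum of
  finitely many images of \<open>W\<close> in \<open>N\<close>, so that \<open>N\<close> may be replaced by a quotient of the
  direct sum of copies of \<open>W\<close> indexed by \<open>M \<times> \<nat>\<close>, whose elements are cosets.
\<close>

definition subgenerated ::
    "('t, 'x) ring_scheme \<Rightarrow> ('t, 'w, 'y) module_scheme \<Rightarrow> ('t, 'm, 'z) module_scheme \<Rightarrow> bool" where
  "subgenerated T W M \<longleftrightarrow> right_module T M \<and>
     (\<exists>(N :: ('t, ('m \<times> nat \<Rightarrow> 'w) set) module). \<exists>j\<in>lin_hom T M N.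
        generated T W N \<and> inj_on j (carrier M))"

definition Gen ::
    "'u itself \<Rightarrow> ('t, 'x) ring_scheme \<Rightarrow> ('t, 'w, 'y) module_scheme \<Rightarrow> ('t, 'u) module set" where
  "Gen _ T W = {M. generated T W M}"

definition sigma_category ::
    "'u itself \<Rightarrow> ('t, 'x) ring_scheme \<Rightarrow> ('t, 'w, 'y) module_scheme \<Rightarrow> ('t, 'u) module set" where
  "sigma_category _ T W = {M. subgenerated T W M}"


section \<open>Corings and comodules\<close>

text \<open>The underlying module of a coring record is its left module; \<open>rmod\<close> is its right module.\<close>

record ('a, 'c) coring = "('a, 'c) module" +
  rsmult :: "'a \<Rightarrow> 'c \<Rightarrow> 'c"
  comult :: "'c \<Rightarrow> ('c \<times> 'c \<Rightarrow>\<^sub>0 int) set"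
  counit :: "'c \<Rightarrow> 'a"

definition rmod :: "('a, 'c) coring \<Rightarrow> ('a, 'c) module" where
  "rmod C = with_smult C (rsmult C)"

record ('a, 'c, 'm) comodule = "('a, 'm) module" +
  coact :: "'m \<Rightarrow> ('m \<times> 'c \<Rightarrow>\<^sub>0 int) set"

definition with_coact ::
    "('a, 'm, 'x) module_scheme \<Rightarrow> ('m \<Rightarrow> ('m \<times> 'c \<Rightarrow>\<^sub>0 int) set) \<Rightarrow> ('a, 'c, 'm) comodule" where
  "with_coact M \<rho> =
     \<lparr>carrier = carrier M, monoid.mult = monoid.mult M, one = one M,
      ring.zero = ring.zero M, add = add M, smult = smult M, coact = \<rho>\<rparr>"

abbreviation (input) tensor_C ::
    "('a, 'x) ring_scheme \<Rightarrow> ('a, 'c) coring \<Rightarrow> ('a, 'm, 'y) module_scheme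
     \<Rightarrow> ('a, ('m \<times> 'c \<Rightarrow>\<^sub>0 int) set) module" where
  "tensor_C A C M \<equiv> tensor_rmod A M C (rmod C)"

abbreviation (input) C_tensor_C ::
    "('a, 'x) ring_scheme \<Rightarrow> ('a, 'c) coring \<Rightarrow> ('a, ('c \<times> 'c \<Rightarrow>\<^sub>0 int) set) module" where
  "C_tensor_C A C \<equiv> tensor_lmod A C (rmod C) C"

text \<open>The isomorphism \<open>(M \<otimes>\<^sub>A C) \<otimes>\<^sub>A C \<simeq> M \<otimes>\<^sub>A (C \<otimes>\<^sub>A C)\<close>.\<close>

definition tensor_assoc ::
    "('a, 'x) ring_scheme \<Rightarrow> ('a, 'c) coring \<Rightarrow> ('a, 'm, 'y) module_scheme
     \<Rightarrow> (('m \<times> 'c \<Rightarrow>\<^sub>0 int) set \<times> 'c \<Rightarrow>\<^sub>0 int) set \<Rightarrow> ('m \<times> ('c \<times> 'c \<Rightarrow>\<^sub>0 int) set \<Rightarrow>\<^sub>0 int) set"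
  where
  "tensor_assoc A C M =
     tensor_lift (tensor A M (C_tensor_C A C))
       (\<lambda>t d. tensor_lift (tensor A M (C_tensor_C A C))
          (\<lambda>m c. tens A M (C_tensor_C A C) m (tens A (rmod C) C c d)) t)"

definition coassociative ::
    "('a, 'x) ring_scheme \<Rightarrow> ('a, 'c) coring \<Rightarrow> ('a, 'm, 'y) module_scheme
     \<Rightarrow> ('m \<Rightarrow> ('m \<times> 'c \<Rightarrow>\<^sub>0 int) set) \<Rightarrow> bool" where
  "coassociative A C M \<rho> \<longleftrightarrow>
     (\<forall>m\<in>carrier M.
        tensor_assoc A C M
          (tensor_lift (tensor A (tensor_C A C M) C)
             (\<lambda>m\<^sub>0 m\<^sub>1. tens A (tensor_C A C M) C (\<rho> m\<^sub>0) m\<^sub>1) (\<rho> m)) =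
        tensor_lift (tensor A M (C_tensor_C A C))
          (\<lambda>m\<^sub>0 m\<^sub>1. tens A M (C_tensor_C A C) m\<^sub>0 (comult C m\<^sub>1)) (\<rho> m))"

locale coring =
  fixes A :: "('a, 'x) ring_scheme" (structure) and C :: "('a, 'c) coring"
  assumes left: "left_module A C"
    and right: "right_module A (rmod C)"
    and bimodule: "\<lbrakk>a \<in> carrier A; b \<in> carrier A; c \<in> carrier C\<rbrakk>
          \<Longrightarrow> (a \<odot>\<^bsub>C\<^esub> c) \<triangleleft>\<^bsub>rmod C\<^esub> b = a \<odot>\<^bsub>C\<^esub> (c \<triangleleft>\<^bsub>rmod C\<^esub> b)"
    and comult_left: "restrict (comult C) (carrier C) \<in> lin_hom A C (C_tensor_C A C)"
    and comult_right: "restrict (comult C) (carrier C) \<in> lin_hom A (rmod C) (tensor_C A C (rmod C))"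
    and counit_left: "restrict (counit C) (carrier C) \<in> lin_hom A C (left_regular A)"
    and counit_right: "restrict (counit C) (carrier C) \<in> lin_hom A (rmod C) (right_regular A)"
    and coassoc: "coassociative A C (rmod C) (comult C)"
    and counital_left: "c \<in> carrier C
          \<Longrightarrow> tensor_lift C (\<lambda>c\<^sub>1 c\<^sub>2. counit C c\<^sub>1 \<odot>\<^bsub>C\<^esub> c\<^sub>2) (comult C c) = c"
    and counital_right: "c \<in> carrier C
          \<Longrightarrow> tensor_lift C (\<lambda>c\<^sub>1 c\<^sub>2. c\<^sub>1 \<triangleleft>\<^bsub>rmod C\<^esub> counit C c\<^sub>2) (comult C c) = c"

definition group_like :: "('a, 'x) ring_scheme \<Rightarrow> ('a, 'c) coring \<Rightarrow> 'c \<Rightarrow> bool" where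
  "group_like A C x \<longleftrightarrow>
     x \<in> carrier C \<and> comult C x = tens A (rmod C) C x x \<and> counit C x = \<one>\<^bsub>A\<^esub>"

locale comodule =
  fixes A :: "('a, 'x) ring_scheme" (structure) and C :: "('a, 'c) coring"
    and M :: "('a, 'c, 'm) comodule"
  assumes right: "right_module A M"
    and coact_linear: "restrict (coact M) (carrier M) \<in> lin_hom A M (tensor_C A C M)"
    and coassoc: "coassociative A C M (coact M)"
    and counital: "m \<in> carrier M
          \<Longrightarrow> tensor_lift M (\<lambda>m\<^sub>0 m\<^sub>1. m\<^sub>0 \<triangleleft>\<^bsub>M\<^esub> counit C m\<^sub>1) (coact M m) = m"

definition colin_hom ::
    "('a, 'x) ring_scheme \<Rightarrow> ('a, 'c) coring \<Rightarrow> ('a, 'c, 'm) comodule \<Rightarrow> ('a, 'c, 'n) comodule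
     \<Rightarrow> ('m \<Rightarrow> 'n) set" where
  "colin_hom A C M N = {f \<in> lin_hom A M N. \<forall>m\<in>carrier M.
     coact N (f m) = tensor_lift (tensor A N C) (\<lambda>m\<^sub>0 m\<^sub>1. tens A N C (f m\<^sub>0) m\<^sub>1) (coact M m)}"

definition colin_iso ::
    "('a, 'x) ring_scheme \<Rightarrow> ('a, 'c) coring \<Rightarrow> ('a, 'c, 'm) comodule \<Rightarrow> ('a, 'c, 'n) comodule
     \<Rightarrow> ('m \<Rightarrow> 'n) \<Rightarrow> bool" where
  "colin_iso A C M N f \<longleftrightarrow> f \<in> colin_hom A C M N \<and>
     (\<exists>g\<in>colin_hom A C N M. (\<forall>m\<in>carrier M. g (f m) = m) \<and> (\<forall>n\<in>carrier N. f (g n) = n))"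

definition coring_comodule :: "('a, 'c) coring \<Rightarrow> ('a, 'c, 'c) comodule" where
  "coring_comodule C = with_coact (rmod C) (comult C)"

text \<open>\<open>A\<close> as a right comodule: \<open>a \<mapsto> \<^bold>x a\<close>, where \<open>c \<in> C\<close> corresponds to \<open>1 \<otimes> c \<in> A \<otimes>\<^sub>A C\<close>.\<close>

definition base_comodule ::
    "('a, 'x) ring_scheme \<Rightarrow> ('a, 'c) coring \<Rightarrow> 'c \<Rightarrow> ('a, 'c, 'a) comodule" where
  "base_comodule A C x =
     with_coact (right_regular A) (\<lambda>a. tens A (right_regular A) C \<one>\<^bsub>A\<^esub> (x \<triangleleft>\<^bsub>rmod C\<^esub> a))"

section \<open>The dual ring and its modules\<close>

definition dual_ring :: "('a, 'x) ring_scheme \<Rightarrow> ('a, 'c) coring \<Rightarrow> ('c \<Rightarrow> 'a) ring" where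
  "dual_ring A C =
     \<lparr>carrier = lin_hom A C (left_regular A),
      monoid.mult = (\<lambda>f g. \<lambda>c\<in>carrier C.
        tensor_lift A (\<lambda>c\<^sub>1 c\<^sub>2. g (c\<^sub>1 \<triangleleft>\<^bsub>rmod C\<^esub> f c\<^sub>2)) (comult C c)),
      one = restrict (counit C) (carrier C),
      ring.zero = (\<lambda>c\<in>carrier C. \<zero>\<^bsub>A\<^esub>),
      add = (\<lambda>f g. \<lambda>c\<in>carrier C. f c \<oplus>\<^bsub>A\<^esub> g c)\<rparr>"

definition dual_module :: "('a, 'c, 'm) comodule \<Rightarrow> ('c \<Rightarrow> 'a, 'm) module" where
  "dual_module M =
     with_smult M (\<lambda>g m. tensor_lift M (\<lambda>m\<^sub>0 m\<^sub>1. m\<^sub>0 \<triangleleft>\<^bsub>M\<^esub> g m\<^sub>1) (coact M m))"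


section \<open>Coinvariants and the structure maps\<close>

definition coinv ::
    "('a, 'x) ring_scheme \<Rightarrow> ('a, 'c) coring \<Rightarrow> 'c \<Rightarrow> ('a, 'c, 'm) comodule \<Rightarrow> 'm set" where
  "coinv A C x M = {m \<in> carrier M. coact M m = tens A M C m x}"

definition coinv_ring ::
    "('a, 'x) ring_scheme \<Rightarrow> ('a, 'c) coring \<Rightarrow> 'c \<Rightarrow> ('a, 'x) ring_scheme" where
  "coinv_ring A C x = A\<lparr>carrier := coinv A C x (base_comodule A C x)\<rparr>"

definition coinv_module ::
    "('a, 'x) ring_scheme \<Rightarrow> ('a, 'c) coring \<Rightarrow> 'c \<Rightarrow> ('a, 'c, 'm) comodule \<Rightarrow> ('a, 'm) module" where
  "coinv_module A C x M = with_smult (M\<lparr>carrier := coinv A C x M\<rparr>) (smult M)"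

text \<open>
  A group \<open>H\<close> of maps from \<open>A\<close> to \<open>M\<close>, as a right module via \<open>(f b) a = f (b a)\<close>; the cases of
  interest are \<open>H = Hom\<^sup>C(A, M)\<close> and, over the dual ring \<open>T\<close> of \<open>C\<close>, \<open>H = Hom\<^sub>T(A, M)\<close>,
  both as right \<open>B\<close>-modules.
\<close>

definition hom_module ::
    "('a, 'x) ring_scheme \<Rightarrow> ('m, 'y) ring_scheme \<Rightarrow> ('a \<Rightarrow> 'm) set \<Rightarrow> ('a, 'a \<Rightarrow> 'm) module" where
  "hom_module A M H =
     \<lparr>carrier = H, monoid.mult = undefined, one = undefined,
      ring.zero = (\<lambda>a\<in>carrier A. \<zero>\<^bsub>M\<^esub>),
      add = (\<lambda>f g. \<lambda>a\<in>carrier A. f a \<oplus>\<^bsub>M\<^esub> g a),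
      smult = (\<lambda>b f. \<lambda>a\<in>carrier A. f (b \<otimes>\<^bsub>A\<^esub> a))\<rparr>"

definition colin_hom_module ::
    "('a, 'x) ring_scheme \<Rightarrow> ('a, 'c) coring \<Rightarrow> 'c \<Rightarrow> ('a, 'c, 'm) comodule
     \<Rightarrow> ('a, 'a \<Rightarrow> 'm) module" where
  "colin_hom_module A C x M = hom_module A M (colin_hom A C (base_comodule A C x) M)"

definition dual_hom_module ::
    "('a, 'x) ring_scheme \<Rightarrow> ('a, 'c) coring \<Rightarrow> 'c \<Rightarrow> ('c \<Rightarrow> 'a, 'm) module
     \<Rightarrow> ('a, 'a \<Rightarrow> 'm) module" where
  "dual_hom_module A C x N =
     hom_module A N (lin_hom (dual_ring A C) (dual_module (base_comodule A C x)) N)"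

text \<open>
  The comodule \<open>N \<otimes>\<^sub>B A\<close> of a right \<open>B\<close>-module \<open>N\<close>, with coaction \<open>n \<otimes> a \<mapsto> (n \<otimes> 1) \<otimes> \<^bold>x a\<close>.
\<close>

definition induced_comodule ::
    "('a, 'x) ring_scheme \<Rightarrow> ('a, 'c) coring \<Rightarrow> 'c \<Rightarrow> ('a, 'n) module
     \<Rightarrow> ('a, 'c, ('n \<times> 'a \<Rightarrow>\<^sub>0 int) set) comodule" where
  "induced_comodule A C x N =
     (let B = coinv_ring A C x;
          T = tensor_rmod B N (left_regular A) (right_regular A)
      in with_coact T (tensor_lift (tensor A T C)
           (\<lambda>n a. tens A T C (tens B N (left_regular A) n \<one>\<^bsub>A\<^esub>) (x \<triangleleft>\<^bsub>rmod C\<^esub> a))))"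

definition \<Psi> ::
    "('a, 'x) ring_scheme \<Rightarrow> ('a, 'c) coring \<Rightarrow> 'c \<Rightarrow> ('a, 'c, 'm) comodule
     \<Rightarrow> ('m \<times> 'a \<Rightarrow>\<^sub>0 int) set \<Rightarrow> 'm" where
  "\<Psi> A C x M =
     restrict (tensor_lift M (\<lambda>m a. m \<triangleleft>\<^bsub>M\<^esub> a))
       (carrier (induced_comodule A C x (coinv_module A C x M)))"

definition \<Psi>' ::
    "('a, 'x) ring_scheme \<Rightarrow> ('a, 'c) coring \<Rightarrow> 'c \<Rightarrow> ('a, 'c, 'm) comodule
     \<Rightarrow> (('a \<Rightarrow> 'm) \<times> 'a \<Rightarrow>\<^sub>0 int) set \<Rightarrow> 'm" where
  "\<Psi>' A C x M =
     restrict (tensor_lift M (\<lambda>f a. f a))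
       (carrier (induced_comodule A C x (colin_hom_module A C x M)))"

definition \<Psi>_iso ::
    "('a, 'x) ring_scheme \<Rightarrow> ('a, 'c) coring \<Rightarrow> 'c \<Rightarrow> ('a, 'c, 'm) comodule \<Rightarrow> bool" where
  "\<Psi>_iso A C x M \<longleftrightarrow>
     colin_iso A C (induced_comodule A C x (coinv_module A C x M)) M (\<Psi> A C x M)"

definition \<Psi>'_iso ::
    "('a, 'x) ring_scheme \<Rightarrow> ('a, 'c) coring \<Rightarrow> 'c \<Rightarrow> ('a, 'c, 'm) comodule \<Rightarrow> bool" where
  "\<Psi>'_iso A C x M \<longleftrightarrow>
     colin_iso A C (induced_comodule A C x (colin_hom_module A C x M)) M (\<Psi>' A C x M)"

definition \<Psi>'_bijective ::
    "('a, 'x) ring_scheme \<Rightarrow> ('a, 'c) coring \<Rightarrow> 'c \<Rightarrow> ('a, 'c, 'm) comodule \<Rightarrow> bool" where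
  "\<Psi>'_bijective A C x M \<longleftrightarrow>
     bij_betw (\<Psi>' A C x M) (carrier (induced_comodule A C x (colin_hom_module A C x M)))
       (carrier M)"

definition weak_structure_theorem ::
    "'u itself \<Rightarrow> ('a, 'x) ring_scheme \<Rightarrow> ('a, 'c) coring \<Rightarrow> 'c \<Rightarrow> bool" where
  "weak_structure_theorem _ A C x \<longleftrightarrow>
     (\<forall>M :: ('a, 'c, 'u) comodule. comodule A C M \<longrightarrow> \<Psi>_iso A C x M)"

definition galois :: "('a, 'x) ring_scheme \<Rightarrow> ('a, 'c) coring \<Rightarrow> 'c \<Rightarrow> bool" where
  "galois A C x \<longleftrightarrow>
     bij_betw (tensor_lift C (\<lambda>a' a. (a' \<odot>\<^bsub>C\<^esub> x) \<triangleleft>\<^bsub>rmod C\<^esub> a))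
       (carrier (tensor (coinv_ring A C x) (right_regular A) (left_regular A))) (carrier C)"


section \<open>The functors \<open>Hom(A, -)\<close>\<close>

definition hom_functor_map ::
    "('a, 'x) ring_scheme \<Rightarrow> ('a \<Rightarrow> 'm) set \<Rightarrow> ('m \<Rightarrow> 'n) \<Rightarrow> ('a \<Rightarrow> 'm) \<Rightarrow> ('a \<Rightarrow> 'n)" where
  "hom_functor_map A H h = (\<lambda>f\<in>H. compose (carrier A) h f)"

definition colin_hom_functor_faithful ::
    "'u itself \<Rightarrow> ('a, 'x) ring_scheme \<Rightarrow> ('a, 'c) coring \<Rightarrow> 'c \<Rightarrow> bool" where
  "colin_hom_functor_faithful _ A C x \<longleftrightarrow>
     (\<forall>(M :: ('a, 'c, 'u) comodule) (N :: ('a, 'c, 'u) comodule).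
        comodule A C M \<and> comodule A C N \<longrightarrow>
        inj_on (hom_functor_map A (colin_hom A C (base_comodule A C x) M)) (colin_hom A C M N))"

definition dual_hom_functor_fully_faithful_on_Gen ::
    "'u itself \<Rightarrow> ('a, 'x) ring_scheme \<Rightarrow> ('a, 'c) coring \<Rightarrow> 'c \<Rightarrow> bool" where
  "dual_hom_functor_fully_faithful_on_Gen _ A C x \<longleftrightarrow>
     (let T = dual_ring A C; A\<^sub>T = dual_module (base_comodule A C x)
      in \<forall>M\<in>Gen TYPE('u) T A\<^sub>T. \<forall>N\<in>Gen TYPE('u) T A\<^sub>T.
           bij_betw (hom_functor_map A (lin_hom T A\<^sub>T M)) (lin_hom T M N)
             (lin_hom (coinv_ring A C x) (dual_hom_module A C x M) (dual_hom_module A C x N)))"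

text \<open>Generators are understood in the categorical sense: morphisms are separated.\<close>

definition comodule_generator ::
    "'u itself \<Rightarrow> ('a, 'x) ring_scheme \<Rightarrow> ('a, 'c) coring \<Rightarrow> ('a, 'c, 'p) comodule \<Rightarrow> bool" where
  "comodule_generator _ A C P \<longleftrightarrow>
     (\<forall>(M :: ('a, 'c, 'u) comodule) (N :: ('a, 'c, 'u) comodule).
        comodule A C M \<and> comodule A C N \<longrightarrow>
        (\<forall>f\<in>colin_hom A C M N. \<forall>g\<in>colin_hom A C M N. f \<noteq> g \<longrightarrow>
           (\<exists>h\<in>colin_hom A C P M. compose (carrier P) f h \<noteq> compose (carrier P) g h)))"

definition all_equivalent :: "bool list \<Rightarrow> bool" where
  "all_equivalent ps \<longleftrightarrow> (\<forall>p\<in>set ps. \<forall>q\<in>set ps. p \<longleftrightarrow> q)"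

end

theory Submission
  imports Defs "HOL-Algebra.Subrings"
begin

text \<open>
  Local projectivity provides local dual bases of \<open>C\<close>, so that functionals separate the elements of
  \<open>M \<otimes>\<^sub>A C\<close>.  Hence comodules are the modules over the dual ring \<open>T\<close> on which every element is acted on
  through finitely many elements of \<open>C\<close> (the rational modules, which form \<open>\<sigma>[C\<^sub>T]\<close>), and colinear maps
  are \<open>T\<close>-linear maps.  All nine conditions are compared with the condition that \<open>A\<^sub>T\<close> generates
  every rational module.

  Given the latter, the kernel of a \<open>T\<close>-linear map \<open>A\<^sup>n \<rightarrow> P\<close> is generated by tuples over \<open>B\<close>, so a relation
  \<open>\<Sum> f\<^sub>i(a\<^sub>i) = 0\<close> follows from relations with coefficients in \<open>B\<close>.  This yields both the flatness of
  \<open>\<^sub>BA\<close> and the injectivity of the maps \<open>Hom(A, P) \<otimes>\<^sub>B A \<rightarrow> P\<close>, whose images are the traces of \<open>A\<close>.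

  Conversely, if \<open>\<^sub>BA\<close> is flat and \<open>A \<otimes>\<^sub>B A \<rightarrow> C\<close> is bijective, then the coaction of \<open>m \<in> M\<close>, seen in
  \<open>M \<otimes>\<^sub>A C \<simeq> M \<otimes>\<^sub>B A\<close>, lies in the kernel of the map induced by \<open>n \<mapsto> \<rho>(n) - n \<otimes> x\<close>, which by flatness is
  \<open>M\<^sup>c\<^sup>o\<^sup>C \<otimes>\<^sub>B A\<close>.  If \<open>\<^sub>BA\<close> is flat and \<open>Hom(A, -)\<close> is fully faithful on generated modules,
  then evaluation is injective for every generated \<open>V\<close>; applied to \<open>V / U\<close> this shows that submodules
  \<open>U\<close> of generated modules are generated.
\<close>

section \<open>Additive maps and list sums\<close>

text \<open>Higher-order logic has no quantifier over all modules, so the conditions speak of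
  modules carried by a universe type \<open>'u\<close>, while tensor products, direct sums and the
  ambient modules of \<open>subgenerated\<close> live in other types. Two devices bridge the gap:
  elements of these constructions are finite sums, hence values of lists, which bounds the
  cardinality; and small modules are moved into \<open>'u\<close> by \<open>transport\<close>. The
  ambient module of a subgenerated module may exceed \<open>'u\<close>; there a small generated
  submodule is cut out. An identity in \<open>M \<otimes> C\<close> is checked under all
  functionals, so that iterated coactions become iterated actions and coassociativity becomes a
  module law. The elements of \<open>B\<close> enter because a linear map on \<open>A\<close> is
  determined by its value at \<open>1\<close>, which is coinvariant, and the coinvariants of a
  finite power of \<open>A\<close> are the tuples over \<open>B\<close>.\<close>

definition add_hom :: "('g, 'x) ring_scheme \<Rightarrow> ('h, 'y) ring_scheme \<Rightarrow> ('g \<Rightarrow> 'h) \<Rightarrow> bool" where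
  "add_hom G H f \<longleftrightarrow> abelian_group G \<and> abelian_group H \<and> f \<in> carrier G \<rightarrow> carrier H \<and>
     (\<forall>x\<in>carrier G. \<forall>y\<in>carrier G. f (x \<oplus>\<^bsub>G\<^esub> y) = f x \<oplus>\<^bsub>H\<^esub> f y)"

text \<open>Lists instead of finite sets index the sums, since an element of a tensor product is
  presented by pairs that may repeat. The carrier does not occur, so submodules share their sums
  with the ambient module.\<close>

primrec lsum :: "('g, 'x) ring_scheme \<Rightarrow> ('i \<Rightarrow> 'g) \<Rightarrow> 'i list \<Rightarrow> 'g" where
  "lsum G f [] = \<zero>\<^bsub>G\<^esub>"
| "lsum G f (i # is) = f i \<oplus>\<^bsub>G\<^esub> lsum G f is"

lemma add_hom_closed: "\<lbrakk>add_hom G H f; x \<in> carrier G\<rbrakk> \<Longrightarrow> f x \<in> carrier H"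
  by (auto simp: add_hom_def)

lemma add_hom_add:
  "\<lbrakk>add_hom G H f; x \<in> carrier G; y \<in> carrier G\<rbrakk> \<Longrightarrow> f (x \<oplus>\<^bsub>G\<^esub> y) = f x \<oplus>\<^bsub>H\<^esub> f y"
  by (auto simp: add_hom_def)

lemma add_hom_zero:
  assumes "add_hom G H f"
  shows "f \<zero>\<^bsub>G\<^esub> = \<zero>\<^bsub>H\<^esub>"
proof -
  interpret G: abelian_group G using assms by (simp add: add_hom_def)
  interpret H: abelian_group H using assms by (simp add: add_hom_def)
  have "f \<zero>\<^bsub>G\<^esub> \<oplus>\<^bsub>H\<^esub> f \<zero>\<^bsub>G\<^esub> = f (\<zero>\<^bsub>G\<^esub> \<oplus>\<^bsub>G\<^esub> \<zero>\<^bsub>G\<^esub>)"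
    by (rule add_hom_add [OF assms, symmetric]) auto
  then have "f \<zero>\<^bsub>G\<^esub> \<oplus>\<^bsub>H\<^esub> f \<zero>\<^bsub>G\<^esub> = f \<zero>\<^bsub>G\<^esub>" by simp
  then show ?thesis
    using add_hom_closed [OF assms G.zero_closed] H.add.l_cancel_one by blast
qed

lemma add_hom_neg:
  assumes "add_hom G H f" "x \<in> carrier G"
  shows "f (\<ominus>\<^bsub>G\<^esub> x) = \<ominus>\<^bsub>H\<^esub> f x"
proof -
  interpret G: abelian_group G using assms by (simp add: add_hom_def)
  interpret H: abelian_group H using assms by (simp add: add_hom_def)
  have "f (\<ominus>\<^bsub>G\<^esub> x) \<oplus>\<^bsub>H\<^esub> f x = \<zero>\<^bsub>H\<^esub>"
    using assms add_hom_add [OF assms(1), of "\<ominus>\<^bsub>G\<^esub> x" x, symmetric]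
    by (simp add: add_hom_zero G.l_neg)
  then show ?thesis
    using H.minus_equality assms add_hom_closed [OF assms(1)] G.a_inv_closed by metis
qed

lemma add_hom_minus:
  assumes "add_hom G H f" "x \<in> carrier G" "y \<in> carrier G"
  shows "f (x \<ominus>\<^bsub>G\<^esub> y) = f x \<ominus>\<^bsub>H\<^esub> f y"
proof -
  interpret G: abelian_group G using assms by (simp add: add_hom_def)
  show ?thesis using assms by (simp add: a_minus_def add_hom_add add_hom_neg)
qed

lemma add_hom_comp:
  assumes "add_hom G H f" "add_hom H K g"
  shows "add_hom G K (\<lambda>x. g (f x))"
proof -
  interpret G: abelian_group G using assms by (simp add: add_hom_def)
  show ?thesis using assms unfolding add_hom_def by (auto simp: Pi_iff)
qed

lemma (in abelian_group) diff_eq_zero_iff: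
  "\<lbrakk>x \<in> carrier G; y \<in> carrier G\<rbrakk> \<Longrightarrow> x \<ominus> y = \<zero> \<longleftrightarrow> x = y"
  by (metis a_inv_closed a_minus_def minus_equality minus_minus r_neg)

lemma add_hom_eq_zero_inj:
  assumes "add_hom G H f" "\<And>x. \<lbrakk>x \<in> carrier G; f x = \<zero>\<^bsub>H\<^esub>\<rbrakk> \<Longrightarrow> x = \<zero>\<^bsub>G\<^esub>"
  shows "inj_on f (carrier G)"
proof (rule inj_onI)
  fix x y assume xy: "x \<in> carrier G" "y \<in> carrier G" "f x = f y"
  interpret G: abelian_group G using assms by (simp add: add_hom_def)
  interpret H: abelian_group H using assms by (simp add: add_hom_def)
  have "f (x \<ominus>\<^bsub>G\<^esub> y) = \<zero>\<^bsub>H\<^esub>"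
    using add_hom_minus [OF assms(1) xy(1,2)] add_hom_closed [OF assms(1) xy(2)] xy(3)
    by (simp add: a_minus_def H.r_neg)
  then have "x \<ominus>\<^bsub>G\<^esub> y = \<zero>\<^bsub>G\<^esub>" using assms(2) xy by simp
  then show "x = y" using xy by (simp add: G.diff_eq_zero_iff)
qed

lemma add_hom_cong:
  assumes "add_hom G H f" "\<And>x. x \<in> carrier G \<Longrightarrow> g x = f x"
  shows "add_hom G H g"
proof -
  interpret G: abelian_group G using assms by (simp add: add_hom_def)
  show ?thesis using assms unfolding add_hom_def by (auto simp: Pi_iff)
qed

lemma lsum_cong: "(\<And>i. i \<in> set is \<Longrightarrow> f i = g i) \<Longrightarrow> lsum G f is = lsum G g is"
  by (induction "is") auto

lemma lsum_map: "lsum G f (map g is) = lsum G (\<lambda>i. f (g i)) is"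
  by (induction "is") auto

lemma lsum_closed [intro]:
  assumes "abelian_group G" "\<And>i. i \<in> set is \<Longrightarrow> f i \<in> carrier G"
  shows "lsum G f is \<in> carrier G"
proof -
  interpret abelian_group G by fact
  show ?thesis using assms(2) by (induction "is") auto
qed

lemma lsum_append:
  assumes "abelian_group G" "\<And>i. i \<in> set is \<Longrightarrow> f i \<in> carrier G" "\<And>i. i \<in> set js \<Longrightarrow> f i \<in> carrier G"
  shows "lsum G f (is @ js) = lsum G f is \<oplus>\<^bsub>G\<^esub> lsum G f js"
proof -
  interpret abelian_group G by fact
  show ?thesis using assms(2,3)
  proof (induction "is")
    case (Cons i "is")
    then have "lsum G f is \<in> carrier G" "lsum G f js \<in> carrier G"
      by (auto intro!: lsum_closed assms(1))
    with Cons show ?case by (simp add: a_assoc)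
  next
    case Nil
    then show ?case using lsum_closed [OF assms(1), of js f] by simp
  qed
qed

lemma lsum_concat:
  assumes "abelian_group G" "\<And>i. i \<in> set (concat iss) \<Longrightarrow> f i \<in> carrier G"
  shows "lsum G f (concat iss) = lsum G (lsum G f) iss"
  using assms(2)
proof (induction iss)
  case (Cons js iss)
  have "lsum G f (js @ concat iss) = lsum G f js \<oplus>\<^bsub>G\<^esub> lsum G f (concat iss)"
    by (rule lsum_append [OF assms(1)]) (use Cons.prems in auto)
  then show ?case using Cons by simp
qed simp

lemma lsum_zero:
  assumes "abelian_group G" "\<And>i. i \<in> set is \<Longrightarrow> f i = \<zero>\<^bsub>G\<^esub>"
  shows "lsum G f is = \<zero>\<^bsub>G\<^esub>"
proof -
  interpret abelian_group G by fact
  show ?thesis using assms(2) by (induction "is") auto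
qed

lemma lsum_add:
  assumes "abelian_group G" "\<And>i. i \<in> set is \<Longrightarrow> f i \<in> carrier G" "\<And>i. i \<in> set is \<Longrightarrow> g i \<in> carrier G"
  shows "lsum G (\<lambda>i. f i \<oplus>\<^bsub>G\<^esub> g i) is = lsum G f is \<oplus>\<^bsub>G\<^esub> lsum G g is"
proof -
  interpret abelian_group G by fact
  show ?thesis using assms(2,3)
  proof (induction "is")
    case (Cons i "is")
    then have "lsum G f is \<in> carrier G" "lsum G g is \<in> carrier G"
      by (auto intro!: lsum_closed assms(1))
    with Cons show ?case by (simp add: a_ac)
  qed auto
qed

lemma add_hom_lsum:
  assumes "add_hom G H h" "\<And>i. i \<in> set is \<Longrightarrow> f i \<in> carrier G"
  shows "h (lsum G f is) = lsum H (\<lambda>i. h (f i)) is"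
  using assms(2)
proof (induction "is")
  case Nil then show ?case using add_hom_zero [OF assms(1)] by simp
next
  case (Cons i "is")
  have G: "abelian_group G" using assms by (simp add: add_hom_def)
  have "lsum G f is \<in> carrier G" using Cons by (auto intro!: lsum_closed G)
  then show ?case using Cons by (simp add: add_hom_add [OF assms(1)])
qed

lemma lsum_swap:
  assumes "abelian_group G" "\<And>i j. \<lbrakk>i \<in> set is; j \<in> set js\<rbrakk> \<Longrightarrow> f i j \<in> carrier G"
  shows "lsum G (\<lambda>i. lsum G (\<lambda>j. f i j) js) is = lsum G (\<lambda>j. lsum G (\<lambda>i. f i j) is) js"
  using assms(2)
proof (induction "is")
  case Nil
  then show ?case using lsum_zero [OF assms(1), of js "\<lambda>_. \<zero>\<^bsub>G\<^esub>"] by simp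
next
  case (Cons i "is")
  have "lsum G (\<lambda>j. f i j \<oplus>\<^bsub>G\<^esub> lsum G (\<lambda>i. f i j) is) js
      = lsum G (f i) js \<oplus>\<^bsub>G\<^esub> lsum G (\<lambda>j. lsum G (\<lambda>i. f i j) is) js"
    using Cons.prems by (intro lsum_add assms(1)) (auto intro!: lsum_closed assms(1))
  then show ?case using Cons by simp
qed

text \<open>The same addition occurs in several records (\<open>dual_module M\<close>,
  \<open>base_module P\<close>, a module with a smaller carrier); sums pass between them by this
  rule.\<close>

lemma lsum_cong_structure:
  assumes "\<zero>\<^bsub>G\<^esub> = \<zero>\<^bsub>H\<^esub>" "add G = add H"
  shows "lsum G f is = lsum H f is"
  using assms by (induction "is") auto

lemma abelian_group_cong:
  assumes "abelian_group G" "carrier H = carrier G" "\<zero>\<^bsub>H\<^esub> = \<zero>\<^bsub>G\<^esub>"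
    "\<And>x y. \<lbrakk>x \<in> carrier G; y \<in> carrier G\<rbrakk> \<Longrightarrow> x \<oplus>\<^bsub>H\<^esub> y = x \<oplus>\<^bsub>G\<^esub> y"
  shows "abelian_group H"
proof -
  interpret abelian_group G by fact
  show ?thesis
  proof (rule abelian_groupI)
    fix x assume "x \<in> carrier H"
    then have "\<ominus>\<^bsub>G\<^esub> x \<in> carrier H \<and> \<ominus>\<^bsub>G\<^esub> x \<oplus>\<^bsub>H\<^esub> x = \<zero>\<^bsub>H\<^esub>"
      using assms(2-) by (simp add: l_neg)
    then show "\<exists>y\<in>carrier H. y \<oplus>\<^bsub>H\<^esub> x = \<zero>\<^bsub>H\<^esub>" by blast
  qed (use assms(2-) in \<open>simp_all add: a_ac\<close>)
qed

lemma with_smult_simps [simp]: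
  "carrier (with_smult G act) = carrier G" "\<zero>\<^bsub>with_smult G act\<^esub> = \<zero>\<^bsub>G\<^esub>"
  "add (with_smult G act) = add G" "smult (with_smult G act) = act"
  by (simp_all add: with_smult_def)

lemma abelian_group_with_smult [simp]: "abelian_group (with_smult G act) \<longleftrightarrow> abelian_group G"
  using abelian_group_cong [of G "with_smult G act"] abelian_group_cong [of "with_smult G act" G] by auto

section \<open>Tensor products\<close>

definition balanced ::
    "('r, 'x) ring_scheme \<Rightarrow> ('r, 'm, 'y) module_scheme \<Rightarrow> ('r, 'n, 'z) module_scheme
     \<Rightarrow> ('g, 'w) ring_scheme \<Rightarrow> ('m \<Rightarrow> 'n \<Rightarrow> 'g) \<Rightarrow> bool" where
  "balanced R M N G \<phi> \<longleftrightarrow> abelian_group G \<and>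
     (\<forall>m\<in>carrier M. \<forall>n\<in>carrier N. \<phi> m n \<in> carrier G) \<and>
     (\<forall>m\<in>carrier M. \<forall>m'\<in>carrier M. \<forall>n\<in>carrier N. \<phi> (m \<oplus>\<^bsub>M\<^esub> m') n = \<phi> m n \<oplus>\<^bsub>G\<^esub> \<phi> m' n) \<and>
     (\<forall>m\<in>carrier M. \<forall>n\<in>carrier N. \<forall>n'\<in>carrier N. \<phi> m (n \<oplus>\<^bsub>N\<^esub> n') = \<phi> m n \<oplus>\<^bsub>G\<^esub> \<phi> m n') \<and>
     (\<forall>m\<in>carrier M. \<forall>r\<in>carrier R. \<forall>n\<in>carrier N. \<phi> (m \<triangleleft>\<^bsub>M\<^esub> r) n = \<phi> m (r \<odot>\<^bsub>N\<^esub> n))"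

lemma balancedI:
  assumes "abelian_group G"
    "\<And>m n. \<lbrakk>m \<in> carrier M; n \<in> carrier N\<rbrakk> \<Longrightarrow> \<phi> m n \<in> carrier G"
    "\<And>m m' n. \<lbrakk>m \<in> carrier M; m' \<in> carrier M; n \<in> carrier N\<rbrakk>
       \<Longrightarrow> \<phi> (m \<oplus>\<^bsub>M\<^esub> m') n = \<phi> m n \<oplus>\<^bsub>G\<^esub> \<phi> m' n"
    "\<And>m n n'. \<lbrakk>m \<in> carrier M; n \<in> carrier N; n' \<in> carrier N\<rbrakk>
       \<Longrightarrow> \<phi> m (n \<oplus>\<^bsub>N\<^esub> n') = \<phi> m n \<oplus>\<^bsub>G\<^esub> \<phi> m n'"
    "\<And>m r n. \<lbrakk>m \<in> carrier M; r \<in> carrier R; n \<in> carrier N\<rbrakk> \<Longrightarrow> \<phi> (m \<triangleleft>\<^bsub>M\<^esub> r) n = \<phi> m (r \<odot>\<^bsub>N\<^esub> n)"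
  shows "balanced R M N G \<phi>"
  using assms by (simp add: balanced_def)

locale tensor_product =
  fixes R :: "('r, 'x) ring_scheme" and M :: "('r, 'm, 'y) module_scheme"
    and N :: "('r, 'n, 'z) module_scheme"
  assumes M: "right_module R M" and N: "left_module R N"
begin

sublocale M: right_module R M by (rule M)
sublocale N: left_module R N by (rule N)

abbreviation "PG \<equiv> free_Abelian_group (carrier M \<times> carrier N)"
abbreviation "KG \<equiv> tensor_kernel R M N"

lemma relations_subset: "tensor_relations R M N \<subseteq> carrier PG"
  by (auto simp: tensor_relations_def M.ract_closed N.lact_closed
      dest!: subsetD [OF keys_diff] simp: keys_frag_of)

lemma kernel_subgroup: "subgroup KG PG"
  unfolding tensor_kernel_def
  by (rule group.generate_is_subgroup) (auto simp: relations_subset)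

lemma kernel_normal: "KG \<lhd> PG"
  using comm_group.normal_iff_subgroup [OF abelian_free_Abelian_group] kernel_subgroup by blast

lemma tensor_simps:
  "carrier (tensor R M N) = carrier (PG Mod KG)" "\<zero>\<^bsub>tensor R M N\<^esub> = \<one>\<^bsub>PG Mod KG\<^esub>"
  "add (tensor R M N) = mult (PG Mod KG)"
  by (simp_all add: tensor_def Let_def)

lemma abelian_group_tensor: "abelian_group (tensor R M N)"
proof (rule comm_group_abelian_groupI)
  have "comm_group (PG Mod KG)"
    by (rule comm_group.abelian_FactGroup [OF abelian_free_Abelian_group kernel_subgroup])
  then show "comm_group (add_monoid (tensor R M N))"
    by (rule back_subst [of comm_group])
       (auto simp: tensor_def Let_def FactGroup_def)
qed

lemma coset_add:
  assumes "s \<in> carrier PG" "t \<in> carrier PG"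
  shows "(KG #>\<^bsub>PG\<^esub> s) \<oplus>\<^bsub>tensor R M N\<^esub> (KG #>\<^bsub>PG\<^esub> t) = KG #>\<^bsub>PG\<^esub> (s + t)"
  using normal.rcos_sum [OF kernel_normal assms] by (simp add: tensor_simps FactGroup_def)

lemma coset_closed: "s \<in> carrier PG \<Longrightarrow> KG #>\<^bsub>PG\<^esub> s \<in> carrier (tensor R M N)"
  by (auto simp: tensor_simps FactGroup_def RCOSETS_def)

lemma coset_eqI:
  assumes "s \<in> carrier PG" "t \<in> carrier PG" "s - t \<in> KG"
  shows "KG #>\<^bsub>PG\<^esub> s = KG #>\<^bsub>PG\<^esub> t"
proof -
  interpret group PG by simp
  have "s \<in> KG #>\<^bsub>PG\<^esub> t"
    using assms unfolding r_coset_def by (auto intro!: bexI [of _ "s - t"])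
  then show ?thesis using repr_independence [OF _ _ kernel_subgroup] assms(2) by simp
qed

lemma pair_closed: "\<lbrakk>m \<in> carrier M; n \<in> carrier N\<rbrakk> \<Longrightarrow> frag_of (m, n) \<in> carrier PG"
  by simp

lemma sum_closed: "\<lbrakk>s \<in> carrier PG; t \<in> carrier PG\<rbrakk> \<Longrightarrow> s + t \<in> carrier PG"
  using keys_add by fastforce

lemma tens_closed [simp]:
  "\<lbrakk>m \<in> carrier M; n \<in> carrier N\<rbrakk> \<Longrightarrow> tens R M N m n \<in> carrier (tensor R M N)"
  unfolding tens_def by (intro coset_closed) simp

lemma tens_add_left:
  assumes "m \<in> carrier M" "m' \<in> carrier M" "n \<in> carrier N"
  shows "tens R M N (m \<oplus>\<^bsub>M\<^esub> m') n = tens R M N m n \<oplus>\<^bsub>tensor R M N\<^esub> tens R M N m' n"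
proof -
  have "frag_of (m \<oplus>\<^bsub>M\<^esub> m', n) - (frag_of (m, n) + frag_of (m', n)) \<in> KG"
    unfolding tensor_kernel_def using assms
    by (intro generate.incl) (auto simp: tensor_relations_def diff_diff_add)
  then show ?thesis unfolding tens_def
    using assms by (simp only: coset_add pair_closed) (intro coset_eqI sum_closed pair_closed; simp)
qed

lemma tens_add_right:
  assumes "m \<in> carrier M" "n \<in> carrier N" "n' \<in> carrier N"
  shows "tens R M N m (n \<oplus>\<^bsub>N\<^esub> n') = tens R M N m n \<oplus>\<^bsub>tensor R M N\<^esub> tens R M N m n'"
proof -
  have "frag_of (m, n \<oplus>\<^bsub>N\<^esub> n') - (frag_of (m, n) + frag_of (m, n')) \<in> KG"
    unfolding tensor_kernel_def using assms
    by (intro generate.incl) (auto simp: tensor_relations_def diff_diff_add)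
  then show ?thesis unfolding tens_def
    using assms by (simp only: coset_add pair_closed) (intro coset_eqI sum_closed pair_closed; simp)
qed

lemma tens_balanced:
  assumes "m \<in> carrier M" "r \<in> carrier R" "n \<in> carrier N"
  shows "tens R M N (m \<triangleleft>\<^bsub>M\<^esub> r) n = tens R M N m (r \<odot>\<^bsub>N\<^esub> n)"
proof -
  have "frag_of (m \<triangleleft>\<^bsub>M\<^esub> r, n) - frag_of (m, r \<odot>\<^bsub>N\<^esub> n) \<in> KG"
    unfolding tensor_kernel_def using assms
    by (intro generate.incl) (auto simp: tensor_relations_def)
  then show ?thesis unfolding tens_def
    using assms by (intro coset_eqI pair_closed) (simp_all add: M.ract_closed N.lact_closed)
qed

text \<open>Formal combinations are obtained from single pairs by subtraction, and passing to cosets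
  respects subtraction; hence pure tensors generate under differences.\<close>

lemma tensor_hull_induct [consumes 1, case_names gen zero diff]:
  assumes "t \<in> carrier (tensor R M N)"
    and gen: "\<And>m n. \<lbrakk>m \<in> carrier M; n \<in> carrier N\<rbrakk> \<Longrightarrow> P (tens R M N m n)"
    and zero: "P \<zero>\<^bsub>tensor R M N\<^esub>"
    and diff: "\<And>s t. \<lbrakk>s \<in> carrier (tensor R M N); t \<in> carrier (tensor R M N); P s; P t\<rbrakk>
       \<Longrightarrow> P (s \<ominus>\<^bsub>tensor R M N\<^esub> t)"
  shows "P t"
proof -
  interpret T: abelian_group "tensor R M N" by (rule abelian_group_tensor)
  obtain s where s: "s \<in> carrier PG" and t: "t = KG #>\<^bsub>PG\<^esub> s"
    using assms(1) by (auto simp: tensor_simps FactGroup_def RCOSETS_def)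
  have diff': "KG #>\<^bsub>PG\<^esub> (a - b) = (KG #>\<^bsub>PG\<^esub> a) \<ominus>\<^bsub>tensor R M N\<^esub> (KG #>\<^bsub>PG\<^esub> b)"
    if "a \<in> carrier PG" "b \<in> carrier PG" for a b
  proof -
    have ab: "a - b \<in> carrier PG" using that keys_diff by fastforce
    then have "(KG #>\<^bsub>PG\<^esub> (a - b)) \<oplus>\<^bsub>tensor R M N\<^esub> (KG #>\<^bsub>PG\<^esub> b) = KG #>\<^bsub>PG\<^esub> a"
      using coset_add [OF ab that(2)] by simp
    then show ?thesis
      using coset_closed [OF ab] coset_closed [OF that(1)] coset_closed [OF that(2)]
      by (metis T.add.inv_solve_right a_minus_def)
  qed
  have "P (KG #>\<^bsub>PG\<^esub> s)"
  proof (rule free_Abelian_group_induct [where S = "carrier M \<times> carrier N" and x = s], goal_cases)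
    case 1
    then show ?case using s by simp
  next
    case 2
    have "KG #>\<^bsub>PG\<^esub> 0 = \<zero>\<^bsub>tensor R M N\<^esub>"
      using group.coset_mult_one [of PG KG] subgroup.subset [OF kernel_subgroup]
      by (simp add: tensor_simps FactGroup_def)
    then show ?case using zero by simp
  next
    case (3 a b)
    then show ?case by (auto simp: diff' intro!: diff coset_closed)
  next
    case (4 p)
    then show ?case using gen unfolding tens_def by auto
  qed
  then show ?thesis using t by simp
qed

lemma tens_zero_left:
  assumes "n \<in> carrier N" shows "tens R M N \<zero>\<^bsub>M\<^esub> n = \<zero>\<^bsub>tensor R M N\<^esub>"
proof -
  have "add_hom M (tensor R M N) (\<lambda>m. tens R M N m n)"
    using assms by (auto simp: add_hom_def abelian_group_tensor tens_add_left M.abelian_group_axioms)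
  then show ?thesis by (rule add_hom_zero)
qed

lemma tens_neg_left:
  assumes "m \<in> carrier M" "n \<in> carrier N"
  shows "tens R M N (\<ominus>\<^bsub>M\<^esub> m) n = \<ominus>\<^bsub>tensor R M N\<^esub> tens R M N m n"
proof -
  have "add_hom M (tensor R M N) (\<lambda>m. tens R M N m n)"
    using assms by (auto simp: add_hom_def abelian_group_tensor tens_add_left M.abelian_group_axioms)
  then show ?thesis using assms by (auto dest: add_hom_neg)
qed

text \<open>Integer coefficients disappear: a sign is absorbed into the left factor and a multiple
  is a repetition in the list.\<close>

lemma tensor_list:
  assumes "t \<in> carrier (tensor R M N)"
  obtains ps where "set ps \<subseteq> carrier M \<times> carrier N"
    "t = lsum (tensor R M N) (\<lambda>(m, n). tens R M N m n) ps"
proof -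
  interpret T: abelian_group "tensor R M N" by (rule abelian_group_tensor)
  let ?s = "lsum (tensor R M N) (\<lambda>(m, n). tens R M N m n)"
  have "\<exists>ps. set ps \<subseteq> carrier M \<times> carrier N \<and> t = ?s ps"
    using assms
  proof (induction t rule: tensor_hull_induct)
    case (gen m n)
    then show ?case by (intro exI [of _ "[(m, n)]"]) auto
  next
    case zero
    then show ?case by (intro exI [of _ "[]"]) auto
  next
    case (diff s t)
    then obtain ps qs where ps: "set ps \<subseteq> carrier M \<times> carrier N" "s = ?s ps"
      and qs: "set qs \<subseteq> carrier M \<times> carrier N" "t = ?s qs" by auto
    let ?neg = "map (\<lambda>(m, n). (\<ominus>\<^bsub>M\<^esub> m, n)) qs"
    have "add_hom (tensor R M N) (tensor R M N) (\<lambda>t. \<ominus>\<^bsub>tensor R M N\<^esub> t)"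
      by (auto simp: add_hom_def T.minus_add abelian_group_tensor T.a_comm)
    then have "\<ominus>\<^bsub>tensor R M N\<^esub> t = lsum (tensor R M N) (\<lambda>p. \<ominus>\<^bsub>tensor R M N\<^esub> (\<lambda>(m, n). tens R M N m n) p) qs"
      unfolding qs(2) using qs(1) by (intro add_hom_lsum) auto
    also have "\<dots> = ?s ?neg"
      using qs(1) by (auto simp: lsum_map tens_neg_left intro!: lsum_cong)
    finally have "?s ?neg = \<ominus>\<^bsub>tensor R M N\<^esub> t" by simp
    then have "s \<ominus>\<^bsub>tensor R M N\<^esub> t = ?s (ps @ ?neg)"
      using ps qs by (subst lsum_append) (auto simp: a_minus_def abelian_group_tensor)
    then show ?case using ps qs by (intro exI [of _ "ps @ ?neg"]) auto
  qed
  then show ?thesis using that by blast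
qed

text \<open>A presentation by indices below \<open>k\<close>, so that the right factors can be read
  as a tuple in a finite power of a module.\<close>

lemma tensor_index:
  assumes "t \<in> carrier (tensor R M N)"
  obtains k :: nat and m n where "\<And>i. i < k \<Longrightarrow> m i \<in> carrier M" "\<And>i. i < k \<Longrightarrow> n i \<in> carrier N"
    "t = lsum (tensor R M N) (\<lambda>i. tens R M N (m i) (n i)) [0..<k]"
proof -
  obtain ps where ps: "set ps \<subseteq> carrier M \<times> carrier N"
    "t = lsum (tensor R M N) (\<lambda>(m, n). tens R M N m n) ps"
    using tensor_list [OF assms] .
  show ?thesis
  proof (rule that [of "length ps" "\<lambda>i. fst (ps ! i)" "\<lambda>i. snd (ps ! i)"])
    show "t = lsum (tensor R M N) (\<lambda>i. tens R M N (fst (ps ! i)) (snd (ps ! i))) [0..<length ps]"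
      using ps(2) lsum_map [of "tensor R M N" "\<lambda>(m, n). tens R M N m n" "\<lambda>i. ps ! i" "[0..<length ps]"]
      by (simp add: map_nth case_prod_beta)
    have "ps ! i \<in> carrier M \<times> carrier N" if "i < length ps" for i
      using ps(1) nth_mem [OF that] by blast
    then show "fst (ps ! i) \<in> carrier M" "snd (ps ! i) \<in> carrier N" if "i < length ps" for i
      using that by (auto simp: mem_Times_iff)
  qed
qed

text \<open>Pure tensors generate. Nearly every identity on a tensor product is proved below by
  writing both sides as composites of additive maps and comparing them on pure tensors.\<close>

lemma add_hom_tensor_eq:
  assumes "add_hom (tensor R M N) G f" "add_hom (tensor R M N) G g"
    and "\<And>m n. \<lbrakk>m \<in> carrier M; n \<in> carrier N\<rbrakk> \<Longrightarrow> f (tens R M N m n) = g (tens R M N m n)"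
    and "t \<in> carrier (tensor R M N)"
  shows "f t = g t"
  using assms(4)
proof (induction t rule: tensor_hull_induct)
  case zero
  then show ?case using assms(1,2) by (simp add: add_hom_zero)
next
  case (diff s t)
  then show ?case using assms(1,2) by (simp add: add_hom_minus)
qed (use assms(3) in blast)

text \<open>The universal property of the free abelian group yields a homomorphism \<open>h\<close>
  which equals the sum in \<open>tensor_lift\<close> on every representative. It kills the tensor
  relations because \<open>\<phi>\<close> is balanced, so the representative picked by choice does
  not matter.\<close>

lemma tensor_lift_additive_tens:
  assumes "balanced R M N G \<phi>"
  shows "add_hom (tensor R M N) G (tensor_lift G \<phi>) \<and>
    (\<forall>m\<in>carrier M. \<forall>n\<in>carrier N. tensor_lift G \<phi> (tens R M N m n) = \<phi> m n)"
proof -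
  interpret PG: comm_group PG by (rule abelian_free_Abelian_group)
  interpret G: abelian_group G using assms by (simp add: balanced_def)
  have \<phi>: "\<phi> m n \<in> carrier G" if "m \<in> carrier M" "n \<in> carrier N" for m n
    using assms that by (simp add: balanced_def)
  have img: "(\<lambda>(m, n). \<phi> m n) ` (carrier M \<times> carrier N) \<subseteq> carrier (add_monoid G)"
    using \<phi> by auto
  interpret cg: comm_group "add_monoid G" by (rule G.a_comm_group)
  obtain h where h: "h \<in> hom PG (add_monoid G)"
      and h_of: "\<And>p. p \<in> carrier M \<times> carrier N \<Longrightarrow> h (frag_of p) = (\<lambda>(m, n). \<phi> m n) p"
    using comm_group.free_Abelian_group_universal [OF G.a_comm_group img] by metis
  interpret h: group_hom PG "add_monoid G" h
    by unfold_locales (rule h)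
  have sums: "h (\<Sum>p\<in>I. frag_cmul (c p) (frag_of p)) = (\<Oplus>\<^bsub>G\<^esub>p\<in>I. [c p] \<cdot>\<^bsub>G\<^esub> \<phi> (fst p) (snd p))"
    if "finite I" "I \<subseteq> carrier M \<times> carrier N" for I c
    using that
  proof (induction I rule: finite_induct)
    case empty
    then show ?case using h.hom_one by simp
  next
    case (insert p I)
    let ?s = "\<Sum>p\<in>I. frag_cmul (c p) (frag_of p)"
    have p: "frag_cmul (c p) (frag_of p) \<in> carrier PG"
      using insert.prems keys_cmul [of "c p" "frag_of p"] by (auto simp: keys_frag_of)
    have s: "?s \<in> carrier PG"
      using insert.prems keys_cmul by (intro sum_closed_free_Abelian_group) (auto simp: keys_frag_of)
    have "h (frag_cmul (c p) (frag_of p)) = [c p] \<cdot>\<^bsub>G\<^esub> h (frag_of p)"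
      using h.hom_int_pow [of "frag_of p" "c p"] insert.prems
      by (simp add: keys_frag_of add_pow_def)
    then have hp: "h (frag_cmul (c p) (frag_of p)) = [c p] \<cdot>\<^bsub>G\<^esub> \<phi> (fst p) (snd p)"
      using h_of [of p] insert.prems by (simp add: case_prod_beta)
    have "h (frag_cmul (c p) (frag_of p) + ?s) = h (frag_cmul (c p) (frag_of p)) \<oplus>\<^bsub>G\<^esub> h ?s"
      using h.hom_mult [OF p s] by simp
    then show ?case using insert hp \<phi>
      by (subst G.finsum_insert) (auto simp: Pi_iff G.add.int_pow_closed)
  qed
  let ?\<Phi> = "\<lambda>t. \<Oplus>\<^bsub>G\<^esub>p\<in>Poly_Mapping.keys t. [Poly_Mapping.lookup t p] \<cdot>\<^bsub>G\<^esub> \<phi> (fst p) (snd p)"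
  have \<Phi>: "?\<Phi> t = h t" if "t \<in> carrier PG" for t
  proof -
    have "(\<Sum>p\<in>Poly_Mapping.keys t. frag_cmul (Poly_Mapping.lookup t p) (frag_of p)) = t"
      using frag_expansion [of t] unfolding frag_extend_def by (rule sym)
    then show ?thesis
      using sums [of "Poly_Mapping.keys t" "Poly_Mapping.lookup t"] that by simp
  qed
  have hd: "h (a - b) = h a \<ominus>\<^bsub>G\<^esub> h b" if "a \<in> carrier PG" "b \<in> carrier PG" for a b
  proof -
    have "h (a \<otimes>\<^bsub>PG\<^esub> inv\<^bsub>PG\<^esub> b) = h a \<oplus>\<^bsub>G\<^esub> (\<ominus>\<^bsub>G\<^esub> h b)"
      using that h.hom_mult [of a "inv\<^bsub>PG\<^esub> b"] h.hom_inv [of b] PG.inv_closed [of b]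
      by (simp add: a_inv_def del: inv_free_Abelian_group mult_free_Abelian_group carrier_free_Abelian_group_iff)
    then show ?thesis using that by (simp add: a_minus_def)
  qed
  have dcl: "a - b \<in> carrier PG" if "a \<in> carrier PG" "b \<in> carrier PG" for a b
    using that keys_diff by fastforce
  have z3: "x \<ominus>\<^bsub>G\<^esub> y \<ominus>\<^bsub>G\<^esub> z = \<zero>\<^bsub>G\<^esub>"
    if "x = y \<oplus>\<^bsub>G\<^esub> z" "y \<in> carrier G" "z \<in> carrier G" for x y z
    using that G.r_neg [of "y \<oplus>\<^bsub>G\<^esub> z"] by (simp add: a_minus_def G.a_assoc G.minus_add)
  have z2: "x \<ominus>\<^bsub>G\<^esub> y = \<zero>\<^bsub>G\<^esub>" if "x = y" "y \<in> carrier G" for x y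
    using that by (simp add: a_minus_def G.r_neg)
  have h_of': "h (frag_of (m, n)) = \<phi> m n" if "m \<in> carrier M" "n \<in> carrier N" for m n
    using h_of [of "(m, n)"] that by simp
  have rel: "h r = \<zero>\<^bsub>G\<^esub>" if "r \<in> tensor_relations R M N" for r
    using that unfolding tensor_relations_def
  proof (elim UnE CollectE exE conjE, goal_cases)
    case (1 m m' n)
    then show ?case using assms unfolding balanced_def
      by (simp add: hd h_of' dcl \<phi> z3 pair_closed del: carrier_free_Abelian_group_iff)
  next
    case (2 m n n')
    then show ?case using assms unfolding balanced_def
      by (simp add: hd h_of' dcl \<phi> z3 pair_closed del: carrier_free_Abelian_group_iff)
  next
    case (3 m r' n)
    then show ?case using assms unfolding balanced_def
      by (simp add: hd h_of' dcl \<phi> z2 pair_closed M.ract_closed N.lact_closed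
          del: carrier_free_Abelian_group_iff)
  qed
  have ker: "h r = \<zero>\<^bsub>G\<^esub>" if "r \<in> KG" for r
    using that unfolding tensor_kernel_def
  proof (induction r rule: generate.induct)
    case one
    then show ?case using h.hom_one by simp
  next
    case (incl r) then show ?case by (rule rel)
  next
    case (inv r)
    then show ?case using h.hom_inv [of r] rel [of r] relations_subset by (auto simp: a_inv_def [symmetric])
  next
    case (eng a b)
    then have "a \<in> carrier PG" "b \<in> carrier PG"
      using group.generate_in_carrier [OF group_free_Abelian_group relations_subset] by blast+
    then show ?case using eng h.hom_mult [of a b] by simp
  qed
  have lift: "tensor_lift G \<phi> (KG #>\<^bsub>PG\<^esub> s) = h s" if "s \<in> carrier PG" for s
  proof -
    define t where "t = (SOME t. t \<in> KG #>\<^bsub>PG\<^esub> s)"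
    have "s \<in> KG #>\<^bsub>PG\<^esub> s" using that by (intro group.rcos_self kernel_subgroup) auto
    then have "t \<in> KG #>\<^bsub>PG\<^esub> s" unfolding t_def by (rule someI)
    then obtain k where k: "k \<in> KG" "t = k + s" by (auto simp: r_coset_def)
    have kF: "k \<in> carrier PG" using k subgroup.subset [OF kernel_subgroup] by blast
    have "tensor_lift G \<phi> (KG #>\<^bsub>PG\<^esub> s) = h t"
      unfolding tensor_lift_def Let_def t_def [symmetric]
      using \<Phi> [of t] k kF that sum_closed by simp
    also have "\<dots> = h k \<oplus>\<^bsub>G\<^esub> h s" using k h.hom_mult [OF kF that] by simp
    also have "\<dots> = h s" using ker [OF k(1)] h.hom_closed [OF that] by simp
    finally show ?thesis .
  qed
  have "add_hom (tensor R M N) G (tensor_lift G \<phi>)"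
    unfolding add_hom_def
  proof (intro conjI abelian_group_tensor G.abelian_group_axioms ballI Pi_I)
    fix t assume "t \<in> carrier (tensor R M N)"
    then obtain s where s: "s \<in> carrier PG" and t: "t = KG #>\<^bsub>PG\<^esub> s"
      by (auto simp: tensor_simps FactGroup_def RCOSETS_def)
    then show "tensor_lift G \<phi> t \<in> carrier G" using lift h.hom_closed [OF s] by simp
    fix t' assume "t' \<in> carrier (tensor R M N)"
    then obtain s' where s': "s' \<in> carrier PG" and t': "t' = KG #>\<^bsub>PG\<^esub> s'"
      by (auto simp: tensor_simps FactGroup_def RCOSETS_def)
    show "tensor_lift G \<phi> (t \<oplus>\<^bsub>tensor R M N\<^esub> t') = tensor_lift G \<phi> t \<oplus>\<^bsub>G\<^esub> tensor_lift G \<phi> t'"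
      using s s' t t' h.hom_mult [OF s s'] sum_closed [OF s s']
      by (simp add: coset_add lift del: carrier_free_Abelian_group_iff)
  qed
  moreover have "tensor_lift G \<phi> (tens R M N m n) = \<phi> m n" if "m \<in> carrier M" "n \<in> carrier N" for m n
    unfolding tens_def using that by (subst lift) (auto simp: h_of)
  ultimately show ?thesis by blast
qed

lemmas tensor_lift_additive = tensor_lift_additive_tens [THEN conjunct1]

lemma tensor_lift_tens:
  "\<lbrakk>balanced R M N G \<phi>; m \<in> carrier M; n \<in> carrier N\<rbrakk> \<Longrightarrow> tensor_lift G \<phi> (tens R M N m n) = \<phi> m n"
  using tensor_lift_additive_tens by blast

lemma tensor_lift_closed:
  "\<lbrakk>balanced R M N G \<phi>; t \<in> carrier (tensor R M N)\<rbrakk> \<Longrightarrow> tensor_lift G \<phi> t \<in> carrier G"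
  by (rule add_hom_closed [OF tensor_lift_additive])

lemma tensor_zero_closed: "\<zero>\<^bsub>tensor R M N\<^esub> \<in> carrier (tensor R M N)"
  using abelian_group_tensor by (simp add: abelian_group_def abelian_monoid.zero_closed)

lemma tens_lsum_closed:
  "set ps \<subseteq> carrier M \<times> carrier N \<Longrightarrow> lsum (tensor R M N) (\<lambda>(m, n). tens R M N m n) ps \<in> carrier (tensor R M N)"
  by (rule lsum_closed [OF abelian_group_tensor]) auto

lemma tensor_lift_lsum:
  assumes bal: "balanced R M N G \<phi>" and ps: "set ps \<subseteq> carrier M \<times> carrier N"
  shows "tensor_lift G \<phi> (lsum (tensor R M N) (\<lambda>(m, n). tens R M N m n) ps) = lsum G (\<lambda>(m, n). \<phi> m n) ps"
proof -
  have "tensor_lift G \<phi> (lsum (tensor R M N) (\<lambda>(m, n). tens R M N m n) ps)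
      = lsum G (\<lambda>p. tensor_lift G \<phi> ((\<lambda>(m, n). tens R M N m n) p)) ps"
    by (rule add_hom_lsum [OF tensor_lift_additive [OF bal]]) (use ps in auto)
  also have "\<dots> = lsum G (\<lambda>(m, n). \<phi> m n) ps"
    using ps by (intro lsum_cong) (auto simp: tensor_lift_tens [OF bal])
  finally show ?thesis .
qed

end

section \<open>Linear maps, submodules and quotients\<close>

text \<open>In contrast to \<open>lin_hom\<close>, the values outside the carrier are arbitrary, so
  that plain composites are again linear; \<open>restrict\<close> leads back to
  \<open>lin_hom\<close>.\<close>

definition linear_map ::
    "('r, 'x) ring_scheme \<Rightarrow> ('r, 'm, 'y) module_scheme \<Rightarrow> ('r, 'n, 'z) module_scheme \<Rightarrow> ('m \<Rightarrow> 'n) \<Rightarrow> bool"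
  where
  "linear_map R M N f \<longleftrightarrow> add_hom M N f \<and>
     (\<forall>r\<in>carrier R. \<forall>m\<in>carrier M. f (r \<odot>\<^bsub>M\<^esub> m) = r \<odot>\<^bsub>N\<^esub> f m)"

lemma linear_map_additive: "linear_map R M N f \<Longrightarrow> add_hom M N f"
  by (simp add: linear_map_def)

lemma linear_map_add:
  "\<lbrakk>linear_map R M N f; m \<in> carrier M; m' \<in> carrier M\<rbrakk> \<Longrightarrow> f (m \<oplus>\<^bsub>M\<^esub> m') = f m \<oplus>\<^bsub>N\<^esub> f m'"
  by (rule add_hom_add [OF linear_map_additive])

lemma linear_map_zero: "linear_map R M N f \<Longrightarrow> f \<zero>\<^bsub>M\<^esub> = \<zero>\<^bsub>N\<^esub>"
  by (rule add_hom_zero [OF linear_map_additive])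

lemma linear_map_smult:
  "\<lbrakk>linear_map R M N f; r \<in> carrier R; m \<in> carrier M\<rbrakk> \<Longrightarrow> f (r \<odot>\<^bsub>M\<^esub> m) = r \<odot>\<^bsub>N\<^esub> f m"
  by (simp add: linear_map_def)

lemma linear_map_closed: "\<lbrakk>linear_map R M N f; m \<in> carrier M\<rbrakk> \<Longrightarrow> f m \<in> carrier N"
  by (meson add_hom_closed linear_map_def)

lemma linear_mapI:
  assumes "abelian_group M" "abelian_group N" "\<And>m. m \<in> carrier M \<Longrightarrow> f m \<in> carrier N"
    "\<And>m m'. \<lbrakk>m \<in> carrier M; m' \<in> carrier M\<rbrakk> \<Longrightarrow> f (m \<oplus>\<^bsub>M\<^esub> m') = f m \<oplus>\<^bsub>N\<^esub> f m'"
    "\<And>r m. \<lbrakk>r \<in> carrier R; m \<in> carrier M\<rbrakk> \<Longrightarrow> f (r \<odot>\<^bsub>M\<^esub> m) = r \<odot>\<^bsub>N\<^esub> f m"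
  shows "linear_map R M N f"
  using assms by (auto simp: linear_map_def add_hom_def)

lemma lin_hom_iff:
  assumes "abelian_group M" "abelian_group N"
  shows "f \<in> lin_hom R M N \<longleftrightarrow> f \<in> extensional (carrier M) \<and> linear_map R M N f"
  using assms by (auto simp: lin_hom_def linear_map_def add_hom_def PiE_def Pi_iff)

lemma lin_hom_linear:
  "\<lbrakk>f \<in> lin_hom R M N; abelian_group M; abelian_group N\<rbrakk> \<Longrightarrow> linear_map R M N f"
  by (simp add: lin_hom_iff)

lemma linear_map_cong:
  assumes "linear_map R M N f" "right_module R M \<or> left_module R M" "\<And>m. m \<in> carrier M \<Longrightarrow> g m = f m"
  shows "linear_map R M N g"
proof -
  have "add_hom M N g"
    using assms by (blast intro: add_hom_cong dest: linear_map_additive)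
  moreover have "r \<odot>\<^bsub>M\<^esub> m \<in> carrier M" if "r \<in> carrier R" "m \<in> carrier M" for r m
    using assms(2) that right_module.ract_closed left_module.lact_closed by metis
  ultimately show ?thesis using assms(1,3) by (simp add: linear_map_def)
qed

lemma restrict_lin_hom:
  assumes "linear_map R M N f" "right_module R M \<or> left_module R M"
  shows "restrict f (carrier M) \<in> lin_hom R M N"
proof -
  have "abelian_group M" "abelian_group N" using assms by (auto simp: linear_map_def add_hom_def)
  then show ?thesis
    using linear_map_cong [OF assms, of "restrict f (carrier M)"] by (simp add: lin_hom_iff)
qed

lemma linear_map_comp:
  assumes "linear_map R M N f" "linear_map R N P g"
  shows "linear_map R M P (\<lambda>m. g (f m))"
  using assms add_hom_comp [of M N f P g]
  by (auto simp: linear_map_def dest: add_hom_closed)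

lemma lin_hom_ext:
  assumes "f \<in> lin_hom R M N" "g \<in> lin_hom R M N'" "\<And>m. m \<in> carrier M \<Longrightarrow> f m = g m"
  shows "f = g"
  using assms by (auto simp: lin_hom_def PiE_def intro: extensionalityI)

lemma lin_hom_cong:
  assumes "carrier M = carrier M'" "carrier N = carrier N'"
    "\<And>m m'. \<lbrakk>m \<in> carrier M; m' \<in> carrier M\<rbrakk> \<Longrightarrow> m \<oplus>\<^bsub>M\<^esub> m' = m \<oplus>\<^bsub>M'\<^esub> m'"
    "\<And>m m'. \<lbrakk>m \<in> carrier N; m' \<in> carrier N\<rbrakk> \<Longrightarrow> m \<oplus>\<^bsub>N\<^esub> m' = m \<oplus>\<^bsub>N'\<^esub> m'"
    "\<And>r m. \<lbrakk>r \<in> carrier R; m \<in> carrier M\<rbrakk> \<Longrightarrow> r \<odot>\<^bsub>M\<^esub> m = r \<odot>\<^bsub>M'\<^esub> m"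
    "\<And>r m. \<lbrakk>r \<in> carrier R; m \<in> carrier N\<rbrakk> \<Longrightarrow> r \<odot>\<^bsub>N\<^esub> m = r \<odot>\<^bsub>N'\<^esub> m"
  shows "lin_hom R M N = lin_hom R M' N'"
proof -
  have "f \<in> lin_hom R M N \<longleftrightarrow> f \<in> lin_hom R M' N'" for f
    unfolding lin_hom_def using assms by (auto simp: PiE_iff)
  then show ?thesis by blast
qed

lemma right_module_group: "right_module R M \<Longrightarrow> abelian_group M"
  by (simp add: right_module_def)

lemma left_module_group: "left_module R M \<Longrightarrow> abelian_group M"
  by (simp add: left_module_def)

lemma right_moduleI:
  fixes R (structure)
  assumes "ring R" "abelian_group M"
    "\<And>r m. \<lbrakk>r \<in> carrier R; m \<in> carrier M\<rbrakk> \<Longrightarrow> m \<triangleleft>\<^bsub>M\<^esub> r \<in> carrier M"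
    "\<And>r m n. \<lbrakk>r \<in> carrier R; m \<in> carrier M; n \<in> carrier M\<rbrakk>
       \<Longrightarrow> (m \<oplus>\<^bsub>M\<^esub> n) \<triangleleft>\<^bsub>M\<^esub> r = m \<triangleleft>\<^bsub>M\<^esub> r \<oplus>\<^bsub>M\<^esub> n \<triangleleft>\<^bsub>M\<^esub> r"
    "\<And>r s m. \<lbrakk>r \<in> carrier R; s \<in> carrier R; m \<in> carrier M\<rbrakk>
       \<Longrightarrow> m \<triangleleft>\<^bsub>M\<^esub> (r \<oplus> s) = m \<triangleleft>\<^bsub>M\<^esub> r \<oplus>\<^bsub>M\<^esub> m \<triangleleft>\<^bsub>M\<^esub> s"
    "\<And>r s m. \<lbrakk>r \<in> carrier R; s \<in> carrier R; m \<in> carrier M\<rbrakk>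
       \<Longrightarrow> m \<triangleleft>\<^bsub>M\<^esub> (r \<otimes> s) = (m \<triangleleft>\<^bsub>M\<^esub> r) \<triangleleft>\<^bsub>M\<^esub> s"
    "\<And>m. m \<in> carrier M \<Longrightarrow> m \<triangleleft>\<^bsub>M\<^esub> \<one> = m"
  shows "right_module R M"
  using assms unfolding right_module_def right_module_axioms_def by blast

text \<open>A left module is a right module over the opposite ring. Results on direct powers, their
  maps and transport are proved for right modules and carried over in this way.\<close>

definition op_ring :: "('r, 'x) ring_scheme \<Rightarrow> ('r, 'x) ring_scheme" where
  "op_ring R = R\<lparr>monoid.mult := \<lambda>r s. s \<otimes>\<^bsub>R\<^esub> r\<rparr>"

lemma op_ring_simps [simp]:
  "carrier (op_ring R) = carrier R" "\<one>\<^bsub>op_ring R\<^esub> = \<one>\<^bsub>R\<^esub>" "\<zero>\<^bsub>op_ring R\<^esub> = \<zero>\<^bsub>R\<^esub>"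
  "add (op_ring R) = add R" "r \<otimes>\<^bsub>op_ring R\<^esub> s = s \<otimes>\<^bsub>R\<^esub> r"
  by (simp_all add: op_ring_def)

lemma ring_op_ring:
  assumes "ring R" shows "ring (op_ring R)"
proof -
  interpret R: ring R by fact
  show ?thesis
    by (rule ringI)
       (auto intro!: abelian_group_cong [OF R.abelian_group_axioms] monoidI
         simp: R.m_assoc R.l_distr R.r_distr)
qed

lemma op_ring_op_ring: "op_ring (op_ring R) = R"
  by (cases R) (simp add: op_ring_def)

lemma right_module_op_ring: "right_module (op_ring R) M \<longleftrightarrow> left_module R M"
proof
  assume "left_module R M"
  then interpret left_module R M .
  show "right_module (op_ring R) M"
    by (rule right_moduleI)
       (auto simp: ring_op_ring R.ring_axioms M.abelian_group_axioms
         lact_closed lact_l_distr lact_r_distr lact_assoc lact_one)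
next
  assume "right_module (op_ring R) M"
  then interpret right_module "op_ring R" M .
  have "ring R" using ring_op_ring [OF R.ring_axioms] by (simp add: op_ring_op_ring)
  then show "left_module R M"
    unfolding left_module_def left_module_axioms_def
    using ract_closed ract_l_distr ract_r_distr ract_assoc ract_one M.abelian_group_axioms by simp
qed

lemma lin_hom_op_ring [simp]: "lin_hom (op_ring R) M N = lin_hom R M N"
  by (simp add: lin_hom_def)

lemma linear_map_op_ring [simp]: "linear_map (op_ring R) M N f \<longleftrightarrow> linear_map R M N f"
  by (simp add: linear_map_def)

context right_module begin

lemma ract_zero_left: "r \<in> carrier R \<Longrightarrow> \<zero>\<^bsub>M\<^esub> \<triangleleft>\<^bsub>M\<^esub> r = \<zero>\<^bsub>M\<^esub>"
proof -
  assume "r \<in> carrier R"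
  then have "add_hom M M (\<lambda>m. m \<triangleleft>\<^bsub>M\<^esub> r)"
    by (auto simp: add_hom_def ract_closed ract_l_distr M.abelian_group_axioms)
  then show ?thesis by (rule add_hom_zero)
qed

lemma additive_ract_left: "r \<in> carrier R \<Longrightarrow> add_hom M M (\<lambda>m. m \<triangleleft>\<^bsub>M\<^esub> r)"
  by (auto simp: add_hom_def ract_closed ract_l_distr M.abelian_group_axioms)

lemma additive_ract_right: "m \<in> carrier M \<Longrightarrow> add_hom R M (\<lambda>r. m \<triangleleft>\<^bsub>M\<^esub> r)"
  by (auto simp: add_hom_def ract_closed ract_r_distr M.abelian_group_axioms R.abelian_group_axioms)

lemma ract_minus_one: "m \<in> carrier M \<Longrightarrow> m \<triangleleft>\<^bsub>M\<^esub> (\<ominus> \<one>) = \<ominus>\<^bsub>M\<^esub> m"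
  using add_hom_neg [OF additive_ract_right, of m "\<one>"] by (simp add: ract_one)

end

text \<open>In a right module, negatives are supplied by the action of
  \<open>\<ominus> \<one>\<close>, as \<open>closed_submodule_neg\<close> shows.\<close>

definition closed_submodule ::
    "('r, 'x) ring_scheme \<Rightarrow> ('r, 'm, 'y) module_scheme \<Rightarrow> 'm set \<Rightarrow> bool" where
  "closed_submodule R M S \<longleftrightarrow> S \<subseteq> carrier M \<and> \<zero>\<^bsub>M\<^esub> \<in> S \<and>
     (\<forall>m\<in>S. \<forall>n\<in>S. m \<oplus>\<^bsub>M\<^esub> n \<in> S) \<and> (\<forall>r\<in>carrier R. \<forall>m\<in>S. r \<odot>\<^bsub>M\<^esub> m \<in> S)"

lemma closed_submodule_neg:
  assumes "right_module R M" "closed_submodule R M S" "m \<in> S"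
  shows "\<ominus>\<^bsub>M\<^esub> m \<in> S"
proof -
  interpret right_module R M by fact
  have "m \<triangleleft>\<^bsub>M\<^esub> (\<ominus>\<^bsub>R\<^esub> \<one>\<^bsub>R\<^esub>) \<in> S" using assms(2,3) by (auto simp: closed_submodule_def)
  moreover have "m \<in> carrier M" using assms(2,3) by (auto simp: closed_submodule_def)
  ultimately show ?thesis by (simp add: ract_minus_one)
qed

lemma closed_submodule_lsum:
  assumes "closed_submodule R M S" "\<And>i. i \<in> set is \<Longrightarrow> f i \<in> S"
  shows "lsum M f is \<in> S"
  using assms(2) by (induction "is") (use assms(1) in \<open>auto simp: closed_submodule_def\<close>)

lemma right_module_submodule:
  assumes "right_module R M" "closed_submodule R M S"
  shows "right_module R (M\<lparr>carrier := S\<rparr>)"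
proof -
  interpret right_module R M by fact
  have S: "m \<in> carrier M" if "m \<in> S" for m using that assms(2) by (auto simp: closed_submodule_def)
  have "abelian_group (M\<lparr>carrier := S\<rparr>)"
  proof (rule abelian_groupI)
    fix m assume "m \<in> carrier (M\<lparr>carrier := S\<rparr>)"
    then have "\<ominus>\<^bsub>M\<^esub> m \<in> S \<and> \<ominus>\<^bsub>M\<^esub> m \<oplus>\<^bsub>M\<^esub> m = \<zero>\<^bsub>M\<^esub>"
      using closed_submodule_neg [OF assms] S by (simp add: M.l_neg)
    then show "\<exists>y\<in>carrier (M\<lparr>carrier := S\<rparr>). y \<oplus>\<^bsub>M\<lparr>carrier := S\<rparr>\<^esub> m = \<zero>\<^bsub>M\<lparr>carrier := S\<rparr>\<^esub>"
      by auto
  qed (use assms(2) S in \<open>auto simp: closed_submodule_def M.a_ac\<close>)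
  then show ?thesis
    using assms(2) S
    by (intro right_moduleI R.ring_axioms)
       (auto simp: closed_submodule_def ract_l_distr ract_r_distr ract_assoc ract_one)
qed

section \<open>Subgroups and quotients\<close>

definition additive_subgroup :: "('g, 'x) ring_scheme \<Rightarrow> 'g set \<Rightarrow> bool" where
  "additive_subgroup G S \<longleftrightarrow> abelian_group G \<and> S \<subseteq> carrier G \<and> \<zero>\<^bsub>G\<^esub> \<in> S \<and>
     (\<forall>a\<in>S. \<forall>b\<in>S. a \<oplus>\<^bsub>G\<^esub> b \<in> S) \<and> (\<forall>a\<in>S. \<ominus>\<^bsub>G\<^esub> a \<in> S)"

text \<open>
  Quotients are formed on chosen representatives of the cosets, so that the carrier type does not
  change; quantification over all modules carried by a fixed type then covers quotients.
\<close>

definition coset_rep :: "('g, 'x) ring_scheme \<Rightarrow> 'g set \<Rightarrow> 'g \<Rightarrow> 'g" where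
  "coset_rep G S a = (SOME b. b \<in> carrier G \<and> a \<ominus>\<^bsub>G\<^esub> b \<in> S)"

definition quotient_module :: "('r, 'm, 'y) module_scheme \<Rightarrow> 'm set \<Rightarrow> ('r, 'm) module" where
  "quotient_module M S =
     \<lparr>carrier = coset_rep M S ` carrier M, monoid.mult = undefined, one = undefined,
      ring.zero = coset_rep M S \<zero>\<^bsub>M\<^esub>, add = (\<lambda>a b. coset_rep M S (a \<oplus>\<^bsub>M\<^esub> b)),
      smult = (\<lambda>r a. coset_rep M S (r \<odot>\<^bsub>M\<^esub> a))\<rparr>"

context
  fixes M :: "('r, 'm, 'y) module_scheme" and S :: "'m set"
  assumes S: "additive_subgroup M S"
begin

interpretation M: abelian_group M using S by (simp add: additive_subgroup_def)

lemma coset_rep: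
  assumes "a \<in> carrier M"
  shows "coset_rep M S a \<in> carrier M" "a \<ominus>\<^bsub>M\<^esub> coset_rep M S a \<in> S"
proof -
  have "a \<in> carrier M \<and> a \<ominus>\<^bsub>M\<^esub> a \<in> S"
    using assms S by (simp add: additive_subgroup_def a_minus_def M.r_neg)
  then have "coset_rep M S a \<in> carrier M \<and> a \<ominus>\<^bsub>M\<^esub> coset_rep M S a \<in> S"
    unfolding coset_rep_def by (rule someI)
  then show "coset_rep M S a \<in> carrier M" "a \<ominus>\<^bsub>M\<^esub> coset_rep M S a \<in> S" by auto
qed

lemma diff_sym: "\<lbrakk>a \<ominus>\<^bsub>M\<^esub> b \<in> S; a \<in> carrier M; b \<in> carrier M\<rbrakk> \<Longrightarrow> b \<ominus>\<^bsub>M\<^esub> a \<in> S"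
proof -
  assume "a \<ominus>\<^bsub>M\<^esub> b \<in> S" "a \<in> carrier M" "b \<in> carrier M"
  moreover from this have "\<ominus>\<^bsub>M\<^esub> (a \<ominus>\<^bsub>M\<^esub> b) = b \<ominus>\<^bsub>M\<^esub> a"
    by (simp add: a_minus_def M.minus_add M.a_comm)
  ultimately show ?thesis using S unfolding additive_subgroup_def by metis
qed

lemma diff_trans:
  "\<lbrakk>a \<ominus>\<^bsub>M\<^esub> b \<in> S; b \<ominus>\<^bsub>M\<^esub> c \<in> S; a \<in> carrier M; b \<in> carrier M; c \<in> carrier M\<rbrakk> \<Longrightarrow> a \<ominus>\<^bsub>M\<^esub> c \<in> S"
proof -
  assume h: "a \<ominus>\<^bsub>M\<^esub> b \<in> S" "b \<ominus>\<^bsub>M\<^esub> c \<in> S" "a \<in> carrier M" "b \<in> carrier M" "c \<in> carrier M"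
  then have "(a \<ominus>\<^bsub>M\<^esub> b) \<oplus>\<^bsub>M\<^esub> (b \<ominus>\<^bsub>M\<^esub> c) = a \<ominus>\<^bsub>M\<^esub> c"
    by (simp add: a_minus_def M.a_assoc M.r_neg1)
  then show ?thesis using h S unfolding additive_subgroup_def by metis
qed

lemma diff_add:
  "\<lbrakk>a \<ominus>\<^bsub>M\<^esub> a' \<in> S; b \<ominus>\<^bsub>M\<^esub> b' \<in> S; a \<in> carrier M; a' \<in> carrier M; b \<in> carrier M; b' \<in> carrier M\<rbrakk>
    \<Longrightarrow> (a \<oplus>\<^bsub>M\<^esub> b) \<ominus>\<^bsub>M\<^esub> (a' \<oplus>\<^bsub>M\<^esub> b') \<in> S"
proof -
  assume h: "a \<ominus>\<^bsub>M\<^esub> a' \<in> S" "b \<ominus>\<^bsub>M\<^esub> b' \<in> S"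
    "a \<in> carrier M" "a' \<in> carrier M" "b \<in> carrier M" "b' \<in> carrier M"
  then have "(a \<ominus>\<^bsub>M\<^esub> a') \<oplus>\<^bsub>M\<^esub> (b \<ominus>\<^bsub>M\<^esub> b') = (a \<oplus>\<^bsub>M\<^esub> b) \<ominus>\<^bsub>M\<^esub> (a' \<oplus>\<^bsub>M\<^esub> b')"
    by (simp add: a_minus_def M.a_ac M.minus_add)
  then show ?thesis using h S unfolding additive_subgroup_def by metis
qed

text \<open>Congruent elements have the same admissible representatives; the choice operator,
  applied to equal predicates, returns the same element.\<close>

lemma coset_rep_eq_iff:
  assumes "a \<in> carrier M" "b \<in> carrier M"
  shows "coset_rep M S a = coset_rep M S b \<longleftrightarrow> a \<ominus>\<^bsub>M\<^esub> b \<in> S"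
proof
  assume "coset_rep M S a = coset_rep M S b"
  then show "a \<ominus>\<^bsub>M\<^esub> b \<in> S"
    using coset_rep [OF assms(1)] coset_rep [OF assms(2)] assms
    by (metis diff_sym diff_trans)
next
  assume ab: "a \<ominus>\<^bsub>M\<^esub> b \<in> S"
  have "(c \<in> carrier M \<and> a \<ominus>\<^bsub>M\<^esub> c \<in> S) \<longleftrightarrow> (c \<in> carrier M \<and> b \<ominus>\<^bsub>M\<^esub> c \<in> S)" for c
    using ab assms by (meson diff_sym diff_trans)
  then show "coset_rep M S a = coset_rep M S b" by (simp add: coset_rep_def)
qed

lemma coset_rep_rep: "a \<in> carrier M \<Longrightarrow> coset_rep M S (coset_rep M S a) = coset_rep M S a"
  by (meson coset_rep coset_rep_eq_iff diff_sym)

lemma coset_rep_add: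
  assumes "a \<in> carrier M" "b \<in> carrier M"
  shows "coset_rep M S (coset_rep M S a \<oplus>\<^bsub>M\<^esub> b) = coset_rep M S (a \<oplus>\<^bsub>M\<^esub> b)"
    "coset_rep M S (a \<oplus>\<^bsub>M\<^esub> coset_rep M S b) = coset_rep M S (a \<oplus>\<^bsub>M\<^esub> b)"
proof -
  have r: "coset_rep M S c \<in> carrier M" "coset_rep M S c \<ominus>\<^bsub>M\<^esub> c \<in> S" "c \<ominus>\<^bsub>M\<^esub> c \<in> S" if "c \<in> carrier M" for c
    using coset_rep [OF that] that S diff_sym [OF coset_rep(2) [OF that]]
    by (auto simp: additive_subgroup_def a_minus_def M.r_neg)
  show "coset_rep M S (coset_rep M S a \<oplus>\<^bsub>M\<^esub> b) = coset_rep M S (a \<oplus>\<^bsub>M\<^esub> b)"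
    "coset_rep M S (a \<oplus>\<^bsub>M\<^esub> coset_rep M S b) = coset_rep M S (a \<oplus>\<^bsub>M\<^esub> b)"
    using assms r by (subst coset_rep_eq_iff; auto intro!: diff_add)+
qed

lemma quotient_simps [simp]:
  "carrier (quotient_module M S) = coset_rep M S ` carrier M"
  "\<zero>\<^bsub>quotient_module M S\<^esub> = coset_rep M S \<zero>\<^bsub>M\<^esub>"
  "a \<oplus>\<^bsub>quotient_module M S\<^esub> b = coset_rep M S (a \<oplus>\<^bsub>M\<^esub> b)"
  "r \<odot>\<^bsub>quotient_module M S\<^esub> a = coset_rep M S (r \<odot>\<^bsub>M\<^esub> a)"
  by (simp_all add: quotient_module_def)

lemma abelian_group_quotient: "abelian_group (quotient_module M S)"
proof (rule abelian_groupI)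
  fix x assume "x \<in> carrier (quotient_module M S)"
  then obtain a where a: "a \<in> carrier M" "x = coset_rep M S a" by auto
  show "\<exists>y\<in>carrier (quotient_module M S). y \<oplus>\<^bsub>quotient_module M S\<^esub> x = \<zero>\<^bsub>quotient_module M S\<^esub>"
    using a by (intro bexI [of _ "coset_rep M S (\<ominus>\<^bsub>M\<^esub> a)"]) (auto simp: coset_rep coset_rep_add M.l_neg)
next
  fix x y assume "x \<in> carrier (quotient_module M S)" "y \<in> carrier (quotient_module M S)"
  then show "x \<oplus>\<^bsub>quotient_module M S\<^esub> y = y \<oplus>\<^bsub>quotient_module M S\<^esub> x"
    using M.a_comm coset_rep(1) by (auto intro!: arg_cong [where f = "coset_rep M S"])
qed (auto simp: coset_rep coset_rep_add coset_rep_rep M.a_assoc)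

lemma coset_rep_additive: "add_hom M (quotient_module M S) (coset_rep M S)"
  by (auto simp: add_hom_def abelian_group_quotient M.abelian_group_axioms coset_rep coset_rep_add)

lemma coset_rep_eq_zero_iff: "a \<in> carrier M \<Longrightarrow> coset_rep M S a = \<zero>\<^bsub>quotient_module M S\<^esub> \<longleftrightarrow> a \<in> S"
proof -
  assume a: "a \<in> carrier M"
  have "\<ominus>\<^bsub>M\<^esub> \<zero>\<^bsub>M\<^esub> = \<zero>\<^bsub>M\<^esub>" by (metis M.minus_equality M.r_zero M.zero_closed)
  then have "a \<ominus>\<^bsub>M\<^esub> \<zero>\<^bsub>M\<^esub> = a" unfolding a_minus_def using a by (metis M.r_zero)
  then show ?thesis using coset_rep_eq_iff [OF a M.zero_closed] by simp
qed

end

lemma additive_subgroup_closed_submodule: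
  "\<lbrakk>right_module R M; closed_submodule R M S\<rbrakk> \<Longrightarrow> additive_subgroup M S"
  using closed_submodule_neg [of R M S] by (auto simp: additive_subgroup_def closed_submodule_def right_module_group)

lemma quotient_right_module:
  assumes "right_module R M" "closed_submodule R M S"
  shows "right_module R (quotient_module M S)" "linear_map R M (quotient_module M S) (coset_rep M S)"
proof -
  interpret right_module R M by fact
  have S: "additive_subgroup M S" by (rule additive_subgroup_closed_submodule [OF assms])
  \<comment> \<open>The action is well defined on cosets: it sends the difference between an element
    and its representative into \<open>S\<close>.\<close>
  have act: "coset_rep M S (coset_rep M S a \<triangleleft>\<^bsub>M\<^esub> r) = coset_rep M S (a \<triangleleft>\<^bsub>M\<^esub> r)"
    if "a \<in> carrier M" "r \<in> carrier R" for a r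
  proof (subst coset_rep_eq_iff [OF S])
    have c: "coset_rep M S a \<in> carrier M" "coset_rep M S a \<ominus>\<^bsub>M\<^esub> a \<in> S"
      using coset_rep [OF S that(1)] diff_sym [OF S _ that(1)] by auto
    then have "(coset_rep M S a \<ominus>\<^bsub>M\<^esub> a) \<triangleleft>\<^bsub>M\<^esub> r \<in> S"
      using assms(2) that by (simp add: closed_submodule_def)
    then show "coset_rep M S a \<triangleleft>\<^bsub>M\<^esub> r \<ominus>\<^bsub>M\<^esub> a \<triangleleft>\<^bsub>M\<^esub> r \<in> S"
      using add_hom_minus [OF additive_ract_left [OF that(2)] c(1) that(1)] by simp
  qed (use that coset_rep [OF S] in \<open>auto intro: ract_closed\<close>)
  note [simp] = quotient_simps [OF S] coset_rep_add [OF S] coset_rep_rep [OF S] coset_rep(1) [OF S] act ract_closed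
  show "right_module R (quotient_module M S)"
  proof (rule right_moduleI)
    fix r s x assume rs: "r \<in> carrier R" "s \<in> carrier R" and "x \<in> carrier (quotient_module M S)"
    then obtain a where a: "a \<in> carrier M" "x = coset_rep M S a" by auto
    show "x \<triangleleft>\<^bsub>quotient_module M S\<^esub> (r \<oplus>\<^bsub>R\<^esub> s) =
        x \<triangleleft>\<^bsub>quotient_module M S\<^esub> r \<oplus>\<^bsub>quotient_module M S\<^esub> x \<triangleleft>\<^bsub>quotient_module M S\<^esub> s"
      using rs a by (simp add: ract_r_distr [symmetric])
    show "x \<triangleleft>\<^bsub>quotient_module M S\<^esub> (r \<otimes>\<^bsub>R\<^esub> s) = (x \<triangleleft>\<^bsub>quotient_module M S\<^esub> r) \<triangleleft>\<^bsub>quotient_module M S\<^esub> s"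
      using rs a by (simp add: ract_assoc [symmetric])
  qed (auto simp: R.ring_axioms abelian_group_quotient [OF S] ract_l_distr ract_one)
  show "linear_map R M (quotient_module M S) (coset_rep M S)"
    using coset_rep_additive [OF S] by (auto simp: linear_map_def)
qed

section \<open>Transport of structure\<close>

text \<open>Brings a module of a foreign type into the universe along an injection of its carrier,
  so that hypotheses quantified over the universe apply to it.\<close>

definition transport :: "('m \<Rightarrow> 'u) \<Rightarrow> ('r, 'm, 'y) module_scheme \<Rightarrow> ('r, 'u) module" where
  "transport h M =
     \<lparr>carrier = h ` carrier M, monoid.mult = undefined, one = undefined,
      ring.zero = h \<zero>\<^bsub>M\<^esub>,
      add = (\<lambda>x y. h (inv_into (carrier M) h x \<oplus>\<^bsub>M\<^esub> inv_into (carrier M) h y)),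
      smult = (\<lambda>r x. h (r \<odot>\<^bsub>M\<^esub> inv_into (carrier M) h x))\<rparr>"

lemma transport_simps [simp]:
  "carrier (transport h M) = h ` carrier M" "\<zero>\<^bsub>transport h M\<^esub> = h \<zero>\<^bsub>M\<^esub>"
  by (simp_all add: transport_def)

lemma transport_add [simp]:
  "\<lbrakk>inj_on h (carrier M); m \<in> carrier M; n \<in> carrier M\<rbrakk> \<Longrightarrow> h m \<oplus>\<^bsub>transport h M\<^esub> h n = h (m \<oplus>\<^bsub>M\<^esub> n)"
  by (simp add: transport_def)

lemma transport_smult [simp]:
  "\<lbrakk>inj_on h (carrier M); m \<in> carrier M\<rbrakk> \<Longrightarrow> r \<odot>\<^bsub>transport h M\<^esub> h m = h (r \<odot>\<^bsub>M\<^esub> m)"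
  by (simp add: transport_def)

lemma abelian_group_transport:
  assumes "abelian_group M" "inj_on h (carrier M)"
  shows "abelian_group (transport h M)"
proof -
  interpret abelian_group M by fact
  show ?thesis
  proof (rule abelian_groupI)
    fix x assume "x \<in> carrier (transport h M)"
    then obtain m where "m \<in> carrier M" "x = h m" by auto
    then show "\<exists>y\<in>carrier (transport h M). y \<oplus>\<^bsub>transport h M\<^esub> x = \<zero>\<^bsub>transport h M\<^esub>"
      using assms(2) by (intro bexI [of _ "h (\<ominus>\<^bsub>M\<^esub> m)"]) (auto simp: l_neg)
  qed (use assms(2) in \<open>auto simp: a_ac\<close>)
qed

lemma right_module_transport:
  assumes "right_module R M" "inj_on h (carrier M)"
  shows "right_module R (transport h M)"
proof -
  interpret right_module R M by fact
  show ?thesis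
    using assms(2)
    by (intro right_moduleI)
       (auto simp: R.ring_axioms abelian_group_transport M.abelian_group_axioms
         ract_closed ract_l_distr ract_r_distr ract_assoc ract_one)
qed

lemma left_module_transport:
  "\<lbrakk>left_module R M; inj_on h (carrier M)\<rbrakk> \<Longrightarrow> left_module R (transport h M)"
  using right_module_transport [of "op_ring R" M h] by (simp add: right_module_op_ring)

lemma linear_map_transport:
  assumes "abelian_group M" "inj_on h (carrier M)"
  shows "linear_map R M (transport h M) h"
  using assms by (intro linear_mapI abelian_group_transport) auto

lemma linear_map_transport_inv:
  assumes "right_module R M \<or> left_module R M" "inj_on h (carrier M)"
  shows "linear_map R (transport h M) M (inv_into (carrier M) h)"
proof -
  have M: "abelian_group M" using assms(1) right_module_group left_module_group by blast
  interpret abelian_group M by fact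
  have cl: "r \<odot>\<^bsub>M\<^esub> m \<in> carrier M" if "r \<in> carrier R" "m \<in> carrier M" for r m
    using assms(1) that right_module.ract_closed left_module.lact_closed by metis
  show ?thesis
    using assms(2) cl by (intro linear_mapI abelian_group_transport M) auto
qed

section \<open>Direct powers and generated modules\<close>

lemma (in abelian_group) neg_zero [simp]: "\<ominus> \<zero> = \<zero>"
  by (metis minus_equality r_zero zero_closed)

context
  fixes W :: "('t, 'w, 'x) module_scheme" and I :: "'i set"
  assumes W: "abelian_group W"
begin

interpretation W: abelian_group W by (rule W)

lemma direct_power_simps [simp]:
  "carrier (direct_power I W) = {w \<in> I \<rightarrow>\<^sub>E carrier W. finite {i \<in> I. w i \<noteq> \<zero>\<^bsub>W\<^esub>}}"
  "\<zero>\<^bsub>direct_power I W\<^esub> = (\<lambda>i\<in>I. \<zero>\<^bsub>W\<^esub>)"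
  "v \<oplus>\<^bsub>direct_power I W\<^esub> w = (\<lambda>i\<in>I. v i \<oplus>\<^bsub>W\<^esub> w i)"
  "t \<odot>\<^bsub>direct_power I W\<^esub> w = (\<lambda>i\<in>I. t \<odot>\<^bsub>W\<^esub> w i)"
  using carrier_sum_group [of I "\<lambda>_. add_monoid W"] W.a_group
  by (simp_all add: direct_power_def)

lemma finite_support_add:
  assumes "finite {i \<in> I. v i \<noteq> \<zero>\<^bsub>W\<^esub>}" "finite {i \<in> I. w i \<noteq> \<zero>\<^bsub>W\<^esub>}"
  shows "finite {i \<in> I. v i \<oplus>\<^bsub>W\<^esub> w i \<noteq> \<zero>\<^bsub>W\<^esub>}"
  by (rule finite_subset [OF _ finite_UnI [OF assms]]) auto

lemma abelian_group_direct_power: "abelian_group (direct_power I W)"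
proof (rule abelian_groupI)
  fix w assume w: "w \<in> carrier (direct_power I W)"
  have "{i \<in> I. \<ominus>\<^bsub>W\<^esub> w i \<noteq> \<zero>\<^bsub>W\<^esub>} \<subseteq> {i \<in> I. w i \<noteq> \<zero>\<^bsub>W\<^esub>}"
    by auto
  then have "finite {i \<in> I. \<ominus>\<^bsub>W\<^esub> w i \<noteq> \<zero>\<^bsub>W\<^esub>}"
    using w finite_subset by auto
  then have fin: "finite {i \<in> I. (\<lambda>i\<in>I. \<ominus>\<^bsub>W\<^esub> w i) i \<noteq> \<zero>\<^bsub>W\<^esub>}"
    by (rule rev_finite_subset) auto
  show "\<exists>v\<in>carrier (direct_power I W). v \<oplus>\<^bsub>direct_power I W\<^esub> w = \<zero>\<^bsub>direct_power I W\<^esub>"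
    using w fin by (intro bexI [of _ "\<lambda>i\<in>I. \<ominus>\<^bsub>W\<^esub> w i"]) (auto simp: PiE_iff W.l_neg intro!: restrict_ext)
next
  fix v w assume vw: "v \<in> carrier (direct_power I W)" "w \<in> carrier (direct_power I W)"
  then have "finite {i \<in> I. v i \<oplus>\<^bsub>W\<^esub> w i \<noteq> \<zero>\<^bsub>W\<^esub>}" using finite_support_add by auto
  then have "finite {i \<in> I. (\<lambda>i\<in>I. v i \<oplus>\<^bsub>W\<^esub> w i) i \<noteq> \<zero>\<^bsub>W\<^esub>}"
    by (rule rev_finite_subset) auto
  then show "v \<oplus>\<^bsub>direct_power I W\<^esub> w \<in> carrier (direct_power I W)"
    using vw by (auto simp: PiE_iff)
next
  show "\<zero>\<^bsub>direct_power I W\<^esub> \<in> carrier (direct_power I W)"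
  proof -
    have "{i \<in> I. (\<lambda>i\<in>I. \<zero>\<^bsub>W\<^esub>) i \<noteq> \<zero>\<^bsub>W\<^esub>} = {}" by auto
    then show ?thesis by simp
  qed
next
  fix u v w
  assume "u \<in> carrier (direct_power I W)" "v \<in> carrier (direct_power I W)" "w \<in> carrier (direct_power I W)"
  then show "u \<oplus>\<^bsub>direct_power I W\<^esub> v \<oplus>\<^bsub>direct_power I W\<^esub> w = u \<oplus>\<^bsub>direct_power I W\<^esub> (v \<oplus>\<^bsub>direct_power I W\<^esub> w)"
    by (auto simp: PiE_iff W.a_assoc intro!: restrict_ext)
next
  fix v w assume "v \<in> carrier (direct_power I W)" "w \<in> carrier (direct_power I W)"
  then show "v \<oplus>\<^bsub>direct_power I W\<^esub> w = w \<oplus>\<^bsub>direct_power I W\<^esub> v"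
    by (auto simp: PiE_iff W.a_comm intro!: restrict_ext)
next
  fix w assume "w \<in> carrier (direct_power I W)"
  then show "\<zero>\<^bsub>direct_power I W\<^esub> \<oplus>\<^bsub>direct_power I W\<^esub> w = w"
    by (auto simp: PiE_iff intro!: extensionalityI [of _ I])
qed

definition power_single :: "'i \<Rightarrow> 'w \<Rightarrow> 'i \<Rightarrow> 'w" where
  "power_single i a = (\<lambda>j\<in>I. if j = i then a else \<zero>\<^bsub>W\<^esub>)"

lemma power_single_closed:
  "\<lbrakk>i \<in> I; a \<in> carrier W\<rbrakk> \<Longrightarrow> power_single i a \<in> carrier (direct_power I W)"
proof -
  assume a: "i \<in> I" "a \<in> carrier W"
  have "finite {j \<in> I. power_single i a j \<noteq> \<zero>\<^bsub>W\<^esub>}"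
    by (rule finite_subset [of _ "{i}"]) (auto simp: power_single_def)
  then show ?thesis using a by (auto simp: power_single_def)
qed

lemma add_hom_power_single:
  "i \<in> I \<Longrightarrow> add_hom W (direct_power I W) (power_single i)"
proof -
  assume i: "i \<in> I"
  have "power_single i (a \<oplus>\<^bsub>W\<^esub> b) = power_single i a \<oplus>\<^bsub>direct_power I W\<^esub> power_single i b"
    if "a \<in> carrier W" "b \<in> carrier W" for a b
    using that by (auto simp: power_single_def intro!: restrict_ext)
  then show ?thesis
    using power_single_closed [OF i] by (auto simp: add_hom_def W abelian_group_direct_power simp del: direct_power_simps)
qed

lemma direct_power_lsum:
  assumes "w \<in> carrier (direct_power I W)" "distinct is" "set is \<subseteq> I" "{i \<in> I. w i \<noteq> \<zero>\<^bsub>W\<^esub>} \<subseteq> set is"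
  shows "w = lsum (direct_power I W) (\<lambda>i. power_single i (w i)) is"
proof -
  have wc: "w i \<in> carrier W" if "i \<in> I" for i using assms(1) that by auto
  have "lsum (direct_power I W) (\<lambda>i. power_single i (w i)) is = (\<lambda>j\<in>I. if j \<in> set is then w j else \<zero>\<^bsub>W\<^esub>)"
    using assms(2,3)
  proof (induction "is")
    case Nil
    then show ?case by auto
  next
    case (Cons i "is")
    then show ?case using wc by (auto simp: power_single_def intro!: restrict_ext)
  qed
  also have "\<dots> = w"
  proof -
    have "w j = \<zero>\<^bsub>W\<^esub>" if "j \<in> I" "j \<notin> set is" for j using assms(4) that by blast
    then show ?thesis using assms(1) by (auto simp: PiE_iff intro!: extensionalityI [of _ I])
  qed
  finally show ?thesis by simp
qed

text \<open>The map out of the direct sum that is induced by the family \<open>h\<close>. Summation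
  runs over the support of the argument, which is finite even if the index set is not.\<close>

definition power_sum :: "('m, 'y) ring_scheme \<Rightarrow> ('i \<Rightarrow> 'w \<Rightarrow> 'm) \<Rightarrow> ('i \<Rightarrow> 'w) \<Rightarrow> 'm" where
  "power_sum M h w = (\<Oplus>\<^bsub>M\<^esub>i\<in>{i \<in> I. w i \<noteq> \<zero>\<^bsub>W\<^esub>}. h i (w i))"

text \<open>Prepares additivity: the supports of two elements and of their sum differ, and the three
  sums must be compared over one index set.\<close>

lemma power_sum_superset:
  assumes h: "\<And>i. i \<in> I \<Longrightarrow> add_hom W M (h i)" and M: "abelian_group M"
    and w: "\<And>i. i \<in> I \<Longrightarrow> w i \<in> carrier W" and J: "finite J" "J \<subseteq> I" "{i \<in> I. w i \<noteq> \<zero>\<^bsub>W\<^esub>} \<subseteq> J"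
  shows "power_sum M h w = (\<Oplus>\<^bsub>M\<^esub>i\<in>J. h i (w i))"
proof -
  interpret M: abelian_group M by (rule M)
  show ?thesis unfolding power_sum_def
  proof (rule M.add.finprod_mono_neutral_cong_left [OF J(1,3)])
    fix i assume "i \<in> J - {i \<in> I. w i \<noteq> \<zero>\<^bsub>W\<^esub>}"
    then have "i \<in> I" "w i = \<zero>\<^bsub>W\<^esub>" using J by auto
    then show "h i (w i) = \<zero>\<^bsub>M\<^esub>" using add_hom_zero [OF h] by simp
  qed (use J(2) w add_hom_closed [OF h] in auto)
qed

lemma power_sum_single:
  assumes h: "\<And>i. i \<in> I \<Longrightarrow> add_hom W M (h i)" and M: "abelian_group M"
    and i: "i \<in> I" and a: "a \<in> carrier W"
  shows "power_sum M h (power_single i a) = h i a"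
proof -
  interpret M: abelian_group M by (rule M)
  have "power_sum M h (power_single i a) = (\<Oplus>\<^bsub>M\<^esub>j\<in>{i}. h j (power_single i a j))"
    by (rule power_sum_superset [OF h M]) (use i a in \<open>auto simp: power_single_def\<close>)
  also have "\<dots> = h i a"
    using add_hom_closed [OF h a] i a by (simp add: power_single_def)
  finally show ?thesis .
qed

lemma add_hom_power_sum:
  assumes h: "\<And>i. i \<in> I \<Longrightarrow> add_hom W M (h i)" and M: "abelian_group M"
  shows "add_hom (direct_power I W) M (power_sum M h)"
proof -
  interpret M: abelian_group M by (rule M)
  have hc: "h i a \<in> carrier M" if "i \<in> I" "a \<in> carrier W" for i a
    using add_hom_closed [OF h] that by blast
  have add: "power_sum M h (v \<oplus>\<^bsub>direct_power I W\<^esub> w) = power_sum M h v \<oplus>\<^bsub>M\<^esub> power_sum M h w"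
    if "v \<in> carrier (direct_power I W)" "w \<in> carrier (direct_power I W)" for v w
  proof -
    let ?J = "{i \<in> I. v i \<noteq> \<zero>\<^bsub>W\<^esub>} \<union> {i \<in> I. w i \<noteq> \<zero>\<^bsub>W\<^esub>}"
    have J: "finite ?J" "?J \<subseteq> I" using that by auto
    have c: "v i \<in> carrier W" "w i \<in> carrier W" if "i \<in> I" for i
      using that \<open>v \<in> _\<close> \<open>w \<in> _\<close> by auto
    have "power_sum M h (v \<oplus>\<^bsub>direct_power I W\<^esub> w) = (\<Oplus>\<^bsub>M\<^esub>i\<in>?J. h i ((v \<oplus>\<^bsub>direct_power I W\<^esub> w) i))"
      by (rule power_sum_superset [OF h M _ J]) (use c in auto)
    also have "\<dots> = (\<Oplus>\<^bsub>M\<^esub>i\<in>?J. h i (v i) \<oplus>\<^bsub>M\<^esub> h i (w i))"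
      by (rule M.finsum_cong') (use c hc add_hom_add [OF h] in auto)
    also have "\<dots> = (\<Oplus>\<^bsub>M\<^esub>i\<in>?J. h i (v i)) \<oplus>\<^bsub>M\<^esub> (\<Oplus>\<^bsub>M\<^esub>i\<in>?J. h i (w i))"
      by (rule M.finsum_addf) (use c hc in auto)
    also have "\<dots> = power_sum M h v \<oplus>\<^bsub>M\<^esub> power_sum M h w"
      using power_sum_superset [OF h M _ J, where w = v] power_sum_superset [OF h M _ J, where w = w] c
      by auto
    finally show ?thesis .
  qed
  have "power_sum M h w \<in> carrier M" if "w \<in> carrier (direct_power I W)" for w
    unfolding power_sum_def using that hc by (intro M.finsum_closed) auto
  with add show ?thesis
    by (simp add: add_hom_def abelian_group_direct_power M.abelian_group_axioms del: direct_power_simps)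
qed

lemma add_hom_power_eq:
  assumes "add_hom (direct_power I W) M f" "add_hom (direct_power I W) M g"
    and "\<And>i a. \<lbrakk>i \<in> I; a \<in> carrier W\<rbrakk> \<Longrightarrow> f (power_single i a) = g (power_single i a)"
    and w: "w \<in> carrier (direct_power I W)"
  shows "f w = g w"
proof -
  obtain "is" where "is": "set is = {i \<in> I. w i \<noteq> \<zero>\<^bsub>W\<^esub>}" "distinct is"
    using w finite_distinct_list [of "{i \<in> I. w i \<noteq> \<zero>\<^bsub>W\<^esub>}"] by auto
  have c: "power_single i (w i) \<in> carrier (direct_power I W)" "i \<in> I" "w i \<in> carrier W" if "i \<in> set is" for i
    using that w "is" by (auto intro!: power_single_closed simp del: direct_power_simps(1)) (auto simp: PiE_iff)
  have eq: "w = lsum (direct_power I W) (\<lambda>i. power_single i (w i)) is"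
    by (rule direct_power_lsum [OF w]) (use "is" in auto)
  have "f (lsum (direct_power I W) (\<lambda>i. power_single i (w i)) is)
      = g (lsum (direct_power I W) (\<lambda>i. power_single i (w i)) is)"
    using c assms(3) by (simp add: add_hom_lsum [OF assms(1)] add_hom_lsum [OF assms(2)] cong: lsum_cong)
  then show ?thesis using eq by simp
qed

end

lemma direct_power_right_module:
  assumes "right_module T W"
  shows "right_module T (direct_power I W)"
proof -
  interpret right_module T W by fact
  note [simp] = direct_power_simps [OF M.abelian_group_axioms]
  have act: "(\<lambda>i\<in>I. w i \<triangleleft>\<^bsub>W\<^esub> t) \<in> carrier (direct_power I W)"
    if "t \<in> carrier T" "w \<in> carrier (direct_power I W)" for t w
  proof -
    have "finite {i \<in> I. w i \<noteq> \<zero>\<^bsub>W\<^esub>}" using that by simp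
    then have "finite {i \<in> I. (\<lambda>i\<in>I. w i \<triangleleft>\<^bsub>W\<^esub> t) i \<noteq> \<zero>\<^bsub>W\<^esub>}"
      by (rule rev_finite_subset) (use that ract_zero_left in auto)
    then show ?thesis using that by (auto simp: ract_closed PiE_iff)
  qed
  show ?thesis
  proof (rule right_moduleI)
    show "abelian_group (direct_power I W)"
      by (rule abelian_group_direct_power [OF M.abelian_group_axioms])
    show "w \<triangleleft>\<^bsub>direct_power I W\<^esub> t \<in> carrier (direct_power I W)"
      if "t \<in> carrier T" "w \<in> carrier (direct_power I W)" for t w
      using act [OF that] by simp
  qed (auto simp: R.ring_axioms PiE_iff ract_l_distr ract_r_distr ract_assoc ract_one
      intro!: restrict_ext extensionalityI [of _ I])
qed

lemma linear_map_power_single: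
  assumes "right_module T W" "i \<in> I"
  shows "linear_map T W (direct_power I W) (power_single W I i)"
proof -
  interpret right_module T W by fact
  show ?thesis unfolding linear_map_def
    using assms(2) add_hom_power_single [OF M.abelian_group_axioms assms(2)]
    by (auto simp: power_single_def [OF M.abelian_group_axioms] direct_power_simps [OF M.abelian_group_axioms]
        ract_zero_left intro!: restrict_ext)
qed

lemma linear_map_power_sum:
  assumes "right_module T W" "right_module T M" "\<And>i. i \<in> I \<Longrightarrow> linear_map T W M (h i)"
  shows "linear_map T (direct_power I W) M (power_sum W I M h)"
proof -
  interpret W: right_module T W by fact
  interpret M: right_module T M by fact
  interpret P: right_module T "direct_power I W" by (rule direct_power_right_module) fact
  have h: "add_hom W M (h i)" if "i \<in> I" for i
    using assms(3) [OF that] by (rule linear_map_additive)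
  note sum = add_hom_power_sum [OF W.M.abelian_group_axioms h M.M.abelian_group_axioms]
  have "power_sum W I M h (w \<triangleleft>\<^bsub>direct_power I W\<^esub> t) = power_sum W I M h w \<triangleleft>\<^bsub>M\<^esub> t"
    if t: "t \<in> carrier T" and w: "w \<in> carrier (direct_power I W)" for t w
  proof (rule add_hom_power_eq [OF W.M.abelian_group_axioms _ _ _ w])
    show "add_hom (direct_power I W) M (\<lambda>w. power_sum W I M h (w \<triangleleft>\<^bsub>direct_power I W\<^esub> t))"
      by (rule add_hom_comp [OF P.additive_ract_left [OF t] sum])
    show "add_hom (direct_power I W) M (\<lambda>w. power_sum W I M h w \<triangleleft>\<^bsub>M\<^esub> t)"
      by (rule add_hom_comp [OF sum M.additive_ract_left [OF t]])
    fix i a assume ia: "i \<in> I" "a \<in> carrier W"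
    have single: "power_sum W I M h (power_single W I i b) = h i b" if "b \<in> carrier W" for b
      by (rule power_sum_single [OF W.M.abelian_group_axioms h M.M.abelian_group_axioms ia(1) that])
    have "power_single W I i a \<triangleleft>\<^bsub>direct_power I W\<^esub> t = power_single W I i (a \<triangleleft>\<^bsub>W\<^esub> t)"
      using linear_map_smult [OF linear_map_power_single [OF assms(1) ia(1)] t ia(2)] by simp
    then show "power_sum W I M h (power_single W I i a \<triangleleft>\<^bsub>direct_power I W\<^esub> t)
        = power_sum W I M h (power_single W I i a) \<triangleleft>\<^bsub>M\<^esub> t"
      using single [OF ia(2)] single [OF W.ract_closed [OF t ia(2)]] linear_map_smult [OF assms(3) t ia(2)] ia(1)
      by metis
  qed
  then show ?thesis using sum by (simp add: linear_map_def)
qed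

text \<open>With this submodule, generation by \<open>W\<close> becomes a statement about single
  elements, free of index sets and of their types.\<close>

definition trace ::
    "('t, 'x) ring_scheme \<Rightarrow> ('t, 'w, 'y) module_scheme \<Rightarrow> ('t, 'm, 'z) module_scheme \<Rightarrow> 'm set" where
  "trace T W M = {lsum M (\<lambda>(h, w). h w) ks | ks. set ks \<subseteq> lin_hom T W M \<times> carrier W}"

lemma traceI: "set ks \<subseteq> lin_hom T W M \<times> carrier W \<Longrightarrow> lsum M (\<lambda>(h, w). h w) ks \<in> trace T W M"
  by (auto simp: trace_def)

lemma lin_hom_closed: "\<lbrakk>h \<in> lin_hom T W M; w \<in> carrier W\<rbrakk> \<Longrightarrow> h w \<in> carrier M"
  by (auto simp: lin_hom_def)

lemma trace_closed_submodule:
  assumes "right_module T W" "right_module T M"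
  shows "closed_submodule T M (trace T W M)"
proof -
  interpret W: right_module T W by fact
  interpret M: right_module T M by fact
  have hc: "(\<lambda>(h, w). h w) p \<in> carrier M" if "p \<in> lin_hom T W M \<times> carrier W" for p
    using that lin_hom_closed [of "fst p" T W M "snd p"] by (cases p) auto
  show ?thesis unfolding closed_submodule_def
  proof (intro conjI ballI subsetI)
    fix m assume "m \<in> trace T W M"
    then obtain ks where ks: "set ks \<subseteq> lin_hom T W M \<times> carrier W" "m = lsum M (\<lambda>(h, w). h w) ks"
      by (auto simp: trace_def)
    then show "m \<in> carrier M" using hc by (auto intro!: lsum_closed M.M.abelian_group_axioms)
    fix n assume "n \<in> trace T W M"
    then obtain ls where ls: "set ls \<subseteq> lin_hom T W M \<times> carrier W" "n = lsum M (\<lambda>(h, w). h w) ls"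
      by (auto simp: trace_def)
    have "m \<oplus>\<^bsub>M\<^esub> n = lsum M (\<lambda>(h, w). h w) (ks @ ls)"
      unfolding ks ls by (rule lsum_append [symmetric, OF M.M.abelian_group_axioms]) (use ks ls hc in blast)+
    then show "m \<oplus>\<^bsub>M\<^esub> n \<in> trace T W M" using ks ls by (auto intro!: traceI)
  next
    show "\<zero>\<^bsub>M\<^esub> \<in> trace T W M" using traceI [of "[]"] by simp
  next
    fix t m assume t: "t \<in> carrier T" and "m \<in> trace T W M"
    then obtain ks where ks: "set ks \<subseteq> lin_hom T W M \<times> carrier W" "m = lsum M (\<lambda>(h, w). h w) ks"
      by (auto simp: trace_def)
    have "m \<triangleleft>\<^bsub>M\<^esub> t = lsum M (\<lambda>p. (\<lambda>(h, w). h w) p \<triangleleft>\<^bsub>M\<^esub> t) ks"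
      unfolding ks by (rule add_hom_lsum [OF M.additive_ract_left [OF t]]) (use ks hc in blast)
    also have "\<dots> = lsum M (\<lambda>(h, w). h w) (map (\<lambda>(h, w). (h, w \<triangleleft>\<^bsub>W\<^esub> t)) ks)"
      unfolding lsum_map using ks t by (intro lsum_cong) (auto simp: lin_hom_def)
    finally show "m \<triangleleft>\<^bsub>M\<^esub> t \<in> trace T W M"
      using t by (auto intro!: traceI W.ract_closed dest: subsetD [OF ks(1)])
  qed
qed

lemma lin_hom_image_trace:
  assumes "h \<in> lin_hom T W M" "w \<in> carrier W" "abelian_group M"
  shows "h w \<in> trace T W M"
proof -
  interpret abelian_group M by fact
  show ?thesis using traceI [of "[(h, w)]" T W M] assms lin_hom_closed [OF assms(1,2)] by simp
qed

lemma trace_linear_image: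
  assumes "right_module T W" "right_module T M" "right_module T N" "linear_map T M N f" "m \<in> trace T W M"
  shows "f m \<in> trace T W N"
proof -
  interpret W: right_module T W by fact
  interpret M: right_module T M by fact
  interpret N: right_module T N by fact
  obtain ks where ks: "set ks \<subseteq> lin_hom T W M \<times> carrier W" "m = lsum M (\<lambda>(h, w). h w) ks"
    using assms by (auto simp: trace_def)
  have lin: "restrict (\<lambda>w. f (h w)) (carrier W) \<in> lin_hom T W N" if "h \<in> lin_hom T W M" for h
    using that assms W.M.abelian_group_axioms M.M.abelian_group_axioms
    by (intro restrict_lin_hom linear_map_comp [OF _ assms(4)]) (auto simp: lin_hom_iff)
  have "f m = lsum N (\<lambda>p. f ((\<lambda>(h, w). h w) p)) ks"
    unfolding ks
  proof (rule add_hom_lsum [OF linear_map_additive [OF assms(4)]])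
    fix p assume "p \<in> set ks"
    then show "(\<lambda>(h, w). h w) p \<in> carrier M"
      using ks(1) lin_hom_closed [of "fst p" T W M "snd p"] by (cases p) auto
  qed
  also have "\<dots> = lsum N (\<lambda>(h, w). h w) (map (\<lambda>(h, w). (restrict (\<lambda>w. f (h w)) (carrier W), w)) ks)"
    unfolding lsum_map using ks by (intro lsum_cong) auto
  finally have eq: "f m = lsum N (\<lambda>(h, w). h w)
      (map (\<lambda>(h, w). (restrict (\<lambda>w. f (h w)) (carrier W), w)) ks)" .
  show ?thesis unfolding eq
    by (rule traceI) (use ks(1) in \<open>auto intro!: lin dest!: subsetD [OF ks(1)]\<close>)
qed

text \<open>A surjection from a direct sum splits into its components, whose images lie in the
  trace. Conversely all of \<open>lin_hom T W M\<close> serves as index set; its elements have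
  exactly the index type allowed in \<open>generated\<close>.\<close>

lemma generated_iff:
  fixes W :: "('t, 'w, 'y) module_scheme" and M :: "('t, 'm, 'z) module_scheme"
  assumes "right_module T W"
  shows "generated T W M \<longleftrightarrow> right_module T M \<and> carrier M \<subseteq> trace T W M"
proof (cases "right_module T M")
  case True
  interpret W: right_module T W by fact
  interpret M: right_module T M by fact
  note gW = W.M.abelian_group_axioms and gM = M.M.abelian_group_axioms
  show ?thesis
  proof
    assume "generated T W M"
    then obtain I :: "('w \<Rightarrow> 'm) set" and p where p: "p \<in> lin_hom T (direct_power I W) M" "p ` carrier (direct_power I W) = carrier M"
      by (auto simp: generated_def)
    interpret P: right_module T "direct_power I W" by (rule direct_power_right_module) fact
    note gP = P.M.abelian_group_axioms
    have lp: "linear_map T (direct_power I W) M p"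
      by (rule lin_hom_linear [OF p(1) gP gM])
    have lh: "restrict (\<lambda>w. p (power_single W I i w)) (carrier W) \<in> lin_hom T W M" if "i \<in> I" for i
      using assms by (intro restrict_lin_hom linear_map_comp [OF linear_map_power_single lp] that) auto
    have "m \<in> trace T W M" if "m \<in> carrier M" for m
    proof -
      have "m \<in> p ` carrier (direct_power I W)" using that by (simp only: p(2))
      then obtain w where w: "w \<in> carrier (direct_power I W)" "m = p w" by (metis imageE)
      obtain "is" where "is": "set is = {i \<in> I. w i \<noteq> \<zero>\<^bsub>W\<^esub>}" "distinct is"
        using w finite_distinct_list [of "{i \<in> I. w i \<noteq> \<zero>\<^bsub>W\<^esub>}"] by (auto simp: direct_power_simps [OF gW])
      have c: "w i \<in> carrier W" "i \<in> I" if "i \<in> set is" for i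
        using that w "is" by (auto simp: PiE_iff direct_power_simps [OF gW])
      have "w = lsum (direct_power I W) (\<lambda>i. power_single W I i (w i)) is"
        by (rule direct_power_lsum [OF gW w(1)]) (use "is" in auto)
      then have "m = p (lsum (direct_power I W) (\<lambda>i. power_single W I i (w i)) is)" using w(2) by simp
      also have "\<dots> = lsum M (\<lambda>i. p (power_single W I i (w i))) is"
        by (rule add_hom_lsum [OF linear_map_additive [OF lp] power_single_closed [OF gW c(2) c(1)]])
      also have "\<dots> = lsum M (\<lambda>(h, w). h w)
          (map (\<lambda>i. (restrict (\<lambda>w. p (power_single W I i w)) (carrier W), w i)) is)"
        unfolding lsum_map using c by (intro lsum_cong) auto
      finally show ?thesis using c lh by (auto intro!: traceI)
    qed
    then show "right_module T M \<and> carrier M \<subseteq> trace T W M" using True by blast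
  next
    assume "right_module T M \<and> carrier M \<subseteq> trace T W M"
    then have sub: "carrier M \<subseteq> trace T W M" by blast
    let ?I = "lin_hom T W M" and ?P = "direct_power (lin_hom T W M) W"
    let ?p = "power_sum W ?I M (\<lambda>h. h)"
    interpret P: right_module T ?P by (rule direct_power_right_module) fact
    have lh: "linear_map T W M h" if "h \<in> ?I" for h by (rule lin_hom_linear [OF that gW gM])
    have lp: "linear_map T ?P M ?p" by (rule linear_map_power_sum) (use assms True lh in auto)
    have rp: "restrict ?p (carrier ?P) \<in> lin_hom T ?P M"
      by (rule restrict_lin_hom [OF lp]) (simp add: P.right_module_axioms)
    have "carrier M \<subseteq> restrict ?p (carrier ?P) ` carrier ?P"
    proof
      fix m assume "m \<in> carrier M"
      then obtain ks where ks: "set ks \<subseteq> lin_hom T W M \<times> carrier W" "m = lsum M (\<lambda>(h, w). h w) ks"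
        using sub by (auto simp: trace_def)
      let ?w = "lsum ?P (\<lambda>(h, w). power_single W ?I h w) ks"
      have c: "(\<lambda>(h, w). power_single W ?I h w) k \<in> carrier ?P" if "k \<in> set ks" for k
        using subsetD [OF ks(1) that] power_single_closed [OF gW, of "fst k" ?I "snd k"]
        by (simp add: case_prod_beta mem_Times_iff)
      then have "?w \<in> carrier ?P" by (intro lsum_closed P.M.abelian_group_axioms)
      moreover have "?p ?w = lsum M (\<lambda>k. ?p ((\<lambda>(h, w). power_single W ?I h w) k)) ks"
        by (rule add_hom_lsum [OF linear_map_additive [OF lp] c])
      moreover have "\<dots> = m"
        unfolding ks(2) using ks(1)
        by (intro lsum_cong) (auto simp: power_sum_single [OF gW linear_map_additive [OF lh] gM])
      ultimately show "m \<in> restrict ?p (carrier ?P) ` carrier ?P"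
        by (intro image_eqI [of _ _ ?w]) auto
    qed
    moreover have "restrict ?p (carrier ?P) ` carrier ?P \<subseteq> carrier M"
      using linear_map_closed [OF lp] by (simp add: image_subset_iff)
    ultimately have "restrict ?p (carrier ?P) ` carrier ?P = carrier M" by (rule equalityI [rotated])
    then show "generated T W M" unfolding generated_def using True rp by blast
  qed
qed (simp add: generated_def)

section \<open>Cardinality bounds\<close>

lemma lists_lepoll_infinite:
  assumes "infinite (UNIV :: 'u set)" "X \<lesssim> (UNIV :: 'u set)"
  shows "lists X \<lesssim> (UNIV :: 'u set)"
proof -
  have "lists X \<lesssim> lists (UNIV :: 'u set)" by (rule lists_lepoll_mono) fact
  also have "lists (UNIV :: 'u set) \<approx> (UNIV :: 'u set)"
    using card_of_lists_infinite [OF assms(1)] by (simp add: eqpoll_iff_card_of_ordIso)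
  finally show ?thesis .
qed

lemma times_lepoll_infinite:
  assumes "infinite (UNIV :: 'u set)" "X \<lesssim> (UNIV :: 'u set)" "Y \<lesssim> (UNIV :: 'u set)"
  shows "X \<times> Y \<lesssim> (UNIV :: 'u set)"
proof -
  have "X \<times> Y \<lesssim> (UNIV :: 'u set) \<times> (UNIV :: 'u set)" using assms by (intro times_lepoll_mono)
  also have "\<dots> \<lesssim> lists (UNIV :: 'u set)"
    unfolding lepoll_def by (rule exI [of _ "\<lambda>(x, y). [x, y]"]) (auto simp: inj_on_def)
  also have "\<dots> \<lesssim> (UNIV :: 'u set)" by (rule lists_lepoll_infinite [OF assms(1)]) simp
  finally show ?thesis .
qed

text \<open>An infinite set is as large as the set of its lists; so a structure whose elements are
  finite sums is no larger than an infinite bound on the summands.\<close>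

lemma lists_image_lepoll:
  assumes "infinite (UNIV :: 'u set)" "X \<lesssim> (UNIV :: 'u set)" "S \<subseteq> g ` lists X"
  shows "S \<lesssim> (UNIV :: 'u set)"
  using lepoll_trans [OF subset_image_lepoll [OF assms(3)] lists_lepoll_infinite [OF assms(1,2)]] .

lemma (in tensor_product) tensor_lepoll:
  assumes "infinite (UNIV :: 'u set)" "carrier M \<lesssim> (UNIV :: 'u set)" "carrier N \<lesssim> (UNIV :: 'u set)"
  shows "carrier (tensor R M N) \<lesssim> (UNIV :: 'u set)"
proof (rule lists_image_lepoll [OF assms(1) times_lepoll_infinite [OF assms]])
  show "carrier (tensor R M N)
      \<subseteq> lsum (tensor R M N) (\<lambda>(m, n). tens R M N m n) ` lists (carrier M \<times> carrier N)"
    by (auto elim!: tensor_list)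
qed

lemma direct_power_lepoll:
  assumes "infinite (UNIV :: 'u set)" "I \<lesssim> (UNIV :: 'u set)" "carrier W \<lesssim> (UNIV :: 'u set)" "abelian_group W"
  shows "carrier (direct_power I W) \<lesssim> (UNIV :: 'u set)"
proof (rule lists_image_lepoll [OF assms(1) times_lepoll_infinite [OF assms(1-3)]])
  show "carrier (direct_power I W)
      \<subseteq> lsum (direct_power I W) (\<lambda>(i, w). power_single W I i w) ` lists (I \<times> carrier W)"
  proof
    fix w assume w: "w \<in> carrier (direct_power I W)"
    obtain "is" where "is": "set is = {i \<in> I. w i \<noteq> \<zero>\<^bsub>W\<^esub>}" "distinct is"
      using w finite_distinct_list [of "{i \<in> I. w i \<noteq> \<zero>\<^bsub>W\<^esub>}"]
      by (auto simp: direct_power_simps [OF assms(4)])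
    have "w = lsum (direct_power I W) (\<lambda>i. power_single W I i (w i)) is"
      by (rule direct_power_lsum [OF assms(4) w]) (use "is" in auto)
    also have "\<dots> = lsum (direct_power I W) (\<lambda>(i, w). power_single W I i w) (map (\<lambda>i. (i, w i)) is)"
      by (simp add: lsum_map)
    finally show "w \<in> lsum (direct_power I W) (\<lambda>(i, w). power_single W I i w) ` lists (I \<times> carrier W)"
      using w "is" by (intro image_eqI) (auto simp: direct_power_simps [OF assms(4)] PiE_iff)
  qed
qed

section \<open>Functoriality and exactness of the tensor product\<close>

abbreviation tensor_map ::
    "('r, 'x) ring_scheme \<Rightarrow> ('r, 'l, 'y) module_scheme \<Rightarrow> ('r, 'n, 'z) module_scheme \<Rightarrow> ('m \<Rightarrow> 'l)
     \<Rightarrow> ('m \<times> 'n \<Rightarrow>\<^sub>0 int) set \<Rightarrow> ('l \<times> 'n \<Rightarrow>\<^sub>0 int) set" where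
  "tensor_map R L N f \<equiv> tensor_lift (tensor R L N) (\<lambda>m n. tens R L N (f m) n)"

lemma tensor_productI: "\<lbrakk>right_module R M; left_module R N\<rbrakk> \<Longrightarrow> tensor_product R M N"
  by (simp add: tensor_product_def)

lemma balanced_tensor_map:
  assumes "right_module R M" "right_module R L" "left_module R N" "linear_map R M L f"
  shows "balanced R M N (tensor R L N) (\<lambda>m n. tens R L N (f m) n)"
proof -
  interpret L: tensor_product R L N using assms by (intro tensor_productI)
  show ?thesis
    using assms(4) linear_map_add [OF assms(4)]
    by (intro balancedI L.abelian_group_tensor)
       (simp_all add: L.tens_add_left L.tens_add_right L.tens_balanced linear_map_closed
         linear_map_smult)
qed

context
  fixes R :: "('r, 'x) ring_scheme" and M :: "('r, 'm, 'y) module_scheme"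
    and L :: "('r, 'l, 'w) module_scheme" and N :: "('r, 'n, 'z) module_scheme" and f :: "'m \<Rightarrow> 'l"
  assumes M: "right_module R M" and L: "right_module R L" and N: "left_module R N"
    and f: "linear_map R M L f"
begin

interpretation M: tensor_product R M N using M N by (rule tensor_productI)

lemma tensor_map_tens:
  "\<lbrakk>m \<in> carrier M; n \<in> carrier N\<rbrakk> \<Longrightarrow> tensor_map R L N f (tens R M N m n) = tens R L N (f m) n"
  by (rule M.tensor_lift_tens [OF balanced_tensor_map [OF M L N f]])

lemma tensor_map_additive: "add_hom (tensor R M N) (tensor R L N) (tensor_map R L N f)"
  by (rule M.tensor_lift_additive [OF balanced_tensor_map [OF M L N f]])

lemma tensor_map_closed:
  "t \<in> carrier (tensor R M N) \<Longrightarrow> tensor_map R L N f t \<in> carrier (tensor R L N)"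
  by (rule add_hom_closed [OF tensor_map_additive])

lemma tensor_map_lsum:
  "set ps \<subseteq> carrier M \<times> carrier N \<Longrightarrow> tensor_map R L N f (lsum (tensor R M N) (\<lambda>(m, n). tens R M N m n) ps)
    = lsum (tensor R L N) (\<lambda>(m, n). tens R L N (f m) n) ps"
  by (rule tensor_product.tensor_lift_lsum [OF tensor_productI [OF M N] balanced_tensor_map [OF M L N f]])

lemma tensor_map_cong:
  assumes "\<And>m. m \<in> carrier M \<Longrightarrow> g m = f m" "t \<in> carrier (tensor R M N)"
  shows "tensor_map R L N g t = tensor_map R L N f t"
proof -
  have g: "linear_map R M L g" by (rule linear_map_cong [OF f]) (simp_all add: M assms(1))
  have bg: "balanced R M N (tensor R L N) (\<lambda>m n. tens R L N (g m) n)"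
    by (rule balanced_tensor_map [OF M L N g])
  show ?thesis
    by (rule M.add_hom_tensor_eq [OF M.tensor_lift_additive [OF bg] tensor_map_additive _ assms(2)])
       (simp add: M.tensor_lift_tens [OF bg] tensor_map_tens assms(1))
qed

end

lemma tensor_map_comp:
  assumes "right_module R M" "right_module R L" "right_module R P" "left_module R N"
    and f: "linear_map R M L f" and g: "linear_map R L P g" and t: "t \<in> carrier (tensor R M N)"
  shows "tensor_map R P N g (tensor_map R L N f t) = tensor_map R P N (\<lambda>m. g (f m)) t"
proof -
  interpret M: tensor_product R M N using assms by (intro tensor_productI)
  note fg = linear_map_comp [OF f g]
  show ?thesis
    by (rule M.add_hom_tensor_eq [OF
          add_hom_comp [OF tensor_map_additive tensor_map_additive] tensor_map_additive _ t])
       (use assms fg in \<open>auto simp: tensor_map_tens [of R M L N f] tensor_map_tens [of R L P N g]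
          tensor_map_tens [OF _ _ _ fg] linear_map_closed\<close>)
qed

lemma tensor_map_id:
  assumes "right_module R M" "left_module R N" "\<And>m. m \<in> carrier M \<Longrightarrow> f m = m" "t \<in> carrier (tensor R M N)"
  shows "tensor_map R M N f t = t"
proof -
  interpret M: tensor_product R M N using assms by (intro tensor_productI)
  have f: "linear_map R M M f"
    by (rule linear_map_cong [of R M M "\<lambda>m. m"])
       (use assms in \<open>auto intro!: linear_mapI right_module_group right_module.ract_closed\<close>)
  have id: "add_hom (tensor R M N) (tensor R M N) (\<lambda>t. t)"
    by (auto simp: add_hom_def M.abelian_group_tensor)
  show ?thesis
    by (rule M.add_hom_tensor_eq [OF tensor_map_additive id])
       (use assms f in \<open>auto simp: tensor_map_tens [of R M M N f]\<close>)
qed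

lemma tensor_map_bij:
  assumes M: "right_module R M" and L: "right_module R L" and N: "left_module R N"
    and f: "linear_map R M L f" and g: "linear_map R L M g"
    and gf: "\<And>m. m \<in> carrier M \<Longrightarrow> g (f m) = m" and fg: "\<And>l. l \<in> carrier L \<Longrightarrow> f (g l) = l"
  shows "bij_betw (tensor_map R L N f) (carrier (tensor R M N)) (carrier (tensor R L N))"
proof (rule bij_betw_byWitness [where f' = "tensor_map R M N g"])
  show "\<forall>t\<in>carrier (tensor R M N). tensor_map R M N g (tensor_map R L N f t) = t"
    using tensor_map_comp [OF M L M N f g] tensor_map_id [OF M N, of "\<lambda>m. g (f m)"] gf by simp
  show "\<forall>t\<in>carrier (tensor R L N). tensor_map R L N f (tensor_map R M N g t) = t"
    using tensor_map_comp [OF L M L N g f] tensor_map_id [OF L N, of "\<lambda>m. f (g m)"] fg by simp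
qed (use tensor_map_closed [OF M L N f] tensor_map_closed [OF L M N g] in auto)

text \<open>Let \<open>S\<close> be the subgroup of \<open>M \<otimes> N\<close> spanned by the
  tensors with left factor in the kernel of \<open>f\<close>. Modulo \<open>S\<close> a pure tensor
  depends on its left factor only through \<open>f\<close>; this defines a map on
  \<open>L \<otimes> N\<close> through which the projection modulo \<open>S\<close> factors. Hence
  an element vanishing in \<open>L \<otimes> N\<close> lies in \<open>S\<close>.\<close>

lemma tensor_right_exact:
  assumes M: "right_module R M" and L: "right_module R L" and N: "left_module R N"
    and f: "linear_map R M L f" and surj: "carrier L \<subseteq> f ` carrier M"
    and t: "t \<in> carrier (tensor R M N)" "tensor_map R L N f t = \<zero>\<^bsub>tensor R L N\<^esub>"
  obtains ps where "set ps \<subseteq> {m \<in> carrier M. f m = \<zero>\<^bsub>L\<^esub>} \<times> carrier N"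
    "t = lsum (tensor R M N) (\<lambda>(m, n). tens R M N m n) ps"
proof -
  interpret M: tensor_product R M N using M N by (rule tensor_productI)
  interpret L: tensor_product R L N using L N by (rule tensor_productI)
  let ?K = "{m \<in> carrier M. f m = \<zero>\<^bsub>L\<^esub>}" and ?s = "lsum (tensor R M N) (\<lambda>(m, n). tens R M N m n)"
  \<comment> \<open>\<open>quotient_module\<close> expects a module record, so the group receives a
    dummy action; only its addition is used.\<close>
  let ?G = "with_smult (tensor R M N) (\<lambda>(_::nat) t. t)"
  define S where "S = {?s ps | ps. set ps \<subseteq> ?K \<times> carrier N}"
  note gT = M.abelian_group_tensor
  interpret T: abelian_group "tensor R M N" by (rule gT)
  have fa: "add_hom M L f" using f by (rule linear_map_additive)
  have tc: "(\<lambda>(m, n). tens R M N m n) p \<in> carrier (tensor R M N)" if "p \<in> carrier M \<times> carrier N" for p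
    using that by auto
  have S: "additive_subgroup ?G S"
    unfolding additive_subgroup_def
  proof (intro conjI ballI subsetI)
    show "abelian_group ?G" by (simp add: gT)
    show "\<zero>\<^bsub>?G\<^esub> \<in> S" by (auto simp: S_def intro!: exI [of _ "[]"])
  next
    fix a assume "a \<in> S"
    then obtain ps where ps: "set ps \<subseteq> ?K \<times> carrier N" "a = ?s ps" by (auto simp: S_def)
    then show a: "a \<in> carrier ?G" by (auto intro!: lsum_closed gT)
    fix b assume "b \<in> S"
    then obtain qs where qs: "set qs \<subseteq> ?K \<times> carrier N" "b = ?s qs" by (auto simp: S_def)
    have "?s (ps @ qs) = ?s ps \<oplus>\<^bsub>tensor R M N\<^esub> ?s qs"
      using ps(1) qs(1) by (intro lsum_append gT) auto
    then show "a \<oplus>\<^bsub>?G\<^esub> b \<in> S"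
      using ps qs unfolding S_def by (auto intro!: exI [of _ "ps @ qs"])
  next
    fix a assume "a \<in> S"
    then obtain ps where ps: "set ps \<subseteq> ?K \<times> carrier N" "a = ?s ps" by (auto simp: S_def)
    let ?neg = "map (\<lambda>(m, n). (\<ominus>\<^bsub>M\<^esub> m, n)) ps"
    have "add_hom (tensor R M N) (tensor R M N) (\<lambda>t. \<ominus>\<^bsub>tensor R M N\<^esub> t)"
      by (auto simp: add_hom_def T.minus_add gT T.a_comm)
    then have "\<ominus>\<^bsub>tensor R M N\<^esub> a = lsum (tensor R M N) (\<lambda>p. \<ominus>\<^bsub>tensor R M N\<^esub> (\<lambda>(m, n). tens R M N m n) p) ps"
      unfolding ps(2) using ps(1) by (intro add_hom_lsum) auto
    also have "\<dots> = ?s ?neg"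
      using ps(1) by (auto simp: lsum_map M.tens_neg_left intro!: lsum_cong)
    finally have eq: "\<ominus>\<^bsub>tensor R M N\<^esub> a = ?s ?neg" .
    have neg: "\<ominus>\<^bsub>?G\<^esub> a = \<ominus>\<^bsub>tensor R M N\<^esub> a"
      by (simp add: a_inv_def m_inv_def with_smult_def)
    have "f (\<ominus>\<^bsub>M\<^esub> m) = \<zero>\<^bsub>L\<^esub>" if "m \<in> ?K" for m
      using add_hom_neg [OF fa] that by simp
    then have "set ?neg \<subseteq> ?K \<times> carrier N" using ps(1) by auto
    then show "\<ominus>\<^bsub>?G\<^esub> a \<in> S" unfolding neg eq S_def by blast
  qed
  let ?Q = "quotient_module ?G S" and ?q = "coset_rep ?G S"
  have q: "add_hom (tensor R M N) ?Q ?q"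
    using coset_rep_additive [OF S] by (simp add: add_hom_def gT)
  have gQ: "abelian_group ?Q" by (rule abelian_group_quotient [OF S])
  interpret Q: abelian_group ?Q by (rule gQ)
  have q0: "?q t = \<zero>\<^bsub>?Q\<^esub> \<longleftrightarrow> t \<in> S" if "t \<in> carrier (tensor R M N)" for t
    using coset_rep_eq_zero_iff [OF S] that by simp
  have qt: "?q (tens R M N m n) = ?q (tens R M N m' n)"
    if "m \<in> carrier M" "m' \<in> carrier M" "n \<in> carrier N" "f m = f m'" for m m' n
  proof -
    have "f (m \<ominus>\<^bsub>M\<^esub> m') = \<zero>\<^bsub>L\<^esub>"
      using that add_hom_minus [OF fa, of m m'] add_hom_closed [OF fa, of m']
      by (simp add: L.M.diff_eq_zero_iff)
    then have "?s [(m \<ominus>\<^bsub>M\<^esub> m', n)] \<in> S" using that unfolding S_def by (intro CollectI exI [of _ "[(m \<ominus>\<^bsub>M\<^esub> m', n)]"]) auto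
    then have "tens R M N (m \<ominus>\<^bsub>M\<^esub> m') n \<in> S" using that by simp
    moreover have "tens R M N (m \<ominus>\<^bsub>M\<^esub> m') n = tens R M N m n \<ominus>\<^bsub>tensor R M N\<^esub> tens R M N m' n"
      using that by (simp add: a_minus_def M.tens_add_left M.tens_neg_left)
    ultimately have "?q (tens R M N m n) \<ominus>\<^bsub>?Q\<^esub> ?q (tens R M N m' n) = \<zero>\<^bsub>?Q\<^esub>"
      using that q0 [of "tens R M N m n \<ominus>\<^bsub>tensor R M N\<^esub> tens R M N m' n"] add_hom_minus [OF q]
      by simp
    then show ?thesis using that add_hom_closed [OF q] by (simp add: Q.diff_eq_zero_iff del: quotient_simps)
  qed
  \<comment> \<open>Preimages are chosen arbitrarily and need not be additive; \<open>qt\<close>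
    repairs this modulo \<open>S\<close>.\<close>
  let ?g = "inv_into (carrier M) f"
  have g: "?g l \<in> carrier M" "f (?g l) = l" if "l \<in> carrier L" for l
    using that surj inv_into_into f_inv_into_f by (metis subsetD)+
  let ?\<psi> = "\<lambda>l n. ?q (tens R M N (?g l) n)"
  have fr: "f (r \<odot>\<^bsub>M\<^esub> m) = r \<odot>\<^bsub>L\<^esub> f m" if "r \<in> carrier R" "m \<in> carrier M" for r m
    using f that by (rule linear_map_smult)
  have \<psi>: "balanced R L N ?Q ?\<psi>"
  proof (rule balancedI [OF gQ])
    show "?\<psi> l n \<in> carrier ?Q" if "l \<in> carrier L" "n \<in> carrier N" for l n
      using g that by (intro add_hom_closed [OF q]) simp
    show "?\<psi> (l \<oplus>\<^bsub>L\<^esub> l') n = ?\<psi> l n \<oplus>\<^bsub>?Q\<^esub> ?\<psi> l' n"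
      if "l \<in> carrier L" "l' \<in> carrier L" "n \<in> carrier N" for l l' n
    proof -
      have "?\<psi> (l \<oplus>\<^bsub>L\<^esub> l') n = ?q (tens R M N (?g l \<oplus>\<^bsub>M\<^esub> ?g l') n)"
        by (rule qt) (use that g add_hom_add [OF fa] in auto)
      also have "\<dots> = ?\<psi> l n \<oplus>\<^bsub>?Q\<^esub> ?\<psi> l' n"
        using that g by (simp add: M.tens_add_left add_hom_add [OF q] del: quotient_simps)
      finally show ?thesis .
    qed
    show "?\<psi> l (n \<oplus>\<^bsub>N\<^esub> n') = ?\<psi> l n \<oplus>\<^bsub>?Q\<^esub> ?\<psi> l n'"
      if "l \<in> carrier L" "n \<in> carrier N" "n' \<in> carrier N" for l n n'
      using that g by (simp add: M.tens_add_right add_hom_add [OF q] del: quotient_simps)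
    show "?\<psi> (r \<odot>\<^bsub>L\<^esub> l) n = ?\<psi> l (r \<odot>\<^bsub>N\<^esub> n)"
      if "l \<in> carrier L" "r \<in> carrier R" "n \<in> carrier N" for l r n
    proof -
      have "?\<psi> (r \<odot>\<^bsub>L\<^esub> l) n = ?q (tens R M N (r \<odot>\<^bsub>M\<^esub> ?g l) n)"
        by (rule qt) (use that g fr L.M.ract_closed M.M.ract_closed in auto)
      then show ?thesis using that g by (simp add: M.tens_balanced)
    qed
  qed
  note lift = L.tensor_lift_additive [OF \<psi>]
  have "tensor_lift ?Q ?\<psi> (tensor_map R L N f u) = ?q u" if "u \<in> carrier (tensor R M N)" for u
  proof (rule M.add_hom_tensor_eq [OF add_hom_comp [OF tensor_map_additive [OF M L N f] lift] q _ that])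
    fix m n assume mn: "m \<in> carrier M" "n \<in> carrier N"
    then have fm: "f m \<in> carrier L" using linear_map_closed [OF f] by blast
    show "tensor_lift ?Q ?\<psi> (tensor_map R L N f (tens R M N m n)) = ?q (tens R M N m n)"
      unfolding tensor_map_tens [OF M L N f mn] L.tensor_lift_tens [OF \<psi> fm mn(2)]
      by (rule qt) (use mn fm g in auto)
  qed
  then have "?q t = \<zero>\<^bsub>?Q\<^esub>" using t add_hom_zero [OF lift] by metis
  then have "t \<in> S" using q0 t by simp
  then show thesis using that by (auto simp: S_def)
qed

lemma submodule_inclusion_linear:
  assumes "right_module R M" "closed_submodule R M S"
  shows "linear_map R (M\<lparr>carrier := S\<rparr>) M (\<lambda>m. m)"
  using assms(2)
  by (intro linear_mapI right_module_group [OF assms(1)] right_module_group [OF right_module_submodule [OF assms]])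
     (auto simp: closed_submodule_def)

lemma linear_image_closed_submodule:
  assumes "right_module R M" "right_module R L" "linear_map R M L f"
  shows "closed_submodule R L (f ` carrier M)"
proof -
  interpret M: right_module R M by fact
  have fa: "add_hom M L f" using assms(3) by (rule linear_map_additive)
  show ?thesis
    unfolding closed_submodule_def
  proof (intro conjI ballI)
    show "f ` carrier M \<subseteq> carrier L" using linear_map_closed [OF assms(3)] by auto
    show "\<zero>\<^bsub>L\<^esub> \<in> f ` carrier M"
      by (rule image_eqI [of _ _ "\<zero>\<^bsub>M\<^esub>"]) (simp_all add: add_hom_zero [OF fa])
  next
    fix a b assume "a \<in> f ` carrier M" "b \<in> f ` carrier M"
    then obtain m n where "a = f m" "b = f n" "m \<in> carrier M" "n \<in> carrier M" by auto
    then show "a \<oplus>\<^bsub>L\<^esub> b \<in> f ` carrier M"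
      by (intro image_eqI [of _ _ "m \<oplus>\<^bsub>M\<^esub> n"]) (simp_all add: add_hom_add [OF fa])
  next
    fix r a assume "r \<in> carrier R" "a \<in> f ` carrier M"
    then obtain m where "a = f m" "m \<in> carrier M" by auto
    then show "r \<odot>\<^bsub>L\<^esub> a \<in> f ` carrier M"
      using \<open>r \<in> carrier R\<close>
      by (intro image_eqI [of _ _ "r \<odot>\<^bsub>M\<^esub> m"]) (simp_all add: linear_map_smult [OF assms(3)] M.ract_closed)
  qed
qed

lemma linear_map_inv_into:
  assumes P: "right_module R P" and Q: "right_module R Q" and e: "linear_map R P Q e" "inj_on e (carrier P)"
  shows "linear_map R (Q\<lparr>carrier := e ` carrier P\<rparr>) P (inv_into (carrier P) e)"
proof -
  interpret P: right_module R P by (rule P)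
  have S: "right_module R (Q\<lparr>carrier := e ` carrier P\<rparr>)"
    by (rule right_module_submodule [OF Q linear_image_closed_submodule [OF P Q e(1)]])
  show ?thesis
  proof (rule linear_mapI [OF right_module_group [OF S] P.M.abelian_group_axioms])
    fix u v assume "u \<in> carrier (Q\<lparr>carrier := e ` carrier P\<rparr>)" "v \<in> carrier (Q\<lparr>carrier := e ` carrier P\<rparr>)"
    then obtain p q where "u = e p" "p \<in> carrier P" "v = e q" "q \<in> carrier P" by auto
    then show "inv_into (carrier P) e (u \<oplus>\<^bsub>Q\<lparr>carrier := e ` carrier P\<rparr>\<^esub> v) = inv_into (carrier P) e u \<oplus>\<^bsub>P\<^esub> inv_into (carrier P) e v"
      using e(2) by (simp add: linear_map_add [OF e(1), symmetric])
  next
    fix r u assume r: "r \<in> carrier R" and "u \<in> carrier (Q\<lparr>carrier := e ` carrier P\<rparr>)"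
    then obtain p where "u = e p" "p \<in> carrier P" by auto
    then show "inv_into (carrier P) e (r \<odot>\<^bsub>Q\<lparr>carrier := e ` carrier P\<rparr>\<^esub> u) = r \<odot>\<^bsub>P\<^esub> inv_into (carrier P) e u"
      using e(2) r by (simp add: linear_map_smult [OF e(1), symmetric] P.ract_closed)
  qed (use e(2) in auto)
qed

text \<open>Flatness concerns injections between modules of the universe; this is its kernel form.
  The map is factored through its image: right exactness treats \<open>X \<rightarrow> f(X)\<close>,
  flatness the inclusion \<open>f(X) \<rightarrow> Y\<close>. Only the modules of the second step
  have to be transported, so \<open>X\<close> may have any type.\<close>

lemma flat_exact:
  fixes Y :: "('r, 'm, 'y) module_scheme"
  assumes flat: "flat TYPE('u) R N"
    and X: "right_module R X" and Y: "right_module R Y" and Y_small: "carrier Y \<lesssim> (UNIV :: 'u set)"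
    and f: "linear_map R X Y f"
    and t: "t \<in> carrier (tensor R X N)" "tensor_map R Y N f t = \<zero>\<^bsub>tensor R Y N\<^esub>"
  obtains ps where "set ps \<subseteq> {m \<in> carrier X. f m = \<zero>\<^bsub>Y\<^esub>} \<times> carrier N"
    "t = lsum (tensor R X N) (\<lambda>(m, n). tens R X N m n) ps"
proof -
  have N: "left_module R N" using flat by (simp add: flat_def)
  obtain h :: "'m \<Rightarrow> 'u" where h: "inj_on h (carrier Y)" using Y_small by (auto simp: lepoll_def)
  let ?I = "Y\<lparr>carrier := f ` carrier X\<rparr>"
  have sub: "closed_submodule R Y (f ` carrier X)" by (rule linear_image_closed_submodule [OF X Y f])
  have I: "right_module R ?I" by (rule right_module_submodule [OF Y sub])
  have incl: "linear_map R ?I Y (\<lambda>m. m)" by (rule submodule_inclusion_linear [OF Y sub])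
  have hI: "inj_on h (carrier ?I)" using h sub by (auto simp: closed_submodule_def intro: inj_on_subset)
  \<comment> \<open>Both modules are transported along the same \<open>h\<close>, so that the
    inclusion becomes the identity on elements.\<close>
  let ?K' = "transport h ?I" and ?L' = "transport h Y"
  have K': "right_module R ?K'" and L': "right_module R ?L'"
    using right_module_transport [OF I hI] right_module_transport [OF Y h] by auto
  have j: "linear_map R ?K' ?L' (\<lambda>u. u)"
  proof (rule linear_mapI [OF right_module_group [OF K'] right_module_group [OF L']])
    fix u assume "u \<in> carrier ?K'"
    then show "u \<in> carrier ?L'" using sub by (auto simp: closed_submodule_def)
  next
    fix u v assume "u \<in> carrier ?K'" "v \<in> carrier ?K'"
    then obtain k l where "u = h k" "v = h l" "k \<in> f ` carrier X" "l \<in> f ` carrier X" by auto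
    moreover from this have "k \<in> carrier Y" "l \<in> carrier Y" using sub by (auto simp: closed_submodule_def)
    ultimately show "u \<oplus>\<^bsub>?K'\<^esub> v = u \<oplus>\<^bsub>?L'\<^esub> v"
      using transport_add [OF hI, of k l] transport_add [OF h, of k l] by simp
  next
    fix r u assume "r \<in> carrier R" "u \<in> carrier ?K'"
    then obtain k where "u = h k" "k \<in> f ` carrier X" by auto
    moreover from this have "k \<in> carrier Y" using sub by (auto simp: closed_submodule_def)
    ultimately show "r \<odot>\<^bsub>?K'\<^esub> u = r \<odot>\<^bsub>?L'\<^esub> u"
      using transport_smult [OF hI, of k r] transport_smult [OF h, of k r] by simp
  qed
  let ?j = "restrict (\<lambda>u. u) (carrier ?K')"
  have "?j \<in> lin_hom R ?K' ?L'" by (rule restrict_lin_hom [OF j]) (simp add: K')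
  moreover have "inj_on ?j (carrier ?K')" by (auto simp: inj_on_def)
  ultimately have inj: "inj_on (tensor_map R ?L' N ?j) (carrier (tensor R ?K' N))"
    using flat K' L' unfolding flat_def by blast
  have jr: "linear_map R ?K' ?L' ?j" by (rule linear_map_cong [OF j]) (simp_all add: K')
  have fI: "linear_map R X ?I f"
    using linear_map_add [OF f]
    by (intro linear_mapI right_module_group [OF X] right_module_group [OF I])
       (simp_all add: linear_map_smult [OF f])
  have hl: "linear_map R ?I ?K' h" "linear_map R Y ?L' h"
    using linear_map_transport [OF right_module_group [OF I] hI]
      linear_map_transport [OF right_module_group [OF Y] h] by auto
  have hinv: "linear_map R ?K' ?I (inv_into (carrier ?I) h)"
    by (rule linear_map_transport_inv [OF _ hI]) (simp add: I)
  let ?u = "tensor_map R ?I N f t"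
  let ?v = "tensor_map R ?K' N h ?u"
  interpret TX: tensor_product R X N using X N by (rule tensor_productI)
  interpret TK: tensor_product R ?K' N using K' N by (rule tensor_productI)
  have u: "?u \<in> carrier (tensor R ?I N)" by (rule tensor_map_closed [OF X I N fI t(1)])
  have v: "?v \<in> carrier (tensor R ?K' N)" by (rule tensor_map_closed [OF I K' N hl(1) u])
  note ac = add_hom_comp [OF add_hom_comp [OF tensor_map_additive [OF X I N fI]
        tensor_map_additive [OF I K' N hl(1)]] tensor_map_additive [OF K' L' N jr]]
    and bc = add_hom_comp [OF tensor_map_additive [OF X Y N f] tensor_map_additive [OF Y L' N hl(2)]]
  have "tensor_map R ?L' N ?j ?v = tensor_map R ?L' N h (tensor_map R Y N f t)"
  proof (rule TX.add_hom_tensor_eq [OF ac bc _ t(1)])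
    fix m n assume mn: "m \<in> carrier X" "n \<in> carrier N"
    have c: "f m \<in> carrier ?I" "h (f m) \<in> carrier ?K'" "f m \<in> carrier Y"
      using mn linear_map_closed [OF f] by auto
    show "tensor_map R ?L' N ?j (tensor_map R ?K' N h (tensor_map R ?I N f (tens R X N m n)))
        = tensor_map R ?L' N h (tensor_map R Y N f (tens R X N m n))"
      unfolding tensor_map_tens [OF X I N fI mn] tensor_map_tens [OF X Y N f mn]
        tensor_map_tens [OF I K' N hl(1) c(1) mn(2)] tensor_map_tens [OF Y L' N hl(2) c(3) mn(2)]
        tensor_map_tens [OF K' L' N jr c(2) mn(2)]
      using c(2) by simp
  qed
  then have "tensor_map R ?L' N ?j ?v = \<zero>\<^bsub>tensor R ?L' N\<^esub>"
    using t(2) add_hom_zero [OF tensor_map_additive [OF Y L' N hl(2)]] by simp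
  also have "\<dots> = tensor_map R ?L' N ?j \<zero>\<^bsub>tensor R ?K' N\<^esub>"
    using add_hom_zero [OF tensor_map_additive [OF K' L' N jr]] by simp
  finally have v0: "?v = \<zero>\<^bsub>tensor R ?K' N\<^esub>"
    by (rule inj_onD [OF inj])
       (use v TK.tensor_zero_closed in simp_all)
  \<comment> \<open>Back from the universe: the transported element vanishes, and \<open>h\<close>
    is undone by its inverse.\<close>
  have "?u = tensor_map R ?I N (\<lambda>m. inv_into (carrier ?I) h (h m)) ?u"
    using tensor_map_id [OF I N _ u, of "\<lambda>m. inv_into (carrier ?I) h (h m)"] hI by simp
  also have "\<dots> = tensor_map R ?I N (inv_into (carrier ?I) h) ?v"
    by (rule tensor_map_comp [OF I K' I N hl(1) hinv u, symmetric])
  also have "\<dots> = \<zero>\<^bsub>tensor R ?I N\<^esub>"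
    unfolding v0 by (rule add_hom_zero [OF tensor_map_additive [OF K' I N hinv]])
  finally have u0: "?u = \<zero>\<^bsub>tensor R ?I N\<^esub>" .
  obtain ps where "set ps \<subseteq> {m \<in> carrier X. f m = \<zero>\<^bsub>?I\<^esub>} \<times> carrier N"
    "t = lsum (tensor R X N) (\<lambda>(m, n). tens R X N m n) ps"
    by (rule tensor_right_exact [OF X I N fI _ t(1) u0]) auto
  then show thesis using that by simp
qed

section \<open>Bimodule structures on tensor products\<close>

context tensor_product begin

context
  fixes S :: "('s, 'v) ring_scheme" and N' :: "('s, 'n, 'w) module_scheme"
  assumes N': "right_module S N'" and carrier_eq: "carrier N' = carrier N" and add_eq: "add N' = add N"
    and bimodule: "\<And>r s n. \<lbrakk>r \<in> carrier R; s \<in> carrier S; n \<in> carrier N\<rbrakk>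
      \<Longrightarrow> (r \<odot>\<^bsub>N\<^esub> n) \<triangleleft>\<^bsub>N'\<^esub> s = r \<odot>\<^bsub>N\<^esub> (n \<triangleleft>\<^bsub>N'\<^esub> s)"
begin

interpretation N': right_module S N' by (rule N')

lemma balanced_rmod:
  "s \<in> carrier S \<Longrightarrow> balanced R M N (tensor R M N) (\<lambda>m n. tens R M N m (n \<triangleleft>\<^bsub>N'\<^esub> s))"
  using N'.ract_closed N'.ract_l_distr
  by (intro balancedI abelian_group_tensor)
     (auto simp: carrier_eq add_eq tens_add_left tens_add_right tens_balanced bimodule)

lemma rmod_simps [simp]:
  "carrier (tensor_rmod R M N N') = carrier (tensor R M N)"
  "\<zero>\<^bsub>tensor_rmod R M N N'\<^esub> = \<zero>\<^bsub>tensor R M N\<^esub>"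
  "add (tensor_rmod R M N N') = add (tensor R M N)"
  by (simp_all add: tensor_rmod_def)

lemma rmod_act_tens:
  assumes "s \<in> carrier S" "m \<in> carrier M" "n \<in> carrier N"
  shows "tens R M N m n \<triangleleft>\<^bsub>tensor_rmod R M N N'\<^esub> s = tens R M N m (n \<triangleleft>\<^bsub>N'\<^esub> s)"
  using tensor_lift_tens [OF balanced_rmod [OF assms(1)] assms(2,3)] by (simp add: tensor_rmod_def)

lemma rmod_act_additive:
  "s \<in> carrier S \<Longrightarrow> add_hom (tensor R M N) (tensor R M N) (\<lambda>t. t \<triangleleft>\<^bsub>tensor_rmod R M N N'\<^esub> s)"
  using tensor_lift_additive [OF balanced_rmod] by (simp add: tensor_rmod_def)

lemma right_module_tensor_rmod: "right_module S (tensor_rmod R M N N')"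
proof -
  interpret T: abelian_group "tensor R M N" by (rule abelian_group_tensor)
  let ?T = "tensor_rmod R M N N'"
  note act = rmod_act_additive and acl = add_hom_closed [OF rmod_act_additive]
  have nc: "n \<triangleleft>\<^bsub>N'\<^esub> s \<in> carrier N" if "n \<in> carrier N" "s \<in> carrier S" for n s
    using N'.ract_closed that carrier_eq by auto
  show ?thesis
  proof (rule right_moduleI [OF N'.R.ring_axioms])
    show "abelian_group ?T" by (simp add: tensor_rmod_def abelian_group_tensor)
  next
    fix r s t assume rs: "r \<in> carrier S" "s \<in> carrier S" and "t \<in> carrier ?T"
    then have t: "t \<in> carrier (tensor R M N)" by simp
    have "add_hom (tensor R M N) (tensor R M N) (\<lambda>t. t \<triangleleft>\<^bsub>?T\<^esub> r \<oplus>\<^bsub>tensor R M N\<^esub> t \<triangleleft>\<^bsub>?T\<^esub> s)"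
      using rs acl by (auto simp: add_hom_def abelian_group_tensor add_hom_add [OF act] T.a_ac)
    then have "t \<triangleleft>\<^bsub>?T\<^esub> (r \<oplus>\<^bsub>S\<^esub> s) = t \<triangleleft>\<^bsub>?T\<^esub> r \<oplus>\<^bsub>tensor R M N\<^esub> t \<triangleleft>\<^bsub>?T\<^esub> s"
      using rs N'.ract_r_distr carrier_eq nc
      by (intro add_hom_tensor_eq [OF act _ _ t])
         (auto simp: rmod_act_tens add_eq tens_add_right)
    then show "t \<triangleleft>\<^bsub>?T\<^esub> (r \<oplus>\<^bsub>S\<^esub> s) = t \<triangleleft>\<^bsub>?T\<^esub> r \<oplus>\<^bsub>?T\<^esub> t \<triangleleft>\<^bsub>?T\<^esub> s" by simp
    show "t \<triangleleft>\<^bsub>?T\<^esub> (r \<otimes>\<^bsub>S\<^esub> s) = (t \<triangleleft>\<^bsub>?T\<^esub> r) \<triangleleft>\<^bsub>?T\<^esub> s"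
      by (rule add_hom_tensor_eq [OF act add_hom_comp [OF act act] _ t])
         (use rs N'.ract_assoc carrier_eq nc in \<open>auto simp: rmod_act_tens\<close>)
  next
    fix t assume "t \<in> carrier ?T"
    then have t: "t \<in> carrier (tensor R M N)" by simp
    have id: "add_hom (tensor R M N) (tensor R M N) (\<lambda>t. t)"
      by (auto simp: add_hom_def abelian_group_tensor)
    show "t \<triangleleft>\<^bsub>?T\<^esub> \<one>\<^bsub>S\<^esub> = t"
      by (rule add_hom_tensor_eq [OF act id _ t])
         (use N'.ract_one carrier_eq in \<open>auto simp: rmod_act_tens\<close>)
  qed (auto simp: acl add_hom_add [OF act])
qed

lemma rmod_tens_linear:
  assumes m: "m \<in> carrier M"
  shows "linear_map S N' (tensor_rmod R M N N') (tens R M N m)"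
  using m tens_add_right [OF m] rmod_act_tens
  by (intro linear_mapI right_module_group [OF N'] right_module_group [OF right_module_tensor_rmod])
    (simp_all add: carrier_eq add_eq)

text \<open>For fixed \<open>m\<close> the map \<open>n \<mapsto> m \<otimes> n\<close> is linear on
  \<open>N'\<close>, and the images of these maps span the tensor product.\<close>

lemma rmod_trace: "carrier (tensor_rmod R M N N') \<subseteq> trace S N' (tensor_rmod R M N N')"
proof
  let ?Q = "tensor_rmod R M N N'"
  fix t assume "t \<in> carrier ?Q"
  then obtain ps where ps: "set ps \<subseteq> carrier M \<times> carrier N" "t = lsum (tensor R M N) (\<lambda>(m, n). tens R M N m n) ps"
    using tensor_list [of t] by auto
  have "t = lsum ?Q (\<lambda>(m, n). tens R M N m n) ps"
    unfolding ps(2) by (rule lsum_cong_structure) simp_all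
  also have "\<dots> \<in> trace S N' ?Q"
  proof (rule closed_submodule_lsum [OF trace_closed_submodule [OF N' right_module_tensor_rmod]])
    fix p assume "p \<in> set ps"
    then have p: "fst p \<in> carrier M" "snd p \<in> carrier N'" using ps(1) carrier_eq by auto
    have h: "restrict (tens R M N (fst p)) (carrier N') \<in> lin_hom S N' ?Q"
      by (rule restrict_lin_hom [OF rmod_tens_linear [OF p(1)]]) (simp add: N')
    show "(\<lambda>(m, n). tens R M N m n) p \<in> trace S N' ?Q"
      using lin_hom_image_trace [OF h p(2) right_module_group [OF right_module_tensor_rmod]] p by (simp add: case_prod_beta)
  qed
  finally show "t \<in> trace S N' ?Q" .
qed

end

context
  fixes S :: "('s, 'v) ring_scheme" and M' :: "('s, 'm, 'w) module_scheme"
  assumes M': "left_module S M'" and carrier_eq: "carrier M' = carrier M" and add_eq: "add M' = add M"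
    and bimodule: "\<And>r s m. \<lbrakk>r \<in> carrier R; s \<in> carrier S; m \<in> carrier M\<rbrakk>
      \<Longrightarrow> (s \<odot>\<^bsub>M'\<^esub> m) \<triangleleft>\<^bsub>M\<^esub> r = s \<odot>\<^bsub>M'\<^esub> (m \<triangleleft>\<^bsub>M\<^esub> r)"
begin

interpretation M': left_module S M' by (rule M')

lemma balanced_lmod:
  "s \<in> carrier S \<Longrightarrow> balanced R M N (tensor R M N) (\<lambda>m n. tens R M N (s \<odot>\<^bsub>M'\<^esub> m) n)"
  using M'.lact_closed M'.lact_r_distr
  by (intro balancedI abelian_group_tensor)
     (auto simp: carrier_eq add_eq tens_add_left tens_add_right tens_balanced bimodule [symmetric])

lemma lmod_simps [simp]:
  "carrier (tensor_lmod R M' M N) = carrier (tensor R M N)"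
  "\<zero>\<^bsub>tensor_lmod R M' M N\<^esub> = \<zero>\<^bsub>tensor R M N\<^esub>"
  "add (tensor_lmod R M' M N) = add (tensor R M N)"
  by (simp_all add: tensor_lmod_def)

lemma lmod_act_tens:
  assumes "s \<in> carrier S" "m \<in> carrier M" "n \<in> carrier N"
  shows "s \<odot>\<^bsub>tensor_lmod R M' M N\<^esub> tens R M N m n = tens R M N (s \<odot>\<^bsub>M'\<^esub> m) n"
  using tensor_lift_tens [OF balanced_lmod [OF assms(1)] assms(2,3)] by (simp add: tensor_lmod_def)

lemma lmod_act_additive:
  "s \<in> carrier S \<Longrightarrow> add_hom (tensor R M N) (tensor R M N) (\<lambda>t. s \<odot>\<^bsub>tensor_lmod R M' M N\<^esub> t)"
  using tensor_lift_additive [OF balanced_lmod] by (simp add: tensor_lmod_def)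

lemma left_module_tensor_lmod: "left_module S (tensor_lmod R M' M N)"
proof -
  interpret T: abelian_group "tensor R M N" by (rule abelian_group_tensor)
  let ?T = "tensor_lmod R M' M N"
  note act = lmod_act_additive and acl = add_hom_closed [OF lmod_act_additive]
  have mc: "s \<odot>\<^bsub>M'\<^esub> m \<in> carrier M" if "m \<in> carrier M" "s \<in> carrier S" for m s
    using M'.lact_closed that carrier_eq by auto
  have "right_module (op_ring S) ?T"
  proof (rule right_moduleI [OF ring_op_ring [OF M'.R.ring_axioms]])
    show "abelian_group ?T" by (simp add: tensor_lmod_def abelian_group_tensor)
  next
    fix r s t assume "r \<in> carrier (op_ring S)" "s \<in> carrier (op_ring S)" and "t \<in> carrier ?T"
    then have t: "t \<in> carrier (tensor R M N)" and rs: "r \<in> carrier S" "s \<in> carrier S" by simp_all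
    have "add_hom (tensor R M N) (tensor R M N) (\<lambda>t. r \<odot>\<^bsub>?T\<^esub> t \<oplus>\<^bsub>tensor R M N\<^esub> s \<odot>\<^bsub>?T\<^esub> t)"
      using rs acl by (auto simp: add_hom_def abelian_group_tensor add_hom_add [OF act] T.a_ac)
    then have "(r \<oplus>\<^bsub>S\<^esub> s) \<odot>\<^bsub>?T\<^esub> t = r \<odot>\<^bsub>?T\<^esub> t \<oplus>\<^bsub>tensor R M N\<^esub> s \<odot>\<^bsub>?T\<^esub> t"
      using rs M'.lact_l_distr carrier_eq mc
      by (intro add_hom_tensor_eq [OF act _ _ t])
         (auto simp: lmod_act_tens add_eq tens_add_left)
    then show "(r \<oplus>\<^bsub>op_ring S\<^esub> s) \<odot>\<^bsub>?T\<^esub> t = r \<odot>\<^bsub>?T\<^esub> t \<oplus>\<^bsub>?T\<^esub> s \<odot>\<^bsub>?T\<^esub> t" by simp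
    have "(s \<otimes>\<^bsub>S\<^esub> r) \<odot>\<^bsub>?T\<^esub> t = s \<odot>\<^bsub>?T\<^esub> (r \<odot>\<^bsub>?T\<^esub> t)"
      by (rule add_hom_tensor_eq [OF act add_hom_comp [OF act act] _ t])
         (use rs M'.lact_assoc carrier_eq mc in \<open>auto simp: lmod_act_tens\<close>)
    then show "(r \<otimes>\<^bsub>op_ring S\<^esub> s) \<odot>\<^bsub>?T\<^esub> t = s \<odot>\<^bsub>?T\<^esub> (r \<odot>\<^bsub>?T\<^esub> t)" by simp
  next
    fix t assume "t \<in> carrier ?T"
    then have t: "t \<in> carrier (tensor R M N)" by simp
    have id: "add_hom (tensor R M N) (tensor R M N) (\<lambda>t. t)"
      by (auto simp: add_hom_def abelian_group_tensor)
    have "\<one>\<^bsub>S\<^esub> \<odot>\<^bsub>?T\<^esub> t = t"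
      by (rule add_hom_tensor_eq [OF act id _ t])
         (use M'.lact_one carrier_eq in \<open>auto simp: lmod_act_tens\<close>)
    then show "\<one>\<^bsub>op_ring S\<^esub> \<odot>\<^bsub>?T\<^esub> t = t" by simp
  qed (auto simp: acl add_hom_add [OF act])
  then show ?thesis by (simp add: right_module_op_ring)
qed

end

end

section \<open>Functionals on corings\<close>

lemma regular_simps [simp]:
  "carrier (left_regular A) = carrier A" "\<zero>\<^bsub>left_regular A\<^esub> = \<zero>\<^bsub>A\<^esub>" "add (left_regular A) = add A"
  "r \<odot>\<^bsub>left_regular A\<^esub> a = r \<otimes>\<^bsub>A\<^esub> a"
  "carrier (right_regular A) = carrier A" "\<zero>\<^bsub>right_regular A\<^esub> = \<zero>\<^bsub>A\<^esub>" "add (right_regular A) = add A"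
  "r \<odot>\<^bsub>right_regular A\<^esub> a = a \<otimes>\<^bsub>A\<^esub> r"
  by (simp_all add: left_regular_def right_regular_def)

lemma abelian_group_regular:
  "ring A \<Longrightarrow> abelian_group (left_regular A)" "ring A \<Longrightarrow> abelian_group (right_regular A)"
  by (simp_all add: left_regular_def right_regular_def ring.is_abelian_group)

lemma right_regular_module:
  assumes "ring A" shows "right_module A (right_regular A)"
proof -
  interpret ring A by fact
  show ?thesis
    by (rule right_moduleI) (auto simp: assms abelian_group_regular l_distr r_distr m_assoc)
qed

lemma left_regular_module:
  assumes "ring A" shows "left_module A (left_regular A)"
proof -
  interpret ring A by fact
  show ?thesis
    unfolding left_module_def left_module_axioms_def
    by (auto simp: assms abelian_group_regular l_distr r_distr m_assoc)
qed

lemma rmod_simps [simp]: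
  "carrier (rmod C) = carrier C" "\<zero>\<^bsub>rmod C\<^esub> = \<zero>\<^bsub>C\<^esub>" "add (rmod C) = add C"
  by (simp_all add: rmod_def)

lemma with_coact_simps [simp]:
  "carrier (with_coact M \<rho>) = carrier M" "\<zero>\<^bsub>with_coact M \<rho>\<^esub> = \<zero>\<^bsub>M\<^esub>" "add (with_coact M \<rho>) = add M"
  "smult (with_coact M \<rho>) = smult M" "coact (with_coact M \<rho>) = \<rho>"
  by (simp_all add: with_coact_def)

lemma right_module_cong:
  assumes "right_module R M" "carrier M' = carrier M" "\<zero>\<^bsub>M'\<^esub> = \<zero>\<^bsub>M\<^esub>" "add M' = add M"
    "\<And>r m. \<lbrakk>r \<in> carrier R; m \<in> carrier M\<rbrakk> \<Longrightarrow> m \<triangleleft>\<^bsub>M'\<^esub> r = m \<triangleleft>\<^bsub>M\<^esub> r"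
  shows "right_module R M'"
proof -
  interpret right_module R M by fact
  have "abelian_group M'"
    by (rule abelian_group_cong [OF M.abelian_group_axioms]) (simp_all add: assms)
  then show ?thesis
    by (intro right_moduleI R.ring_axioms)
       (simp_all add: assms ract_closed ract_l_distr ract_r_distr ract_assoc ract_one)
qed

lemma right_module_with_coact: "right_module A M \<Longrightarrow> right_module A (with_coact M \<rho>)"
  by (rule right_module_cong) simp_all

text \<open>The map \<open>M \<otimes> f\<close> followed by
  \<open>M \<otimes> A \<simeq> M\<close>. Applied to the coaction of \<open>m\<close> it gives the
  action of \<open>f\<close> on \<open>m\<close>.\<close>

definition eval_functional ::
    "('a, 'm, 'y) module_scheme \<Rightarrow> ('w \<Rightarrow> 'a) \<Rightarrow> ('m \<times> 'w \<Rightarrow>\<^sub>0 int) set \<Rightarrow> 'm" where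
  "eval_functional M f = tensor_lift M (\<lambda>m w. m \<triangleleft>\<^bsub>M\<^esub> f w)"

context tensor_product begin

context
  fixes f :: "'n \<Rightarrow> 'r"
  assumes f: "linear_map R N (left_regular R) f"
begin

lemma balanced_eval: "balanced R M N M (\<lambda>m n. m \<triangleleft>\<^bsub>M\<^esub> f n)"
  using linear_map_closed [OF f] linear_map_add [OF f] linear_map_smult [OF f]
  by (intro balancedI M.M.abelian_group_axioms)
     (simp_all add: M.ract_closed M.ract_l_distr M.ract_r_distr M.ract_assoc)

lemma eval_additive: "add_hom (tensor R M N) M (eval_functional M f)"
  unfolding eval_functional_def by (rule tensor_lift_additive [OF balanced_eval])

lemma eval_tens: "\<lbrakk>m \<in> carrier M; n \<in> carrier N\<rbrakk> \<Longrightarrow> eval_functional M f (tens R M N m n) = m \<triangleleft>\<^bsub>M\<^esub> f n"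
  unfolding eval_functional_def by (rule tensor_lift_tens [OF balanced_eval])

lemma eval_list:
  assumes "set ps \<subseteq> carrier M \<times> carrier N"
  shows "eval_functional M f (lsum (tensor R M N) (\<lambda>(m, n). tens R M N m n) ps)
    = lsum M (\<lambda>(m, n). m \<triangleleft>\<^bsub>M\<^esub> f n) ps"
  unfolding eval_functional_def by (rule tensor_lift_lsum [OF balanced_eval assms])

end

text \<open>
  Local dual bases: on a finite set \<open>S\<close> the identity is of the form \<open>\<Sum> f\<^sub>k(-) w\<^sub>k\<close>.  Hence each
  element of a tensor product is determined by its values under functionals.
\<close>

lemma dual_basis_expansion:
  assumes F: "\<And>f. f \<in> F \<Longrightarrow> linear_map R N (left_regular R) f"
    and basis: "\<And>S. \<lbrakk>finite S; S \<subseteq> carrier N\<rbrakk> \<Longrightarrow> \<exists>ks. set ks \<subseteq> F \<times> carrier N \<and>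
      (\<forall>s\<in>S. s = lsum N (\<lambda>(f, n). f s \<odot>\<^bsub>N\<^esub> n) ks)"
    and S: "finite S" "S \<subseteq> carrier (tensor R M N)"
  shows "\<exists>ks. set ks \<subseteq> F \<times> carrier N \<and>
      (\<forall>t\<in>S. t = lsum (tensor R M N) (\<lambda>(f, n). tens R M N (eval_functional M f t) n) ks)"
proof -
  have "\<forall>t\<in>S. \<exists>ps. set ps \<subseteq> carrier M \<times> carrier N \<and> t = lsum (tensor R M N) (\<lambda>(m, n). tens R M N m n) ps"
    using tensor_list [OF subsetD [OF S(2)]] by blast
  then obtain rep where rep: "\<And>t. t \<in> S \<Longrightarrow> set (rep t) \<subseteq> carrier M \<times> carrier N"
    "\<And>t. t \<in> S \<Longrightarrow> t = lsum (tensor R M N) (\<lambda>(m, n). tens R M N m n) (rep t)" by metis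
  \<comment> \<open>A single dual basis is taken for all right factors that occur in presentations
    of the elements of \<open>S\<close>.\<close>
  let ?U = "\<Union>t\<in>S. snd ` set (rep t)"
  have U: "finite ?U" "?U \<subseteq> carrier N" using S(1) by simp (use rep(1) in fastforce)
  obtain ks where ks: "set ks \<subseteq> F \<times> carrier N" and expU: "\<forall>s\<in>?U. s = lsum N (\<lambda>(f, n). f s \<odot>\<^bsub>N\<^esub> n) ks"
    using basis [OF U] by (elim exE conjE) (rule that)
  have exp: "s = lsum N (\<lambda>(f, n). f s \<odot>\<^bsub>N\<^esub> n) ks" if "t \<in> S" "s \<in> snd ` set (rep t)" for t s
    by (rule bspec [OF expU], rule UN_I [OF that(1)], rule that(2))
  have fc: "f n \<in> carrier R" if "(f, e) \<in> set ks" "n \<in> carrier N" for f e n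
    using linear_map_closed [OF F] that ks by fastforce
  have "t = lsum (tensor R M N) (\<lambda>(f, n). tens R M N (eval_functional M f t) n) ks" if t: "t \<in> S" for t
  proof -
    obtain ps where ps: "set ps \<subseteq> carrier M \<times> carrier N" "t = lsum (tensor R M N) (\<lambda>(m, n). tens R M N m n) ps"
      and exp: "\<And>s. s \<in> snd ` set ps \<Longrightarrow> s = lsum N (\<lambda>(f, n). f s \<odot>\<^bsub>N\<^esub> n) ks"
      by (rule that [OF rep(1) [OF t] rep(2) [OF t] exp [OF t]])
    have tk: "tens R M N (m \<triangleleft>\<^bsub>M\<^esub> f n) e \<in> carrier (tensor R M N)"
      if "(m, n) \<in> set ps" "(f, e) \<in> set ks" for m n f e
    proof -
      have "m \<in> carrier M" "n \<in> carrier N" "e \<in> carrier N" using that ps ks by auto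
      then show ?thesis using fc that by (simp add: M.ract_closed)
    qed
    have "t = lsum (tensor R M N) (\<lambda>p. lsum (tensor R M N)
        (\<lambda>k. tens R M N (fst p \<triangleleft>\<^bsub>M\<^esub> fst k (snd p)) (snd k)) ks) ps"
      unfolding ps(2)
    proof (rule lsum_cong)
      fix p assume p: "p \<in> set ps"
      obtain m n where mn: "p = (m, n)" by (cases p)
      have c: "m \<in> carrier M" "n \<in> carrier N" using p mn ps by auto
      have n: "n = lsum N (\<lambda>(f, e). f n \<odot>\<^bsub>N\<^esub> e) ks" using exp [of n] p mn by force
      have ad: "add_hom N (tensor R M N) (\<lambda>n. tens R M N m n)"
        using c by (auto simp: add_hom_def abelian_group_tensor tens_add_right N.abelian_group_axioms)
      have "tens R M N m n = tens R M N m (lsum N (\<lambda>(f, e). f n \<odot>\<^bsub>N\<^esub> e) ks)" using n by simp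
      also have "\<dots> = lsum (tensor R M N) (\<lambda>k. tens R M N m ((\<lambda>(f, e). f n \<odot>\<^bsub>N\<^esub> e) k)) ks"
        by (rule add_hom_lsum [OF ad]) (use ks c fc in \<open>auto intro!: N.lact_closed\<close>)
      also have "\<dots> = lsum (tensor R M N) (\<lambda>k. tens R M N (m \<triangleleft>\<^bsub>M\<^esub> fst k n) (snd k)) ks"
        using ks c fc by (intro lsum_cong) (auto simp: tens_balanced)
      finally show "(\<lambda>(m, n). tens R M N m n) p
          = lsum (tensor R M N) (\<lambda>k. tens R M N (fst p \<triangleleft>\<^bsub>M\<^esub> fst k (snd p)) (snd k)) ks"
        using mn by simp
    qed
    \<comment> \<open>After the interchange of sums, the left factors belonging to a fixed
      functional add up to the value of \<open>t\<close> under it.\<close>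
    also have "\<dots> = lsum (tensor R M N) (\<lambda>k. lsum (tensor R M N)
        (\<lambda>p. tens R M N (fst p \<triangleleft>\<^bsub>M\<^esub> fst k (snd p)) (snd k)) ps) ks"
      by (rule lsum_swap [OF abelian_group_tensor]) (use tk in \<open>metis prod.collapse\<close>)
    also have "\<dots> = lsum (tensor R M N) (\<lambda>(f, n). tens R M N (eval_functional M f t) n) ks"
    proof (rule lsum_cong)
      fix k assume k: "k \<in> set ks"
      obtain f e where fe: "k = (f, e)" by (cases k)
      have f: "f \<in> F" "e \<in> carrier N" using k fe ks by auto
      have ad: "add_hom M (tensor R M N) (\<lambda>m. tens R M N m e)"
        using f by (auto simp: add_hom_def abelian_group_tensor tens_add_left M.M.abelian_group_axioms)
      have "tens R M N (eval_functional M f t) e = tens R M N (lsum M (\<lambda>(m, n). m \<triangleleft>\<^bsub>M\<^esub> f n) ps) e"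
        unfolding ps(2) by (simp add: eval_list [OF F [OF f(1)] ps(1)])
      also have "\<dots> = lsum (tensor R M N) (\<lambda>p. tens R M N ((\<lambda>(m, n). m \<triangleleft>\<^bsub>M\<^esub> f n) p) e) ps"
        by (rule add_hom_lsum [OF ad])
           (use ps(1) linear_map_closed [OF F [OF f(1)]] in \<open>auto intro!: M.ract_closed\<close>)
      finally show "lsum (tensor R M N) (\<lambda>p. tens R M N (fst p \<triangleleft>\<^bsub>M\<^esub> fst k (snd p)) (snd k)) ps
          = (\<lambda>(f, n). tens R M N (eval_functional M f t) n) k"
        unfolding fe by (simp add: case_prod_beta)
    qed
    finally show ?thesis .
  qed
  then show ?thesis using ks by (intro exI conjI ballI)
qed

lemma functionals_separate:
  assumes F: "\<And>f. f \<in> F \<Longrightarrow> linear_map R N (left_regular R) f"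
    and basis: "\<And>S. \<lbrakk>finite S; S \<subseteq> carrier N\<rbrakk> \<Longrightarrow> \<exists>ks. set ks \<subseteq> F \<times> carrier N \<and>
      (\<forall>s\<in>S. s = lsum N (\<lambda>(f, n). f s \<odot>\<^bsub>N\<^esub> n) ks)"
    and t: "s \<in> carrier (tensor R M N)" "t \<in> carrier (tensor R M N)"
    and eq: "\<And>f. f \<in> F \<Longrightarrow> eval_functional M f s = eval_functional M f t"
  shows "s = t"
proof -
  interpret T: abelian_group "tensor R M N" by (rule abelian_group_tensor)
  \<comment> \<open>All functionals of \<open>F\<close> vanish on the difference, so every
    coefficient in its expansion is zero.\<close>
  let ?d = "s \<ominus>\<^bsub>tensor R M N\<^esub> t"
  have d: "?d \<in> carrier (tensor R M N)" using t by simp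
  have "finite {?d}" "{?d} \<subseteq> carrier (tensor R M N)" using d by simp_all
  then have "\<exists>ks. set ks \<subseteq> F \<times> carrier N \<and>
      (\<forall>t\<in>{?d}. t = lsum (tensor R M N) (\<lambda>(f, n). tens R M N (eval_functional M f t) n) ks)"
    by (intro dual_basis_expansion F basis)
  then obtain ks where ks: "set ks \<subseteq> F \<times> carrier N"
    "?d = lsum (tensor R M N) (\<lambda>(f, n). tens R M N (eval_functional M f ?d) n) ks"
    by (elim exE conjE) (rule that, assumption, erule bspec, rule singletonI)
  have "eval_functional M f ?d = \<zero>\<^bsub>M\<^esub>" if "f \<in> F" for f
    using add_hom_minus [OF eval_additive [OF F [OF that]] t] eq [OF that]
      add_hom_closed [OF eval_additive [OF F [OF that]] t(2)]
    by (simp add: M.M.diff_eq_zero_iff)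
  then have "lsum (tensor R M N) (\<lambda>(f, n). tens R M N (eval_functional M f ?d) n) ks = \<zero>\<^bsub>tensor R M N\<^esub>"
    using ks(1) by (intro lsum_zero abelian_group_tensor) (fastforce simp: tens_zero_left)
  then have "?d = \<zero>\<^bsub>tensor R M N\<^esub>" using ks(2) by (rule trans [rotated])
  then show ?thesis using t by (simp add: T.diff_eq_zero_iff)
qed

end

section \<open>Corings and pairs of functionals\<close>

context coring begin

sublocale L: left_module A C by (rule left)
sublocale RC: right_module A "rmod C" by (rule right)

lemma ring_A: "ring A" by (rule L.R.ring_axioms)

lemmas right_regular = right_regular_module [OF ring_A]
lemmas left_regular = left_regular_module [OF ring_A]

abbreviation "T \<equiv> dual_ring A C"
abbreviation "CC \<equiv> C_tensor_C A C"
abbreviation "LA \<equiv> left_regular A"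
abbreviation "RA \<equiv> right_regular A"
abbreviation lactC (infixl \<open>\<bullet>\<close> 70) where "a \<bullet> c \<equiv> a \<odot>\<^bsub>C\<^esub> c"
abbreviation ractC (infixl \<open>\<star>\<close> 70) where "c \<star> a \<equiv> c \<triangleleft>\<^bsub>rmod C\<^esub> a"

lemma tensor_product_C: "right_module A M \<Longrightarrow> tensor_product A M C"
  by (rule tensor_productI [OF _ left])

sublocale CC: tensor_product A "rmod C" C by (rule tensor_product_C [OF right])

lemma carrier_CC [simp]: "carrier CC = carrier (tensor A (rmod C) C)"
  and zero_CC [simp]: "\<zero>\<^bsub>CC\<^esub> = \<zero>\<^bsub>tensor A (rmod C) C\<^esub>" and add_CC [simp]: "add CC = add (tensor A (rmod C) C)"
  by (simp_all add: tensor_lmod_def)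

lemma CC_smult: "\<lbrakk>a \<in> carrier A; c \<in> carrier C; d \<in> carrier C\<rbrakk>
    \<Longrightarrow> a \<odot>\<^bsub>CC\<^esub> tens A (rmod C) C c d = tens A (rmod C) C (a \<bullet> c) d"
  by (rule CC.lmod_act_tens [OF left]) (simp_all add: bimodule)

lemma left_module_CC: "left_module A CC"
  by (rule CC.left_module_tensor_lmod [OF left]) (simp_all add: bimodule)

lemma CC_act_additive:
  "a \<in> carrier A \<Longrightarrow> add_hom (tensor A (rmod C) C) (tensor A (rmod C) C) (\<lambda>u. a \<odot>\<^bsub>CC\<^esub> u)"
  by (rule CC.lmod_act_additive [OF left]) (simp_all add: bimodule)

lemma tensor_C_simps [simp]:
  "carrier (tensor_C A C M) = carrier (tensor A M C)" "\<zero>\<^bsub>tensor_C A C M\<^esub> = \<zero>\<^bsub>tensor A M C\<^esub>"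
  "add (tensor_C A C M) = add (tensor A M C)"
  by (simp_all add: tensor_rmod_def)

lemma right_module_tensor_C: "right_module A M \<Longrightarrow> right_module A (tensor_C A C M)"
  by (rule tensor_product.right_module_tensor_rmod [OF tensor_product_C right]) (simp_all add: bimodule)

lemma tensor_C_smult:
  "\<lbrakk>right_module A M; a \<in> carrier A; m \<in> carrier M; c \<in> carrier C\<rbrakk>
    \<Longrightarrow> tens A M C m c \<triangleleft>\<^bsub>tensor_C A C M\<^esub> a = tens A M C m (c \<star> a)"
  by (rule tensor_product.rmod_act_tens [OF tensor_product_C right]) (simp_all add: bimodule)

lemma tensor_C_act_additive:
  "\<lbrakk>right_module A M; a \<in> carrier A\<rbrakk>
    \<Longrightarrow> add_hom (tensor A M C) (tensor A M C) (\<lambda>t. t \<triangleleft>\<^bsub>tensor_C A C M\<^esub> a)"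
  by (rule tensor_product.rmod_act_additive [OF tensor_product_C right]) (simp_all add: bimodule)

lemma linear_map_restrict_iff:
  assumes "abelian_group M" "abelian_group N" "right_module R M \<or> left_module R M"
  shows "restrict f (carrier M) \<in> lin_hom R M N \<longleftrightarrow> linear_map R M N f"
proof
  assume "restrict f (carrier M) \<in> lin_hom R M N"
  then have "linear_map R M N (restrict f (carrier M))" using assms by (simp add: lin_hom_iff)
  then show "linear_map R M N f" using assms(3) by (rule linear_map_cong) simp
qed (use assms(3) restrict_lin_hom in blast)

lemma comult_linear_left: "linear_map A C CC (comult C)"
  using comult_left linear_map_restrict_iff [OF L.M.abelian_group_axioms left_module_group [OF left_module_CC]] left
  by blast

lemma comult_linear_right: "linear_map A (rmod C) (tensor_C A C (rmod C)) (comult C)"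
  using comult_right linear_map_restrict_iff [OF RC.M.abelian_group_axioms
      right_module_group [OF right_module_tensor_C [OF right]], of A "comult C"] right
  by simp

lemma counit_linear_left: "linear_map A C LA (counit C)"
  using counit_left linear_map_restrict_iff [OF L.M.abelian_group_axioms abelian_group_regular(1) [OF ring_A]] left
  by blast

lemma counit_linear_right: "linear_map A (rmod C) RA (counit C)"
  using counit_right linear_map_restrict_iff [OF RC.M.abelian_group_axioms
      abelian_group_regular(2) [OF ring_A], of A "counit C"] right
  by simp

lemma T_carrier: "carrier T = lin_hom A C LA"
  by (simp add: dual_ring_def)

lemma T_linear: "f \<in> carrier T \<Longrightarrow> linear_map A C LA f"
  unfolding T_carrier
  by (rule lin_hom_linear [OF _ L.M.abelian_group_axioms abelian_group_regular(1) [OF ring_A]])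

lemma T_closed: "\<lbrakk>f \<in> carrier T; c \<in> carrier C\<rbrakk> \<Longrightarrow> f c \<in> carrier A"
  using linear_map_closed [OF T_linear] by simp

lemma T_additive: "f \<in> carrier T \<Longrightarrow> add_hom C A f"
proof -
  assume "f \<in> carrier T"
  then have "add_hom C LA f" by (rule linear_map_additive [OF T_linear])
  then show ?thesis by (simp add: add_hom_def L.R.abelian_group_axioms)
qed

lemma T_smult: "\<lbrakk>f \<in> carrier T; a \<in> carrier A; c \<in> carrier C\<rbrakk> \<Longrightarrow> f (a \<bullet> c) = a \<otimes> f c"
  using linear_map_smult [OF T_linear] by simp

lemma T_memI: "linear_map A C LA f \<Longrightarrow> restrict f (carrier C) \<in> carrier T"
  unfolding T_carrier by (rule restrict_lin_hom) (simp_all add: left)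

lemma T_ext: "\<lbrakk>f \<in> carrier T; g \<in> carrier T; \<And>c. c \<in> carrier C \<Longrightarrow> f c = g c\<rbrakk> \<Longrightarrow> f = g"
  unfolding T_carrier by (rule lin_hom_ext)

text \<open>Preceded by the comultiplication this is the product of \<open>f\<close> and
  \<open>g\<close> in the dual ring. These functionals are numerous enough to separate the elements
  of \<open>M \<otimes> (C \<otimes> C)\<close> once local dual bases are available.\<close>

definition pair_functional :: "('c \<Rightarrow> 'a) \<Rightarrow> ('c \<Rightarrow> 'a) \<Rightarrow> ('c \<times> 'c \<Rightarrow>\<^sub>0 int) set \<Rightarrow> 'a" where
  "pair_functional f g = tensor_lift A (\<lambda>c d. g (c \<star> f d))"

context
  fixes f g assumes f: "f \<in> carrier T" and g: "g \<in> carrier T"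
begin

lemma balanced_pair: "balanced A (rmod C) C A (\<lambda>c d. g (c \<star> f d))"
proof (rule balancedI [OF L.R.abelian_group_axioms])
  have c: "c \<star> f d \<in> carrier C" if "c \<in> carrier C" "d \<in> carrier C" for c d
    using RC.ract_closed [of "f d" c] T_closed [OF f] that by simp
  show "g (c \<star> f d) \<in> carrier A" if "c \<in> carrier (rmod C)" "d \<in> carrier C" for c d
    using c T_closed [OF g] that by simp
  show "g ((c \<oplus>\<^bsub>rmod C\<^esub> c') \<star> f d) = g (c \<star> f d) \<oplus> g (c' \<star> f d)"
    if "c \<in> carrier (rmod C)" "c' \<in> carrier (rmod C)" "d \<in> carrier C" for c c' d
    using that c RC.ract_l_distr [of "f d" c c'] T_closed [OF f]
    by (simp add: add_hom_add [OF T_additive [OF g]])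
  show "g (c \<star> f (d \<oplus>\<^bsub>C\<^esub> d')) = g (c \<star> f d) \<oplus> g (c \<star> f d')"
    if "c \<in> carrier (rmod C)" "d \<in> carrier C" "d' \<in> carrier C" for c d d'
    using that c RC.ract_r_distr [of "f d" "f d'" c] T_closed [OF f]
    by (simp add: add_hom_add [OF T_additive [OF g]] add_hom_add [OF T_additive [OF f]])
  show "g ((c \<star> a) \<star> f d) = g (c \<star> f (a \<bullet> d))"
    if "c \<in> carrier (rmod C)" "a \<in> carrier A" "d \<in> carrier C" for c a d
    using that RC.ract_assoc [of a "f d" c] T_closed [OF f] by (simp add: T_smult [OF f])
qed

lemma pair_additive: "add_hom (tensor A (rmod C) C) A (pair_functional f g)"
  unfolding pair_functional_def by (rule CC.tensor_lift_additive [OF balanced_pair])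

lemma pair_tens:
  "\<lbrakk>c \<in> carrier C; d \<in> carrier C\<rbrakk> \<Longrightarrow> pair_functional f g (tens A (rmod C) C c d) = g (c \<star> f d)"
  unfolding pair_functional_def using CC.tensor_lift_tens [OF balanced_pair] by simp

lemma pair_linear: "linear_map A CC LA (pair_functional f g)"
proof -
  have "pair_functional f g (a \<odot>\<^bsub>CC\<^esub> u) = a \<otimes> pair_functional f g u"
    if a: "a \<in> carrier A" and u: "u \<in> carrier (tensor A (rmod C) C)" for a u
  proof (rule CC.add_hom_tensor_eq [OF add_hom_comp [OF CC_act_additive [OF a] pair_additive] _ _ u])
    have "add_hom A A (\<lambda>b. a \<otimes> b)"
      using a by (auto simp: add_hom_def L.R.abelian_group_axioms L.R.r_distr)
    then show "add_hom (tensor A (rmod C) C) A (\<lambda>u. a \<otimes> pair_functional f g u)"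
      by (rule add_hom_comp [OF pair_additive])
    fix c d assume "c \<in> carrier (rmod C)" "d \<in> carrier C"
    moreover from this have "c \<star> f d \<in> carrier C"
      using RC.ract_closed [of "f d" c] T_closed [OF f] by simp
    ultimately show "pair_functional f g (a \<odot>\<^bsub>CC\<^esub> tens A (rmod C) C c d) = a \<otimes> pair_functional f g (tens A (rmod C) C c d)"
      using a T_closed [OF f] by (simp add: CC_smult pair_tens L.lact_closed bimodule T_smult [OF g])
  qed
  moreover have "add_hom CC LA (pair_functional f g)"
    using pair_additive left_module_group [OF left_module_CC] abelian_group_regular(1) [OF ring_A]
    by (simp add: add_hom_def)
  ultimately show ?thesis by (simp add: linear_map_def)
qed

lemma T_mult_apply:
  "c \<in> carrier C \<Longrightarrow> (f \<otimes>\<^bsub>T\<^esub> g) c = pair_functional f g (comult C c)"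
  by (simp add: dual_ring_def pair_functional_def)

lemma T_mult_closed: "f \<otimes>\<^bsub>T\<^esub> g \<in> carrier T"
  using T_memI [OF linear_map_comp [OF comult_linear_left pair_linear]]
  by (simp add: dual_ring_def pair_functional_def)

end

text \<open>
  For an \<open>A\<close>-linear map \<open>\<rho>: M \<rightarrow> M \<otimes> C\<close>, both sides of the coassociativity equation are evaluated
  under the functionals \<open>c \<otimes> d \<mapsto> g(c f(d))\<close> on \<open>C \<otimes> C\<close>.
\<close>

context
  fixes M :: "('a, 'm, 'y) module_scheme" and \<rho> :: "'m \<Rightarrow> ('m \<times> 'c \<Rightarrow>\<^sub>0 int) set"
  assumes M: "right_module A M" and \<rho>: "linear_map A M (tensor_C A C M) \<rho>"
begin

interpretation M: right_module A M by (rule M)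
interpretation MC: tensor_product A M C by (rule tensor_product_C [OF M])
interpretation MCC: tensor_product A M CC by (rule tensor_productI [OF M left_module_CC])
interpretation MCt: tensor_product A "tensor_C A C M" C
  by (rule tensor_product_C [OF right_module_tensor_C [OF M]])

lemma balanced_assoc_inner:
  assumes d: "d \<in> carrier C"
  shows "balanced A M C (tensor A M CC) (\<lambda>m c. tens A M CC m (tens A (rmod C) C c d))"
proof (rule balancedI [OF MCC.abelian_group_tensor])
  fix m a c assume mac: "m \<in> carrier M" "a \<in> carrier A" "c \<in> carrier C"
  have "tens A M CC (m \<triangleleft>\<^bsub>M\<^esub> a) (tens A (rmod C) C c d) = tens A M CC m (a \<odot>\<^bsub>CC\<^esub> tens A (rmod C) C c d)"
    using mac d by (intro MCC.tens_balanced) auto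
  then show "tens A M CC (m \<triangleleft>\<^bsub>M\<^esub> a) (tens A (rmod C) C c d)
      = tens A M CC m (tens A (rmod C) C (a \<bullet> c) d)"
    using mac d by (simp add: CC_smult)
next
  fix m c c' assume mc: "m \<in> carrier M" "c \<in> carrier C" "c' \<in> carrier C"
  then show "tens A M CC m (tens A (rmod C) C (c \<oplus>\<^bsub>C\<^esub> c') d)
      = tens A M CC m (tens A (rmod C) C c d) \<oplus>\<^bsub>tensor A M CC\<^esub> tens A M CC m (tens A (rmod C) C c' d)"
    using d CC.tens_add_left [of c c' d] MCC.tens_add_right [of m "tens A (rmod C) C c d" "tens A (rmod C) C c' d"]
    by simp
qed (use d in \<open>auto simp: MCC.tens_add_left\<close>)

lemma balanced_assoc_outer:
  "balanced A (tensor_C A C M) C (tensor A M CC)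
    (\<lambda>t d. tensor_lift (tensor A M CC) (\<lambda>m c. tens A M CC m (tens A (rmod C) C c d)) t)"
proof (rule balancedI [OF MCC.abelian_group_tensor])
  let ?i = "\<lambda>t d. tensor_lift (tensor A M CC) (\<lambda>m c. tens A M CC m (tens A (rmod C) C c d)) t"
  note add = MC.tensor_lift_additive [OF balanced_assoc_inner] and tens = MC.tensor_lift_tens [OF balanced_assoc_inner]
  interpret G: abelian_group "tensor A M CC" by (rule MCC.abelian_group_tensor)
  show "?i t d \<in> carrier (tensor A M CC)" if "t \<in> carrier (tensor_C A C M)" "d \<in> carrier C" for t d
    using add_hom_closed [OF add] that by simp
  show "?i (t \<oplus>\<^bsub>tensor_C A C M\<^esub> t') d = ?i t d \<oplus>\<^bsub>tensor A M CC\<^esub> ?i t' d"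
    if "t \<in> carrier (tensor_C A C M)" "t' \<in> carrier (tensor_C A C M)" "d \<in> carrier C" for t t' d
    using add_hom_add [OF add] that by simp
  show "?i t (d \<oplus>\<^bsub>C\<^esub> d') = ?i t d \<oplus>\<^bsub>tensor A M CC\<^esub> ?i t d'"
    if t: "t \<in> carrier (tensor_C A C M)" and d: "d \<in> carrier C" "d' \<in> carrier C" for t d d'
  proof (rule MC.add_hom_tensor_eq [OF add])
    show "add_hom (tensor A M C) (tensor A M CC) (\<lambda>t. ?i t d \<oplus>\<^bsub>tensor A M CC\<^esub> ?i t d')"
      using d add_hom_closed [OF add] add_hom_add [OF add]
      by (auto simp: add_hom_def MC.abelian_group_tensor MCC.abelian_group_tensor G.a_ac)
    fix m c assume mc: "m \<in> carrier M" "c \<in> carrier C"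
    then show "?i (tens A M C m c) (d \<oplus>\<^bsub>C\<^esub> d') = ?i (tens A M C m c) d \<oplus>\<^bsub>tensor A M CC\<^esub> ?i (tens A M C m c) d'"
      using d CC.tens_add_right [of c d d'] MCC.tens_add_right [of m "tens A (rmod C) C c d" "tens A (rmod C) C c d'"]
      by (simp add: tens)
  qed (use t d in auto)
  show "?i (t \<triangleleft>\<^bsub>tensor_C A C M\<^esub> a) d = ?i t (a \<bullet> d)"
    if t: "t \<in> carrier (tensor_C A C M)" and a: "a \<in> carrier A" and d: "d \<in> carrier C" for t a d
  proof (rule MC.add_hom_tensor_eq [OF add_hom_comp [OF tensor_C_act_additive [OF M a] add [OF d]]
        add [OF L.lact_closed [OF a d]]])
    fix m c assume mc: "m \<in> carrier M" "c \<in> carrier C"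
    then have "c \<star> a \<in> carrier C" using RC.ract_closed a by simp
    then show "?i (tens A M C m c \<triangleleft>\<^bsub>tensor_C A C M\<^esub> a) d = ?i (tens A M C m c) (a \<bullet> d)"
      using mc a d CC.tens_balanced [of c a d] by (simp add: tensor_C_smult [OF M] tens L.lact_closed)
  qed (use t in auto)
qed

lemma balanced_comult: "balanced A M C (tensor A M CC) (\<lambda>m c. tens A M CC m (comult C c))"
proof (rule balancedI [OF MCC.abelian_group_tensor])
  note cc = linear_map_closed [OF comult_linear_left] and cs = linear_map_smult [OF comult_linear_left]
    and ca = linear_map_add [OF comult_linear_left]
  fix m a c assume mac: "m \<in> carrier M" "a \<in> carrier A" "c \<in> carrier C"
  show "tens A M CC (m \<triangleleft>\<^bsub>M\<^esub> a) (comult C c) = tens A M CC m (comult C (a \<bullet> c))"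
    using mac cc [of c] MCC.tens_balanced [of m a "comult C c"] by (simp add: cs)
next
  note cc = linear_map_closed [OF comult_linear_left]
    and ca = linear_map_add [OF comult_linear_left]
  fix m c c' assume mc: "m \<in> carrier M" "c \<in> carrier C" "c' \<in> carrier C"
  then show "tens A M CC m (comult C (c \<oplus>\<^bsub>C\<^esub> c')) =
      tens A M CC m (comult C c) \<oplus>\<^bsub>tensor A M CC\<^esub> tens A M CC m (comult C c')"
    using cc [of c] cc [of c'] MCC.tens_add_right [of m "comult C c" "comult C c'"] ca [of c c'] by simp
qed (use linear_map_closed [OF comult_linear_left] in \<open>auto simp: MCC.tens_add_left\<close>)

lemma coassoc_left_closed:
  assumes m: "m \<in> carrier M"
  shows "tensor_assoc A C M (tensor_map A (tensor_C A C M) C \<rho> (\<rho> m)) \<in> carrier (tensor A M CC)"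
    "tensor_lift (tensor A M CC) (\<lambda>m\<^sub>0 m\<^sub>1. tens A M CC m\<^sub>0 (comult C m\<^sub>1)) (\<rho> m) \<in> carrier (tensor A M CC)"
proof -
  have t: "\<rho> m \<in> carrier (tensor A M C)" using linear_map_closed [OF \<rho> m] by simp
  have "tensor_map A (tensor_C A C M) C \<rho> (\<rho> m) \<in> carrier (tensor A (tensor_C A C M) C)"
    by (rule tensor_map_closed [OF M right_module_tensor_C [OF M] left \<rho> t])
  then show "tensor_assoc A C M (tensor_map A (tensor_C A C M) C \<rho> (\<rho> m)) \<in> carrier (tensor A M CC)"
    unfolding tensor_assoc_def by (rule MCt.tensor_lift_closed [OF balanced_assoc_outer])
  show "tensor_lift (tensor A M CC) (\<lambda>m\<^sub>0 m\<^sub>1. tens A M CC m\<^sub>0 (comult C m\<^sub>1)) (\<rho> m) \<in> carrier (tensor A M CC)"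
    by (rule MC.tensor_lift_closed [OF balanced_comult t])
qed

text \<open>Iterating \<open>\<rho>\<close> and evaluating the outer factor by \<open>f\<close>, the
  inner one by \<open>g\<close>, is the same as acting by \<open>f\<close>, then by
  \<open>g\<close>.\<close>

lemma eval_coassoc_left:
  assumes f: "f \<in> carrier T" and g: "g \<in> carrier T" and m: "m \<in> carrier M"
  shows "eval_functional M (pair_functional f g)
      (tensor_assoc A C M (tensor_map A (tensor_C A C M) C \<rho> (\<rho> m)))
    = eval_functional M g (\<rho> (eval_functional M f (\<rho> m)))"
proof -
  note fl = T_linear [OF f] and gl = T_linear [OF g] and pl = pair_linear [OF f g]
  have t: "\<rho> m \<in> carrier (tensor A M C)" using linear_map_closed [OF \<rho> m] by simp
  have assoc: "add_hom (tensor A (tensor_C A C M) C) (tensor A M CC) (tensor_assoc A C M)"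
    unfolding tensor_assoc_def by (rule MCt.tensor_lift_additive [OF balanced_assoc_outer])
  have \<rho>a: "add_hom M (tensor A M C) \<rho>"
    using linear_map_additive [OF \<rho>] MC.abelian_group_tensor by (simp add: add_hom_def)
  \<comment> \<open>With the last factor \<open>d\<close> fixed, evaluation by the pair amounts to
    multiplication by \<open>f(d)\<close> followed by evaluation under \<open>g\<close>. Linearity
    of \<open>\<rho>\<close> over \<open>A\<close> then moves \<open>f(d)\<close> inside
    \<open>\<rho>\<close>.\<close>
  have inner: "eval_functional M (pair_functional f g)
      (tensor_lift (tensor A M CC) (\<lambda>m c. tens A M CC m (tens A (rmod C) C c d)) s)
      = eval_functional M g (s \<triangleleft>\<^bsub>tensor_C A C M\<^esub> f d)"
    if d: "d \<in> carrier C" and s: "s \<in> carrier (tensor A M C)" for d s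
  proof -
    have fd: "f d \<in> carrier A" by (rule T_closed [OF f d])
    show ?thesis
    proof (rule MC.add_hom_tensor_eq [OF
          add_hom_comp [OF MC.tensor_lift_additive [OF balanced_assoc_inner [OF d]] MCC.eval_additive [OF pl]]
          add_hom_comp [OF tensor_C_act_additive [OF M fd] MC.eval_additive [OF gl]] _ s])
      fix m c assume mc: "m \<in> carrier M" "c \<in> carrier C"
      then have "c \<star> f d \<in> carrier C" using RC.ract_closed fd by simp
      then show "eval_functional M (pair_functional f g)
          (tensor_lift (tensor A M CC) (\<lambda>m c. tens A M CC m (tens A (rmod C) C c d)) (tens A M C m c))
          = eval_functional M g (tens A M C m c \<triangleleft>\<^bsub>tensor_C A C M\<^esub> f d)"
        using mc d fd by (simp add: MC.tensor_lift_tens [OF balanced_assoc_inner] MCC.eval_tens [OF pl]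
            pair_tens [OF f g] tensor_C_smult [OF M] MC.eval_tens [OF gl])
    qed
  qed
  show ?thesis
  proof (rule MC.add_hom_tensor_eq [OF
        add_hom_comp [OF add_hom_comp [OF tensor_map_additive [OF M right_module_tensor_C [OF M] left \<rho>] assoc]
          MCC.eval_additive [OF pl]]
        add_hom_comp [OF add_hom_comp [OF MC.eval_additive [OF fl] \<rho>a] MC.eval_additive [OF gl]] _ t])
    fix n d assume nd: "n \<in> carrier M" "d \<in> carrier C"
    have \<rho>n: "\<rho> n \<in> carrier (tensor A M C)" using linear_map_closed [OF \<rho> nd(1)] by simp
    have "tensor_assoc A C M (tensor_map A (tensor_C A C M) C \<rho> (tens A M C n d))
        = tensor_lift (tensor A M CC) (\<lambda>m c. tens A M CC m (tens A (rmod C) C c d)) (\<rho> n)"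
      unfolding tensor_map_tens [OF M right_module_tensor_C [OF M] left \<rho> nd] tensor_assoc_def
      using nd \<rho>n by (intro MCt.tensor_lift_tens [OF balanced_assoc_outer]) auto
    moreover have "\<rho> (eval_functional M f (tens A M C n d)) = \<rho> n \<triangleleft>\<^bsub>tensor_C A C M\<^esub> f d"
      using nd T_closed [OF f] by (simp add: MC.eval_tens [OF fl] linear_map_smult [OF \<rho>])
    ultimately show "eval_functional M (pair_functional f g)
        (tensor_assoc A C M (tensor_map A (tensor_C A C M) C \<rho> (tens A M C n d)))
        = eval_functional M g (\<rho> (eval_functional M f (tens A M C n d)))"
      using inner [OF nd(2) \<rho>n] by simp
  qed
qed

text \<open>The pair of functionals meets the comultiplication of the right factor, which is how the
  product of the dual ring is defined.\<close>

lemma eval_coassoc_right: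
  assumes f: "f \<in> carrier T" and g: "g \<in> carrier T" and m: "m \<in> carrier M"
  shows "eval_functional M (pair_functional f g)
      (tensor_lift (tensor A M CC) (\<lambda>m\<^sub>0 m\<^sub>1. tens A M CC m\<^sub>0 (comult C m\<^sub>1)) (\<rho> m))
    = eval_functional M (f \<otimes>\<^bsub>T\<^esub> g) (\<rho> m)"
proof -
  have t: "\<rho> m \<in> carrier (tensor A M C)" using linear_map_closed [OF \<rho> m] by simp
  show ?thesis
  proof (rule MC.add_hom_tensor_eq [OF
        add_hom_comp [OF MC.tensor_lift_additive [OF balanced_comult] MCC.eval_additive [OF pair_linear [OF f g]]]
        MC.eval_additive [OF T_linear [OF T_mult_closed [OF f g]]] _ t])
    fix n c assume nc: "n \<in> carrier M" "c \<in> carrier C"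
    then show "eval_functional M (pair_functional f g)
        (tensor_lift (tensor A M CC) (\<lambda>m\<^sub>0 m\<^sub>1. tens A M CC m\<^sub>0 (comult C m\<^sub>1)) (tens A M C n c))
        = eval_functional M (f \<otimes>\<^bsub>T\<^esub> g) (tens A M C n c)"
      using linear_map_closed [OF comult_linear_left nc(2)]
      by (simp add: MC.tensor_lift_tens [OF balanced_comult] MCC.eval_tens [OF pair_linear [OF f g]]
          MC.eval_tens [OF T_linear [OF T_mult_closed [OF f g]]] T_mult_apply [OF f g])
  qed
qed

text \<open>For a coaction this is the law \<open>m (f g) = (m f) g\<close>; for the
  comultiplication itself it gives the associativity of the dual ring.\<close>

lemma eval_T_mult:
  assumes "coassociative A C M \<rho>" "f \<in> carrier T" "g \<in> carrier T" "m \<in> carrier M"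
  shows "eval_functional M (f \<otimes>\<^bsub>T\<^esub> g) (\<rho> m) = eval_functional M g (\<rho> (eval_functional M f (\<rho> m)))"
  using assms(1) eval_coassoc_left [OF assms(2-4)] eval_coassoc_right [OF assms(2-4)] assms(4)
  unfolding coassociative_def by simp

end

end

section \<open>The dual ring, comodules and rational modules\<close>

text \<open>Attaching a coaction to a module changes the record, but none of the fields that enter
  the tensor product.\<close>

lemma tensor_cong:
  assumes "carrier M' = carrier M" "add M' = add M" "smult M' = smult M"
  shows "tensor R M' N = tensor R M N" "tens R M' N = tens R M N"
proof -
  have "tensor_relations R M' N = tensor_relations R M N"
    by (simp add: tensor_relations_def assms)
  then have "tensor_kernel R M' N = tensor_kernel R M N" by (simp add: tensor_kernel_def assms)
  then show "tensor R M' N = tensor R M N" "tens R M' N = tens R M N"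
    by (simp_all add: tensor_def tens_def assms fun_eq_iff)
qed

lemma tensor_lift_cong:
  assumes "carrier H = carrier G" "\<zero>\<^bsub>H\<^esub> = \<zero>\<^bsub>G\<^esub>" "add H = add G"
  shows "tensor_lift H \<phi> = tensor_lift G \<phi>"
  unfolding tensor_lift_def [abs_def] finsum_def add_pow_def finprod_def int_pow_def nat_pow_def m_inv_def
  by (simp add: assms cong: if_cong)

lemma tensor_with_coact [simp]:
  "tensor R (with_coact M \<rho>) N = tensor R M N" "tens R (with_coact M \<rho>) N = tens R M N"
  "tensor_rmod R (with_coact M \<rho>) N N' = tensor_rmod R M N N'"
  using tensor_cong [of "with_coact M \<rho>" M R N] by (simp_all add: tensor_rmod_def)

lemma tensor_lift_rmod [simp]: "tensor_lift (rmod C) = tensor_lift C"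
  by (intro ext tensor_lift_cong [THEN fun_cong]) simp_all

lemma tensor_lift_with_coact [simp]: "tensor_lift (with_coact M \<rho>) = tensor_lift M"
  by (intro ext tensor_lift_cong [THEN fun_cong]) simp_all

lemma tensor_lift_with_smult [simp]: "tensor_lift (with_smult M act) = tensor_lift M"
  by (intro ext tensor_lift_cong [THEN fun_cong]) simp_all

lemma eval_functional_with_coact [simp]: "eval_functional (with_coact M \<rho>) = eval_functional M"
  by (simp add: eval_functional_def fun_eq_iff)

lemma coassociative_with_coact [simp]: "coassociative A C (with_coact M \<rho>) = coassociative A C M"
  by (simp add: coassociative_def tensor_assoc_def fun_eq_iff)

lemma dual_module_simps [simp]:
  "carrier (dual_module M) = carrier M" "\<zero>\<^bsub>dual_module M\<^esub> = \<zero>\<^bsub>M\<^esub>" "add (dual_module M) = add M"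
  "m \<triangleleft>\<^bsub>dual_module M\<^esub> g = eval_functional M g (coact M m)"
  by (simp_all add: dual_module_def eval_functional_def)

section \<open>The action of the dual ring on the coring\<close>

context coring begin

text \<open>The right action \<open>c \<mapsto> \<Sum> c\<^sub>1 f(c\<^sub>2)\<close> of the dual
  ring on \<open>C\<close>. A product of functionals is the second one composed with the action of
  the first.\<close>

definition actC :: "('c \<Rightarrow> 'a) \<Rightarrow> 'c \<Rightarrow> 'c" where
  "actC f c = eval_functional (rmod C) f (comult C c)"

lemma comult_closed: "c \<in> carrier C \<Longrightarrow> comult C c \<in> carrier (tensor A (rmod C) C)"
  using linear_map_closed [OF comult_linear_left] by simp

lemma actC_closed: "\<lbrakk>f \<in> carrier T; c \<in> carrier C\<rbrakk> \<Longrightarrow> actC f c \<in> carrier C"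
  using add_hom_closed [OF CC.eval_additive [OF T_linear] comult_closed] by (simp add: actC_def)

lemma additive_rmod_iff [simp]:
  "add_hom (rmod C) H h \<longleftrightarrow> add_hom C H h" "add_hom H (rmod C) k \<longleftrightarrow> add_hom H C k"
  using L.M.abelian_group_axioms RC.M.abelian_group_axioms by (auto simp: add_hom_def)

lemma pair_functional_eval:
  assumes "f \<in> carrier T" "g \<in> carrier T" "u \<in> carrier (tensor A (rmod C) C)"
  shows "pair_functional f g u = g (eval_functional (rmod C) f u)"
proof (rule CC.add_hom_tensor_eq [OF pair_additive [OF assms(1,2)] _ _ assms(3)])
  show "add_hom (tensor A (rmod C) C) A (\<lambda>u. g (eval_functional (rmod C) f u))"
    by (rule add_hom_comp [where H = C and f = "eval_functional (rmod C) f"])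
       (use CC.eval_additive [OF T_linear [OF assms(1)]] T_additive [OF assms(2)] in simp_all)
qed (simp add: pair_tens [OF assms(1,2)] CC.eval_tens [OF T_linear [OF assms(1)]])

lemma T_mult_act: "\<lbrakk>f \<in> carrier T; g \<in> carrier T; c \<in> carrier C\<rbrakk> \<Longrightarrow> (f \<otimes>\<^bsub>T\<^esub> g) c = g (actC f c)"
  by (simp add: T_mult_apply pair_functional_eval comult_closed actC_def)

lemma actC_mult:
  assumes "f \<in> carrier T" "g \<in> carrier T" "c \<in> carrier C"
  shows "actC (f \<otimes>\<^bsub>T\<^esub> g) c = actC g (actC f c)"
  using eval_T_mult [OF right comult_linear_right coassoc assms(1,2)] assms(3) by (simp add: actC_def)

lemma T_one: "\<one>\<^bsub>T\<^esub> = restrict (counit C) (carrier C)"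
  by (simp add: dual_ring_def)

lemma T_one_closed: "\<one>\<^bsub>T\<^esub> \<in> carrier T"
  unfolding T_one by (rule T_memI [OF counit_linear_left])

text \<open>Elements of the dual ring are extensional while \<open>counit C\<close> is not; this
  rule mediates between the counit and the unit of the dual ring.\<close>

lemma eval_functional_cong:
  assumes "right_module A M" "linear_map A C LA f"
    and "\<And>c. c \<in> carrier C \<Longrightarrow> g c = f c" "t \<in> carrier (tensor A M C)"
  shows "eval_functional M g t = eval_functional M f t"
proof -
  interpret M: tensor_product A M C by (rule tensor_product_C) fact
  have g: "linear_map A C LA g"
    by (rule linear_map_cong [OF assms(2)]) (simp_all add: left assms)
  show ?thesis
    by (rule M.add_hom_tensor_eq [OF M.eval_additive [OF g] M.eval_additive [OF assms(2)] _ assms(4)])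
       (simp add: M.eval_tens [OF g] M.eval_tens [OF assms(2)] assms(3))
qed

lemma actC_one:
  assumes "c \<in> carrier C" shows "actC \<one>\<^bsub>T\<^esub> c = c"
proof -
  have "actC \<one>\<^bsub>T\<^esub> c = eval_functional (rmod C) (counit C) (comult C c)"
    unfolding actC_def T_one
    by (rule eval_functional_cong [OF right counit_linear_left _ comult_closed [OF assms]]) simp
  also have "\<dots> = tensor_lift C (\<lambda>c\<^sub>1 c\<^sub>2. c\<^sub>1 \<star> counit C c\<^sub>2) (comult C c)"
    by (simp add: eval_functional_def)
  finally show ?thesis using counital_right [OF assms] by simp
qed

lemma counit_closed: "c \<in> carrier C \<Longrightarrow> counit C c \<in> carrier A"
  using linear_map_closed [OF counit_linear_left] by simp

lemma counit_add: "\<lbrakk>c \<in> carrier C; d \<in> carrier C\<rbrakk> \<Longrightarrow> counit C (c \<oplus>\<^bsub>C\<^esub> d) = counit C c \<oplus> counit C d"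
  using linear_map_add [OF counit_linear_left] by simp

lemma counit_smult_left: "\<lbrakk>a \<in> carrier A; c \<in> carrier C\<rbrakk> \<Longrightarrow> counit C (a \<bullet> c) = a \<otimes> counit C c"
  using linear_map_smult [OF counit_linear_left] by simp

lemma counit_smult_right: "\<lbrakk>a \<in> carrier A; c \<in> carrier C\<rbrakk> \<Longrightarrow> counit C (c \<star> a) = counit C c \<otimes> a"
  using linear_map_smult [OF counit_linear_right] by simp

lemma ractC_closed: "\<lbrakk>a \<in> carrier A; c \<in> carrier C\<rbrakk> \<Longrightarrow> c \<star> a \<in> carrier C"
  using RC.ract_closed by simp

text \<open>\<open>\<epsilon>(c\<^sub>1 f(c\<^sub>2)) = \<epsilon>(c\<^sub>1) f(c\<^sub>2) =
  f(\<epsilon>(c\<^sub>1) c\<^sub>2)\<close>, and the left counit axiom applies under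
  \<open>f\<close>. It makes the counit a right unit of the dual ring.\<close>

lemma counit_actC:
  assumes f: "f \<in> carrier T" and c: "c \<in> carrier C"
  shows "counit C (actC f c) = f c"
proof -
  have bal: "balanced A (rmod C) C C (\<lambda>c\<^sub>1 c\<^sub>2. counit C c\<^sub>1 \<bullet> c\<^sub>2)"
    by (intro balancedI L.M.abelian_group_axioms)
       (simp_all add: L.lact_closed counit_closed counit_add L.lact_l_distr L.lact_r_distr
         counit_smult_right L.lact_assoc)
  have ce: "add_hom C A (counit C)"
    using linear_map_additive [OF counit_linear_left] by (simp add: add_hom_def L.R.abelian_group_axioms)
  have "counit C (eval_functional (rmod C) f u) = f (tensor_lift C (\<lambda>c\<^sub>1 c\<^sub>2. counit C c\<^sub>1 \<bullet> c\<^sub>2) u)"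
    if "u \<in> carrier (tensor A (rmod C) C)" for u
  proof (rule CC.add_hom_tensor_eq [OF _ add_hom_comp [OF CC.tensor_lift_additive [OF bal] T_additive [OF f]] _ that])
    show "add_hom (tensor A (rmod C) C) A (\<lambda>u. counit C (eval_functional (rmod C) f u))"
      by (rule add_hom_comp [where H = C and f = "eval_functional (rmod C) f"])
         (use CC.eval_additive [OF T_linear [OF f]] ce in simp_all)
    fix c d assume "c \<in> carrier (rmod C)" "d \<in> carrier C"
    then show "counit C (eval_functional (rmod C) f (tens A (rmod C) C c d))
        = f (tensor_lift C (\<lambda>c\<^sub>1 c\<^sub>2. counit C c\<^sub>1 \<bullet> c\<^sub>2) (tens A (rmod C) C c d))"
      using T_closed [OF f, of d]
      by (simp add: CC.eval_tens [OF T_linear [OF f]] CC.tensor_lift_tens [OF bal] counit_smult_right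
          T_smult [OF f] counit_closed)
  qed
  then show ?thesis using counital_left [OF c] comult_closed [OF c] by (simp add: actC_def)
qed

lemma T_add_apply: "c \<in> carrier C \<Longrightarrow> (f \<oplus>\<^bsub>T\<^esub> g) c = f c \<oplus> g c"
  by (simp add: dual_ring_def)

lemma T_add_closed:
  assumes "f \<in> carrier T" "g \<in> carrier T" shows "f \<oplus>\<^bsub>T\<^esub> g \<in> carrier T"
proof -
  have "linear_map A C LA (\<lambda>c. f c \<oplus> g c)"
    using assms T_closed
    by (intro linear_mapI L.M.abelian_group_axioms abelian_group_regular(1) [OF ring_A])
       (auto simp: add_hom_add [OF T_additive] T_smult L.R.r_distr L.R.a_ac)
  from T_memI [OF this] show ?thesis by (simp add: dual_ring_def)
qed

lemma abelian_group_T: "abelian_group T"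
proof (rule abelian_groupI)
  fix f assume f: "f \<in> carrier T"
  have "linear_map A C LA (\<lambda>c. \<ominus> f c)"
    using f T_closed [OF f]
    by (intro linear_mapI L.M.abelian_group_axioms abelian_group_regular(1) [OF ring_A])
       (auto simp: add_hom_add [OF T_additive] T_smult L.R.r_minus L.R.minus_add L.R.a_comm)
  from T_memI [OF this] have n: "restrict (\<lambda>c. \<ominus> f c) (carrier C) \<in> carrier T" .
  moreover have "restrict (\<lambda>c. \<ominus> f c) (carrier C) \<oplus>\<^bsub>T\<^esub> f = \<zero>\<^bsub>T\<^esub>"
    using T_closed [OF f] by (auto simp: dual_ring_def L.R.l_neg intro!: restrict_ext)
  ultimately show "\<exists>g\<in>carrier T. g \<oplus>\<^bsub>T\<^esub> f = \<zero>\<^bsub>T\<^esub>" by blast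
next
  have "linear_map A C LA (\<lambda>c. \<zero>)"
    by (intro linear_mapI L.M.abelian_group_axioms abelian_group_regular(1) [OF ring_A]) auto
  from T_memI [OF this] show z: "\<zero>\<^bsub>T\<^esub> \<in> carrier T" by (simp add: dual_ring_def)
  fix f assume f: "f \<in> carrier T"
  show "\<zero>\<^bsub>T\<^esub> \<oplus>\<^bsub>T\<^esub> f = f"
    using T_closed [OF f] by (intro T_ext T_add_closed z f) (simp_all add: dual_ring_def)
next
  fix f g assume fg: "f \<in> carrier T" "g \<in> carrier T"
  show "f \<oplus>\<^bsub>T\<^esub> g = g \<oplus>\<^bsub>T\<^esub> f"
    using fg T_closed by (intro T_ext T_add_closed) (simp_all add: T_add_apply L.R.a_comm)
  fix h assume h: "h \<in> carrier T"
  show "f \<oplus>\<^bsub>T\<^esub> g \<oplus>\<^bsub>T\<^esub> h = f \<oplus>\<^bsub>T\<^esub> (g \<oplus>\<^bsub>T\<^esub> h)"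
    using fg h T_closed by (intro T_ext T_add_closed) (simp_all add: T_add_apply L.R.a_assoc)
qed (rule T_add_closed)

lemma eval_functional_add:
  assumes M: "right_module A M" and "f \<in> carrier T" "g \<in> carrier T" "t \<in> carrier (tensor A M C)"
  shows "eval_functional M (f \<oplus>\<^bsub>T\<^esub> g) t = eval_functional M f t \<oplus>\<^bsub>M\<^esub> eval_functional M g t"
proof -
  interpret M: tensor_product A M C by (rule tensor_product_C) fact
  note fl = T_linear [OF assms(2)] and gl = T_linear [OF assms(3)]
    and fgl = T_linear [OF T_add_closed [OF assms(2,3)]]
  have "add_hom (tensor A M C) M (\<lambda>t. eval_functional M f t \<oplus>\<^bsub>M\<^esub> eval_functional M g t)"
    using M.eval_additive [OF fl] M.eval_additive [OF gl]
    by (auto simp: add_hom_def M.M.a_ac Pi_iff)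
  then show ?thesis
    by (rule M.add_hom_tensor_eq [OF M.eval_additive [OF fgl] _ _ assms(4)])
       (simp add: M.eval_tens [OF fl] M.eval_tens [OF gl] M.eval_tens [OF fgl] T_add_apply
         M.M.ract_r_distr T_closed assms(2,3))
qed

lemma actC_add:
  "\<lbrakk>f \<in> carrier T; g \<in> carrier T; c \<in> carrier C\<rbrakk> \<Longrightarrow> actC (f \<oplus>\<^bsub>T\<^esub> g) c = actC f c \<oplus>\<^bsub>C\<^esub> actC g c"
  using eval_functional_add [OF right] comult_closed by (simp add: actC_def)

text \<open>Since the product of \<open>f\<close> and \<open>g\<close> is \<open>g\<close> after
  \<open>actC f\<close>, the ring laws reduce to the laws of an action and to the additivity of
  functionals.\<close>

lemma ring_T: "ring T"
proof (rule ringI [OF abelian_group_T])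
  show "Group.monoid T"
  proof (rule monoidI)
    fix f g h assume fgh: "f \<in> carrier T" "g \<in> carrier T" "h \<in> carrier T"
    show "f \<otimes>\<^bsub>T\<^esub> g \<otimes>\<^bsub>T\<^esub> h = f \<otimes>\<^bsub>T\<^esub> (g \<otimes>\<^bsub>T\<^esub> h)"
      using fgh by (intro T_ext T_mult_closed) (simp_all add: T_mult_act T_mult_closed actC_mult actC_closed)
  next
    fix f assume f: "f \<in> carrier T"
    show "\<one>\<^bsub>T\<^esub> \<otimes>\<^bsub>T\<^esub> f = f"
      using f by (intro T_ext T_mult_closed T_one_closed) (simp_all add: T_mult_act T_one_closed actC_one)
    have "(f \<otimes>\<^bsub>T\<^esub> \<one>\<^bsub>T\<^esub>) c = f c" if "c \<in> carrier C" for c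
      using f that by (simp add: T_mult_act T_one_closed) (simp add: T_one counit_actC actC_closed)
    then show "f \<otimes>\<^bsub>T\<^esub> \<one>\<^bsub>T\<^esub> = f"
      using f by (intro T_ext T_mult_closed T_one_closed)
  qed (simp_all add: T_mult_closed T_one_closed)
next
  fix f g h assume fgh: "f \<in> carrier T" "g \<in> carrier T" "h \<in> carrier T"
  show "(f \<oplus>\<^bsub>T\<^esub> g) \<otimes>\<^bsub>T\<^esub> h = f \<otimes>\<^bsub>T\<^esub> h \<oplus>\<^bsub>T\<^esub> g \<otimes>\<^bsub>T\<^esub> h"
    using fgh
    by (intro T_ext T_mult_closed T_add_closed)
       (simp_all add: T_mult_act T_add_apply T_add_closed actC_add add_hom_add [OF T_additive] actC_closed)
  show "h \<otimes>\<^bsub>T\<^esub> (f \<oplus>\<^bsub>T\<^esub> g) = h \<otimes>\<^bsub>T\<^esub> f \<oplus>\<^bsub>T\<^esub> h \<otimes>\<^bsub>T\<^esub> g"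
    using fgh by (intro T_ext T_mult_closed T_add_closed)
      (simp_all add: T_mult_act T_add_apply T_add_closed actC_closed)
qed

sublocale T: ring T by (rule ring_T)

text \<open>The ring homomorphism from \<open>A\<close> to the dual ring; on \<open>C\<close> its
  value at \<open>a\<close> acts as right multiplication by \<open>a\<close>.\<close>

definition iota :: "'a \<Rightarrow> 'c \<Rightarrow> 'a" where
  "iota a = (\<lambda>c\<in>carrier C. counit C c \<otimes> a)"

lemma iota_apply: "c \<in> carrier C \<Longrightarrow> iota a c = counit C c \<otimes> a"
  by (simp add: iota_def)

lemma iota_closed: "a \<in> carrier A \<Longrightarrow> iota a \<in> carrier T"
proof -
  assume a: "a \<in> carrier A"
  have "linear_map A C LA (\<lambda>c. counit C c \<otimes> a)"
    using a by (intro linear_mapI L.M.abelian_group_axioms abelian_group_regular(1) [OF ring_A])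
      (auto simp: counit_closed counit_add counit_smult_left L.R.l_distr L.R.m_assoc)
  then show ?thesis unfolding iota_def by (rule T_memI)
qed

lemma actC_iota:
  assumes "a \<in> carrier A" "c \<in> carrier C" shows "actC (iota a) c = c \<star> a"
proof -
  have lin: "add_hom (tensor A (rmod C) C) (rmod C) (\<lambda>u. eval_functional (rmod C) (counit C) u \<star> a)"
    by (rule add_hom_comp [OF CC.eval_additive [OF counit_linear_left] RC.additive_ract_left [OF assms(1)]])
  have "eval_functional (rmod C) (iota a) u = eval_functional (rmod C) (counit C) u \<star> a"
    if "u \<in> carrier (tensor A (rmod C) C)" for u
    using assms(1) RC.ract_assoc
    by (intro CC.add_hom_tensor_eq [OF CC.eval_additive [OF T_linear [OF iota_closed [OF assms(1)]]] lin _ that])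
       (simp_all add: CC.eval_tens [OF T_linear [OF iota_closed [OF assms(1)]]] CC.eval_tens [OF counit_linear_left]
         iota_apply counit_closed)
  moreover have "eval_functional (rmod C) (counit C) (comult C c) = c"
    using counital_right [OF assms(2)] by (simp add: eval_functional_def)
  ultimately show ?thesis using comult_closed [OF assms(2)] by (simp add: actC_def)
qed

lemma iota_mult:
  "\<lbrakk>a \<in> carrier A; f \<in> carrier T; c \<in> carrier C\<rbrakk> \<Longrightarrow> (iota a \<otimes>\<^bsub>T\<^esub> f) c = f (c \<star> a)"
  by (simp add: T_mult_act iota_closed actC_iota)

lemma iota_hom_mult: "\<lbrakk>a \<in> carrier A; b \<in> carrier A\<rbrakk> \<Longrightarrow> iota (a \<otimes> b) = iota a \<otimes>\<^bsub>T\<^esub> iota b"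
  by (intro T_ext) (simp_all add: iota_closed iota_mult, simp add: iota_def ractC_closed
    counit_smult_right counit_closed L.R.m_assoc)

lemma iota_hom_add: "\<lbrakk>a \<in> carrier A; b \<in> carrier A\<rbrakk> \<Longrightarrow> iota (a \<oplus> b) = iota a \<oplus>\<^bsub>T\<^esub> iota b"
  by (intro T_ext) (simp_all add: iota_closed T_add_apply, simp add: iota_def counit_closed L.R.r_distr)

lemma iota_one: "iota \<one> = \<one>\<^bsub>T\<^esub>"
  unfolding iota_def T_one by (rule restrict_ext) (simp add: counit_closed)

text \<open>The right \<open>A\<close>-module underlying a right module over the dual ring, along \<open>a \<mapsto> \<epsilon>(-) a\<close>.\<close>

definition base_module :: "('c \<Rightarrow> 'a, 'm, 'y) module_scheme \<Rightarrow> ('a, 'm) module" where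
  "base_module P = with_smult P (\<lambda>a p. p \<triangleleft>\<^bsub>P\<^esub> iota a)"

lemma base_module_simps [simp]:
  "carrier (base_module P) = carrier P" "\<zero>\<^bsub>base_module P\<^esub> = \<zero>\<^bsub>P\<^esub>" "add (base_module P) = add P"
  "p \<triangleleft>\<^bsub>base_module P\<^esub> a = p \<triangleleft>\<^bsub>P\<^esub> iota a"
  by (simp_all add: base_module_def)

lemma right_module_base:
  assumes "right_module T P" shows "right_module A (base_module P)"
proof -
  interpret P: right_module T P by fact
  show ?thesis
    by (rule right_moduleI)
       (auto simp: ring_A base_module_def P.M.abelian_group_axioms iota_closed P.ract_closed P.ract_l_distr
         iota_hom_add P.ract_r_distr iota_hom_mult P.ract_assoc iota_one P.ract_one)
qed

section \<open>Comodules as modules over the dual ring\<close>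

lemma comodule_linear:
  assumes "comodule A C M"
  shows "linear_map A M (tensor_C A C M) (coact M)"
proof -
  interpret M: comodule A C M by fact
  show ?thesis
    using M.coact_linear linear_map_restrict_iff [OF right_module_group [OF M.right]
        right_module_group [OF right_module_tensor_C [OF M.right]], of A "coact M"] M.right by blast
qed

lemma coact_closed:
  "\<lbrakk>comodule A C M; m \<in> carrier M\<rbrakk> \<Longrightarrow> coact M m \<in> carrier (tensor A M C)"
  using linear_map_closed [OF comodule_linear] by simp

lemma coact_additive: "comodule A C M \<Longrightarrow> add_hom M (tensor A M C) (coact M)"
proof -
  assume M: "comodule A C M"
  interpret MC: tensor_product A M C by (rule tensor_product_C [OF comodule.right [OF M]])
  show ?thesis
    using linear_map_additive [OF comodule_linear [OF M]] MC.abelian_group_tensor by (simp add: add_hom_def)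
qed

text \<open>\<open>\<Sum> m\<^sub>0 (\<epsilon>(m\<^sub>1) a) = m a\<close> by counitality: the
  action of the dual ring extends that of \<open>A\<close>.\<close>

lemma comodule_act_iota:
  assumes M: "comodule A C M" and a: "a \<in> carrier A" and m: "m \<in> carrier M"
  shows "m \<triangleleft>\<^bsub>dual_module M\<^esub> iota a = m \<triangleleft>\<^bsub>M\<^esub> a"
proof -
  interpret M: comodule A C M by (rule M)
  interpret MC: tensor_product A M C by (rule tensor_product_C [OF M.right])
  note il = T_linear [OF iota_closed [OF a]]
  have lin: "add_hom (tensor A M C) M (\<lambda>u. eval_functional M (counit C) u \<triangleleft>\<^bsub>M\<^esub> a)"
    by (rule add_hom_comp [OF MC.eval_additive [OF counit_linear_left] MC.M.additive_ract_left [OF a]])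
  have "eval_functional M (iota a) (coact M m) = eval_functional M (counit C) (coact M m) \<triangleleft>\<^bsub>M\<^esub> a"
    using a by (intro MC.add_hom_tensor_eq [OF MC.eval_additive [OF il] lin _ coact_closed [OF M m]])
       (simp_all add: MC.eval_tens [OF il] MC.eval_tens [OF counit_linear_left] iota_apply counit_closed MC.M.ract_assoc)
  then show ?thesis using M.counital [OF m] by (simp add: eval_functional_def)
qed

lemma right_module_dual:
  assumes M: "comodule A C M" shows "right_module T (dual_module M)"
proof -
  interpret M: comodule A C M by (rule M)
  interpret MC: tensor_product A M C by (rule tensor_product_C [OF M.right])
  note cl = coact_closed [OF M] and ev = MC.eval_additive [OF T_linear]
  have one: "m \<triangleleft>\<^bsub>dual_module M\<^esub> \<one>\<^bsub>T\<^esub> = m" if "m \<in> carrier M" for m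
    using comodule_act_iota [OF M _ that, of \<one>] that by (simp add: iota_one MC.M.ract_one del: dual_module_simps)
  show ?thesis
  proof (rule right_moduleI [OF ring_T])
    show "abelian_group (dual_module M)" by (simp add: dual_module_def MC.M.M.abelian_group_axioms)
    fix f m assume f: "f \<in> carrier T" and "m \<in> carrier (dual_module M)"
    then have m: "m \<in> carrier M" by simp
    show "m \<triangleleft>\<^bsub>dual_module M\<^esub> f \<in> carrier (dual_module M)"
      using add_hom_closed [OF ev [OF f] cl [OF m]] by simp
    show "(m \<oplus>\<^bsub>dual_module M\<^esub> n) \<triangleleft>\<^bsub>dual_module M\<^esub> f
        = m \<triangleleft>\<^bsub>dual_module M\<^esub> f \<oplus>\<^bsub>dual_module M\<^esub> n \<triangleleft>\<^bsub>dual_module M\<^esub> f"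
      if "n \<in> carrier (dual_module M)" for n
      using that m cl by (simp add: add_hom_add [OF coact_additive [OF M]] add_hom_add [OF ev [OF f]])
    fix g assume g: "g \<in> carrier T"
    show "m \<triangleleft>\<^bsub>dual_module M\<^esub> (f \<oplus>\<^bsub>T\<^esub> g) = m \<triangleleft>\<^bsub>dual_module M\<^esub> f \<oplus>\<^bsub>dual_module M\<^esub> m \<triangleleft>\<^bsub>dual_module M\<^esub> g"
      using eval_functional_add [OF M.right f g cl [OF m]] by simp
    show "m \<triangleleft>\<^bsub>dual_module M\<^esub> (f \<otimes>\<^bsub>T\<^esub> g) = (m \<triangleleft>\<^bsub>dual_module M\<^esub> f) \<triangleleft>\<^bsub>dual_module M\<^esub> g"
      using eval_T_mult [OF M.right comodule_linear [OF M] M.coassoc f g m] by simp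
  qed (use one in simp)
qed

lemma comodule_coring: "comodule A C (coring_comodule C)"
  unfolding coring_comodule_def
proof (rule comodule.intro)
  show "right_module A (with_coact (rmod C) (comult C))" by (rule right_module_with_coact [OF right])
  have "lin_hom A (with_coact (rmod C) (comult C)) (tensor_C A C (rmod C)) = lin_hom A (rmod C) (tensor_C A C (rmod C))"
    by (simp add: lin_hom_def)
  then show "restrict (coact (with_coact (rmod C) (comult C))) (carrier (with_coact (rmod C) (comult C)))
      \<in> lin_hom A (with_coact (rmod C) (comult C)) (tensor_C A C (with_coact (rmod C) (comult C)))"
    using comult_right by simp
  show "coassociative A C (with_coact (rmod C) (comult C)) (coact (with_coact (rmod C) (comult C)))"
    using coassoc by simp
  show "tensor_lift (with_coact (rmod C) (comult C))
      (\<lambda>m\<^sub>0 m\<^sub>1. m\<^sub>0 \<triangleleft>\<^bsub>with_coact (rmod C) (comult C)\<^esub> counit C m\<^sub>1) (coact (with_coact (rmod C) (comult C)) m) = m"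
    if "m \<in> carrier (with_coact (rmod C) (comult C))" for m
    using counital_right that by simp
qed

lemma coring_comodule_act: "c \<triangleleft>\<^bsub>dual_module (coring_comodule C)\<^esub> f = actC f c"
  by (simp add: coring_comodule_def actC_def)

lemma carrier_coring_comodule [simp]: "carrier (coring_comodule C) = carrier C"
  "\<zero>\<^bsub>coring_comodule C\<^esub> = \<zero>\<^bsub>C\<^esub>" "add (coring_comodule C) = add C"
  by (simp_all add: coring_comodule_def)

section \<open>Rational modules\<close>

text \<open>The list stands for an element of \<open>P \<otimes> C\<close> through which all
  functionals act on \<open>p\<close>, that is, for a candidate of the coaction of \<open>p\<close>.
  Uniqueness is not part of the notion; it comes from separation by functionals.\<close>

definition rational_elem :: "('c \<Rightarrow> 'a, 'm, 'y) module_scheme \<Rightarrow> 'm \<Rightarrow> bool" where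
  "rational_elem P p \<longleftrightarrow> (\<exists>ks. set ks \<subseteq> carrier P \<times> carrier C \<and>
     (\<forall>f\<in>carrier T. p \<triangleleft>\<^bsub>P\<^esub> f = lsum P (\<lambda>(q, c). q \<triangleleft>\<^bsub>P\<^esub> iota (f c)) ks))"

definition rational :: "('c \<Rightarrow> 'a, 'm, 'y) module_scheme \<Rightarrow> bool" where
  "rational P \<longleftrightarrow> right_module T P \<and> (\<forall>p\<in>carrier P. rational_elem P p)"

lemma rational_right_module: "rational P \<Longrightarrow> right_module T P"
  by (simp add: rational_def)

lemma rational_dual_module:
  assumes M: "comodule A C M" shows "rational (dual_module M)"
proof -
  interpret M: comodule A C M by (rule M)
  interpret MC: tensor_product A M C by (rule tensor_product_C [OF M.right])
  have "rational_elem (dual_module M) m" if m: "m \<in> carrier M" for m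
  proof -
    obtain ps where ps: "set ps \<subseteq> carrier M \<times> carrier C"
      "coact M m = lsum (tensor A M C) (\<lambda>(m, n). tens A M C m n) ps"
      using MC.tensor_list [OF coact_closed [OF M m]] .
    have "m \<triangleleft>\<^bsub>dual_module M\<^esub> f = lsum (dual_module M) (\<lambda>(q, c). q \<triangleleft>\<^bsub>dual_module M\<^esub> iota (f c)) ps"
      if f: "f \<in> carrier T" for f
    proof -
      have "m \<triangleleft>\<^bsub>dual_module M\<^esub> f = lsum M (\<lambda>(q, c). q \<triangleleft>\<^bsub>M\<^esub> f c) ps"
        using MC.eval_list [OF T_linear [OF f] ps(1)] ps(2) by simp
      also have "\<dots> = lsum M (\<lambda>(q, c). q \<triangleleft>\<^bsub>dual_module M\<^esub> iota (f c)) ps"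
        using ps(1) T_closed [OF f]
        by (intro lsum_cong) (auto simp: comodule_act_iota [OF M] simp del: dual_module_simps)
      also have "\<dots> = lsum (dual_module M) (\<lambda>(q, c). q \<triangleleft>\<^bsub>dual_module M\<^esub> iota (f c)) ps"
        by (rule lsum_cong_structure) simp_all
      finally show ?thesis .
    qed
    then show ?thesis using ps(1) unfolding rational_elem_def by (intro exI [of _ ps]) simp
  qed
  then show ?thesis using right_module_dual [OF M] by (simp add: rational_def)
qed

text \<open>Applying \<open>h\<close> to the left entries of a list for \<open>p\<close> gives a
  list for \<open>h p\<close>.\<close>

lemma rational_elem_image:
  assumes P: "right_module T P" and Q: "right_module T Q" and h: "linear_map T P Q h"
    and p: "p \<in> carrier P" "rational_elem P p"
  shows "rational_elem Q (h p)"
proof -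
  interpret P: right_module T P by (rule P)
  obtain ks where ks: "set ks \<subseteq> carrier P \<times> carrier C"
    "\<And>f. f \<in> carrier T \<Longrightarrow> p \<triangleleft>\<^bsub>P\<^esub> f = lsum P (\<lambda>(q, c). q \<triangleleft>\<^bsub>P\<^esub> iota (f c)) ks"
    using p by (auto simp: rational_elem_def)
  have "h p \<triangleleft>\<^bsub>Q\<^esub> f = lsum Q (\<lambda>(q, c). q \<triangleleft>\<^bsub>Q\<^esub> iota (f c)) (map (\<lambda>(q, c). (h q, c)) ks)"
    if f: "f \<in> carrier T" for f
  proof -
    have cl: "q \<in> carrier P" "c \<in> carrier C" "iota (f c) \<in> carrier T" if "(q, c) \<in> set ks" for q c
      using that ks(1) T_closed [OF f] by (auto intro!: iota_closed)
    have "h p \<triangleleft>\<^bsub>Q\<^esub> f = h (lsum P (\<lambda>(q, c). q \<triangleleft>\<^bsub>P\<^esub> iota (f c)) ks)"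
      using linear_map_smult [OF h f p(1)] ks(2) [OF f] by simp
    also have "\<dots> = lsum Q (\<lambda>k. h ((\<lambda>(q, c). q \<triangleleft>\<^bsub>P\<^esub> iota (f c)) k)) ks"
      by (rule add_hom_lsum [OF linear_map_additive [OF h]]) (use cl P.ract_closed in auto)
    also have "\<dots> = lsum Q (\<lambda>(q, c). q \<triangleleft>\<^bsub>Q\<^esub> iota (f c)) (map (\<lambda>(q, c). (h q, c)) ks)"
      unfolding lsum_map using cl by (intro lsum_cong) (auto simp: linear_map_smult [OF h])
    finally show ?thesis .
  qed
  moreover have "set (map (\<lambda>(q, c). (h q, c)) ks) \<subseteq> carrier Q \<times> carrier C"
    using ks(1) linear_map_closed [OF h] by auto
  ultimately show ?thesis unfolding rational_elem_def by blast
qed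

lemma rational_elem_add:
  assumes P: "right_module T P" and pq: "p \<in> carrier P" "q \<in> carrier P" "rational_elem P p" "rational_elem P q"
  shows "rational_elem P (p \<oplus>\<^bsub>P\<^esub> q)"
proof -
  interpret P: right_module T P by (rule P)
  let ?s = "\<lambda>f. lsum P (\<lambda>(q, c). q \<triangleleft>\<^bsub>P\<^esub> iota (f c))"
  obtain ks ls where ks: "set ks \<subseteq> carrier P \<times> carrier C" "\<And>f. f \<in> carrier T \<Longrightarrow> p \<triangleleft>\<^bsub>P\<^esub> f = ?s f ks"
    and ls: "set ls \<subseteq> carrier P \<times> carrier C" "\<And>f. f \<in> carrier T \<Longrightarrow> q \<triangleleft>\<^bsub>P\<^esub> f = ?s f ls"
    using pq by (auto simp: rational_elem_def)
  have "(p \<oplus>\<^bsub>P\<^esub> q) \<triangleleft>\<^bsub>P\<^esub> f = ?s f (ks @ ls)" if f: "f \<in> carrier T" for f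
  proof -
    have "?s f (ks @ ls) = ?s f ks \<oplus>\<^bsub>P\<^esub> ?s f ls"
      by (rule lsum_append [OF P.M.abelian_group_axioms])
         (use ks(1) ls(1) T_closed [OF f] in \<open>auto intro!: P.ract_closed iota_closed\<close>)
    then show ?thesis using f ks(2) ls(2) pq by (simp add: P.ract_l_distr)
  qed
  then show ?thesis using ks(1) ls(1) unfolding rational_elem_def by (intro exI [of _ "ks @ ls"]) auto
qed

lemma rational_elem_zero:
  assumes P: "right_module T P" shows "rational_elem P \<zero>\<^bsub>P\<^esub>"
proof -
  interpret P: right_module T P by (rule P)
  show ?thesis unfolding rational_elem_def by (intro exI [of _ "[]"]) (simp add: P.ract_zero_left)
qed

text \<open>Images of elements of \<open>W\<close> are rational, and so are sums of rational
  elements, by concatenation of their lists.\<close>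

lemma rational_if_generated:
  assumes W: "rational W" and P: "right_module T P" "carrier P \<subseteq> trace T W P"
  shows "rational P"
proof -
  have WM: "right_module T W" using W by (rule rational_right_module)
  have hc: "h w \<in> carrier P \<and> rational_elem P (h w)" if "h \<in> lin_hom T W P" "w \<in> carrier W" for h w
    using W that rational_elem_image [OF WM P(1) lin_hom_linear [OF that(1) right_module_group [OF WM]
        right_module_group [OF P(1)]] that(2)] lin_hom_closed [OF that]
    by (auto simp: rational_def)
  have "lsum P (\<lambda>(h, w). h w) ks \<in> carrier P \<and> rational_elem P (lsum P (\<lambda>(h, w). h w) ks)"
    if "set ks \<subseteq> lin_hom T W P \<times> carrier W" for ks
    using that
  proof (induction ks)
    case Nil
    then show ?case
      using rational_elem_zero [OF P(1)]
        abelian_monoid.zero_closed [OF abelian_group.axioms(1) [OF right_module_group [OF P(1)]]]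
      by simp
  next
    case (Cons k ks)
    moreover obtain h w where k: "k = (h, w)" by (cases k)
    moreover from Cons.prems k have "h w \<in> carrier P \<and> rational_elem P (h w)"
      using hc by simp
    moreover have "abelian_monoid P" using abelian_group.axioms(1) right_module_group [OF P(1)] by blast
    ultimately show ?case
      using rational_elem_add [OF P(1), of "h w" "lsum P (\<lambda>(h, w). h w) ks"]
        abelian_monoid.a_closed [of P "h w" "lsum P (\<lambda>(h, w). h w) ks"] by simp
  qed
  then show ?thesis using P by (auto simp: rational_def trace_def)
qed

lemma rational_surjective_image:
  assumes "rational P" "right_module T Q" "linear_map T P Q h" "carrier Q \<subseteq> h ` carrier P"
  shows "rational Q"
  using assms rational_elem_image [OF rational_right_module [OF assms(1)] assms(2,3)]
  by (auto simp: rational_def)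

lemma rational_direct_power:
  assumes "rational W" shows "rational (direct_power I W)"
proof -
  have W: "right_module T W" using assms by (rule rational_right_module)
  note gW = right_module_group [OF W]
  note P = direct_power_right_module [OF W, of I]
  have "w \<in> trace T W (direct_power I W)" if w: "w \<in> carrier (direct_power I W)" for w
  proof -
    obtain "is" where "is": "set is = {i \<in> I. w i \<noteq> \<zero>\<^bsub>W\<^esub>}" "distinct is"
      using w finite_distinct_list [of "{i \<in> I. w i \<noteq> \<zero>\<^bsub>W\<^esub>}"] by (auto simp: direct_power_simps [OF gW])
    have wc: "w i \<in> carrier W" if "i \<in> set is" for i
      using that w "is" by (auto simp: direct_power_simps [OF gW])
    have "w = lsum (direct_power I W) (\<lambda>i. power_single W I i (w i)) is"
      by (rule direct_power_lsum [OF gW w]) (use "is" in auto)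
    also have "\<dots> \<in> trace T W (direct_power I W)"
    proof (rule closed_submodule_lsum [OF trace_closed_submodule [OF W P]])
      fix i assume i: "i \<in> set is"
      then have "i \<in> I" using "is" by auto
      then have "restrict (power_single W I i) (carrier W) \<in> lin_hom T W (direct_power I W)"
        by (intro restrict_lin_hom linear_map_power_single W) (simp_all add: W)
      from lin_hom_image_trace [OF this wc [OF i] right_module_group [OF P]]
      show "power_single W I i (w i) \<in> trace T W (direct_power I W)" using wc [OF i] by simp
    qed
    finally show ?thesis .
  qed
  then show ?thesis by (intro rational_if_generated [OF assms P]) blast
qed

end

section \<open>Local dual bases\<close>

text \<open>The identity of \<open>W\<close> is lifted, on the span of \<open>S\<close>, through a
  free cover. The coordinates of the lift are linear functionals, and only finitely many of them are
  nonzero on \<open>S\<close>.\<close>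

lemma locally_projective_dual_basis:
  fixes W :: "('r, 'm, 'y) module_scheme"
  assumes lp: "locally_projective TYPE('u) R W"
    and u: "infinite (UNIV :: 'u set)" "carrier R \<lesssim> (UNIV :: 'u set)" "carrier W \<lesssim> (UNIV :: 'u set)"
    and S: "finite S" "S \<subseteq> carrier W"
  shows "\<exists>ks. set ks \<subseteq> lin_hom R W (left_regular R) \<times> carrier W \<and>
    (\<forall>s\<in>S. s = lsum W (\<lambda>(f, w). f s \<odot>\<^bsub>W\<^esub> w) ks)"
proof -
  have W: "left_module R W" using lp by (simp add: locally_projective_def)
  interpret W: left_module R W by (rule W)
  note reg = left_regular_module [OF W.R.ring_axioms]
  \<comment> \<open>The cover is free with one basis vector for each element of
    \<open>W\<close>.\<close>
  let ?A = "left_regular R" and ?I = "carrier W"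
  note gA = abelian_group_regular(1) [OF W.R.ring_axioms] and gW = W.M.abelian_group_axioms
  let ?L = "direct_power ?I ?A"
  have "right_module (op_ring R) ?L"
    by (rule direct_power_right_module) (simp add: right_module_op_ring reg)
  then have L: "left_module R ?L" by (simp add: right_module_op_ring)
  let ?\<pi> = "power_sum ?A ?I W (\<lambda>w r. r \<odot>\<^bsub>W\<^esub> w)"
  have lw: "linear_map R ?A W (\<lambda>r. r \<odot>\<^bsub>W\<^esub> w)" if "w \<in> carrier W" for w
    using that by (intro linear_mapI gA gW) (auto simp: W.lact_closed W.lact_l_distr W.lact_assoc)
  have "linear_map (op_ring R) ?L W ?\<pi>"
    by (rule linear_map_power_sum) (simp_all add: right_module_op_ring reg W lw)
  then have \<pi>: "linear_map R ?L W ?\<pi>" by simp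
  have single: "?\<pi> (power_single ?A ?I w r) = r \<odot>\<^bsub>W\<^esub> w" if "w \<in> carrier W" "r \<in> carrier R" for w r
    using power_sum_single [OF gA linear_map_additive [OF lw] gW] that by simp
  have "carrier ?L \<lesssim> (UNIV :: 'u set)"
    by (rule direct_power_lepoll [OF u(1,3) _ gA]) (simp add: u)
  then obtain hL :: "('m \<Rightarrow> 'r) \<Rightarrow> 'u" where hL: "inj_on hL (carrier ?L)" by (auto simp: lepoll_def)
  obtain h :: "'m \<Rightarrow> 'u" where h: "inj_on h (carrier W)" using u(3) by (auto simp: lepoll_def)
  \<comment> \<open>Local projectivity speaks of modules in the universe, so the cover and its
    target are transported; the map to be lifted becomes \<open>h\<close>, standing for the identity
    of \<open>W\<close>.\<close>
  let ?L' = "transport hL ?L" and ?N = "transport h W"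
  have L': "left_module R ?L'" and N: "left_module R ?N"
    by (rule left_module_transport [OF L hL], rule left_module_transport [OF W h])
  have hl: "linear_map R W ?N h" by (rule linear_map_transport [OF gW h])
  let ?hi = "inv_into (carrier ?L) hL"
  have hi: "linear_map R ?L' ?L ?hi" by (rule linear_map_transport_inv [OF _ hL]) (simp add: L)
  let ?p = "restrict (\<lambda>v. h (?\<pi> (?hi v))) (carrier ?L')"
  have p: "?p \<in> lin_hom R ?L' ?N"
    by (rule restrict_lin_hom [OF linear_map_comp [OF linear_map_comp [OF hi \<pi>] hl]]) (simp add: L')
  have g: "restrict h (carrier W) \<in> lin_hom R W ?N"
    by (rule restrict_lin_hom [OF hl]) (simp add: W)
  have surj: "?p ` carrier ?L' = carrier ?N"
  proof (rule equalityI)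
    show "?p ` carrier ?L' \<subseteq> carrier ?N" using p by (auto simp: lin_hom_def)
    show "carrier ?N \<subseteq> ?p ` carrier ?L'"
    proof
      fix v assume "v \<in> carrier ?N"
      then obtain w where w: "w \<in> carrier W" "v = h w" by auto
      let ?s = "power_single ?A ?I w \<one>\<^bsub>R\<^esub>"
      have s: "?s \<in> carrier ?L" using power_single_closed [OF gA w(1)] by simp
      then have "?p (hL ?s) = h (\<one>\<^bsub>R\<^esub> \<odot>\<^bsub>W\<^esub> w)"
        using single [OF w(1) W.R.one_closed] inv_into_f_f [OF hL s] by simp
      then have "v = ?p (hL ?s)" using w by (simp add: W.lact_one)
      then show "v \<in> ?p ` carrier ?L'" using s by (intro image_eqI [of _ _ "hL ?s"]) auto
    qed
  qed
  obtain g' where g': "g' \<in> lin_hom R W ?L'"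
    and lift: "\<forall>w\<in>Defs.span R W S. ?p (g' w) = restrict h (carrier W) w"
    using lp p g surj L' N S unfolding locally_projective_def by blast
  have spanI: "s \<in> Defs.span R W S" if "s \<in> S" for s using that by (auto simp: Defs.span_def)
  define k where "k w = ?hi (g' w)" for w
  have k: "linear_map R W ?L k"
    unfolding k_def by (rule linear_map_comp [OF lin_hom_linear [OF g' gW left_module_group [OF L']] hi])
  have kS: "?\<pi> (k s) = s" if s: "s \<in> S" for s
  proof -
    have sW: "s \<in> carrier W" using s S by auto
    then have "g' s \<in> carrier ?L'" using g' by (auto simp: lin_hom_def)
    then have "h (?\<pi> (k s)) = h s" using bspec [OF lift spanI [OF s]] sW by (simp add: k_def)
    then show ?thesis
      using h sW linear_map_closed [OF \<pi> linear_map_closed [OF k sW]] by (auto dest: inj_onD)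
  qed
  \<comment> \<open>The finite union of the supports of the lifted elements of
    \<open>S\<close>.\<close>
  define J where "J = (\<Union>s\<in>S. {i \<in> ?I. k s i \<noteq> \<zero>\<^bsub>R\<^esub>})"
  have ks: "k s \<in> carrier ?L" if "s \<in> carrier W" for s by (rule linear_map_closed [OF k that])
  have kc: "k s i \<in> carrier R" if "s \<in> carrier W" "i \<in> ?I" for s i
    using ks [OF that(1)] that(2) by (auto simp: direct_power_simps [OF gA])
  have "finite {i \<in> ?I. k s i \<noteq> \<zero>\<^bsub>R\<^esub>}" if "s \<in> S" for s
    using ks [of s] that S by (auto simp: direct_power_simps [OF gA])
  then have "finite J" using S by (auto simp: J_def)
  then obtain ws where ws: "set ws = J" "distinct ws" using finite_distinct_list by blast
  have wsW: "set ws \<subseteq> carrier W" using ws by (auto simp: J_def)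
  define co where "co w = restrict (\<lambda>s. k s w) (carrier W)" for w
  have co: "co w \<in> lin_hom R W ?A" if w: "w \<in> carrier W" for w
  proof -
    have "linear_map R W ?A (\<lambda>s. k s w)"
    proof (rule linear_mapI [OF gW gA])
      fix m n assume mn: "m \<in> carrier W" "n \<in> carrier W"
      show "k (m \<oplus>\<^bsub>W\<^esub> n) w = k m w \<oplus>\<^bsub>?A\<^esub> k n w"
        using linear_map_add [OF k mn] w by (simp add: direct_power_simps [OF gA])
    next
      fix r m assume rm: "r \<in> carrier R" "m \<in> carrier W"
      show "k (r \<odot>\<^bsub>W\<^esub> m) w = r \<odot>\<^bsub>?A\<^esub> k m w"
        using linear_map_smult [OF k rm] w by (simp add: direct_power_simps [OF gA])
    qed (use kc w in simp)
    then show ?thesis unfolding co_def by (rule restrict_lin_hom) (simp add: W)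
  qed
  have "s = lsum W (\<lambda>(f, w). f s \<odot>\<^bsub>W\<^esub> w) (map (\<lambda>w. (co w, w)) ws)" if s: "s \<in> S" for s
  proof -
    have sW: "s \<in> carrier W" using s S by auto
    have "{i \<in> ?I. k s i \<noteq> \<zero>\<^bsub>?A\<^esub>} \<subseteq> set ws" unfolding ws J_def using s by auto
    note exp = direct_power_lsum [OF gA ks [OF sW] ws(2) wsW this]
    have "s = ?\<pi> (lsum ?L (\<lambda>i. power_single ?A ?I i (k s i)) ws)"
      by (rule trans [OF kS [OF s, symmetric] arg_cong [where f = ?\<pi>, OF exp]])
    also have "\<dots> = lsum W (\<lambda>i. ?\<pi> (power_single ?A ?I i (k s i))) ws"
      by (rule add_hom_lsum [OF linear_map_additive [OF \<pi>]])
         (use wsW kc [OF sW] in \<open>auto intro!: power_single_closed [OF gA] simp del: direct_power_simps\<close>)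
    also have "\<dots> = lsum W (\<lambda>(f, w). f s \<odot>\<^bsub>W\<^esub> w) (map (\<lambda>w. (co w, w)) ws)"
      unfolding lsum_map using wsW kc [OF sW] sW by (intro lsum_cong) (auto simp: single co_def)
    finally show ?thesis .
  qed
  moreover have "set (map (\<lambda>w. (co w, w)) ws) \<subseteq> lin_hom R W ?A \<times> carrier W"
    using co wsW by auto
  ultimately show ?thesis by blast
qed

text \<open>Local projectivity in the form in which the argument uses it: finite sums only, with no
  mention of a universe.\<close>

locale dual_basis_coring = coring A C for A :: "('a, 'x) ring_scheme" (structure) and C :: "('a, 'c) coring" +
  assumes dual_basis: "\<lbrakk>finite S; S \<subseteq> carrier C\<rbrakk> \<Longrightarrow> \<exists>ks. set ks \<subseteq> lin_hom A C (left_regular A) \<times> carrier C \<and>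
      (\<forall>s\<in>S. s = lsum C (\<lambda>(f, c). f s \<odot>\<^bsub>C\<^esub> c) ks)"
begin

lemma dual_basis_T:
  "\<lbrakk>finite S; S \<subseteq> carrier C\<rbrakk> \<Longrightarrow> \<exists>ks. set ks \<subseteq> carrier T \<times> carrier C \<and>
      (\<forall>s\<in>S. s = lsum C (\<lambda>(f, c). f s \<bullet> c) ks)"
  using dual_basis by (simp add: T_carrier)

lemma tensor_C_eqI:
  assumes "right_module A M" "s \<in> carrier (tensor A M C)" "t \<in> carrier (tensor A M C)"
    and "\<And>f. f \<in> carrier T \<Longrightarrow> eval_functional M f s = eval_functional M f t"
  shows "s = t"
proof -
  interpret M: tensor_product A M C by (rule tensor_product_C) fact
  show ?thesis
    by (rule M.functionals_separate [OF T_linear dual_basis_T assms(2,3)]) (use assms(4) in auto)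
qed

text \<open>A dual basis for the set \<open>{c, d}\<close> expands both elements, with coefficients
  that agree by assumption.\<close>

lemma coring_eqI:
  assumes "c \<in> carrier C" "d \<in> carrier C" "\<And>f. f \<in> carrier T \<Longrightarrow> f c = f d"
  shows "c = d"
proof -
  obtain ks where ks: "set ks \<subseteq> carrier T \<times> carrier C"
    "\<forall>s\<in>{c, d}. s = lsum C (\<lambda>(f, c). f s \<bullet> c) ks"
    using dual_basis_T [of "{c, d}"] assms(1,2) by auto
  have "c = lsum C (\<lambda>(f, e). f c \<bullet> e) ks" using ks(2) by simp
  also have "\<dots> = lsum C (\<lambda>(f, e). f d \<bullet> e) ks"
  proof (rule lsum_cong)
    fix k assume "k \<in> set ks"
    then have "fst k \<in> carrier T" using ks(1) by auto
    from assms(3) [OF this] show "(\<lambda>(f, e). f c \<bullet> e) k = (\<lambda>(f, e). f d \<bullet> e) k"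
      by (simp add: case_prod_beta)
  qed
  also have "\<dots> = d" using ks(2) by simp
  finally show ?thesis .
qed

text \<open>A dual basis of \<open>C \<otimes> C\<close> is obtained by first expanding right factors, then left factors.\<close>

lemma dual_basis_CC:
  assumes S: "finite S" "S \<subseteq> carrier CC"
  shows "\<exists>ks. set ks \<subseteq> (\<lambda>(f, g). pair_functional f g) ` (carrier T \<times> carrier T) \<times> carrier CC \<and>
      (\<forall>s\<in>S. s = lsum CC (\<lambda>(f, u). f s \<odot>\<^bsub>CC\<^esub> u) ks)"
proof -
  let ?t = "tens A (rmod C) C" and ?G = "tensor A (rmod C) C" and ?ev = "eval_functional (rmod C)"
  have SG: "S \<subseteq> carrier ?G" using S(2) by simp
  have "\<exists>ks. set ks \<subseteq> carrier T \<times> carrier C \<and> (\<forall>s\<in>S. s = lsum ?G (\<lambda>(f, e). ?t (?ev f s) e) ks)"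
    by (rule CC.dual_basis_expansion [OF T_linear dual_basis_T S(1) SG])
  then obtain ks where ks: "set ks \<subseteq> carrier T \<times> carrier C"
    and ks': "\<forall>s\<in>S. s = lsum ?G (\<lambda>(f, e). ?t (?ev f s) e) ks" by (elim exE conjE) (rule that)
  have fk: "fst k \<in> carrier T" "snd k \<in> carrier C" if "k \<in> set ks" for k using that ks by auto
  have ev: "?ev (fst k) s \<in> carrier C" if "s \<in> S" "k \<in> set ks" for s k
    using add_hom_closed [OF CC.eval_additive [OF T_linear [OF fk(1) [OF that(2)]]] subsetD [OF SG that(1)]] by simp
  \<comment> \<open>The left factors that remain after the first expansion; one dual basis serves
    all of them.\<close>
  define D where "D = (\<lambda>(s, k). ?ev (fst k) s) ` (S \<times> set ks)"
  have D: "finite D" "D \<subseteq> carrier C" using S(1) ev by (auto simp: D_def)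
  obtain ls where ls: "set ls \<subseteq> carrier T \<times> carrier C"
    and ls': "\<And>d. d \<in> D \<Longrightarrow> d = lsum C (\<lambda>(g, e). g d \<bullet> e) ls"
    using dual_basis_T [OF D] by blast
  have fl: "fst l \<in> carrier T" "snd l \<in> carrier C" if "l \<in> set ls" for l using that ls by auto
  let ?u = "\<lambda>k l. (pair_functional (fst k) (fst l), ?t (snd l) (snd k))"
  let ?ks = "concat (map (\<lambda>k. map (?u k) ls) ks)" and ?F = "\<lambda>s (f, u). f s \<odot>\<^bsub>CC\<^esub> u"
  have split: "?t (?ev (fst k) s) (snd k) = lsum ?G (\<lambda>l. ?F s (?u k l)) ls" and Fc: "\<And>l. l \<in> set ls \<Longrightarrow> ?F s (?u k l) \<in> carrier ?G"
    if s: "s \<in> S" and k: "k \<in> set ks" for s k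
  proof -
    let ?d = "?ev (fst k) s"
    have "?d \<in> D" unfolding D_def by (rule image_eqI [of _ _ "(s, k)"]) (use s k in simp_all)
    then have d: "?d = lsum C (\<lambda>(g, e). g ?d \<bullet> e) ls" by (rule ls')
    have gd: "fst l ?d \<in> carrier A" if "l \<in> set ls" for l by (rule T_closed [OF fl(1) [OF that] ev [OF s k]])
    have F: "?t (fst l ?d \<bullet> snd l) (snd k) = ?F s (?u k l)" if "l \<in> set ls" for l
      using CC_smult [OF gd [OF that] fl(2) [OF that] fk(2) [OF k]]
        pair_functional_eval [OF fk(1) [OF k] fl(1) [OF that] subsetD [OF SG s]] by simp
    have "add_hom C ?G (\<lambda>c. ?t c (snd k))"
      using fk [OF k] CC.tens_add_left by (auto simp: add_hom_def CC.abelian_group_tensor L.M.abelian_group_axioms)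
    then have "?t (lsum C (\<lambda>(g, e). g ?d \<bullet> e) ls) (snd k) = lsum ?G (\<lambda>l. ?t ((\<lambda>(g, e). g ?d \<bullet> e) l) (snd k)) ls"
      by (rule add_hom_lsum [where h = "\<lambda>c. ?t c (snd k)"]) (use gd fl in \<open>simp add: case_prod_beta L.lact_closed\<close>)
    also have "\<dots> = lsum ?G (\<lambda>l. ?F s (?u k l)) ls"
      by (rule lsum_cong) (use F in \<open>simp add: case_prod_beta\<close>)
    finally show "?t ?d (snd k) = lsum ?G (\<lambda>l. ?F s (?u k l)) ls" unfolding d [symmetric] .
    show "?F s (?u k l) \<in> carrier ?G" if "l \<in> set ls" for l
      unfolding F [OF that, symmetric] using gd [OF that] fl [OF that] fk [OF k] by (simp add: L.lact_closed)
  qed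
  have "s = lsum CC (?F s) ?ks" if s: "s \<in> S" for s
  proof -
    have "s = lsum ?G (\<lambda>k. ?t (?ev (fst k) s) (snd k)) ks" by (rule bspec [OF ks' s, unfolded case_prod_unfold])
    also have "\<dots> = lsum ?G (\<lambda>k. lsum ?G (?F s) (map (?u k) ls)) ks"
      unfolding lsum_map by (rule lsum_cong) (rule split [OF s])
    also have "\<dots> = lsum ?G (?F s) ?ks"
      by (subst lsum_concat [OF CC.abelian_group_tensor]) (use Fc [OF s] in \<open>auto simp: lsum_map\<close>)
    also have "\<dots> = lsum CC (?F s) ?ks" by (rule lsum_cong_structure) simp_all
    finally show ?thesis .
  qed
  moreover have "set ?ks \<subseteq> (\<lambda>(f, g). pair_functional f g) ` (carrier T \<times> carrier T) \<times> carrier CC"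
    using fk fl by auto
  ultimately show ?thesis by blast
qed

text \<open>The action on \<open>j p\<close> is described by an element \<open>u\<close> of
  \<open>Q \<otimes> C\<close>. A local dual basis expands \<open>u\<close> with left factors
  \<open>(j p) g = j (p g)\<close>, so \<open>u\<close> comes from \<open>P \<otimes> C\<close>, and
  injectivity reflects the identity back to \<open>P\<close>. This is how rationality passes to
  submodules.\<close>

lemma rational_injective:
  assumes P: "right_module T P" and Q: "rational Q" and j: "linear_map T P Q j" "inj_on j (carrier P)"
  shows "rational P"
proof -
  interpret P: right_module T P by (rule P)
  interpret Q: right_module T Q using Q by (rule rational_right_module)
  let ?B = "base_module Q"
  interpret BC: tensor_product A ?B C by (rule tensor_product_C [OF right_module_base [OF Q.right_module_axioms]])
  have "rational_elem P p" if p: "p \<in> carrier P" for p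
  proof -
    have jp: "j p \<in> carrier Q" using linear_map_closed [OF j(1) p] .
    then obtain ks where ks: "set ks \<subseteq> carrier Q \<times> carrier C"
      and act: "\<And>f. f \<in> carrier T \<Longrightarrow> j p \<triangleleft>\<^bsub>Q\<^esub> f = lsum Q (\<lambda>(q, c). q \<triangleleft>\<^bsub>Q\<^esub> iota (f c)) ks"
      using Q by (auto simp: rational_def rational_elem_def)
    define u where "u = lsum (tensor A ?B C) (\<lambda>(q, c). tens A ?B C q c) ks"
    have u: "{u} \<subseteq> carrier (tensor A ?B C)" unfolding u_def using ks by (simp add: BC.tens_lsum_closed)
    have ev: "eval_functional ?B f u = j p \<triangleleft>\<^bsub>Q\<^esub> f" if f: "f \<in> carrier T" for f
      unfolding u_def using BC.eval_list [OF T_linear [OF f], of ks] ks act [OF f] by (simp add: lsum_cong_structure [of ?B Q])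
    have "\<exists>bs. set bs \<subseteq> carrier T \<times> carrier C \<and>
        (\<forall>t\<in>{u}. t = lsum (tensor A ?B C) (\<lambda>(g, e). tens A ?B C (eval_functional ?B g t) e) bs)"
      by (rule BC.dual_basis_expansion [OF T_linear dual_basis_T _ u]) simp_all
    then obtain bs where bs: "set bs \<subseteq> carrier T \<times> carrier C"
      and ub: "u = lsum (tensor A ?B C) (\<lambda>(g, e). tens A ?B C (eval_functional ?B g u) e) bs"
      by (elim exE conjE) (rule that, assumption, erule bspec, rule singletonI)
    have g: "fst b \<in> carrier T" "snd b \<in> carrier C" if "b \<in> set bs" for b using that bs by auto
    let ?js = "map (\<lambda>b. (j p \<triangleleft>\<^bsub>Q\<^esub> fst b, snd b)) bs" and ?ls = "map (\<lambda>b. (p \<triangleleft>\<^bsub>P\<^esub> fst b, snd b)) bs"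
    have js: "set ?js \<subseteq> carrier ?B \<times> carrier C" using g jp by (auto simp: Q.ract_closed)
    have "lsum (tensor A ?B C) (\<lambda>(g, e). tens A ?B C (eval_functional ?B g u) e) bs
        = lsum (tensor A ?B C) (\<lambda>(q, c). tens A ?B C q c) ?js"
      unfolding lsum_map by (rule lsum_cong) (use g ev in \<open>simp add: case_prod_beta\<close>)
    note uj = trans [OF ub this]
    have "p \<triangleleft>\<^bsub>P\<^esub> f = lsum P (\<lambda>(q, c). q \<triangleleft>\<^bsub>P\<^esub> iota (f c)) ?ls" if f: "f \<in> carrier T" for f
    proof (rule inj_onD [OF j(2)])
      have fe: "f (snd b) \<in> carrier A" if "b \<in> set bs" for b using T_closed [OF f] g that by blast
      have "j (p \<triangleleft>\<^bsub>P\<^esub> f) = eval_functional ?B f u" using linear_map_smult [OF j(1) f p] ev [OF f] by simp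
      also have "\<dots> = lsum Q (\<lambda>(q, c). q \<triangleleft>\<^bsub>Q\<^esub> iota (f c)) ?js"
        unfolding uj BC.eval_list [OF T_linear [OF f] js] by (simp add: lsum_cong_structure [of ?B Q])
      also have "\<dots> = lsum Q (\<lambda>b. j (p \<triangleleft>\<^bsub>P\<^esub> fst b \<triangleleft>\<^bsub>P\<^esub> iota (f (snd b)))) bs"
        unfolding lsum_map using g fe p
        by (intro lsum_cong) (simp add: linear_map_smult [OF j(1)] P.ract_closed iota_closed)
      also have "\<dots> = j (lsum P (\<lambda>b. p \<triangleleft>\<^bsub>P\<^esub> fst b \<triangleleft>\<^bsub>P\<^esub> iota (f (snd b))) bs)"
        by (rule add_hom_lsum [OF linear_map_additive [OF j(1)], symmetric])
           (use g fe p in \<open>simp add: P.ract_closed iota_closed\<close>)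
      finally show "j (p \<triangleleft>\<^bsub>P\<^esub> f) = j (lsum P (\<lambda>(q, c). q \<triangleleft>\<^bsub>P\<^esub> iota (f c)) ?ls)"
        by (simp add: lsum_map)
      show "p \<triangleleft>\<^bsub>P\<^esub> f \<in> carrier P" using p f by (rule P.ract_closed [rotated])
      show "lsum P (\<lambda>(q, c). q \<triangleleft>\<^bsub>P\<^esub> iota (f c)) ?ls \<in> carrier P"
        using g fe p by (intro lsum_closed P.M.abelian_group_axioms) (auto simp: P.ract_closed iota_closed)
    qed
    moreover have "set ?ls \<subseteq> carrier P \<times> carrier C" using g p by (auto simp: P.ract_closed)
    ultimately show ?thesis unfolding rational_elem_def by blast
  qed
  then show ?thesis using P by (simp add: rational_def)
qed

text \<open>
  The coaction of \<open>p\<close> is the unique element \<open>\<Sum> p\<^sub>i \<otimes> c\<^sub>i\<close> with \<open>p f = \<Sum> p\<^sub>i f(c\<^sub>i)\<close> for all functionals \<open>f\<close>.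
\<close>

lemma rational_comodule:
  fixes P :: "('c \<Rightarrow> 'a, 'p, 'y) module_scheme"
  assumes P: "rational P"
  obtains M :: "('a, 'c, 'p) comodule" where "comodule A C M" "carrier M = carrier P" "\<zero>\<^bsub>M\<^esub> = \<zero>\<^bsub>P\<^esub>" "add M = add P"
    "\<And>f p. \<lbrakk>f \<in> carrier T; p \<in> carrier P\<rbrakk> \<Longrightarrow> p \<triangleleft>\<^bsub>dual_module M\<^esub> f = p \<triangleleft>\<^bsub>P\<^esub> f"
proof -
  have PT: "right_module T P" by (rule rational_right_module [OF P])
  interpret P: right_module T P by (rule PT)
  let ?B = "base_module P"
  have B: "right_module A ?B" by (rule right_module_base [OF PT])
  interpret B: tensor_product A ?B C by (rule tensor_product_C [OF B])
  let ?G = "tensor A ?B C"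
  note ev = B.eval_additive [OF T_linear]
  have "\<exists>t\<in>carrier ?G. \<forall>f\<in>carrier T. eval_functional ?B f t = p \<triangleleft>\<^bsub>P\<^esub> f" if p: "p \<in> carrier P" for p
  proof -
    obtain ks where ks: "set ks \<subseteq> carrier P \<times> carrier C"
      and act: "\<And>f. f \<in> carrier T \<Longrightarrow> p \<triangleleft>\<^bsub>P\<^esub> f = lsum P (\<lambda>(q, c). q \<triangleleft>\<^bsub>P\<^esub> iota (f c)) ks"
      using P p by (auto simp: rational_def rational_elem_def)
    have ks': "set ks \<subseteq> carrier ?B \<times> carrier C" using ks by simp
    let ?t = "lsum ?G (\<lambda>(q, c). tens A ?B C q c) ks"
    have "eval_functional ?B f ?t = p \<triangleleft>\<^bsub>P\<^esub> f" if f: "f \<in> carrier T" for f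
    proof -
      have "lsum ?B (\<lambda>(q, c). q \<triangleleft>\<^bsub>P\<^esub> iota (f c)) ks = lsum P (\<lambda>(q, c). q \<triangleleft>\<^bsub>P\<^esub> iota (f c)) ks"
        by (rule lsum_cong_structure) simp_all
      then show ?thesis using B.eval_list [OF T_linear [OF f] ks'] act [OF f] by simp
    qed
    moreover have "?t \<in> carrier ?G" using ks' by (intro lsum_closed B.abelian_group_tensor) auto
    ultimately show ?thesis by blast
  qed
  then obtain \<rho> where \<rho>c: "\<And>p. p \<in> carrier P \<Longrightarrow> \<rho> p \<in> carrier ?G"
    and \<rho>e: "\<And>p f. \<lbrakk>p \<in> carrier P; f \<in> carrier T\<rbrakk> \<Longrightarrow> eval_functional ?B f (\<rho> p) = p \<triangleleft>\<^bsub>P\<^esub> f" by metis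
  \<comment> \<open>Uniqueness of the element that belongs to \<open>p\<close>; it forces the chosen
    \<open>\<rho>\<close> to be linear.\<close>
  have ext: "s = t" if "s \<in> carrier ?G" "t \<in> carrier ?G"
    "\<And>f. f \<in> carrier T \<Longrightarrow> eval_functional ?B f s = eval_functional ?B f t" for s t
    by (rule tensor_C_eqI [OF B that])
  have \<rho>: "linear_map A ?B (tensor_C A C ?B) \<rho>"
  proof (rule linear_mapI [OF B.M.M.abelian_group_axioms right_module_group [OF right_module_tensor_C [OF B]]])
    interpret G: abelian_group ?G by (rule B.abelian_group_tensor)
    fix p q assume pq: "p \<in> carrier ?B" "q \<in> carrier ?B"
    have "\<rho> (p \<oplus>\<^bsub>P\<^esub> q) = \<rho> p \<oplus>\<^bsub>?G\<^esub> \<rho> q"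
      using pq by (intro ext) (simp_all add: \<rho>c \<rho>e add_hom_add [OF ev] P.ract_l_distr)
    then show "\<rho> (p \<oplus>\<^bsub>?B\<^esub> q) = \<rho> p \<oplus>\<^bsub>tensor_C A C ?B\<^esub> \<rho> q" by simp
  next
    fix a p assume a: "a \<in> carrier A" and "p \<in> carrier ?B"
    then have p: "p \<in> carrier P" by simp
    have tc: "\<rho> p \<triangleleft>\<^bsub>tensor_C A C ?B\<^esub> a \<in> carrier ?G"
      using add_hom_closed [OF tensor_C_act_additive [OF B a] \<rho>c [OF p]] .
    \<comment> \<open>The functional \<open>c \<mapsto> f(c a)\<close> is the product of
      \<open>iota a\<close> and \<open>f\<close>, so linearity of \<open>\<rho>\<close> over
      \<open>A\<close> is an instance of the module law.\<close>
    have "eval_functional ?B f (t \<triangleleft>\<^bsub>tensor_C A C ?B\<^esub> a) = eval_functional ?B (iota a \<otimes>\<^bsub>T\<^esub> f) t"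
      if f: "f \<in> carrier T" and t: "t \<in> carrier ?G" for f t
    proof (rule B.add_hom_tensor_eq [OF add_hom_comp [OF tensor_C_act_additive [OF B a] ev [OF f]] ev _ t])
      show af: "iota a \<otimes>\<^bsub>T\<^esub> f \<in> carrier T" using a f by (simp add: iota_closed)
      fix q c assume qc: "q \<in> carrier ?B" "c \<in> carrier C"
      then show "eval_functional ?B f (tens A ?B C q c \<triangleleft>\<^bsub>tensor_C A C ?B\<^esub> a)
          = eval_functional ?B (iota a \<otimes>\<^bsub>T\<^esub> f) (tens A ?B C q c)"
        using a f by (simp add: tensor_C_smult [OF B] B.eval_tens [OF T_linear [OF f]]
            B.eval_tens [OF T_linear [OF af]] iota_mult ractC_closed)
    qed
    then have "eval_functional ?B f (\<rho> (p \<triangleleft>\<^bsub>P\<^esub> iota a)) = eval_functional ?B f (\<rho> p \<triangleleft>\<^bsub>tensor_C A C ?B\<^esub> a)"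
      if "f \<in> carrier T" for f
      using that a p by (simp add: \<rho>e \<rho>c P.ract_closed iota_closed P.ract_assoc)
    then have "\<rho> (p \<triangleleft>\<^bsub>P\<^esub> iota a) = \<rho> p \<triangleleft>\<^bsub>tensor_C A C ?B\<^esub> a"
      using p a tc by (intro ext) (simp_all add: \<rho>c P.ract_closed iota_closed)
    then show "\<rho> (p \<triangleleft>\<^bsub>?B\<^esub> a) = \<rho> p \<triangleleft>\<^bsub>tensor_C A C ?B\<^esub> a" by simp
  qed (simp add: \<rho>c)
  interpret BCC: tensor_product A ?B CC by (rule tensor_productI [OF B left_module_CC])
  have coassoc: "coassociative A C ?B \<rho>"
    unfolding coassociative_def
  proof
    fix p assume p: "p \<in> carrier ?B"
    show "tensor_assoc A C ?B (tensor_map A (tensor_C A C ?B) C \<rho> (\<rho> p))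
      = tensor_lift (tensor A ?B CC) (\<lambda>m\<^sub>0 m\<^sub>1. tens A ?B CC m\<^sub>0 (comult C m\<^sub>1)) (\<rho> p)"
    \<comment> \<open>Under the functional given by \<open>f\<close> and \<open>g\<close> the two
      sides become \<open>(p f) g\<close> and \<open>p (f g)\<close>, which agree in a
      module.\<close>
    proof (rule BCC.functionals_separate [OF _ dual_basis_CC coassoc_left_closed(1) [OF B \<rho> p] coassoc_left_closed(2) [OF B \<rho> p]])
      show "linear_map A CC LA f" if "f \<in> (\<lambda>(f, g). pair_functional f g) ` (carrier T \<times> carrier T)" for f
        using that pair_linear by auto
      fix h assume "h \<in> (\<lambda>(f, g). pair_functional f g) ` (carrier T \<times> carrier T)"
      then obtain f g where fg: "h = pair_functional f g" "f \<in> carrier T" "g \<in> carrier T" by auto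
      show "eval_functional ?B h (tensor_assoc A C ?B (tensor_map A (tensor_C A C ?B) C \<rho> (\<rho> p)))
        = eval_functional ?B h (tensor_lift (tensor A ?B CC) (\<lambda>m\<^sub>0 m\<^sub>1. tens A ?B CC m\<^sub>0 (comult C m\<^sub>1)) (\<rho> p))"
        unfolding fg(1) eval_coassoc_left [OF B \<rho> fg(2,3) p] eval_coassoc_right [OF B \<rho> fg(2,3) p]
        using p fg(2,3) by (simp add: \<rho>e P.ract_closed P.ract_assoc)
    qed
  qed
  let ?M = "with_coact ?B \<rho>"
  have M: "comodule A C ?M"
  proof (rule comodule.intro)
    show "right_module A ?M" by (rule right_module_with_coact [OF B])
    have "restrict \<rho> (carrier ?B) \<in> lin_hom A ?B (tensor_C A C ?B)"
      by (rule restrict_lin_hom [OF \<rho>]) (simp add: B)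
    then show "restrict (coact ?M) (carrier ?M) \<in> lin_hom A ?M (tensor_C A C ?M)"
      by (simp add: lin_hom_def)
    show "coassociative A C ?M (coact ?M)" using coassoc by simp
    fix p assume "p \<in> carrier ?M"
    then have p: "p \<in> carrier P" by simp
    have "eval_functional ?B (counit C) (\<rho> p) = eval_functional ?B \<one>\<^bsub>T\<^esub> (\<rho> p)"
      by (rule eval_functional_cong [OF B T_linear [OF T_one_closed] _ \<rho>c [OF p]]) (simp add: T_one)
    then show "tensor_lift ?M (\<lambda>m\<^sub>0 m\<^sub>1. m\<^sub>0 \<triangleleft>\<^bsub>?M\<^esub> counit C m\<^sub>1) (coact ?M p) = p"
      using \<rho>e [OF p T_one_closed] P.ract_one [OF p] by (simp add: eval_functional_def)
  qed
  show thesis by (rule that [OF M]) (simp_all add: \<rho>e)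
qed

text \<open>The colinearity equation lives in \<open>N \<otimes> C\<close>, where functionals
  decide; evaluated under \<open>g\<close> it says that \<open>f\<close> commutes with the action of
  \<open>g\<close>. Linearity over \<open>A\<close> is the case of the elements
  \<open>iota a\<close>.\<close>

lemma colin_hom_eq_lin_hom:
  assumes M: "comodule A C M" and N: "comodule A C N"
  shows "colin_hom A C M N = lin_hom T (dual_module M) (dual_module N)"
proof -
  interpret M: comodule A C M by (rule M)
  interpret N: comodule A C N by (rule N)
  interpret MC: tensor_product A M C by (rule tensor_product_C [OF M.right])
  interpret NC: tensor_product A N C by (rule tensor_product_C [OF N.right])
  note gM = MC.M.M.abelian_group_axioms and gN = NC.M.M.abelian_group_axioms
  note dM = right_module_dual [OF M] and dN = right_module_dual [OF N]
  have ev: "eval_functional N g (tensor_map A N C f t) = f (eval_functional M g t)"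
    if f: "linear_map A M N f" and g: "g \<in> carrier T" and t: "t \<in> carrier (tensor A M C)" for f g t
  proof (rule MC.add_hom_tensor_eq [OF
        add_hom_comp [OF tensor_map_additive [OF M.right N.right left f] NC.eval_additive [OF T_linear [OF g]]]
        add_hom_comp [OF MC.eval_additive [OF T_linear [OF g]] linear_map_additive [OF f]] _ t])
    fix m c assume mc: "m \<in> carrier M" "c \<in> carrier C"
    then show "eval_functional N g (tensor_map A N C f (tens A M C m c)) = f (eval_functional M g (tens A M C m c))"
      using linear_map_closed [OF f] T_closed [OF g]
      by (simp add: tensor_map_tens [OF M.right N.right left f] NC.eval_tens [OF T_linear [OF g]]
          MC.eval_tens [OF T_linear [OF g]] linear_map_smult [OF f])
  qed
  have "f \<in> colin_hom A C M N \<longleftrightarrow> f \<in> lin_hom T (dual_module M) (dual_module N)" for f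
  proof
    assume f: "f \<in> colin_hom A C M N"
    then have lf: "linear_map A M N f" and ex: "f \<in> extensional (carrier M)"
      using lin_hom_iff [OF gM gN] by (auto simp: colin_hom_def)
    have "linear_map T (dual_module M) (dual_module N) f"
    proof (rule linear_mapI [OF right_module_group [OF dM] right_module_group [OF dN]])
      fix g m assume g: "g \<in> carrier T" and "m \<in> carrier (dual_module M)"
      then have m: "m \<in> carrier M" by simp
      have "coact N (f m) = tensor_map A N C f (coact M m)" using f m by (simp add: colin_hom_def)
      then show "f (m \<triangleleft>\<^bsub>dual_module M\<^esub> g) = f m \<triangleleft>\<^bsub>dual_module N\<^esub> g"
        using ev [OF lf g coact_closed [OF M m]] by simp
    qed (use linear_map_closed [OF lf] linear_map_add [OF lf] in simp_all)
    then show "f \<in> lin_hom T (dual_module M) (dual_module N)"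
      unfolding lin_hom_iff [OF right_module_group [OF dM] right_module_group [OF dN]] using ex by simp
  next
    assume f: "f \<in> lin_hom T (dual_module M) (dual_module N)"
    then have tf: "linear_map T (dual_module M) (dual_module N) f" and ex: "f \<in> extensional (carrier M)"
      unfolding lin_hom_iff [OF right_module_group [OF dM] right_module_group [OF dN]] by simp_all
    have fc: "f m \<in> carrier N" if "m \<in> carrier M" for m using linear_map_closed [OF tf, of m] that by simp
    have lf: "linear_map A M N f"
    proof (rule linear_mapI [OF gM gN])
      fix m n assume "m \<in> carrier M" "n \<in> carrier M"
      then show "f (m \<oplus>\<^bsub>M\<^esub> n) = f m \<oplus>\<^bsub>N\<^esub> f n"
        using linear_map_add [OF tf] by simp
    next
      fix a m assume am: "a \<in> carrier A" "m \<in> carrier M"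
      then have "f (m \<triangleleft>\<^bsub>dual_module M\<^esub> iota a) = f m \<triangleleft>\<^bsub>dual_module N\<^esub> iota a"
        using linear_map_smult [OF tf iota_closed [OF am(1)]] by simp
      then show "f (m \<triangleleft>\<^bsub>M\<^esub> a) = f m \<triangleleft>\<^bsub>N\<^esub> a"
        using am fc by (simp only: comodule_act_iota [OF M] comodule_act_iota [OF N])
    qed (use fc in simp)
    have "coact N (f m) = tensor_map A N C f (coact M m)" if m: "m \<in> carrier M" for m
    proof (rule tensor_C_eqI [OF N.right coact_closed [OF N fc [OF m]]
          tensor_map_closed [OF M.right N.right left lf coact_closed [OF M m]]])
      fix g assume g: "g \<in> carrier T"
      show "eval_functional N g (coact N (f m)) = eval_functional N g (tensor_map A N C f (coact M m))"
        using ev [OF lf g coact_closed [OF M m]] linear_map_smult [OF tf g, of m] m by simp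
    qed
    then show "f \<in> colin_hom A C M N"
      unfolding colin_hom_def lin_hom_iff [OF gM gN] using ex lf by simp
  qed
  then show ?thesis by blast
qed

end

section \<open>Group-like elements and coinvariants\<close>

locale grouplike_coring = dual_basis_coring A C for A :: "('a, 'x) ring_scheme" (structure) and C :: "('a, 'c) coring" +
  fixes x :: 'c
  assumes group_like: "group_like A C x"
begin

lemma x_closed: "x \<in> carrier C" and comult_x: "comult C x = tens A (rmod C) C x x"
  and counit_x: "counit C x = \<one>"
  using group_like by (simp_all add: group_like_def)

abbreviation "AC \<equiv> base_comodule A C x"
abbreviation "AT \<equiv> dual_module AC"
abbreviation "B \<equiv> coinv_ring A C x"

lemma AC_simps [simp]:
  "carrier AC = carrier A" "\<zero>\<^bsub>AC\<^esub> = \<zero>" "add AC = add A" "r \<odot>\<^bsub>AC\<^esub> a = a \<otimes> r"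
  "coact AC a = tens A RA C \<one> (x \<star> a)"
  by (simp_all add: base_comodule_def)

lemma comult_xa: "a \<in> carrier A \<Longrightarrow> comult C (x \<star> a) = tens A (rmod C) C x (x \<star> a)"
  using linear_map_smult [OF comult_linear_right, of a x] x_closed comult_x tensor_C_smult [OF right, of a x x]
  by simp

sublocale AR: tensor_product A RA C by (rule tensor_product_C [OF right_regular])

lemma base_coact_linear:
  "linear_map A RA (tensor_C A C RA) (\<lambda>a. tens A RA C \<one> (x \<star> a))"
proof (rule linear_mapI [OF abelian_group_regular(2) [OF ring_A]
      right_module_group [OF right_module_tensor_C [OF right_regular]]])
  fix a b assume "a \<in> carrier RA" "b \<in> carrier RA"
  then show "tens A RA C \<one> (x \<star> (a \<oplus>\<^bsub>RA\<^esub> b))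
      = tens A RA C \<one> (x \<star> a) \<oplus>\<^bsub>tensor_C A C RA\<^esub>
        tens A RA C \<one> (x \<star> b)"
    using RC.ract_r_distr [of a b x] x_closed
      AR.tens_add_right [of \<one> "x \<star> a" "x \<star> b"] by (simp add: ractC_closed)
next
  fix r a assume "r \<in> carrier A" "a \<in> carrier RA"
  then show "tens A RA C \<one> (x \<star> (a \<triangleleft>\<^bsub>RA\<^esub> r))
      = tens A RA C \<one> (x \<star> a) \<triangleleft>\<^bsub>tensor_C A C RA\<^esub> r"
    using RC.ract_assoc [of a r x] x_closed tensor_C_smult [OF right_regular, of r \<one> "x \<star> a"]
    by (simp add: ractC_closed)
qed (use x_closed ractC_closed in simp)

text \<open>Coassociativity, tested by pairs of functionals, comes down to
  \<open>\<Delta>(x a) = x \<otimes> x a\<close>; counitality comes down to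
  \<open>\<epsilon>(x a) = a\<close>.\<close>

lemma comodule_AC: "comodule A C AC"
  unfolding base_comodule_def
proof (rule comodule.intro)
  let ?R = RA and ?\<rho> = "\<lambda>a. tens A RA C \<one> (x \<star> a)"
  show "right_module A (with_coact ?R ?\<rho>)" by (rule right_module_with_coact [OF right_regular])
  have "restrict ?\<rho> (carrier ?R) \<in> lin_hom A ?R (tensor_C A C ?R)"
    by (rule restrict_lin_hom [OF base_coact_linear]) (simp add: right_regular)
  then show "restrict (coact (with_coact ?R ?\<rho>)) (carrier (with_coact ?R ?\<rho>))
      \<in> lin_hom A (with_coact ?R ?\<rho>) (tensor_C A C (with_coact ?R ?\<rho>))"
    by (simp add: lin_hom_def)
  have "coassociative A C ?R ?\<rho>" unfolding coassociative_def
  proof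
    interpret ACC: tensor_product A ?R CC by (rule tensor_productI [OF right_regular left_module_CC])
    fix a assume "a \<in> carrier ?R"
    then have a: "a \<in> carrier A" by simp
    note cl = coassoc_left_closed [OF right_regular base_coact_linear]
    show "tensor_assoc A C ?R (tensor_map A (tensor_C A C ?R) C ?\<rho> (?\<rho> a))
      = tensor_lift (tensor A ?R CC) (\<lambda>m\<^sub>0 m\<^sub>1. tens A ?R CC m\<^sub>0 (comult C m\<^sub>1)) (?\<rho> a)"
    proof (rule ACC.functionals_separate [OF _ dual_basis_CC cl])
      show "linear_map A CC LA f" if "f \<in> (\<lambda>(f, g). pair_functional f g) ` (carrier T \<times> carrier T)" for f
        using that pair_linear by auto
      fix h assume "h \<in> (\<lambda>(f, g). pair_functional f g) ` (carrier T \<times> carrier T)"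
      then obtain f g where fg: "h = pair_functional f g" "f \<in> carrier T" "g \<in> carrier T" by auto
      have xa: "x \<star> b \<in> carrier C" if "b \<in> carrier A" for b using that x_closed by (simp add: ractC_closed)
      have e: "eval_functional ?R f (?\<rho> b) = f (x \<star> b)" if "f \<in> carrier T" "b \<in> carrier A" for f b
        using that xa T_closed [OF that(1) xa [OF that(2)]] by (simp add: AR.eval_tens [OF T_linear [OF that(1)]])
      \<comment> \<open>The formula for \<open>\<Delta>(x a)\<close> in evaluated form: the left
        side is the iterated action on \<open>a\<close>, the right side the action of the
        product.\<close>
      have "g (x \<star> f (x \<star> a)) = (f \<otimes>\<^bsub>T\<^esub> g) (x \<star> a)"
        using a fg(2,3) xa x_closed by (simp add: T_mult_apply comult_xa pair_tens)
      then show "eval_functional ?R h (tensor_assoc A C ?R (tensor_map A (tensor_C A C ?R) C ?\<rho> (?\<rho> a)))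
        = eval_functional ?R h (tensor_lift (tensor A ?R CC) (\<lambda>m\<^sub>0 m\<^sub>1. tens A ?R CC m\<^sub>0 (comult C m\<^sub>1)) (?\<rho> a))"
        using eval_coassoc_left [OF right_regular base_coact_linear fg(2,3), of a]
          eval_coassoc_right [OF right_regular base_coact_linear fg(2,3), of a] a fg(2,3) xa T_closed
        unfolding fg(1) by (simp add: e)
    qed (use a in simp_all)
  qed
  then show "coassociative A C (with_coact ?R ?\<rho>) (coact (with_coact ?R ?\<rho>))" by simp
  fix a assume "a \<in> carrier (with_coact ?R ?\<rho>)"
  then have "eval_functional ?R (counit C) (?\<rho> a) = a"
    using x_closed by (simp add: AR.eval_tens [OF counit_linear_left] ractC_closed counit_smult_right counit_x)
  then show "tensor_lift (with_coact ?R ?\<rho>) (\<lambda>m\<^sub>0 m\<^sub>1. m\<^sub>0 \<triangleleft>\<^bsub>with_coact ?R ?\<rho>\<^esub> counit C m\<^sub>1) (coact (with_coact ?R ?\<rho>) a) = a"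
    by (simp add: eval_functional_def)
qed

lemma AT_act:
  assumes "f \<in> carrier T" "a \<in> carrier A"
  shows "a \<triangleleft>\<^bsub>AT\<^esub> f = f (x \<star> a)"
proof -
  have xa: "x \<star> a \<in> carrier C" using assms x_closed by (simp add: ractC_closed)
  have "eval_functional AC f = eval_functional RA f"
    by (simp add: base_comodule_def)
  then show ?thesis
    using xa T_closed [OF assms(1) xa] by (simp add: AR.eval_tens [OF T_linear [OF assms(1)]])
qed

lemma right_module_AT: "right_module T AT"
  by (rule right_module_dual [OF comodule_AC])

lemma carrier_AT [simp]: "carrier AT = carrier A" "\<zero>\<^bsub>AT\<^esub> = \<zero>" "add AT = add A"
  by simp_all

lemma B_simps [simp]: "\<zero>\<^bsub>B\<^esub> = \<zero>" "\<one>\<^bsub>B\<^esub> = \<one>" "add B = add A" "mult B = mult A"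
  by (simp_all add: coinv_ring_def)

text \<open>Evaluating \<open>1 \<otimes> c\<close> under \<open>f\<close> returns
  \<open>f(c)\<close>, and functionals separate the elements of \<open>C\<close>. Thus the passage
  from \<open>C\<close> to \<open>A \<otimes> C\<close>, in which the coaction of \<open>A\<close>
  is expressed, loses nothing.\<close>

lemma one_tens_eq_iff:
  assumes "c \<in> carrier C" "d \<in> carrier C"
  shows "tens A RA C \<one> c = tens A RA C \<one> d \<longleftrightarrow> c = d"
proof
  assume eq: "tens A RA C \<one> c = tens A RA C \<one> d"
  have "f c = f d" if f: "f \<in> carrier T" for f
  proof -
    have "eval_functional RA f (tens A RA C \<one> c) = f c" if "c \<in> carrier C" for c
      using that T_closed [OF f that] by (simp add: AR.eval_tens [OF T_linear [OF f]])
    then show ?thesis using eq assms by metis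
  qed
  then show "c = d" by (rule coring_eqI [OF assms])
qed simp

text \<open>The coaction sends \<open>b\<close> to \<open>1 \<otimes> x b\<close>, whereas
  \<open>b \<otimes> x = 1 \<otimes> b x\<close>.\<close>

lemma carrier_B: "carrier B = {b \<in> carrier A. b \<bullet> x = x \<star> b}"
proof -
  have "coact AC b = tens A AC C b x \<longleftrightarrow> b \<bullet> x = x \<star> b" if b: "b \<in> carrier A" for b
  proof -
    have "tens A AC C b x = tens A RA C b x" by (simp add: base_comodule_def)
    also have "\<dots> = tens A RA C \<one> (b \<bullet> x)"
      using AR.tens_balanced [of \<one> b x] b x_closed by simp
    finally have eq: "tens A AC C b x = tens A RA C \<one> (b \<bullet> x)" .
    have "coact AC b = tens A AC C b x \<longleftrightarrow> x \<star> b = b \<bullet> x"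
      unfolding eq AC_simps by (rule one_tens_eq_iff) (use b x_closed in \<open>simp_all add: ractC_closed L.lact_closed\<close>)
    then show ?thesis by (simp only: eq_commute)
  qed
  then show ?thesis by (auto simp: coinv_ring_def coinv_def)
qed

lemma B_subset: "b \<in> carrier B \<Longrightarrow> b \<in> carrier A" and B_commutes: "b \<in> carrier B \<Longrightarrow> x \<star> b = b \<bullet> x"
  by (simp_all add: carrier_B)

lemma ring_B: "ring B"
proof -
  have "subring (carrier B) A"
  proof (rule ring.subringI [OF ring_A])
    show "carrier B \<subseteq> carrier A" using B_subset by blast
    show "\<one> \<in> carrier B" using x_closed RC.ract_one [of x] by (simp add: carrier_B L.lact_one)
    fix b assume b: "b \<in> carrier B"
    have "(\<ominus> b) \<bullet> x = \<ominus>\<^bsub>C\<^esub> (b \<bullet> x)"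
    proof (rule add_hom_neg [where f = "\<lambda>b. b \<bullet> x"])
      show "add_hom A C (\<lambda>b. b \<bullet> x)"
        using x_closed by (auto simp: add_hom_def L.R.abelian_group_axioms L.M.abelian_group_axioms
            L.lact_closed L.lact_l_distr)
    qed (use b B_subset in simp)
    moreover have "x \<star> (\<ominus> b) = \<ominus>\<^bsub>C\<^esub> (x \<star> b)"
    proof (rule add_hom_neg [where f = "\<lambda>b. x \<star> b"])
      show "add_hom A C (\<lambda>b. x \<star> b)"
        using RC.additive_ract_right [of x] x_closed by simp
    qed (use b B_subset in simp)
    ultimately show "\<ominus> b \<in> carrier B" using b by (simp add: carrier_B)
    fix c assume c: "c \<in> carrier B"
    show "b \<otimes> c \<in> carrier B"
      using b c x_closed RC.ract_assoc [of b c x] bimodule [of b c x] by (simp add: carrier_B L.lact_assoc)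
    show "b \<oplus> c \<in> carrier B"
      using b c x_closed RC.ract_r_distr [of b c x] by (simp add: carrier_B L.lact_l_distr)
  qed
  then show ?thesis using ring.subring_is_ring [OF ring_A] by (simp add: coinv_ring_def)
qed

lemma A_left_B: "left_module B LA"
proof -
  show ?thesis
    unfolding left_module_def left_module_axioms_def
    by (auto simp: ring_B B_subset abelian_group_regular [OF ring_A] L.R.l_distr L.R.r_distr L.R.m_assoc)
qed

lemma right_module_restrict_B: "right_module A M \<Longrightarrow> right_module B M"
proof -
  assume "right_module A M"
  then interpret M: right_module A M .
  show ?thesis
    by (rule right_moduleI)
       (auto simp: ring_B B_subset M.M.abelian_group_axioms M.ract_closed M.ract_l_distr M.ract_r_distr
         M.ract_assoc M.ract_one)
qed

section \<open>Maps from the base ring\<close>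

abbreviation "HomT \<equiv> dual_hom_module A C x"

lemma xa_closed: "a \<in> carrier A \<Longrightarrow> x \<star> a \<in> carrier C"
  by (simp add: ractC_closed x_closed)

lemma iota_xa: "\<lbrakk>a \<in> carrier A; b \<in> carrier A\<rbrakk> \<Longrightarrow> iota a (x \<star> b) = b \<otimes> a"
  using x_closed by (simp add: iota_apply xa_closed counit_smult_right counit_x)

lemma AT_act_iota: "\<lbrakk>a \<in> carrier A; b \<in> carrier A\<rbrakk> \<Longrightarrow> b \<triangleleft>\<^bsub>AT\<^esub> iota a = b \<otimes> a"
  by (simp add: AT_act iota_closed iota_xa del: dual_module_simps)

lemma x_one: "x \<star> \<one> = x"
  using RC.ract_one x_closed by simp

text \<open>The coinvariants in terms of the action alone: evaluating
  \<open>\<rho>(p) = p \<otimes> x\<close> under \<open>f\<close> gives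
  \<open>p f = p f(x)\<close>.\<close>

definition coinv_T :: "('c \<Rightarrow> 'a, 'p, 'y) module_scheme \<Rightarrow> 'p set" where
  "coinv_T P = {p \<in> carrier P. \<forall>f\<in>carrier T. p \<triangleleft>\<^bsub>P\<^esub> f = p \<triangleleft>\<^bsub>P\<^esub> iota (f x)}"

lemma coinv_eq_coinv_T:
  assumes M: "comodule A C M" shows "coinv A C x M = coinv_T (dual_module M)"
proof -
  interpret MC: tensor_product A M C by (rule tensor_product_C [OF comodule.right [OF M]])
  have ev: "eval_functional M f (tens A M C m x) = m \<triangleleft>\<^bsub>dual_module M\<^esub> iota (f x)"
    if "m \<in> carrier M" "f \<in> carrier T" for m f
    using that x_closed
    by (simp add: MC.eval_tens [OF T_linear] comodule_act_iota [OF M] T_closed del: dual_module_simps(4))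
  have "coact M m = tens A M C m x \<longleftrightarrow> (\<forall>f\<in>carrier T. m \<triangleleft>\<^bsub>dual_module M\<^esub> f = m \<triangleleft>\<^bsub>dual_module M\<^esub> iota (f x))"
    if m: "m \<in> carrier M" for m
  proof
    assume "coact M m = tens A M C m x"
    then show "\<forall>f\<in>carrier T. m \<triangleleft>\<^bsub>dual_module M\<^esub> f = m \<triangleleft>\<^bsub>dual_module M\<^esub> iota (f x)"
      using ev [OF m] by simp
  next
    assume "\<forall>f\<in>carrier T. m \<triangleleft>\<^bsub>dual_module M\<^esub> f = m \<triangleleft>\<^bsub>dual_module M\<^esub> iota (f x)"
    then show "coact M m = tens A M C m x"
      using ev [OF m] m x_closed
      by (intro tensor_C_eqI [OF comodule.right [OF M] coact_closed [OF M m]]) simp_all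
  qed
  then show ?thesis unfolding coinv_def coinv_T_def by auto
qed

text \<open>\<open>f(x b a) = f(b x a) = b f(x a)\<close>, because \<open>b\<close> commutes with
  \<open>x\<close> and \<open>f\<close> is left linear.\<close>

lemma B_act_linear:
  assumes b: "b \<in> carrier B" shows "linear_map T AT AT (\<lambda>a. b \<otimes> a)"
proof (rule linear_mapI [OF right_module_group [OF right_module_AT] right_module_group [OF right_module_AT]])
  have bA: "b \<in> carrier A" by (rule B_subset [OF b])
  fix f a assume f: "f \<in> carrier T" and "a \<in> carrier AT"
  then have a: "a \<in> carrier A" by simp
  have "x \<star> (b \<otimes> a) = b \<bullet> (x \<star> a)"
    using RC.ract_assoc [of b a x] bimodule [of b a x] B_commutes [OF b] bA a x_closed by simp
  then show "b \<otimes> (a \<triangleleft>\<^bsub>AT\<^esub> f) = (b \<otimes> a) \<triangleleft>\<^bsub>AT\<^esub> f"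
    using a bA f by (simp add: AT_act T_smult [OF f] xa_closed del: dual_module_simps(4))
qed (use B_subset [OF b] in \<open>simp_all add: L.R.r_distr\<close>)

lemma HomT_simps [simp]:
  fixes P :: "('c \<Rightarrow> 'a, 'p) module"
  shows "carrier (HomT P) = lin_hom T AT P" "\<zero>\<^bsub>HomT P\<^esub> = (\<lambda>a\<in>carrier A. \<zero>\<^bsub>P\<^esub>)"
    "f \<oplus>\<^bsub>HomT P\<^esub> g = (\<lambda>a\<in>carrier A. f a \<oplus>\<^bsub>P\<^esub> g a)" "b \<odot>\<^bsub>HomT P\<^esub> f = (\<lambda>a\<in>carrier A. f (b \<otimes> a))"
  by (simp_all add: dual_hom_module_def hom_module_def)

abbreviation "eval_hom P \<equiv> tensor_lift P (\<lambda>f a. f a)"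

context
  fixes P :: "('c \<Rightarrow> 'a, 'p) module"
  assumes P: "right_module T P"
begin

interpretation P: right_module T P by (rule P)

lemma hom_T_linear: "h \<in> lin_hom T AT P \<Longrightarrow> linear_map T AT P h"
  by (rule lin_hom_linear [OF _ right_module_group [OF right_module_AT] P.M.abelian_group_axioms])

lemma hom_T_closed: "\<lbrakk>h \<in> lin_hom T AT P; a \<in> carrier A\<rbrakk> \<Longrightarrow> h a \<in> carrier P"
  using lin_hom_closed [of h T AT P a] by simp

lemma hom_T_apply: "\<lbrakk>h \<in> lin_hom T AT P; a \<in> carrier A\<rbrakk> \<Longrightarrow> h a = h \<one> \<triangleleft>\<^bsub>P\<^esub> iota a"
  using linear_map_smult [OF hom_T_linear, of h "iota a" \<one>] AT_act_iota [of a \<one>]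
  by (simp add: iota_closed del: dual_module_simps(4))

text \<open>In \<open>A\<close> one has \<open>1 f = f(x)\<close>, hence
  \<open>h(1) f = h(f(x)) = h(1) f(x)\<close>.\<close>

lemma hom_T_one_coinv: "h \<in> lin_hom T AT P \<Longrightarrow> h \<one> \<in> coinv_T P"
proof -
  assume h: "h \<in> lin_hom T AT P"
  have "h \<one> \<triangleleft>\<^bsub>P\<^esub> f = h \<one> \<triangleleft>\<^bsub>P\<^esub> iota (f x)" if f: "f \<in> carrier T" for f
    using linear_map_smult [OF hom_T_linear [OF h] f, of \<one>] AT_act [OF f, of \<one>]
      hom_T_apply [OF h T_closed [OF f x_closed]]
    by (simp add: x_one del: dual_module_simps(4))
  then show ?thesis using hom_T_closed [OF h] by (simp add: coinv_T_def)
qed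

text \<open>\<open>(p a) f\<close> is the action on \<open>p\<close> of the product of
  \<open>iota a\<close> and \<open>f\<close>, whose value at \<open>x\<close> is
  \<open>f(x a)\<close>. With evaluation at \<open>1\<close> this identifies the maps
  \<open>A \<rightarrow> P\<close> with the coinvariants of \<open>P\<close>.\<close>

lemma coinv_T_hom:
  assumes p: "p \<in> coinv_T P" shows "(\<lambda>a\<in>carrier A. p \<triangleleft>\<^bsub>P\<^esub> iota a) \<in> lin_hom T AT P"
proof -
  have pc: "p \<in> carrier P" and pf: "\<And>f. f \<in> carrier T \<Longrightarrow> p \<triangleleft>\<^bsub>P\<^esub> f = p \<triangleleft>\<^bsub>P\<^esub> iota (f x)"
    using p unfolding coinv_T_def by blast+
  have "linear_map T AT P (\<lambda>a. p \<triangleleft>\<^bsub>P\<^esub> iota a)"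
  proof (rule linear_mapI [OF right_module_group [OF right_module_AT] P.M.abelian_group_axioms])
    fix f a assume f: "f \<in> carrier T" and "a \<in> carrier AT"
    then have a: "a \<in> carrier A" by simp
    have "(p \<triangleleft>\<^bsub>P\<^esub> iota a) \<triangleleft>\<^bsub>P\<^esub> f = p \<triangleleft>\<^bsub>P\<^esub> (iota a \<otimes>\<^bsub>T\<^esub> f)"
      using a f pc by (simp add: P.ract_assoc iota_closed)
    also have "\<dots> = p \<triangleleft>\<^bsub>P\<^esub> iota ((iota a \<otimes>\<^bsub>T\<^esub> f) x)" using a f by (intro pf) (simp add: iota_closed)
    also have "\<dots> = p \<triangleleft>\<^bsub>P\<^esub> iota (a \<triangleleft>\<^bsub>AT\<^esub> f)"
      using a f x_closed by (simp add: iota_mult AT_act del: dual_module_simps(4))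
    finally show "p \<triangleleft>\<^bsub>P\<^esub> iota (a \<triangleleft>\<^bsub>AT\<^esub> f) = (p \<triangleleft>\<^bsub>P\<^esub> iota a) \<triangleleft>\<^bsub>P\<^esub> f" by simp
  qed (use pc in \<open>simp_all add: P.ract_closed iota_closed iota_hom_add P.ract_r_distr\<close>)
  from restrict_lin_hom [OF this] show ?thesis using right_module_AT by simp
qed

lemma right_module_HomT: "right_module B (HomT P)"
proof (rule right_moduleI [OF ring_B])
  have lh: "restrict h (carrier A) \<in> lin_hom T AT P" if "linear_map T AT P h" for h
    using restrict_lin_hom [OF that] right_module_AT by simp
  have ext: "f = g" if "f \<in> lin_hom T AT P" "g \<in> lin_hom T AT P" "\<And>a. a \<in> carrier A \<Longrightarrow> f a = g a" for f g
    using lin_hom_ext [OF that(1,2)] that(3) by simp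
  have add: "f \<oplus>\<^bsub>HomT P\<^esub> g \<in> lin_hom T AT P" if fg: "f \<in> lin_hom T AT P" "g \<in> lin_hom T AT P" for f g
  proof -
    note fl = hom_T_linear [OF fg(1)] and gl = hom_T_linear [OF fg(2)]
    have "linear_map T AT P (\<lambda>a. f a \<oplus>\<^bsub>P\<^esub> g a)"
    proof (rule linear_mapI [OF right_module_group [OF right_module_AT] P.M.abelian_group_axioms])
      fix a b assume ab: "a \<in> carrier AT" "b \<in> carrier AT"
      then show "f (a \<oplus>\<^bsub>AT\<^esub> b) \<oplus>\<^bsub>P\<^esub> g (a \<oplus>\<^bsub>AT\<^esub> b) = f a \<oplus>\<^bsub>P\<^esub> g a \<oplus>\<^bsub>P\<^esub> (f b \<oplus>\<^bsub>P\<^esub> g b)"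
        using linear_map_closed [OF fl] linear_map_closed [OF gl]
        by (simp only: linear_map_add [OF fl] linear_map_add [OF gl]
            P.M.a_ac P.M.a_closed)
    next
      fix t a assume "t \<in> carrier T" "a \<in> carrier AT"
      then show "f (a \<triangleleft>\<^bsub>AT\<^esub> t) \<oplus>\<^bsub>P\<^esub> g (a \<triangleleft>\<^bsub>AT\<^esub> t) = (f a \<oplus>\<^bsub>P\<^esub> g a) \<triangleleft>\<^bsub>P\<^esub> t"
        using linear_map_closed [OF fl] linear_map_closed [OF gl]
        by (simp add: linear_map_smult [OF fl] linear_map_smult [OF gl] P.ract_l_distr del: dual_module_simps(4))
    qed (use linear_map_closed [OF fl] linear_map_closed [OF gl] in simp)
    from lh [OF this] show ?thesis by simp
  qed
  show group: "abelian_group (HomT P)"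
  proof (rule abelian_groupI)
    have "linear_map T AT P (\<lambda>a. \<zero>\<^bsub>P\<^esub>)"
      by (rule linear_mapI [OF right_module_group [OF right_module_AT] P.M.abelian_group_axioms])
         (simp_all add: P.ract_zero_left)
    then show z: "\<zero>\<^bsub>HomT P\<^esub> \<in> carrier (HomT P)" using lh by simp
    fix f assume "f \<in> carrier (HomT P)"
    then have f: "f \<in> lin_hom T AT P" by simp
    note fl = hom_T_linear [OF f]
    show "\<zero>\<^bsub>HomT P\<^esub> \<oplus>\<^bsub>HomT P\<^esub> f = f"
      using hom_T_closed [OF f] z f by (intro ext add) simp_all
    have "linear_map T AT P (\<lambda>a. \<ominus>\<^bsub>P\<^esub> f a)"
    proof (rule linear_mapI [OF right_module_group [OF right_module_AT] P.M.abelian_group_axioms])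
      fix a b assume ab: "a \<in> carrier AT" "b \<in> carrier AT"
      then show "\<ominus>\<^bsub>P\<^esub> f (a \<oplus>\<^bsub>AT\<^esub> b) = \<ominus>\<^bsub>P\<^esub> f a \<oplus>\<^bsub>P\<^esub> \<ominus>\<^bsub>P\<^esub> f b"
        using linear_map_closed [OF fl]
        by (simp only: linear_map_add [OF fl] P.M.minus_add)
    next
      fix t a assume t: "t \<in> carrier T" and a: "a \<in> carrier AT"
      then show "\<ominus>\<^bsub>P\<^esub> f (a \<triangleleft>\<^bsub>AT\<^esub> t) = (\<ominus>\<^bsub>P\<^esub> f a) \<triangleleft>\<^bsub>P\<^esub> t"
        using add_hom_neg [OF P.additive_ract_left [OF t] linear_map_closed [OF fl a]]
        by (simp only: linear_map_smult [OF fl])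
    qed (use linear_map_closed [OF fl] in simp)
    from lh [OF this] have n: "(\<lambda>a\<in>carrier A. \<ominus>\<^bsub>P\<^esub> f a) \<in> lin_hom T AT P" .
    have eq: "(\<lambda>a\<in>carrier A. \<ominus>\<^bsub>P\<^esub> f a) \<oplus>\<^bsub>HomT P\<^esub> f = \<zero>\<^bsub>HomT P\<^esub>"
      using hom_T_closed [OF f] z f add [OF n f] by (intro ext) (simp_all add: P.M.l_neg)
    show "\<exists>g\<in>carrier (HomT P). g \<oplus>\<^bsub>HomT P\<^esub> f = \<zero>\<^bsub>HomT P\<^esub>"
      by (rule bexI [where P = "\<lambda>g. g \<oplus>\<^bsub>HomT P\<^esub> f = \<zero>\<^bsub>HomT P\<^esub>", OF eq]) (simp add: n)
  next
    fix f g assume "f \<in> carrier (HomT P)" "g \<in> carrier (HomT P)"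
    then have fg: "f \<in> lin_hom T AT P" "g \<in> lin_hom T AT P" by simp_all
    then show "f \<oplus>\<^bsub>HomT P\<^esub> g \<in> carrier (HomT P)" using add by simp
    show "f \<oplus>\<^bsub>HomT P\<^esub> g = g \<oplus>\<^bsub>HomT P\<^esub> f"
      using fg hom_T_closed by (auto simp: P.M.a_comm intro!: restrict_ext)
    fix h assume "h \<in> carrier (HomT P)"
    then show "f \<oplus>\<^bsub>HomT P\<^esub> g \<oplus>\<^bsub>HomT P\<^esub> h = f \<oplus>\<^bsub>HomT P\<^esub> (g \<oplus>\<^bsub>HomT P\<^esub> h)"
      using fg hom_T_closed by (auto simp: P.M.a_assoc intro!: restrict_ext)
  qed
  have act: "(\<lambda>a\<in>carrier A. f (b \<otimes> a)) \<in> lin_hom T AT P" if "b \<in> carrier B" "f \<in> lin_hom T AT P" for b f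
    using lh [OF linear_map_comp [OF B_act_linear [OF that(1)] hom_T_linear [OF that(2)]]] .
  fix b f assume b: "b \<in> carrier B" and "f \<in> carrier (HomT P)"
  then have f: "f \<in> lin_hom T AT P" and bA: "b \<in> carrier A" using B_subset by simp_all
  show "b \<odot>\<^bsub>HomT P\<^esub> f \<in> carrier (HomT P)" using act [OF b f] by simp
  show "b \<odot>\<^bsub>HomT P\<^esub> (f \<oplus>\<^bsub>HomT P\<^esub> g) = b \<odot>\<^bsub>HomT P\<^esub> f \<oplus>\<^bsub>HomT P\<^esub> b \<odot>\<^bsub>HomT P\<^esub> g" for g
    using bA by (auto intro!: restrict_ext)
  fix c assume c: "c \<in> carrier B"
  then have cA: "c \<in> carrier A" using B_subset by simp
  show "(b \<oplus>\<^bsub>B\<^esub> c) \<odot>\<^bsub>HomT P\<^esub> f = b \<odot>\<^bsub>HomT P\<^esub> f \<oplus>\<^bsub>HomT P\<^esub> c \<odot>\<^bsub>HomT P\<^esub> f"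
    using bA cA linear_map_add [OF hom_T_linear [OF f]]
    by (auto simp: L.R.l_distr intro!: restrict_ext)
  show "(b \<otimes>\<^bsub>B\<^esub> c) \<odot>\<^bsub>HomT P\<^esub> f = c \<odot>\<^bsub>HomT P\<^esub> (b \<odot>\<^bsub>HomT P\<^esub> f)"
    using bA cA by (auto simp: L.R.m_assoc intro!: restrict_ext)
next
  fix f assume "f \<in> carrier (HomT P)"
  then show "\<one>\<^bsub>B\<^esub> \<odot>\<^bsub>HomT P\<^esub> f = f"
    by (auto simp: lin_hom_def PiE_iff intro!: extensionalityI [of _ "carrier A"])
qed

lemma HomT_eval_balanced: "balanced B (HomT P) LA P (\<lambda>f a. f a)"
proof (rule balancedI [OF P.M.abelian_group_axioms])
  fix f a b assume "f \<in> carrier (HomT P)" "a \<in> carrier LA" "b \<in> carrier LA"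
  then show "f (a \<oplus>\<^bsub>LA\<^esub> b) = f a \<oplus>\<^bsub>P\<^esub> f b"
    using linear_map_add [OF hom_T_linear, of f a b] by simp
qed (simp_all add: hom_T_closed)

interpretation HA: tensor_product B "HomT P" LA by (rule tensor_productI [OF right_module_HomT A_left_B])

lemma eval_hom_additive: "add_hom (tensor B (HomT P) LA) P (eval_hom P)"
  by (rule HA.tensor_lift_additive [OF HomT_eval_balanced])

lemma eval_hom_tens: "\<lbrakk>h \<in> lin_hom T AT P; a \<in> carrier A\<rbrakk> \<Longrightarrow> eval_hom P (tens B (HomT P) LA h a) = h a"
  using HA.tensor_lift_tens [OF HomT_eval_balanced] by simp

lemma eval_hom_lsum:
  "set ks \<subseteq> lin_hom T AT P \<times> carrier A
    \<Longrightarrow> eval_hom P (lsum (tensor B (HomT P) LA) (\<lambda>(h, a). tens B (HomT P) LA h a) ks) = lsum P (\<lambda>(h, a). h a) ks"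
  using HA.tensor_lift_lsum [OF HomT_eval_balanced] by simp

text \<open>A map out of \<open>A\<close> is determined by its value at
  \<open>\<one>\<close>.\<close>

lemma HomT_lepoll: "carrier (HomT P) \<lesssim> carrier P"
  unfolding lepoll_def
proof (rule exI [of _ "\<lambda>h. h \<one>"], rule conjI)
  show "inj_on (\<lambda>h. h \<one>) (carrier (HomT P))"
  proof (rule inj_onI)
    fix f g assume "f \<in> carrier (HomT P)" "g \<in> carrier (HomT P)" and eq: "f \<one> = g \<one>"
    then have fg: "f \<in> lin_hom T AT P" "g \<in> lin_hom T AT P" by simp_all
    show "f = g"
    proof (rule lin_hom_ext [OF fg])
      fix a assume "a \<in> carrier AT"
      then show "f a = g a" using hom_T_apply [OF fg(1), of a] hom_T_apply [OF fg(2), of a] eq by simp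
    qed
  qed
  show "(\<lambda>h. h \<one>) ` carrier (HomT P) \<subseteq> carrier P" using hom_T_closed by auto
qed

end

lemma HomT_tensor_product: "right_module T P \<Longrightarrow> tensor_product B (HomT P) LA"
  by (rule tensor_productI [OF right_module_HomT A_left_B])

section \<open>Consequences of generation by the base ring\<close>

definition generates_rational :: "'u itself \<Rightarrow> bool" where
  "generates_rational _ \<longleftrightarrow> (\<forall>P :: ('c \<Rightarrow> 'a, 'u) module. rational P \<longrightarrow> carrier P \<subseteq> trace T AT P)"

text \<open>A module of another type is transported into the universe. The transported module is
  rational, since the inverse embeds it into \<open>P\<close>, and linear maps carry its trace
  back.\<close>

lemma generates_rationalD:
  fixes P :: "('c \<Rightarrow> 'a, 'p, 'y) module_scheme"
  assumes gen: "generates_rational TYPE('u)" and P: "rational P" "carrier P \<lesssim> (UNIV :: 'u set)"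
  shows "carrier P \<subseteq> trace T AT P"
proof
  fix p assume p: "p \<in> carrier P"
  obtain h :: "'p \<Rightarrow> 'u" where h: "inj_on h (carrier P)" using P(2) by (auto simp: lepoll_def)
  have PT: "right_module T P" by (rule rational_right_module [OF P(1)])
  have P': "right_module T (transport h P)" by (rule right_module_transport [OF PT h])
  have inv: "linear_map T (transport h P) P (inv_into (carrier P) h)"
    by (rule linear_map_transport_inv [OF _ h]) (simp add: PT)
  have "rational (transport h P)"
    by (rule rational_injective [OF P' P(1) inv]) (auto simp: inj_on_inv_into)
  then have "carrier (transport h P) \<subseteq> trace T AT (transport h P)"
    using gen unfolding generates_rational_def by blast
  then have "h p \<in> trace T AT (transport h P)" using p by auto
  from trace_linear_image [OF right_module_AT P' PT inv this] show "p \<in> trace T AT P"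
    using h p by simp
qed

context
  assumes gen: "generates_rational TYPE('u)"
    and universe: "infinite (UNIV :: 'u set)" "carrier A \<lesssim> (UNIV :: 'u set)"
begin

text \<open>
  A tuple in a submodule \<open>K\<close> of \<open>A\<^sup>n\<close> is a combination of tuples in \<open>K\<close> whose entries are coinvariant:
  the coordinates of a \<open>T\<close>-linear map \<open>A \<rightarrow> K\<close> are left multiplications by elements of \<open>B\<close>.
\<close>

lemma tuple_expansion:
  assumes K: "closed_submodule T (direct_power {..<n::nat} AT) K" and k: "k \<in> K"
  obtains ks where "\<And>\<beta> a. (\<beta>, a) \<in> set ks \<Longrightarrow> \<beta> \<in> K \<and> a \<in> carrier A \<and> (\<forall>i<n. \<beta> i \<in> carrier B)"
    "\<And>i. i < n \<Longrightarrow> k i = lsum A (\<lambda>(\<beta>, a). \<beta> i \<otimes> a) ks"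
proof -
  let ?D = "direct_power {..<n} AT"
  let ?P = "?D\<lparr>carrier := K\<rparr>"
  have gAT: "abelian_group AT" by (rule right_module_group [OF right_module_AT])
  note D = direct_power_right_module [OF right_module_AT, of "{..<n}"]
  have P: "right_module T ?P" by (rule right_module_submodule [OF D K])
  have KD: "K \<subseteq> carrier ?D" using K by (simp add: closed_submodule_def)
  \<comment> \<open>The submodule inherits rationality from the finite power of \<open>A\<close>, so
    generation applies to the submodule itself.\<close>
  have rat: "rational ?P"
    by (rule rational_injective [OF P rational_direct_power [OF rational_dual_module [OF comodule_AC]]
          submodule_inclusion_linear [OF D K]]) (simp add: inj_on_def)
  have "carrier ?D \<lesssim> (UNIV :: 'u set)"
    by (rule direct_power_lepoll [OF universe(1) _ _ gAT])
       (use universe in \<open>simp_all add: finite_lepoll_infinite\<close>)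
  then have "carrier ?P \<lesssim> (UNIV :: 'u set)"
    using KD by (simp add: lepoll_trans [OF subset_imp_lepoll])
  then have "k \<in> trace T AT ?P" using generates_rationalD [OF gen rat] k by auto
  then obtain hs where hs: "set hs \<subseteq> lin_hom T AT ?P \<times> carrier A" "k = lsum ?P (\<lambda>(h, a). h a) hs"
    by (auto simp: trace_def)
  have entry: "\<beta> i \<in> carrier A" if "\<beta> \<in> K" "i < n" for \<beta> i
    using that KD by (auto simp: direct_power_simps [OF gAT] PiE_iff)
  have act: "(\<beta> \<triangleleft>\<^bsub>?D\<^esub> f) i = f (x \<star> \<beta> i)" if "f \<in> carrier T" "\<beta> \<in> K" "i < n" for \<beta> f i
    using that entry by (simp add: direct_power_simps [OF gAT] AT_act del: dual_module_simps(4))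
  have h1: "h \<one> \<in> K" "h a \<in> K" "i < n \<Longrightarrow> h \<one> i \<in> carrier B" "i < n \<Longrightarrow> h a i = h \<one> i \<otimes> a"
    if h: "h \<in> lin_hom T AT ?P" and a: "a \<in> carrier A" for h a i
  proof -
    show hK: "h \<one> \<in> K" "h a \<in> K" using hom_T_closed [OF P h] a by simp_all
    assume i: "i < n"
    have "h a = h \<one> \<triangleleft>\<^bsub>?D\<^esub> iota a" using hom_T_apply [OF P h a] by simp
    then show "h a i = h \<one> i \<otimes> a"
      using act [OF iota_closed [OF a] hK(1) i] entry [OF hK(1) i] a by (simp add: iota_xa)
    \<comment> \<open>In the coordinate \<open>b = h \<one> i\<close> the coinvariance of
      \<open>h \<one>\<close> reads \<open>f(x b) = b f(x) = f(b x)\<close> for all functionals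
      \<open>f\<close>; by separation \<open>b\<close> lies in \<open>B\<close>.\<close>
    have "x \<star> h \<one> i = h \<one> i \<bullet> x"
    proof (rule coring_eqI)
      fix f assume f: "f \<in> carrier T"
      have "h \<one> \<triangleleft>\<^bsub>?D\<^esub> f = h \<one> \<triangleleft>\<^bsub>?D\<^esub> iota (f x)"
        using hom_T_one_coinv [OF P h] f by (auto simp: coinv_T_def)
      then have "f (x \<star> h \<one> i) = iota (f x) (x \<star> h \<one> i)"
        using act [OF f hK(1) i] act [OF iota_closed [OF T_closed [OF f x_closed]] hK(1) i] by simp
      then show "f (x \<star> h \<one> i) = f (h \<one> i \<bullet> x)"
        using entry [OF hK(1) i] f x_closed by (simp add: iota_xa T_smult T_closed)
    qed (use entry [OF hK(1) i] x_closed in \<open>simp_all add: xa_closed L.lact_closed\<close>)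
    then show "h \<one> i \<in> carrier B" using entry [OF hK(1) i] by (simp add: carrier_B)
  qed
  let ?ks = "map (\<lambda>(h, a). (h \<one>, a)) hs"
  show thesis
  proof (rule that)
    fix \<beta> a assume "(\<beta>, a) \<in> set ?ks"
    then obtain h where h: "(h, a) \<in> set hs" "\<beta> = h \<one>" by auto
    then have "h \<in> lin_hom T AT ?P" "a \<in> carrier A" using hs(1) by auto
    then show "\<beta> \<in> K \<and> a \<in> carrier A \<and> (\<forall>i<n. \<beta> i \<in> carrier B)" using h1 h(2) by auto
  next
    fix i assume i: "i < n"
    have "add_hom ?P A (\<lambda>w. w i)"
      using right_module_group [OF P] KD i
      by (auto simp: add_hom_def L.R.abelian_group_axioms direct_power_simps [OF gAT] PiE_iff subset_eq)
    then have "k i = lsum A (\<lambda>p. (\<lambda>(h, a). h a) p i) hs"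
      unfolding hs(2)
    proof (rule add_hom_lsum [where h = "\<lambda>w. w i"])
      fix p assume "p \<in> set hs"
      then have "fst p \<in> lin_hom T AT ?P" "snd p \<in> carrier A" using hs(1) by auto
      then show "(\<lambda>(h, a). h a) p \<in> carrier ?P" using h1(2) by (simp add: case_prod_beta)
    qed
    also have "\<dots> = lsum A (\<lambda>(\<beta>, a). \<beta> i \<otimes> a) ?ks"
      unfolding lsum_map
    proof (rule lsum_cong)
      fix p assume "p \<in> set hs"
      then have "fst p \<in> lin_hom T AT ?P" "snd p \<in> carrier A" using hs(1) by auto
      then show "(\<lambda>(h, a). h a) p i = (\<lambda>(\<beta>, a). \<beta> i \<otimes> a) ((\<lambda>(h, a). (h \<one>, a)) p)"
        using h1(4) i by (simp add: case_prod_beta)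
    qed
    finally show "k i = lsum A (\<lambda>(\<beta>, a). \<beta> i \<otimes> a) ?ks" .
  qed
qed

text \<open>Expand \<open>k\<close> into tuples \<open>\<beta>\<close> over \<open>B\<close> that
  lie in \<open>K\<close>, with coefficients in \<open>A\<close>. The entries of
  \<open>\<beta>\<close> cross the tensor sign, and for each \<open>\<beta>\<close> the left factors
  then add up to zero by assumption.\<close>

lemma tensor_tuple_zero:
  fixes Y :: "('a, 'm, 'z) module_scheme"
  assumes Y: "right_module B Y" and y: "\<And>i. i < n \<Longrightarrow> y i \<in> carrier Y"
    and K: "closed_submodule T (direct_power {..<n::nat} AT) K" and k: "k \<in> K"
    and zero: "\<And>\<beta>. \<lbrakk>\<beta> \<in> K; \<And>i. i < n \<Longrightarrow> \<beta> i \<in> carrier B\<rbrakk>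
      \<Longrightarrow> lsum Y (\<lambda>i. y i \<triangleleft>\<^bsub>Y\<^esub> \<beta> i) [0..<n] = \<zero>\<^bsub>Y\<^esub>"
  shows "lsum (tensor B Y LA) (\<lambda>i. tens B Y LA (y i) (k i)) [0..<n]
    = \<zero>\<^bsub>tensor B Y LA\<^esub>"
proof -
  interpret YA: tensor_product B Y LA by (rule tensor_productI [OF Y A_left_B])
  let ?G = "tensor B Y LA" and ?t = "tens B Y LA"
  from tuple_expansion [OF K k] obtain ks where
    ks: "\<And>\<beta> a. (\<beta>, a) \<in> set ks \<Longrightarrow> \<beta> \<in> K \<and> a \<in> carrier A \<and> (\<forall>i<n. \<beta> i \<in> carrier B)"
    and eq: "\<And>i. i < n \<Longrightarrow> k i = lsum A (\<lambda>(\<beta>, a). \<beta> i \<otimes> a) ks" by metis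
  have ks': "fst p \<in> K" "snd p \<in> carrier A" "i < n \<Longrightarrow> fst p i \<in> carrier B" if "p \<in> set ks" for p i
    using ks [of "fst p" "snd p"] that by auto
  have t: "?t (y i) (k i) = lsum ?G (\<lambda>p. ?t (y i \<triangleleft>\<^bsub>Y\<^esub> fst p i) (snd p)) ks" if i: "i < n" for i
  proof -
    have "?t (y i) (lsum A (\<lambda>(\<beta>, a). \<beta> i \<otimes> a) ks) = lsum ?G (\<lambda>p. ?t (y i) ((\<lambda>(\<beta>, a). \<beta> i \<otimes> a) p)) ks"
    proof (rule add_hom_lsum [where h = "?t (y i)"])
      show "add_hom A ?G (?t (y i))"
        using y [OF i] YA.tens_add_right by (auto simp: add_hom_def L.R.abelian_group_axioms YA.abelian_group_tensor)
    qed (use ks' i B_subset in \<open>simp add: case_prod_beta\<close>)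
    also have "\<dots> = lsum ?G (\<lambda>p. ?t (y i \<triangleleft>\<^bsub>Y\<^esub> fst p i) (snd p)) ks"
    proof (rule lsum_cong)
      fix p assume p: "p \<in> set ks"
      show "?t (y i) ((\<lambda>(\<beta>, a). \<beta> i \<otimes> a) p) = ?t (y i \<triangleleft>\<^bsub>Y\<^esub> fst p i) (snd p)"
        using YA.tens_balanced [OF y [OF i] ks'(3) [OF p i], of "snd p"] ks'(2) [OF p] by (simp add: case_prod_beta)
    qed
    finally show ?thesis using eq [OF i] by simp
  qed
  have "lsum ?G (\<lambda>i. ?t (y i) (k i)) [0..<n] = lsum ?G (\<lambda>i. lsum ?G (\<lambda>p. ?t (y i \<triangleleft>\<^bsub>Y\<^esub> fst p i) (snd p)) ks) [0..<n]"
    by (rule lsum_cong) (use t in simp)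
  also have "\<dots> = lsum ?G (\<lambda>p. lsum ?G (\<lambda>i. ?t (y i \<triangleleft>\<^bsub>Y\<^esub> fst p i) (snd p)) [0..<n]) ks"
    by (rule lsum_swap [OF YA.abelian_group_tensor]) (use ks' y in \<open>simp add: YA.M.ract_closed\<close>)
  also have "\<dots> = \<zero>\<^bsub>?G\<^esub>"
  proof (rule lsum_zero [OF YA.abelian_group_tensor])
    fix p assume p: "p \<in> set ks"
    have "lsum ?G (\<lambda>i. ?t (y i \<triangleleft>\<^bsub>Y\<^esub> fst p i) (snd p)) [0..<n] = ?t (lsum Y (\<lambda>i. y i \<triangleleft>\<^bsub>Y\<^esub> fst p i) [0..<n]) (snd p)"
    proof (rule add_hom_lsum [where h = "\<lambda>u. ?t u (snd p)", symmetric])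
      show "add_hom Y ?G (\<lambda>u. ?t u (snd p))"
        using ks'(2) [OF p] YA.tens_add_left
        by (auto simp: add_hom_def YA.M.M.abelian_group_axioms YA.abelian_group_tensor)
    qed (use ks' [OF p] y in \<open>simp add: YA.M.ract_closed\<close>)
    also have "\<dots> = \<zero>\<^bsub>?G\<^esub>" using zero [of "fst p"] ks' [OF p] by (simp add: YA.tens_zero_left)
    finally show "lsum ?G (\<lambda>i. ?t (y i \<triangleleft>\<^bsub>Y\<^esub> fst p i) (snd p)) [0..<n] = \<zero>\<^bsub>?G\<^esub>" .
  qed
  finally show ?thesis .
qed

end

section \<open>Balanced pairings with the base ring\<close>

context
  fixes Y :: "('a, 'm, 'z) module_scheme" and P :: "('c \<Rightarrow> 'a, 'p, 'w) module_scheme" and \<phi> :: "'m \<Rightarrow> 'a \<Rightarrow> 'p"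
  assumes Y: "right_module B Y" and P: "right_module T P"
    and linear: "\<And>y. y \<in> carrier Y \<Longrightarrow> linear_map T AT P (\<phi> y)"
    and add: "\<And>y z a. \<lbrakk>y \<in> carrier Y; z \<in> carrier Y; a \<in> carrier A\<rbrakk> \<Longrightarrow> \<phi> (y \<oplus>\<^bsub>Y\<^esub> z) a = \<phi> y a \<oplus>\<^bsub>P\<^esub> \<phi> z a"
    and act: "\<And>y b a. \<lbrakk>y \<in> carrier Y; b \<in> carrier B; a \<in> carrier A\<rbrakk> \<Longrightarrow> \<phi> (y \<triangleleft>\<^bsub>Y\<^esub> b) a = \<phi> y (b \<otimes> a)"
begin

interpretation P: right_module T P by (rule P)
interpretation YA: tensor_product B Y LA by (rule tensor_productI [OF Y A_left_B])

lemma pairing_closed: "\<lbrakk>y \<in> carrier Y; a \<in> carrier A\<rbrakk> \<Longrightarrow> \<phi> y a \<in> carrier P"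
  using linear_map_closed [OF linear] by simp

lemma pairing_balanced: "balanced B Y LA P \<phi>"
proof (rule balancedI [OF P.M.abelian_group_axioms])
  fix y a b assume "y \<in> carrier Y" "a \<in> carrier LA" "b \<in> carrier LA"
  then show "\<phi> y (a \<oplus>\<^bsub>LA\<^esub> b) = \<phi> y a \<oplus>\<^bsub>P\<^esub> \<phi> y b"
    using linear_map_add [OF linear, of y a b] by simp
qed (simp_all add: pairing_closed add act)

text \<open>For a presentation of \<open>t\<close>, the vanishing of its image says that the tuple
  of right factors lies in the kernel of a map \<open>A^n \<rightarrow> P\<close>. On tuples over
  \<open>B\<close> in this kernel the corresponding sum in \<open>Y\<close> pairs with
  \<open>\<one>\<close> to zero, hence vanishes by \<open>inj\<close>. This serves both for the
  evaluation maps and for flatness.\<close>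

lemma pairing_injective:
  assumes gen: "generates_rational TYPE('u)"
    and universe: "infinite (UNIV :: 'u set)" "carrier A \<lesssim> (UNIV :: 'u set)"
    and inj: "\<And>y. \<lbrakk>y \<in> carrier Y; \<phi> y \<one> = \<zero>\<^bsub>P\<^esub>\<rbrakk> \<Longrightarrow> y = \<zero>\<^bsub>Y\<^esub>"
  shows "inj_on (tensor_lift P \<phi>) (carrier (tensor B Y LA))"
proof (rule add_hom_eq_zero_inj [OF YA.tensor_lift_additive [OF pairing_balanced]])
  note lift = YA.tensor_lift_additive [OF pairing_balanced]
  have gAT: "abelian_group AT" by (rule right_module_group [OF right_module_AT])
  fix t assume t: "t \<in> carrier (tensor B Y LA)" "tensor_lift P \<phi> t = \<zero>\<^bsub>P\<^esub>"
  obtain n :: nat and y a where y: "\<And>i. i < n \<Longrightarrow> y i \<in> carrier Y"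
    and a: "\<And>i. i < n \<Longrightarrow> a i \<in> carrier LA"
    and teq: "t = lsum (tensor B Y LA) (\<lambda>i. tens B Y LA (y i) (a i)) [0..<n]"
    using YA.tensor_index [OF t(1)] by blast
  let ?D = "direct_power {..<n} AT" and ?\<phi> = "\<lambda>k. lsum P (\<lambda>i. \<phi> (y i) (k i)) [0..<n]"
  note D = direct_power_right_module [OF right_module_AT, of "{..<n}"]
  interpret D: right_module T ?D by (rule D)
  have kc: "k i \<in> carrier A" if "k \<in> carrier ?D" "i < n" for k i
    using that by (auto simp: direct_power_simps [OF gAT])
  have fc: "\<phi> (y i) b \<in> carrier P" if "i < n" "b \<in> carrier A" for i b
    by (rule pairing_closed [OF y [OF that(1)] that(2)])
  have \<phi>: "linear_map T ?D P ?\<phi>"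
  proof (rule linear_mapI [OF right_module_group [OF D] P.M.abelian_group_axioms])
    fix k l assume kl: "k \<in> carrier ?D" "l \<in> carrier ?D"
    have "?\<phi> (k \<oplus>\<^bsub>?D\<^esub> l) = lsum P (\<lambda>i. \<phi> (y i) (k i) \<oplus>\<^bsub>P\<^esub> \<phi> (y i) (l i)) [0..<n]"
      using kc kl linear_map_add [OF linear [OF y]]
      by (intro lsum_cong) (simp add: direct_power_simps [OF gAT])
    also have "\<dots> = ?\<phi> k \<oplus>\<^bsub>P\<^esub> ?\<phi> l"
      by (rule lsum_add [OF P.M.abelian_group_axioms]) (use kc kl fc in simp_all)
    finally show "?\<phi> (k \<oplus>\<^bsub>?D\<^esub> l) = ?\<phi> k \<oplus>\<^bsub>P\<^esub> ?\<phi> l" .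
  next
    fix s k assume s: "s \<in> carrier T" and k: "k \<in> carrier ?D"
    have "?\<phi> (k \<triangleleft>\<^bsub>?D\<^esub> s) = lsum P (\<lambda>i. \<phi> (y i) (k i) \<triangleleft>\<^bsub>P\<^esub> s) [0..<n]"
      using kc k s linear_map_smult [OF linear [OF y] s]
      by (intro lsum_cong) (simp add: direct_power_simps [OF gAT] del: dual_module_simps(4))
    also have "\<dots> = ?\<phi> k \<triangleleft>\<^bsub>P\<^esub> s"
      by (rule add_hom_lsum [OF P.additive_ract_left [OF s], symmetric]) (use kc k fc in simp)
    finally show "?\<phi> (k \<triangleleft>\<^bsub>?D\<^esub> s) = ?\<phi> k \<triangleleft>\<^bsub>P\<^esub> s" .
  qed (use kc fc in \<open>auto intro!: lsum_closed P.M.abelian_group_axioms\<close>)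
  \<comment> \<open>A submodule over the dual ring, because the pairing is linear over it in the
    second argument.\<close>
  let ?K = "{k \<in> carrier ?D. ?\<phi> k = \<zero>\<^bsub>P\<^esub>}"
  have K: "closed_submodule T ?D ?K"
    unfolding closed_submodule_def
    using linear_map_zero [OF \<phi>] linear_map_add [OF \<phi>]
      linear_map_smult [OF \<phi>] D.ract_closed P.ract_zero_left D.M.a_closed D.M.zero_closed
    by (simp del: direct_power_simps)
  let ?k = "restrict a {..<n}"
  have "?k \<in> carrier ?D" using a by (auto simp: direct_power_simps [OF gAT])
  moreover have "?\<phi> ?k = tensor_lift P \<phi> t"
  proof -
    have "tensor_lift P \<phi> t = lsum P (\<lambda>i. tensor_lift P \<phi> (tens B Y LA (y i) (a i))) [0..<n]"
      unfolding teq by (rule add_hom_lsum [OF lift]) (use y a in simp)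
    also have "\<dots> = ?\<phi> ?k"
      using y a by (intro lsum_cong) (simp add: YA.tensor_lift_tens [OF pairing_balanced])
    finally show ?thesis by simp
  qed
  ultimately have k: "?k \<in> ?K" using t(2) by simp
  \<comment> \<open>Balancing turns \<open>\<phi>(y \<beta>, 1)\<close> into
    \<open>\<phi>(y, \<beta>)\<close>, so membership of \<open>\<beta>\<close> in the kernel becomes
    a condition at \<open>\<one>\<close>.\<close>
  have zero: "lsum Y (\<lambda>i. y i \<triangleleft>\<^bsub>Y\<^esub> \<beta> i) [0..<n] = \<zero>\<^bsub>Y\<^esub>"
    if \<beta>: "\<beta> \<in> ?K" "\<And>i. i < n \<Longrightarrow> \<beta> i \<in> carrier B" for \<beta>
  proof (rule inj)
    have c: "y i \<triangleleft>\<^bsub>Y\<^esub> \<beta> i \<in> carrier Y" if "i \<in> set [0..<n]" for i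
      using that \<beta> y YA.M.ract_closed by simp
    show "lsum Y (\<lambda>i. y i \<triangleleft>\<^bsub>Y\<^esub> \<beta> i) [0..<n] \<in> carrier Y" by (rule lsum_closed [OF YA.M.M.abelian_group_axioms c])
    have "add_hom Y P (\<lambda>y. \<phi> y \<one>)"
      by (auto simp: add_hom_def YA.M.M.abelian_group_axioms P.M.abelian_group_axioms pairing_closed add)
    from add_hom_lsum [OF this c]
    have "\<phi> (lsum Y (\<lambda>i. y i \<triangleleft>\<^bsub>Y\<^esub> \<beta> i) [0..<n]) \<one> = lsum P (\<lambda>i. \<phi> (y i \<triangleleft>\<^bsub>Y\<^esub> \<beta> i) \<one>) [0..<n]" .
    also have "\<dots> = ?\<phi> \<beta>" using \<beta> y B_subset by (intro lsum_cong) (simp add: act)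
    finally show "\<phi> (lsum Y (\<lambda>i. y i \<triangleleft>\<^bsub>Y\<^esub> \<beta> i) [0..<n]) \<one> = \<zero>\<^bsub>P\<^esub>" using \<beta>(1) by simp
  qed
  have "lsum (tensor B Y LA) (\<lambda>i. tens B Y LA (y i) (?k i)) [0..<n] = \<zero>\<^bsub>tensor B Y LA\<^esub>"
    by (rule tensor_tuple_zero [OF gen universe Y y K k zero])
  moreover have "t = lsum (tensor B Y LA) (\<lambda>i. tens B Y LA (y i) (?k i)) [0..<n]"
    unfolding teq by (rule lsum_cong) simp
  ultimately show "t = \<zero>\<^bsub>tensor B Y LA\<^esub>" by simp
qed

end

lemma HomT_eval_injective:
  assumes gen: "generates_rational TYPE('u)"
    and universe: "infinite (UNIV :: 'u set)" "carrier A \<lesssim> (UNIV :: 'u set)"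
    and P: "right_module T P"
  shows "inj_on (tensor_lift P (\<lambda>f a. f a)) (carrier (tensor B (HomT P) LA))"
proof (rule pairing_injective [OF right_module_HomT [OF P] P _ _ _ gen universe])
  fix h assume "h \<in> carrier (HomT P)" and h0: "h \<one> = \<zero>\<^bsub>P\<^esub>"
  then have h: "h \<in> lin_hom T AT P" by simp
  have "\<zero>\<^bsub>HomT P\<^esub> \<in> carrier (HomT P)"
    using right_module_group [OF right_module_HomT [OF P]] by (simp add: abelian_group_def abelian_monoid.zero_closed del: HomT_simps)
  then have z: "\<zero>\<^bsub>HomT P\<^esub> \<in> lin_hom T AT P" by (simp only: HomT_simps(1))
  show "h = \<zero>\<^bsub>HomT P\<^esub>"
  proof (rule lin_hom_ext [OF h z])
    fix a assume "a \<in> carrier AT"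
    then show "h a = \<zero>\<^bsub>HomT P\<^esub> a"
      using hom_T_apply [OF P h, of a] h0 right_module.ract_zero_left [OF P iota_closed]
      by simp
  qed
qed (simp_all add: hom_T_linear [OF P])

text \<open>An injection \<open>K \<rightarrow> L\<close> is replaced by the inclusion of the
  preimage \<open>F'\<close> of its image into the free module \<open>F\<close> on \<open>L\<close>.
  Elements of \<open>F'\<close> pair with \<open>A\<close> into a direct sum of copies of
  \<open>A\<close>, a module over the dual ring, so that the criterion for pairings applies to
  \<open>F'\<close>. Right exactness then descends from \<open>F\<close> to \<open>L\<close>. The
  type \<open>'v\<close> is arbitrary, since the criterion works with finite tuples.\<close>

lemma generates_rational_flat:
  assumes gen: "generates_rational TYPE('u)"
    and universe: "infinite (UNIV :: 'u set)" "carrier A \<lesssim> (UNIV :: 'u set)"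
  shows "flat TYPE('v) B LA"
  unfolding flat_def
proof (intro conjI allI ballI impI, rule A_left_B, elim conjE)
  fix K L :: "('a, 'v) module" and j
  assume "j \<in> lin_hom B K L" and K: "right_module B K" and L: "right_module B L" and inj: "inj_on j (carrier K)"
  then have j: "linear_map B K L j" by (intro lin_hom_linear right_module_group)
  interpret K: right_module B K by (rule K)
  interpret LM: right_module B L by (rule L)
  interpret KA: tensor_product B K LA by (rule tensor_productI [OF K A_left_B])
  interpret LA: tensor_product B L LA by (rule tensor_productI [OF L A_left_B])
  have BB: "right_module B (right_regular B)" by (rule right_regular_module [OF ring_B])
  have gB: "abelian_group (right_regular B)" by (rule right_module_group [OF BB])
  let ?A = LA and ?F = "direct_power (carrier L) (right_regular B)"
  note dp = direct_power_simps [OF gB]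
  have F: "right_module B ?F" by (rule direct_power_right_module [OF BB])
  interpret F: right_module B ?F by (rule F)
  interpret FA: tensor_product B ?F ?A by (rule tensor_productI [OF F A_left_B])
  let ?\<pi> = "power_sum (right_regular B) (carrier L) L (\<lambda>l b. l \<triangleleft>\<^bsub>L\<^esub> b)"
  have lb: "linear_map B (right_regular B) L (\<lambda>b. l \<triangleleft>\<^bsub>L\<^esub> b)" if "l \<in> carrier L" for l
    using that LM.ract_closed LM.ract_r_distr LM.ract_assoc
    by (intro linear_mapI gB LM.M.abelian_group_axioms) auto
  have \<pi>: "linear_map B ?F L ?\<pi>" by (rule linear_map_power_sum [OF BB L lb])
  have oneB: "\<one> \<in> carrier B" using monoid.one_closed [OF ring.is_monoid [OF ring_B]] by simp
  define s where "s l = power_single (right_regular B) (carrier L) l \<one>" for l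
  have sF: "s l \<in> carrier ?F" if "l \<in> carrier L" for l
    unfolding s_def using that oneB by (intro power_single_closed [OF gB]) simp_all
  have \<pi>s: "?\<pi> (s l) = l" if "l \<in> carrier L" for l
  proof -
    have "?\<pi> (s l) = l \<triangleleft>\<^bsub>L\<^esub> \<one>"
      unfolding s_def
      using power_sum_single [OF gB linear_map_additive [OF lb] LM.M.abelian_group_axioms that, where a = \<one>] oneB by simp
    then show ?thesis using LM.ract_one [OF that] by simp
  qed
  define F' where "F' = {w \<in> carrier ?F. ?\<pi> w \<in> j ` carrier K}"
  have jK: "closed_submodule B L (j ` carrier K)" by (rule linear_image_closed_submodule [OF K L j])
  have F': "closed_submodule B ?F F'"
    using jK F.ract_closed F.M.a_closed F.M.zero_closed
    by (auto simp: closed_submodule_def F'_def linear_map_zero [OF \<pi>]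
        linear_map_add [OF \<pi>] linear_map_smult [OF \<pi>] simp del: direct_power_simps)
  let ?F' = "?F\<lparr>carrier := F'\<rparr>"
  have mF': "right_module B ?F'" by (rule right_module_submodule [OF F F'])
  interpret F'A: tensor_product B ?F' ?A by (rule tensor_productI [OF mF' A_left_B])
  have incl: "linear_map B ?F' ?F (\<lambda>w. w)" by (rule submodule_inclusion_linear [OF F F'])
  define q where "q w = inv_into (carrier K) j (?\<pi> w)" for w
  have jq: "q w \<in> carrier K" "j (q w) = ?\<pi> w" if "w \<in> F'" for w
    using that unfolding q_def F'_def by (auto simp: inv_into_into f_inv_into_f)
  have q: "linear_map B ?F' K q"
  proof -
    have "linear_map B ?F' (L\<lparr>carrier := j ` carrier K\<rparr>) ?\<pi>"
      using linear_map_add [OF \<pi>] linear_map_smult [OF \<pi>]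
      by (intro linear_mapI right_module_group [OF mF'] right_module_group [OF right_module_submodule [OF L jK]])
        (simp_all add: F'_def del: direct_power_simps)
    from linear_map_comp [OF this linear_map_inv_into [OF K L j inj]] show ?thesis unfolding q_def .
  qed
  let ?tm = "tensor_map B" and ?z = "\<lambda>M. \<zero>\<^bsub>tensor B M ?A\<^esub>"
  have gAT: "abelian_group AT" by (rule right_module_group [OF right_module_AT])
  let ?E = "direct_power (carrier L) AT"
  have E: "right_module T ?E" by (rule direct_power_right_module [OF right_module_AT])
  have wl: "w l \<in> carrier B" "w l \<in> carrier A" if "w \<in> carrier ?F" "l \<in> carrier L" for w l
    using that B_subset by (auto simp: dp)
  \<comment> \<open>Multiplication of a finite family over \<open>B\<close> by \<open>a\<close>; it
    is linear over the dual ring in \<open>a\<close>, because left multiplications by elements of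
    \<open>B\<close> are.\<close>
  define \<phi> where "\<phi> w a = (\<lambda>l\<in>carrier L. w l \<otimes> a)" for w a
  have \<phi>: "linear_map T AT ?E (\<phi> w)" if w: "w \<in> carrier ?F" for w
  proof (rule linear_mapI [OF gAT right_module_group [OF E]])
    fix a assume "a \<in> carrier AT"
    then have a: "a \<in> carrier A" by simp
    have "finite {l \<in> carrier L. w l \<noteq> \<zero>}" using w by (simp add: dp)
    moreover have "{l \<in> carrier L. \<phi> w a l \<noteq> \<zero>} \<subseteq> {l \<in> carrier L. w l \<noteq> \<zero>}" using a by (auto simp: \<phi>_def)
    ultimately have "finite {l \<in> carrier L. \<phi> w a l \<noteq> \<zero>}" by (rule rev_finite_subset)
    then show "\<phi> w a \<in> carrier ?E" using wl(2) [OF w] a by (simp add: direct_power_simps [OF gAT] \<phi>_def)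
  next
    fix f a assume f: "f \<in> carrier T" and a: "a \<in> carrier AT"
    have "w l \<otimes> (a \<triangleleft>\<^bsub>AT\<^esub> f) = (w l \<otimes> a) \<triangleleft>\<^bsub>AT\<^esub> f" if "l \<in> carrier L" for l
      by (rule linear_map_smult [OF B_act_linear [OF wl(1) [OF w that]] f a])
    then show "\<phi> w (a \<triangleleft>\<^bsub>AT\<^esub> f) = \<phi> w a \<triangleleft>\<^bsub>?E\<^esub> f"
      unfolding \<phi>_def direct_power_simps [OF gAT] by (intro restrict_ext) (simp del: dual_module_simps(4))
  qed (use wl(2) [OF w] in \<open>auto simp: direct_power_simps [OF gAT] \<phi>_def L.R.r_distr intro!: restrict_ext\<close>)
  have \<phi>_add: "\<phi> (v \<oplus>\<^bsub>?F\<^esub> w) a = \<phi> v a \<oplus>\<^bsub>?E\<^esub> \<phi> w a"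
    if "v \<in> carrier ?F" "w \<in> carrier ?F" "a \<in> carrier A" for v w a
    using wl(2) [OF that(1)] wl(2) [OF that(2)] that(3)
    unfolding \<phi>_def dp direct_power_simps [OF gAT] by (intro restrict_ext) (simp add: L.R.l_distr)
  have \<phi>_act: "\<phi> (w \<triangleleft>\<^bsub>?F\<^esub> b) a = \<phi> w (b \<otimes> a)" if "w \<in> carrier ?F" "b \<in> carrier B" "a \<in> carrier A" for w b a
    using wl(2) [OF that(1)] B_subset [OF that(2)] that(3)
    unfolding \<phi>_def dp by (intro restrict_ext) (simp add: L.R.m_assoc)
  have bal: "balanced B ?F ?A ?E \<phi>"
    by (rule pairing_balanced [where \<phi> = \<phi>, OF F E \<phi> \<phi>_add \<phi>_act])
  note lift = FA.tensor_lift_additive [OF bal]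
  have F'F: "w \<in> carrier ?F" if "w \<in> carrier ?F'" for w using that by (simp add: F'_def)
  have bal': "balanced B ?F' ?A ?E \<phi>"
    by (rule pairing_balanced [where \<phi> = \<phi>, OF mF' E \<phi> [OF F'F]]) (use \<phi>_add \<phi>_act F'F in \<open>simp_all del: direct_power_simps\<close>)
  have inj_lift: "inj_on (tensor_lift ?E \<phi>) (carrier (tensor B ?F' ?A))"
  proof (rule pairing_injective [where \<phi> = \<phi>, OF mF' E \<phi> [OF F'F] _ _ gen universe])
    fix w assume w': "w \<in> carrier ?F'" and eq: "\<phi> w \<one> = \<zero>\<^bsub>?E\<^esub>"
    note w = F'F [OF w']
    have "w l = \<zero>" if l: "l \<in> carrier L" for l
      using fun_cong [OF eq, of l] l wl(2) [OF w l] by (simp add: \<phi>_def direct_power_simps [OF gAT])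
    then show "w = \<zero>\<^bsub>?F'\<^esub>" using w by (auto simp: dp PiE_iff intro!: extensionalityI [of _ "carrier L"])
  qed (use \<phi>_add \<phi>_act F'F in \<open>simp_all del: direct_power_simps\<close>)
  \<comment> \<open>The injective map on \<open>F' \<otimes> A\<close> factors through
    \<open>F \<otimes> A\<close>, so the inclusion stays injective after tensoring.\<close>
  have inj_incl: "d = ?z ?F'" if d: "d \<in> carrier (tensor B ?F' ?A)" "?tm ?F ?A (\<lambda>w. w) d = ?z ?F" for d
  proof (rule inj_onD [OF inj_lift _ d(1)])
    have "tensor_lift ?E \<phi> d = tensor_lift ?E \<phi> (?tm ?F ?A (\<lambda>w. w) d)"
      by (rule F'A.add_hom_tensor_eq [OF F'A.tensor_lift_additive [OF bal']
            add_hom_comp [OF tensor_map_additive [OF mF' F A_left_B incl] lift] _ d(1)])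
        (use F'F in \<open>simp add: tensor_map_tens [OF mF' F A_left_B incl] F'A.tensor_lift_tens [OF bal']
          FA.tensor_lift_tens [OF bal] del: direct_power_simps\<close>)
    then show "tensor_lift ?E \<phi> d = tensor_lift ?E \<phi> (?z ?F')"
      unfolding d(2) add_hom_zero [OF lift] add_hom_zero [OF F'A.tensor_lift_additive [OF bal']] .
    show "?z ?F' \<in> carrier (tensor B ?F' ?A)" by (rule F'A.tensor_zero_closed)
  qed
  show "inj_on (?tm L ?A j) (carrier (tensor B K ?A))"
  proof (rule add_hom_eq_zero_inj [OF tensor_map_additive [OF K L A_left_B j]])
    fix t assume t: "t \<in> carrier (tensor B K ?A)" "?tm L ?A j t = ?z L"
    obtain ps where ps: "set ps \<subseteq> carrier K \<times> carrier ?A"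
      "t = lsum (tensor B K ?A) (\<lambda>(k, a). tens B K ?A k a) ps"
      using KA.tensor_list [OF t(1)] .
    have jk: "j k \<in> carrier L" if "k \<in> carrier K" for k using linear_map_closed [OF j that] .
    have sj: "s (j k) \<in> F'" "q (s (j k)) = k" if k: "k \<in> carrier K" for k
      using sF [OF jk [OF k]] \<pi>s [OF jk [OF k]] k inj by (simp_all add: F'_def q_def del: direct_power_simps)
    \<comment> \<open>A lift of \<open>t\<close> to \<open>F' \<otimes> A\<close>: each
      \<open>k\<close> is replaced by the basis vector at \<open>j k\<close>, which \<open>q\<close>
      sends back to \<open>k\<close>.\<close>
    define rs where "rs = map (\<lambda>(k, a). (s (j k), a)) ps"
    have rs: "set rs \<subseteq> carrier ?F' \<times> carrier ?A" using ps(1) sj by (auto simp: rs_def)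
    define t' where "t' = lsum (tensor B ?F' ?A) (\<lambda>(w, a). tens B ?F' ?A w a) rs"
    have t'c: "t' \<in> carrier (tensor B ?F' ?A)" unfolding t'_def by (rule F'A.tens_lsum_closed [OF rs])
    have qt': "?tm K ?A q t' = t"
      unfolding t'_def tensor_map_lsum [OF mF' K A_left_B q rs] ps(2) unfolding rs_def lsum_map
      using ps(1) sj by (intro lsum_cong) auto
    let ?u = "?tm ?F ?A (\<lambda>w. w) t'"
    have u: "?u \<in> carrier (tensor B ?F ?A)" by (rule tensor_map_closed [OF mF' F A_left_B incl t'c])
    have "?tm L ?A ?\<pi> ?u = ?tm L ?A (\<lambda>w. ?\<pi> w) t'"
      by (rule tensor_map_comp [OF mF' F L A_left_B incl \<pi> t'c])
    also have "\<dots> = ?tm L ?A (\<lambda>w. j (q w)) t'"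
      by (rule tensor_map_cong [OF mF' L A_left_B linear_map_comp [OF q j] _ t'c]) (simp add: jq)
    also have "\<dots> = ?tm L ?A j (?tm K ?A q t')"
      by (rule tensor_map_comp [OF mF' K L A_left_B q j t'c, symmetric])
    finally have u0: "?tm L ?A ?\<pi> ?u = ?z L" using t(2) qt' by simp
    have surj: "carrier L \<subseteq> ?\<pi> ` carrier ?F"
    proof
      fix l assume l: "l \<in> carrier L"
      show "l \<in> ?\<pi> ` carrier ?F" by (rule image_eqI, rule \<pi>s [OF l, symmetric], rule sF [OF l])
    qed
    \<comment> \<open>The image of the lift in \<open>F \<otimes> A\<close> dies in
      \<open>L \<otimes> A\<close>, so it comes from the kernel of \<open>?\<pi>\<close>. That
      kernel is contained in \<open>F'\<close> and annihilated by \<open>q\<close>.\<close>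
    obtain qs where qs: "set qs \<subseteq> {w \<in> carrier ?F. ?\<pi> w = \<zero>\<^bsub>L\<^esub>} \<times> carrier ?A"
      "?u = lsum (tensor B ?F ?A) (\<lambda>(w, a). tens B ?F ?A w a) qs"
      by (rule tensor_right_exact [OF F L A_left_B \<pi> surj u u0])
    have j0: "j \<zero>\<^bsub>K\<^esub> = \<zero>\<^bsub>L\<^esub>" by (rule linear_map_zero [OF j])
    have qsF: "w \<in> F'" "q w = \<zero>\<^bsub>K\<^esub>" if w: "w \<in> carrier ?F" "?\<pi> w = \<zero>\<^bsub>L\<^esub>" for w
    proof -
      show "w \<in> F'" unfolding F'_def
      proof (intro CollectI conjI w(1))
        show "?\<pi> w \<in> j ` carrier K" unfolding w(2) by (rule image_eqI, rule j0 [symmetric], rule K.M.zero_closed)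
      qed
      then show "q w = \<zero>\<^bsub>K\<^esub>" using jq [of w] w(2) j0 inj_onD [OF inj, of "q w" "\<zero>\<^bsub>K\<^esub>"] by simp
    qed
    have qs': "set qs \<subseteq> carrier ?F' \<times> carrier ?A"
    proof
      fix p assume "p \<in> set qs"
      then have "fst p \<in> carrier ?F" "?\<pi> (fst p) = \<zero>\<^bsub>L\<^esub>" "snd p \<in> carrier ?A" using qs(1) by auto
      then show "p \<in> carrier ?F' \<times> carrier ?A" using qsF(1) [of "fst p"] by (simp add: mem_Times_iff)
    qed
    define t'' where "t'' = lsum (tensor B ?F' ?A) (\<lambda>(w, a). tens B ?F' ?A w a) qs"
    have t''c: "t'' \<in> carrier (tensor B ?F' ?A)" unfolding t''_def by (rule F'A.tens_lsum_closed [OF qs'])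
    have qt'': "?tm K ?A q t'' = ?z K"
      unfolding t''_def tensor_map_lsum [OF mF' K A_left_B q qs']
    proof (rule lsum_zero [OF KA.abelian_group_tensor])
      fix p assume "p \<in> set qs"
      then have "fst p \<in> carrier ?F" "?\<pi> (fst p) = \<zero>\<^bsub>L\<^esub>" "snd p \<in> carrier ?A" using qs(1) by auto
      then show "(\<lambda>(w, a). tens B K ?A (q w) a) p = ?z K"
        using qsF(2) [of "fst p"] by (simp add: case_prod_beta KA.tens_zero_left)
    qed
    have it'': "?tm ?F ?A (\<lambda>w. w) t'' = ?u"
      unfolding t''_def qs(2) by (rule tensor_map_lsum [OF mF' F A_left_B incl qs'])
    interpret GF': abelian_group "tensor B ?F' ?A" by (rule F'A.abelian_group_tensor)
    interpret GF: abelian_group "tensor B ?F ?A" by (rule FA.abelian_group_tensor)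
    \<comment> \<open>Both lifts have the same image in \<open>F \<otimes> A\<close> and therefore
      coincide; \<open>q\<close> sends one to \<open>t\<close> and the other to zero.\<close>
    let ?d = "t' \<ominus>\<^bsub>tensor B ?F' ?A\<^esub> t''"
    have "?tm ?F ?A (\<lambda>w. w) ?d = ?z ?F"
      using add_hom_minus [OF tensor_map_additive [OF mF' F A_left_B incl] t'c t''c] it'' u
      by (simp add: GF.diff_eq_zero_iff)
    then have "?d = ?z ?F'" using t'c t''c by (intro inj_incl) simp_all
    then have "t' = t''" using t'c t''c by (simp add: GF'.diff_eq_zero_iff)
    then show "t = ?z K" using qt' qt'' by simp
  qed
qed

section \<open>The structure maps\<close>

lemma colin_hom_module_eq: "comodule A C M \<Longrightarrow> colin_hom_module A C x M = HomT (dual_module M)"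
  by (simp add: colin_hom_module_def dual_hom_module_def hom_module_def colin_hom_eq_lin_hom comodule_AC)

lemma induced_simps [simp]:
  "carrier (induced_comodule A C x X) = carrier (tensor B X LA)"
  by (simp add: induced_comodule_def tensor_rmod_def Let_def)

lemma tensor_lift_dual_module [simp]: "tensor_lift (dual_module M) = tensor_lift M"
  by (simp add: dual_module_def)

lemma Psi'_bijective_iff:
  assumes "comodule A C M"
  shows "\<Psi>'_bijective A C x M \<longleftrightarrow>
    bij_betw (eval_hom M) (carrier (tensor B (HomT (dual_module M)) LA)) (carrier M)"
  unfolding \<Psi>'_bijective_def colin_hom_module_eq [OF assms] induced_simps
  by (rule bij_betw_cong) (simp add: \<Psi>'_def colin_hom_module_eq [OF assms])

text \<open>Presentations of tensors by lists and elements of the trace are given by the same data,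
  sums of values \<open>h(a)\<close>.\<close>

lemma HomT_eval_image:
  assumes P: "right_module T P"
  shows "eval_hom P ` carrier (tensor B (HomT P) LA) = trace T AT P"
proof -
  interpret HA: tensor_product B "HomT P" LA by (rule HomT_tensor_product [OF P])
  show ?thesis
  proof (intro equalityI subsetI)
    fix p assume "p \<in> eval_hom P ` carrier (tensor B (HomT P) LA)"
    then obtain t where t: "t \<in> carrier (tensor B (HomT P) LA)" "p = eval_hom P t" by auto
    obtain ks where ks: "set ks \<subseteq> carrier (HomT P) \<times> carrier LA"
      "t = lsum (tensor B (HomT P) LA) (\<lambda>(f, a). tens B (HomT P) LA f a) ks"
      using HA.tensor_list [OF t(1)] .
    have "set ks \<subseteq> lin_hom T AT P \<times> carrier A" using ks(1) by simp
    then show "p \<in> trace T AT P" using eval_hom_lsum [OF P] t(2) ks(2) traceI [of ks T AT P] by simp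
  next
    fix p assume "p \<in> trace T AT P"
    then obtain ks where ks: "set ks \<subseteq> lin_hom T AT P \<times> carrier A" "p = lsum P (\<lambda>(f, a). f a) ks"
      by (auto simp: trace_def)
    show "p \<in> eval_hom P ` carrier (tensor B (HomT P) LA)"
      by (rule image_eqI [OF _ HA.tens_lsum_closed [of ks]]) (use ks eval_hom_lsum [OF P ks(1)] in simp_all)
  qed
qed

lemma generates_rational_Psi':
  fixes M :: "('a, 'c, 'm) comodule"
  assumes gen: "generates_rational TYPE('u)"
    and universe: "infinite (UNIV :: 'u set)" "carrier A \<lesssim> (UNIV :: 'u set)"
    and M: "comodule A C M" "carrier M \<lesssim> (UNIV :: 'u set)"
  shows "\<Psi>'_bijective A C x M"
proof -
  note P = right_module_dual [OF M(1)]
  have "carrier (dual_module M) \<subseteq> trace T AT (dual_module M)"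
    using generates_rationalD [OF gen rational_dual_module [OF M(1)]] M(2) by simp
  moreover have "trace T AT (dual_module M) \<subseteq> carrier M"
    using trace_closed_submodule [OF right_module_AT P] by (simp add: closed_submodule_def)
  ultimately show ?thesis
    using HomT_eval_injective [OF gen universe P] HomT_eval_image [OF P]
    unfolding Psi'_bijective_iff [OF M(1)] bij_betw_def by simp
qed

lemma Psi'_bijective_trace:
  assumes M: "comodule A C M" and bij: "\<Psi>'_bijective A C x M"
  shows "carrier M \<subseteq> trace T AT (dual_module M)"
  using bij HomT_eval_image [OF right_module_dual [OF M]]
  unfolding Psi'_bijective_iff [OF M] bij_betw_def by simp

lemma comodule_right_B: "comodule A C M \<Longrightarrow> right_module B M"
  by (rule right_module_restrict_B [OF comodule.right])

section \<open>Induced comodules\<close>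

context
  fixes X :: "('a, 'n) module"
  assumes X: "right_module B X"
begin

interpretation X: tensor_product B X LA by (rule tensor_productI [OF X A_left_B])

abbreviation "TX \<equiv> tensor_rmod B X LA RA"

lemma TX_module: "right_module A TX"
  by (rule X.right_module_tensor_rmod [OF right_regular]) (simp_all add: L.R.m_assoc B_subset)

lemma TX_act: "\<lbrakk>a \<in> carrier A; n \<in> carrier X; b \<in> carrier A\<rbrakk>
    \<Longrightarrow> tens B X LA n b \<triangleleft>\<^bsub>TX\<^esub> a = tens B X LA n (b \<otimes> a)"
  using X.rmod_act_tens [OF right_regular, of a n b] by (simp add: L.R.m_assoc B_subset)

lemma TX_simps: "carrier TX = carrier (tensor B X LA)" "add TX = add (tensor B X LA)"
  "\<zero>\<^bsub>TX\<^esub> = \<zero>\<^bsub>tensor B X LA\<^esub>"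
  by (simp_all add: tensor_rmod_def)

lemma induced_comodule_eq: "induced_comodule A C x X =
    with_coact TX (tensor_lift (tensor A TX C) (\<lambda>n a. tens A TX C (tens B X LA n \<one>) (x \<star> a)))"
  by (simp add: induced_comodule_def Let_def)

lemma induced_module: "right_module A (induced_comodule A C x X)"
  unfolding induced_comodule_eq by (rule right_module_with_coact [OF TX_module])

interpretation XC: tensor_product A TX C by (rule tensor_product_C [OF TX_module])

lemma balanced_induced_coact:
  "balanced B X LA (tensor A TX C)
    (\<lambda>n a. tens A TX C (tens B X LA n \<one>) (x \<star> a))"
proof (rule balancedI [OF XC.abelian_group_tensor])
  have c: "tens B X LA n a \<in> carrier TX" if "n \<in> carrier X" "a \<in> carrier A" for n a
    using that X.tens_closed by (simp add: TX_simps)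
  fix n a assume na: "n \<in> carrier X" "a \<in> carrier LA"
  then show "tens A TX C (tens B X LA n \<one>) (x \<star> a) \<in> carrier (tensor A TX C)"
    using c by (intro XC.tens_closed) (simp_all add: xa_closed)
  show "tens A TX C (tens B X LA (n \<oplus>\<^bsub>X\<^esub> n') \<one>) (x \<star> a)
      = tens A TX C (tens B X LA n \<one>) (x \<star> a) \<oplus>\<^bsub>tensor A TX C\<^esub>
        tens A TX C (tens B X LA n' \<one>) (x \<star> a)" if "n' \<in> carrier X" for n'
    using na that c XC.tens_add_left [OF c c xa_closed, of n \<one> n' \<one> a] X.tens_add_left [of n n' \<one>]
    by (simp add: TX_simps)
  show "tens A TX C (tens B X LA n \<one>) (x \<star> (a \<oplus>\<^bsub>LA\<^esub> a'))
      = tens A TX C (tens B X LA n \<one>) (x \<star> a) \<oplus>\<^bsub>tensor A TX C\<^esub>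
        tens A TX C (tens B X LA n \<one>) (x \<star> a')" if "a' \<in> carrier LA" for a'
    using na that XC.tens_add_right [OF c xa_closed xa_closed, of n \<one> a a'] RC.ract_r_distr [of a a' x] x_closed
    by simp
  show "tens A TX C (tens B X LA (n \<triangleleft>\<^bsub>X\<^esub> b) \<one>) (x \<star> a)
      = tens A TX C (tens B X LA n \<one>) (x \<star> (b \<odot>\<^bsub>LA\<^esub> a))" if b: "b \<in> carrier B" for b
  proof -
    have bA: "b \<in> carrier A" by (rule B_subset [OF b])
    have "tens B X LA (n \<triangleleft>\<^bsub>X\<^esub> b) \<one> = tens B X LA n \<one> \<triangleleft>\<^bsub>TX\<^esub> b"
      using X.tens_balanced [of n b \<one>] TX_act [of b n \<one>] na b bA by simp
    \<comment> \<open>As \<open>b\<close> commutes with \<open>x\<close>, it can be pulled out to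
      the left and moved across the outer tensor sign.\<close>
    moreover have "x \<star> (b \<otimes> a) = b \<bullet> (x \<star> a)"
      using RC.ract_assoc [of b a x] bimodule [of b a x] B_commutes [OF b] bA na x_closed by simp
    ultimately show ?thesis
      using XC.tens_balanced [OF c bA xa_closed, of n \<one> a] na by simp
  qed
qed

lemma induced_coact_tens:
  "\<lbrakk>n \<in> carrier X; a \<in> carrier A\<rbrakk> \<Longrightarrow> coact (induced_comodule A C x X) (tens B X LA n a)
    = tens A TX C (tens B X LA n \<one>) (x \<star> a)"
  unfolding induced_comodule_eq with_coact_simps by (rule X.tensor_lift_tens [OF balanced_induced_coact]) simp_all

lemma induced_coact_additive:
  "add_hom (tensor B X LA) (tensor A TX C) (coact (induced_comodule A C x X))"
  unfolding induced_comodule_eq with_coact_simps by (rule X.tensor_lift_additive [OF balanced_induced_coact])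

text \<open>The maps considered are \<open>n \<otimes> a \<mapsto> e(n) a\<close> for a \<open>B\<close>-linear map \<open>e\<close> into the coinvariants of \<open>M\<close>.\<close>

lemma induced_colinear:
  assumes M: "comodule A C M" and e: "\<And>n. n \<in> carrier X \<Longrightarrow> e n \<in> coinv A C x M"
    and e_lin: "linear_map B X M e"
    and \<psi>: "\<And>n a. \<lbrakk>n \<in> carrier X; a \<in> carrier A\<rbrakk> \<Longrightarrow> \<psi> n a = e n \<triangleleft>\<^bsub>M\<^esub> a"
  shows "restrict (tensor_lift M \<psi>) (carrier (induced_comodule A C x X)) \<in> colin_hom A C (induced_comodule A C x X) M"
proof -
  interpret MC: tensor_product A M C by (rule tensor_product_C [OF comodule.right [OF M]])
  let ?I = "induced_comodule A C x X" and ?\<phi> = "tensor_lift M \<psi>" and ?G = "tensor B X LA"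
  have ec: "e n \<in> carrier M" if "n \<in> carrier X" for n using linear_map_closed [OF e_lin that] .
  have bal: "balanced B X LA M \<psi>"
  proof (rule balancedI [OF MC.M.M.abelian_group_axioms])
    fix n b a assume "n \<in> carrier X" "b \<in> carrier B" "a \<in> carrier LA"
    then show "\<psi> (n \<triangleleft>\<^bsub>X\<^esub> b) a = \<psi> n (b \<odot>\<^bsub>LA\<^esub> a)"
      using ec X.M.ract_closed by (simp add: \<psi> linear_map_smult [OF e_lin] MC.M.ract_assoc B_subset)
  qed (use ec X.M.M.a_closed linear_map_add [OF e_lin]
        in \<open>simp_all add: \<psi> MC.M.ract_closed MC.M.ract_l_distr MC.M.ract_r_distr\<close>)
  note \<phi>a = X.tensor_lift_additive [OF bal]
  have \<phi>t: "?\<phi> (tens B X LA n a) = e n \<triangleleft>\<^bsub>M\<^esub> a" if "n \<in> carrier X" "a \<in> carrier A" for n a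
    using X.tensor_lift_tens [OF bal, of n a] that \<psi> by simp
  have \<phi>l: "linear_map A TX M ?\<phi>"
  proof (rule linear_mapI [OF right_module_group [OF TX_module] MC.M.M.abelian_group_axioms])
    fix r t assume r: "r \<in> carrier A" and "t \<in> carrier TX"
    then have t: "t \<in> carrier ?G" by (simp add: TX_simps)
    have "add_hom ?G ?G (\<lambda>t. t \<triangleleft>\<^bsub>TX\<^esub> r)"
      using right_module.additive_ract_left [OF TX_module r] X.abelian_group_tensor
      by (simp add: add_hom_def TX_simps)
    from add_hom_comp [OF this \<phi>a] add_hom_comp [OF \<phi>a MC.M.additive_ract_left [OF r]] _ t
    show "?\<phi> (t \<triangleleft>\<^bsub>TX\<^esub> r) = ?\<phi> t \<triangleleft>\<^bsub>M\<^esub> r"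
      by (rule X.add_hom_tensor_eq) (use r ec in \<open>simp add: TX_act \<phi>t MC.M.ract_assoc\<close>)
  qed (use add_hom_closed [OF \<phi>a] add_hom_add [OF \<phi>a] in \<open>simp_all add: TX_simps\<close>)
  let ?r = "restrict ?\<phi> (carrier ?I)"
  have \<phi>I: "linear_map A ?I M ?\<phi>"
    using \<phi>l right_module_group [OF induced_module] unfolding induced_comodule_eq
    by (simp add: linear_map_def add_hom_def)
  have rl: "?r \<in> lin_hom A ?I M" by (rule restrict_lin_hom [OF \<phi>I]) (simp add: induced_module)
  have rI: "linear_map A TX M ?r"
    by (rule linear_map_cong [OF \<phi>l]) (simp_all add: TX_module TX_simps)
  have "coact M (?\<phi> t) = tensor_map A M C ?r (coact ?I t)" if t: "t \<in> carrier ?G" for t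
  proof (rule X.add_hom_tensor_eq [OF add_hom_comp [OF \<phi>a coact_additive [OF M]]
        add_hom_comp [OF induced_coact_additive tensor_map_additive [OF TX_module comodule.right [OF M] left rI]] _ t])
    fix n a assume n: "n \<in> carrier X" and "a \<in> carrier LA"
    then have a: "a \<in> carrier A" by simp
    have "coact M (e n \<triangleleft>\<^bsub>M\<^esub> a) = tens A M C (e n) x \<triangleleft>\<^bsub>tensor_C A C M\<^esub> a"
      using linear_map_smult [OF comodule_linear [OF M] a ec [OF n]] e [OF n] by (simp add: coinv_def)
    also have "\<dots> = tens A M C (e n) (x \<star> a)"
      by (rule tensor_C_smult [OF comodule.right [OF M] a ec [OF n] x_closed])
    also have "\<dots> = tensor_map A M C ?r (coact ?I (tens B X LA n a))"
    proof -
      have c: "tens B X LA n \<one> \<in> carrier TX" using n by (simp add: TX_simps)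
      have "?r (tens B X LA n \<one>) = e n"
        using n ec [OF n] c by (simp add: \<phi>t MC.M.ract_one TX_simps)
      then show ?thesis
        using tensor_map_tens [OF TX_module comodule.right [OF M] left rI c xa_closed [OF a]]
        by (simp only: induced_coact_tens [OF n a])
    qed
    finally show "coact M (?\<phi> (tens B X LA n a)) = tensor_map A M C ?r (coact ?I (tens B X LA n a))"
      using \<phi>t [OF n a] by simp
  qed
  then show ?thesis
    using rl unfolding colin_hom_def by simp
qed

text \<open>The inverse of a bijective colinear map is colinear: apply the inverse, tensored with
  \<open>C\<close>, to the colinearity equation of \<open>f\<close>.\<close>

lemma induced_colin_iso:
  assumes M: "comodule A C M" and f: "f \<in> colin_hom A C (induced_comodule A C x X) M"
    and bij: "bij_betw f (carrier (tensor B X LA)) (carrier M)"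
  shows "colin_iso A C (induced_comodule A C x X) M f"
proof -
  let ?I = "induced_comodule A C x X"
  interpret MC: tensor_product A M C by (rule tensor_product_C [OF comodule.right [OF M]])
  interpret I: right_module A ?I by (rule induced_module)
  have fl: "linear_map A ?I M f"
    by (rule lin_hom_linear [OF _ I.M.abelian_group_axioms MC.M.M.abelian_group_axioms])
       (use f in \<open>simp add: colin_hom_def\<close>)
  have fco: "coact M (f t) = tensor_map A M C f (coact ?I t)" if "t \<in> carrier ?I" for t
    using f that by (simp add: colin_hom_def)
  have inj: "inj_on f (carrier ?I)" and surj: "f ` carrier ?I = carrier M"
    using bij by (simp_all add: bij_betw_def)
  let ?i = "inv_into (carrier ?I) f" and ?g = "restrict (inv_into (carrier ?I) f) (carrier M)"
  have i: "?i m \<in> carrier ?I" "f (?i m) = m" if "m \<in> carrier M" for m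
    using that surj inv_into_into [of m f "carrier ?I"] f_inv_into_f [of m f "carrier ?I"] by simp_all
  have if': "?i (f t) = t" if "t \<in> carrier ?I" for t using inv_into_f_f [OF inj that] .
  have il: "linear_map A M ?I ?i"
    using linear_map_inv_into [OF induced_module MC.M fl inj] unfolding surj by simp
  have gl: "?g \<in> lin_hom A M ?I" by (rule restrict_lin_hom [OF il]) (simp add: MC.M)
  have gl': "linear_map A M ?I ?g" by (rule linear_map_cong [OF il]) (simp_all add: MC.M)
  have co: "coact ?I t \<in> carrier (tensor A ?I C)" if "t \<in> carrier ?I" for t
    using add_hom_closed [OF induced_coact_additive] that
    by (simp add: induced_comodule_eq TX_simps)
  have "coact ?I (?g m) = tensor_lift (tensor A ?I C) (\<lambda>m\<^sub>0 m\<^sub>1. tens A ?I C (?g m\<^sub>0) m\<^sub>1) (coact M m)"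
    if m: "m \<in> carrier M" for m
  proof -
    have "tensor_map A ?I C ?g (coact M m) = tensor_map A ?I C ?g (tensor_map A M C f (coact ?I (?i m)))"
      using fco [OF i(1) [OF m]] i(2) [OF m] by simp
    also have "\<dots> = tensor_map A ?I C (\<lambda>t. ?g (f t)) (coact ?I (?i m))"
      by (rule tensor_map_comp [OF induced_module MC.M induced_module left fl gl' co [OF i(1) [OF m]]])
    also have "\<dots> = coact ?I (?i m)"
      by (rule tensor_map_id [OF induced_module left _ co [OF i(1) [OF m]]])
         (use if' linear_map_closed [OF fl] in simp)
    finally show ?thesis using m by simp
  qed
  then have "?g \<in> colin_hom A C M ?I" using gl by (simp add: colin_hom_def)
  moreover have "\<forall>t\<in>carrier ?I. ?g (f t) = t" using if' linear_map_closed [OF fl] by simp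
  moreover have "\<forall>m\<in>carrier M. f (?g m) = m" using i by simp
  ultimately show ?thesis using f unfolding colin_iso_def by blast
qed

end

lemma colin_iso_bij:
  assumes "colin_iso A C I M f" shows "bij_betw f (carrier I) (carrier M)"
proof -
  obtain g where f: "f \<in> colin_hom A C I M" and g: "g \<in> colin_hom A C M I"
    and "\<forall>m\<in>carrier I. g (f m) = m" "\<forall>n\<in>carrier M. f (g n) = n"
    using assms by (auto simp: colin_iso_def)
  moreover have "f ` carrier I \<subseteq> carrier M" "g ` carrier M \<subseteq> carrier I"
    using f g by (auto simp: colin_hom_def lin_hom_def)
  ultimately show ?thesis by (intro bij_betw_byWitness [where f' = g]) auto
qed

text \<open>Because \<open>h(a) = h(1) a\<close> and \<open>h(1)\<close> is coinvariant, evaluation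
  has the form treated in \<open>induced_colinear\<close>; a bijective colinear map is then an
  isomorphism.\<close>

lemma Psi'_iso_iff:
  assumes M: "comodule A C M"
  shows "\<Psi>'_iso A C x M \<longleftrightarrow> \<Psi>'_bijective A C x M"
proof
  assume "\<Psi>'_iso A C x M"
  then show "\<Psi>'_bijective A C x M" unfolding \<Psi>'_iso_def \<Psi>'_bijective_def by (rule colin_iso_bij)
next
  assume bij: "\<Psi>'_bijective A C x M"
  let ?P = "dual_module M"
  note P = right_module_dual [OF M]
  interpret P: right_module T ?P by (rule P)
  have lin: "linear_map B (HomT ?P) M (\<lambda>h. h \<one>)"
  proof (rule linear_mapI [OF right_module_group [OF right_module_HomT [OF P]] right_module_group [OF comodule.right [OF M]]])
    fix b h assume b: "b \<in> carrier B" and h: "h \<in> carrier (HomT ?P)"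
    then show "(b \<odot>\<^bsub>HomT ?P\<^esub> h) \<one> = b \<odot>\<^bsub>M\<^esub> h \<one>"
      using hom_T_apply [OF P, of h b] hom_T_closed [OF P, of h \<one>] B_subset [OF b] comodule_act_iota [OF M, of b "h \<one>"]
      by (simp add: del: dual_module_simps(4))
  qed (use hom_T_closed [OF P] in \<open>simp_all add: HomT_simps\<close>)
  have "restrict (eval_hom M) (carrier (induced_comodule A C x (HomT ?P)))
      \<in> colin_hom A C (induced_comodule A C x (HomT ?P)) M"
  proof (rule induced_colinear [OF right_module_HomT [OF P] M _ lin])
    fix h assume h: "h \<in> carrier (HomT ?P)"
    then show "h \<one> \<in> coinv A C x M"
      using hom_T_one_coinv [OF P, of h] by (simp add: coinv_eq_coinv_T [OF M] HomT_simps)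
    fix a assume a: "a \<in> carrier A"
    show "h a = h \<one> \<triangleleft>\<^bsub>M\<^esub> a"
      using hom_T_apply [OF P _ a, of h] hom_T_closed [OF P, of h \<one>] h comodule_act_iota [OF M a, of "h \<one>"]
      by (simp add: del: dual_module_simps(4))
  qed
  from induced_colin_iso [OF right_module_HomT [OF P] M this]
  show "\<Psi>'_iso A C x M"
    using bij unfolding \<Psi>'_iso_def \<Psi>'_bijective_def by (simp add: \<Psi>'_def colin_hom_module_eq [OF M])
qed

section \<open>Coinvariants and the comparison of the structure maps\<close>

lemma coinv_module_simps [simp]:
  "carrier (coinv_module A C x M) = coinv A C x M" "\<zero>\<^bsub>coinv_module A C x M\<^esub> = \<zero>\<^bsub>M\<^esub>"
  "add (coinv_module A C x M) = add M" "smult (coinv_module A C x M) = smult M"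
  by (simp_all add: coinv_module_def)

text \<open>Stability under \<open>B\<close>:
  \<open>(p b) f = p f(x b) = p f(b x) = p b f(x)\<close>.\<close>

lemma coinv_closed_submodule:
  assumes M: "comodule A C M" shows "closed_submodule B M (coinv A C x M)"
proof -
  let ?P = "dual_module M"
  note P = right_module_dual [OF M]
  interpret P: right_module T ?P by (rule P)
  have "p \<triangleleft>\<^bsub>M\<^esub> b \<in> coinv_T ?P" if b: "b \<in> carrier B" and p: "p \<in> coinv_T ?P" for b p
  proof -
    have bA: "b \<in> carrier A" by (rule B_subset [OF b])
    have pc: "p \<in> carrier ?P" and pf: "\<And>f. f \<in> carrier T \<Longrightarrow> p \<triangleleft>\<^bsub>?P\<^esub> f = p \<triangleleft>\<^bsub>?P\<^esub> iota (f x)"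
      using p unfolding coinv_T_def by blast+
    have "(p \<triangleleft>\<^bsub>?P\<^esub> iota b) \<triangleleft>\<^bsub>?P\<^esub> f = (p \<triangleleft>\<^bsub>?P\<^esub> iota b) \<triangleleft>\<^bsub>?P\<^esub> iota (f x)" if f: "f \<in> carrier T" for f
    proof -
      have fx: "f x \<in> carrier A" by (rule T_closed [OF f x_closed])
      have "(p \<triangleleft>\<^bsub>?P\<^esub> iota b) \<triangleleft>\<^bsub>?P\<^esub> f = p \<triangleleft>\<^bsub>?P\<^esub> iota ((iota b \<otimes>\<^bsub>T\<^esub> f) x)"
        using P.ract_assoc [OF iota_closed [OF bA] f pc] pf [of "iota b \<otimes>\<^bsub>T\<^esub> f"] f bA by (simp add: iota_closed del: dual_module_simps(4))
      also have "(iota b \<otimes>\<^bsub>T\<^esub> f) x = b \<otimes> f x"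
        using f bA x_closed B_commutes [OF b] by (simp add: iota_mult T_smult)
      also have "p \<triangleleft>\<^bsub>?P\<^esub> iota (b \<otimes> f x) = (p \<triangleleft>\<^bsub>?P\<^esub> iota b) \<triangleleft>\<^bsub>?P\<^esub> iota (f x)"
        using P.ract_assoc [OF iota_closed [OF bA] iota_closed [OF fx] pc] by (simp only: iota_hom_mult [OF bA fx])
      finally show ?thesis .
    qed
    then have "p \<triangleleft>\<^bsub>?P\<^esub> iota b \<in> coinv_T ?P"
      unfolding coinv_T_def using P.ract_closed [OF iota_closed [OF bA] pc] by simp
    then show ?thesis using comodule_act_iota [OF M bA, of p] pc by simp
  qed
  moreover have "\<zero>\<^bsub>?P\<^esub> \<in> coinv_T ?P"
    using P.ract_zero_left T_closed x_closed by (simp add: coinv_T_def iota_closed del: dual_module_simps)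
  moreover have "p \<oplus>\<^bsub>?P\<^esub> q \<in> coinv_T ?P" if "p \<in> coinv_T ?P" "q \<in> coinv_T ?P" for p q
    using that P.ract_l_distr T_closed x_closed
    by (simp add: coinv_T_def iota_closed del: dual_module_simps)
  ultimately show ?thesis
    unfolding closed_submodule_def coinv_eq_coinv_T [OF M] by (auto simp: coinv_T_def)
qed

lemma coinv_right_module:
  assumes M: "comodule A C M" shows "right_module B (coinv_module A C x M)"
  by (rule right_module_cong [OF right_module_submodule [OF comodule_right_B [OF M] coinv_closed_submodule [OF M]]])
     simp_all

text \<open>Evaluation at \<open>1\<close> identifies the colinear maps
  \<open>A \<rightarrow> M\<close> with the coinvariants of \<open>M\<close>, linearly over
  \<open>B\<close>. Tensored with \<open>A\<close> this isomorphism carries one structure map to the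
  other, and bijectivity suffices for a colinear isomorphism.\<close>

lemma Psi_iso_iff:
  assumes M: "comodule A C M"
  shows "\<Psi>_iso A C x M \<longleftrightarrow> \<Psi>'_bijective A C x M"
proof -
  let ?P = "dual_module M" and ?K = "coinv_module A C x M"
  note P = right_module_dual [OF M] and K = coinv_right_module [OF M]
  interpret P: right_module T ?P by (rule P)
  interpret M: right_module A M by (rule comodule.right [OF M])
  interpret K: right_module B ?K by (rule K)
  interpret HA: tensor_product B "HomT ?P" LA by (rule HomT_tensor_product [OF P])
  interpret KA: tensor_product B ?K LA by (rule tensor_productI [OF K A_left_B])
  have Kc: "p \<in> carrier M" if "p \<in> carrier ?K" for p using that by (simp add: coinv_def)
  have h1: "h \<one> \<in> carrier M" "h a = h \<one> \<triangleleft>\<^bsub>M\<^esub> a" if "h \<in> carrier (HomT ?P)" "a \<in> carrier A" for h a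
    using hom_T_apply [OF P _ that(2), of h] hom_T_closed [OF P, of h \<one>] that comodule_act_iota [OF M that(2), of "h \<one>"]
    by (simp_all add: del: dual_module_simps(4))
  have e: "linear_map B (HomT ?P) ?K (\<lambda>h. h \<one>)"
  proof (rule linear_mapI [OF HA.M.M.abelian_group_axioms K.M.abelian_group_axioms])
    fix b h assume b: "b \<in> carrier B" and h: "h \<in> carrier (HomT ?P)"
    then show "(b \<odot>\<^bsub>HomT ?P\<^esub> h) \<one> = b \<odot>\<^bsub>?K\<^esub> h \<one>"
      using h1(2) [OF h, of b] B_subset [OF b] by simp
  qed (use hom_T_one_coinv [OF P] in \<open>simp_all add: coinv_eq_coinv_T [OF M]\<close>)
  let ?g = "\<lambda>p. \<lambda>a\<in>carrier A. p \<triangleleft>\<^bsub>M\<^esub> a"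
  have gP: "?g p = (\<lambda>a\<in>carrier A. p \<triangleleft>\<^bsub>?P\<^esub> iota a)" if "p \<in> carrier ?K" for p
    using comodule_act_iota [OF M _ Kc [OF that]] by (intro restrict_ext) simp
  have g: "linear_map B ?K (HomT ?P) ?g"
  proof (rule linear_mapI [OF K.M.abelian_group_axioms HA.M.M.abelian_group_axioms])
    fix p assume p: "p \<in> carrier ?K"
    then show "?g p \<in> carrier (HomT ?P)"
      using coinv_T_hom [OF P, of p] unfolding gP [OF p] by (simp add: coinv_eq_coinv_T [OF M] HomT_simps del: dual_module_simps(4))
    fix b assume b: "b \<in> carrier B"
    show "?g (p \<triangleleft>\<^bsub>?K\<^esub> b) = b \<odot>\<^bsub>HomT ?P\<^esub> ?g p"
      using Kc [OF p] B_subset [OF b] by (auto simp: M.ract_assoc intro!: restrict_ext)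
  next
    fix p q assume "p \<in> carrier ?K" "q \<in> carrier ?K"
    then show "?g (p \<oplus>\<^bsub>?K\<^esub> q) = ?g p \<oplus>\<^bsub>HomT ?P\<^esub> ?g q"
      using Kc by (auto simp: M.ract_l_distr simp del: coinv_module_simps(1) intro!: restrict_ext)
  qed
  have bij: "bij_betw (tensor_map B ?K LA (\<lambda>h. h \<one>)) (carrier (tensor B (HomT ?P) LA))
      (carrier (tensor B ?K LA))"
  proof (rule tensor_map_bij [OF HA.M K A_left_B e g])
    fix h assume h: "h \<in> carrier (HomT ?P)"
    then have hl: "h \<in> lin_hom T AT ?P" by simp
    show "?g (h \<one>) = h"
    proof (rule extensionalityI [of _ "carrier A"])
      show "h \<in> extensional (carrier A)" using hl by (simp add: lin_hom_def PiE_iff)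
      show "?g (h \<one>) a = h a" if a: "a \<in> carrier A" for a
        using h1(2) [OF h a, symmetric] a by simp
    qed simp
  next
    fix p assume "p \<in> carrier ?K"
    then show "?g p \<one> = p" using Kc M.ract_one by simp
  qed
  have inc: "linear_map B ?K M (\<lambda>p. p)"
    using Kc by (intro linear_mapI K.M.abelian_group_axioms M.M.abelian_group_axioms) simp_all
  have bal: "balanced B ?K LA M (\<lambda>p a. p \<triangleleft>\<^bsub>M\<^esub> a)"
    using Kc B_subset
    by (intro balancedI M.M.abelian_group_axioms)
       (simp_all add: M.ract_closed M.ract_l_distr M.ract_r_distr M.ract_assoc del: coinv_module_simps(1))
  have comp: "tensor_lift M (\<lambda>p a. p \<triangleleft>\<^bsub>M\<^esub> a) (tensor_map B ?K LA (\<lambda>h. h \<one>) t) = eval_hom M t"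
    if t: "t \<in> carrier (tensor B (HomT ?P) LA)" for t
  proof -
    have lP: "add_hom (tensor B (HomT ?P) LA) M (eval_hom M)"
      using eval_hom_additive [OF P] M.M.abelian_group_axioms by (simp add: add_hom_def)
    show ?thesis
    proof (rule HA.add_hom_tensor_eq [OF add_hom_comp [OF tensor_map_additive [OF HA.M K A_left_B e]
            KA.tensor_lift_additive [OF bal]] lP _ t])
      fix h a assume h: "h \<in> carrier (HomT ?P)" and a: "a \<in> carrier LA"
      have "h \<one> \<in> carrier ?K" using linear_map_closed [OF e h] .
      then have "tensor_lift M (\<lambda>p a. p \<triangleleft>\<^bsub>M\<^esub> a) (tensor_map B ?K LA (\<lambda>h. h \<one>) (tens B (HomT ?P) LA h a)) = h \<one> \<triangleleft>\<^bsub>M\<^esub> a"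
        unfolding tensor_map_tens [OF HA.M K A_left_B e h a] using a by (intro KA.tensor_lift_tens [OF bal])
      moreover have "eval_hom M (tens B (HomT ?P) LA h a) = h a"
        using HA.tensor_lift_tens [OF HomT_eval_balanced [OF P] h a] by simp
      ultimately show "tensor_lift M (\<lambda>p a. p \<triangleleft>\<^bsub>M\<^esub> a) (tensor_map B ?K LA (\<lambda>h. h \<one>) (tens B (HomT ?P) LA h a))
        = eval_hom M (tens B (HomT ?P) LA h a)"
        using h1(2) [OF h, of a] a by simp
    qed
  qed
  have "bij_betw (tensor_lift M (\<lambda>p a. p \<triangleleft>\<^bsub>M\<^esub> a)) (carrier (tensor B ?K LA)) (carrier M)
      \<longleftrightarrow> bij_betw (eval_hom M) (carrier (tensor B (HomT ?P) LA)) (carrier M)"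
  proof -
    have "bij_betw (tensor_lift M (\<lambda>p a. p \<triangleleft>\<^bsub>M\<^esub> a) \<circ> tensor_map B ?K LA (\<lambda>h. h \<one>))
        (carrier (tensor B (HomT ?P) LA)) (carrier M)
      \<longleftrightarrow> bij_betw (eval_hom M) (carrier (tensor B (HomT ?P) LA)) (carrier M)"
      by (rule bij_betw_cong) (simp only: comp o_apply)
    then show ?thesis unfolding bij_betw_comp_iff [OF bij, symmetric] .
  qed
  moreover have "bij_betw (\<Psi> A C x M) (carrier (tensor B ?K LA)) (carrier M)
      \<longleftrightarrow> bij_betw (tensor_lift M (\<lambda>p a. p \<triangleleft>\<^bsub>M\<^esub> a)) (carrier (tensor B ?K LA)) (carrier M)"
    by (rule bij_betw_cong) (simp add: \<Psi>_def)
  moreover have "\<Psi>_iso A C x M \<longleftrightarrow> bij_betw (\<Psi> A C x M) (carrier (tensor B ?K LA)) (carrier M)"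
  proof
    assume "\<Psi>_iso A C x M"
    then show "bij_betw (\<Psi> A C x M) (carrier (tensor B ?K LA)) (carrier M)"
      using colin_iso_bij by (fastforce simp: \<Psi>_iso_def)
  next
    assume bij: "bij_betw (\<Psi> A C x M) (carrier (tensor B ?K LA)) (carrier M)"
    have "\<Psi> A C x M \<in> colin_hom A C (induced_comodule A C x ?K) M"
      unfolding \<Psi>_def by (rule induced_colinear [OF K M _ inc]) simp_all
    from induced_colin_iso [OF K M this bij] show "\<Psi>_iso A C x M" by (simp add: \<Psi>_iso_def)
  qed
  ultimately show ?thesis unfolding Psi'_bijective_iff [OF M] by simp
qed

section \<open>The Galois condition\<close>

lemma AA_tensor_product: "tensor_product B RA LA"
  by (rule tensor_productI [OF right_module_restrict_B [OF right_regular] A_left_B])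

sublocale AA: tensor_product B RA LA by (rule AA_tensor_product)

abbreviation "galois_map \<equiv> tensor_lift C (\<lambda>a' a. (a' \<bullet> x) \<star> a)"

lemma axa_closed: "\<lbrakk>a' \<in> carrier A; a \<in> carrier A\<rbrakk> \<Longrightarrow> (a' \<bullet> x) \<star> a \<in> carrier C"
  by (simp add: ractC_closed L.lact_closed x_closed)

lemma balanced_galois: "balanced B RA LA C (\<lambda>a' a. (a' \<bullet> x) \<star> a)"
proof (rule balancedI [OF L.M.abelian_group_axioms])
  fix a' a b assume "a' \<in> carrier RA" "a \<in> carrier LA"
  then have a: "a' \<in> carrier A" "a \<in> carrier A" by simp_all
  show "(a' \<bullet> x) \<star> a \<in> carrier C" using a by (rule axa_closed)
  show "((a' \<oplus>\<^bsub>RA\<^esub> a'') \<bullet> x) \<star> a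
      = (a' \<bullet> x) \<star> a \<oplus>\<^bsub>C\<^esub> (a'' \<bullet> x) \<star> a" if "a'' \<in> carrier RA" for a''
    using a that x_closed RC.ract_l_distr [of a "a' \<bullet> x" "a'' \<bullet> x"] by (simp add: L.lact_l_distr L.lact_closed)
  show "(a' \<bullet> x) \<star> (a \<oplus>\<^bsub>LA\<^esub> a'')
      = (a' \<bullet> x) \<star> a \<oplus>\<^bsub>C\<^esub> (a' \<bullet> x) \<star> a''" if "a'' \<in> carrier LA" for a''
    using a that x_closed RC.ract_r_distr [of a a'' "a' \<bullet> x"] by (simp add: L.lact_closed)
  show "((a' \<triangleleft>\<^bsub>RA\<^esub> b) \<bullet> x) \<star> a = (a' \<bullet> x) \<star> (b \<odot>\<^bsub>LA\<^esub> a)"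
    if b: "b \<in> carrier B" for b
  proof -
    have bA: "b \<in> carrier A" by (rule B_subset [OF b])
    have "(a' \<otimes> b) \<bullet> x = (a' \<bullet> x) \<star> b"
      using a bA x_closed B_commutes [OF b] bimodule [of a' b x] by (simp add: L.lact_assoc)
    then show ?thesis
      using a bA x_closed RC.ract_assoc [of b a "a' \<bullet> x"] by (simp add: L.lact_closed)
  qed
qed

lemma galois_map_additive: "add_hom (tensor B RA LA) C galois_map"
  by (rule AA.tensor_lift_additive [OF balanced_galois])

lemma galois_map_tens:
  "\<lbrakk>a' \<in> carrier A; a \<in> carrier A\<rbrakk>
    \<Longrightarrow> galois_map (tens B RA LA a' a) = (a' \<bullet> x) \<star> a"
  using AA.tensor_lift_tens [OF balanced_galois] by simp

text \<open>The comultiplication is left linear and the functional acts on the right tensor factor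
  only; so \<open>C\<close> is a bimodule over \<open>A\<close> and the dual ring.\<close>

lemma actC_left_linear: "\<lbrakk>f \<in> carrier T; a \<in> carrier A; c \<in> carrier C\<rbrakk> \<Longrightarrow> actC f (a \<bullet> c) = a \<bullet> actC f c"
proof -
  assume f: "f \<in> carrier T" and a: "a \<in> carrier A" and c: "c \<in> carrier C"
  have aa: "add_hom (rmod C) C (\<lambda>c. a \<bullet> c)"
    using a by (auto simp: add_hom_def L.M.abelian_group_axioms RC.M.abelian_group_axioms L.lact_closed L.lact_r_distr)
  have ev: "add_hom (tensor A (rmod C) C) C (eval_functional (rmod C) f)"
    using CC.eval_additive [OF T_linear [OF f]] by simp
  have "eval_functional (rmod C) f (a \<odot>\<^bsub>CC\<^esub> u) = a \<bullet> eval_functional (rmod C) f u"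
    if u: "u \<in> carrier (tensor A (rmod C) C)" for u
  proof (rule CC.add_hom_tensor_eq [OF add_hom_comp [OF CC_act_additive [OF a] ev]
        add_hom_comp [OF CC.eval_additive [OF T_linear [OF f]] aa] _ u])
    fix c d assume "c \<in> carrier (rmod C)" "d \<in> carrier C"
    then show "eval_functional (rmod C) f (a \<odot>\<^bsub>CC\<^esub> tens A (rmod C) C c d)
        = a \<bullet> eval_functional (rmod C) f (tens A (rmod C) C c d)"
      using a T_closed [OF f, of d] by (simp add: CC_smult CC.eval_tens [OF T_linear [OF f]] L.lact_closed bimodule)
  qed
  then show ?thesis
    using linear_map_smult [OF comult_linear_left a c] comult_closed [OF c] by (simp add: actC_def)
qed

lemma actC_xa: "\<lbrakk>f \<in> carrier T; a \<in> carrier A\<rbrakk> \<Longrightarrow> actC f (x \<star> a) = x \<star> f (x \<star> a)"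
  using x_closed by (simp add: actC_def comult_xa CC.eval_tens [OF T_linear] xa_closed)

abbreviation "CT \<equiv> dual_module (coring_comodule C)"

lemma right_module_CT: "right_module T CT"
  by (rule right_module_dual [OF comodule_coring])

lemma CT_act: "c \<triangleleft>\<^bsub>CT\<^esub> f = actC f c"
  by (rule coring_comodule_act)

lemma ax_coinv:
  assumes a: "a \<in> carrier A" shows "a \<bullet> x \<in> coinv_T CT"
proof -
  have "actC f (a \<bullet> x) = actC (iota (f x)) (a \<bullet> x)" if f: "f \<in> carrier T" for f
    using actC_left_linear [OF f a x_closed] actC_xa [OF f, of \<one>] a x_closed T_closed [OF f x_closed]
    by (simp add: x_one actC_iota L.lact_closed bimodule)
  then show ?thesis
    unfolding coinv_T_def CT_act using a x_closed by (simp add: L.lact_closed)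
qed

text \<open>Apply the counit to \<open>c f = c f(x)\<close>: this yields
  \<open>f(c) = \<epsilon>(c) f(x) = f(\<epsilon>(c) x)\<close>. Together with
  \<open>ax_coinv\<close>, the coinvariants of \<open>C\<close> are the left multiples of
  \<open>x\<close>.\<close>

lemma coinv_CT:
  assumes c: "c \<in> coinv_T CT" shows "c = counit C c \<bullet> x"
proof (rule coring_eqI)
  have cC: "c \<in> carrier C" and act: "\<And>f. f \<in> carrier T \<Longrightarrow> actC f c = actC (iota (f x)) c"
    using c unfolding coinv_T_def CT_act by auto
  show "c \<in> carrier C" by (rule cC)
  show "counit C c \<bullet> x \<in> carrier C" using cC x_closed by (simp add: L.lact_closed counit_closed)
  fix f assume f: "f \<in> carrier T"
  have "f c = counit C (actC (iota (f x)) c)" using counit_actC [OF f cC] act [OF f] by simp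
  then show "f c = f (counit C c \<bullet> x)"
    using T_closed [OF f x_closed] cC x_closed
    by (simp add: actC_iota counit_smult_right T_smult [OF f] counit_closed)
qed

text \<open>The map sending \<open>a'\<close> to \<open>a \<mapsto> a' x a\<close> identifies
  \<open>A\<close> with the maps \<open>A \<rightarrow> C\<close>, the inverse being
  \<open>h \<mapsto> \<epsilon>(h(1))\<close>. Under this identification the evaluation map for
  \<open>C\<close> is the Galois map.\<close>

lemma galois_iff: "galois A C x \<longleftrightarrow> \<Psi>'_bijective A C x (coring_comodule C)"
proof -
  note P = right_module_CT
  let ?R = RA and ?H = "HomT CT"
  have R: "right_module B ?R" by (rule right_module_restrict_B [OF right_regular])
  interpret HA: tensor_product B ?H LA by (rule HomT_tensor_product [OF P])
  let ?e = "\<lambda>a'. \<lambda>a\<in>carrier A. (a' \<bullet> x) \<star> a" and ?g = "\<lambda>h. counit C (h \<one>)"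
  have ec: "?e a' \<in> lin_hom T AT CT" if a': "a' \<in> carrier A" for a'
  proof -
    have "?e a' = (\<lambda>a\<in>carrier A. (a' \<bullet> x) \<triangleleft>\<^bsub>CT\<^esub> iota a)"
      using a' x_closed by (intro restrict_ext) (simp add: CT_act actC_iota L.lact_closed del: dual_module_simps(4))
    then show ?thesis using coinv_T_hom [OF P ax_coinv [OF a']] by simp
  qed
  have h1: "h \<one> \<in> carrier C" "h a = h \<one> \<star> a" "h \<one> = counit C (h \<one>) \<bullet> x"
    if h: "h \<in> lin_hom T AT CT" and a: "a \<in> carrier A" for h a
  proof -
    show c: "h \<one> \<in> carrier C" using hom_T_closed [OF P h, of \<one>] by simp
    show "h a = h \<one> \<star> a"
      using hom_T_apply [OF P h a] c a by (simp add: CT_act actC_iota del: dual_module_simps(4))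
    show "h \<one> = counit C (h \<one>) \<bullet> x" by (rule coinv_CT [OF hom_T_one_coinv [OF P h]])
  qed
  have e: "linear_map B ?R ?H ?e"
  proof (rule linear_mapI [OF right_module_group [OF R] HA.M.M.abelian_group_axioms])
    fix a' assume "a' \<in> carrier ?R"
    then have a': "a' \<in> carrier A" by simp
    then show "?e a' \<in> carrier ?H" using ec by simp
    show "?e (a' \<oplus>\<^bsub>?R\<^esub> a'') = ?e a' \<oplus>\<^bsub>?H\<^esub> ?e a''" if "a'' \<in> carrier ?R" for a''
      using that a' add_hom_add [OF RC.additive_ract_left, of _ "a' \<bullet> x" "a'' \<bullet> x"] x_closed
      by (auto simp: L.lact_l_distr L.lact_closed intro!: restrict_ext)
    fix b assume b: "b \<in> carrier B"
    have bA: "b \<in> carrier A" by (rule B_subset [OF b])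
    have "(a' \<otimes> b) \<bullet> x = (a' \<bullet> x) \<star> b"
      using a' bA x_closed B_commutes [OF b] bimodule [of a' b x] by (simp add: L.lact_assoc)
    then show "?e (a' \<triangleleft>\<^bsub>?R\<^esub> b) = b \<odot>\<^bsub>?H\<^esub> ?e a'"
      using a' bA x_closed RC.ract_assoc [of b _ "a' \<bullet> x"]
      by (auto simp: L.lact_closed intro!: restrict_ext)
  qed
  have g: "linear_map B ?H ?R ?g"
  proof (rule linear_mapI [OF HA.M.M.abelian_group_axioms right_module_group [OF R]])
    fix b h assume b: "b \<in> carrier B" and "h \<in> carrier ?H"
    then have h: "h \<in> lin_hom T AT CT" by simp
    show "?g (b \<odot>\<^bsub>?H\<^esub> h) = ?g h \<triangleleft>\<^bsub>?R\<^esub> b"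
      using h1(1) [OF h L.R.one_closed] h1(2) [OF h B_subset [OF b]] B_subset [OF b]
      by (simp add: counit_smult_right)
  qed (use h1(1) [OF _ L.R.one_closed] in \<open>simp_all add: counit_closed counit_add\<close>)
  have bij: "bij_betw (tensor_map B ?H LA ?e) (carrier (tensor B ?R LA))
      (carrier (tensor B ?H LA))"
  proof (rule tensor_map_bij [OF R HA.M A_left_B e g])
    fix a' assume "a' \<in> carrier ?R"
    then show "?g (?e a') = a'"
      using x_closed RC.ract_one [of "a' \<bullet> x"] by (simp add: L.lact_closed counit_smult_left counit_x)
  next
    fix h assume "h \<in> carrier ?H"
    then have h: "h \<in> lin_hom T AT CT" by simp
    show "?e (?g h) = h"
    proof (rule extensionalityI [of _ "carrier A"])
      show "h \<in> extensional (carrier A)" using h by (simp add: lin_hom_def PiE_iff)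
      show "?e (?g h) a = h a" if a: "a \<in> carrier A" for a
        using h1(2) [OF h a] h1(3) [OF h a] a by simp
    qed simp
  qed
  let ?ev = "eval_hom CT"
  have bal: "balanced B ?H LA CT (\<lambda>f a. f a)" by (rule HomT_eval_balanced [OF P])
  have evC: "add_hom (tensor B ?H LA) C ?ev"
    using HA.tensor_lift_additive [OF bal] L.M.abelian_group_axioms by (simp add: add_hom_def)
  have comp: "?ev (tensor_map B ?H LA ?e t) = galois_map t"
    if t: "t \<in> carrier (tensor B ?R LA)" for t
  proof (rule AA.add_hom_tensor_eq [OF add_hom_comp [OF tensor_map_additive [OF R HA.M A_left_B e] evC]
        galois_map_additive _ t])
    fix a' a assume a: "a' \<in> carrier ?R" "a \<in> carrier LA"
    then have "?ev (tens B ?H LA (?e a') a) = ?e a' a"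
      using ec by (intro HA.tensor_lift_tens [OF bal]) simp_all
    then show "?ev (tensor_map B ?H LA ?e (tens B ?R LA a' a))
        = galois_map (tens B ?R LA a' a)"
      using a by (simp only: tensor_map_tens [OF R HA.M A_left_B e a]) (simp add: galois_map_tens)
  qed
  have "bij_betw (?ev \<circ> tensor_map B ?H LA ?e) (carrier (tensor B ?R LA)) (carrier C)
    \<longleftrightarrow> bij_betw galois_map (carrier (tensor B ?R LA)) (carrier C)"
    by (rule bij_betw_cong) (simp only: comp o_apply)
  then have "galois A C x \<longleftrightarrow> bij_betw ?ev (carrier (tensor B ?H LA)) (carrier C)"
    unfolding bij_betw_comp_iff [OF bij, symmetric] galois_def by simp
  then show ?thesis unfolding Psi'_bijective_iff [OF comodule_coring] by simp
qed

section \<open>The canonical isomorphism under the Galois condition\<close>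

context
  assumes galois: "galois A C x"
begin

text \<open>
  Under the Galois condition \<open>N \<otimes>\<^sub>B A \<simeq> N \<otimes>\<^sub>A C\<close> via \<open>n \<otimes> a \<mapsto> n \<otimes> \<^bold>x a\<close>, with inverse \<open>n \<otimes> c \<mapsto> n \<beta>\<^sup>-\<^sup>1(c)\<close>.
\<close>

abbreviation "canonical N \<equiv> tensor_lift (tensor A N C) (\<lambda>n a. tens A N C n (x \<star> a))"

context
  fixes N :: "('a, 'n, 'y) module_scheme"
  assumes N: "right_module A N"
begin

interpretation N: right_module A N by (rule N)
interpretation NC: tensor_product A N C by (rule tensor_product_C [OF N])
interpretation NA: tensor_product B N LA
  by (rule tensor_productI [OF right_module_restrict_B [OF N] A_left_B])

lemma balanced_canonical: "balanced B N LA (tensor A N C) (\<lambda>n a. tens A N C n (x \<star> a))"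
proof (rule balancedI [OF NC.abelian_group_tensor])
  fix n b a assume n: "n \<in> carrier N" and b: "b \<in> carrier B" and "a \<in> carrier LA"
  then have a: "a \<in> carrier A" and bA: "b \<in> carrier A" using B_subset by simp_all
  have "x \<star> (b \<otimes> a) = b \<bullet> (x \<star> a)"
    using RC.ract_assoc [of b a x] bimodule [of b a x] B_commutes [OF b] bA a x_closed by simp
  then show "tens A N C (n \<triangleleft>\<^bsub>N\<^esub> b) (x \<star> a) = tens A N C n (x \<star> (b \<odot>\<^bsub>LA\<^esub> a))"
    using NC.tens_balanced [OF n bA xa_closed [OF a]] by simp
next
  fix n a a' assume "n \<in> carrier N" "a \<in> carrier LA" "a' \<in> carrier LA"
  then show "tens A N C n (x \<star> (a \<oplus>\<^bsub>LA\<^esub> a'))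
      = tens A N C n (x \<star> a) \<oplus>\<^bsub>tensor A N C\<^esub> tens A N C n (x \<star> a')"
    using NC.tens_add_right [OF _ xa_closed xa_closed, of n a a'] RC.ract_r_distr [of a a' x] x_closed by simp
qed (simp_all add: xa_closed NC.tens_add_left)

lemma canonical_additive: "add_hom (tensor B N LA) (tensor A N C) (canonical N)"
  by (rule NA.tensor_lift_additive [OF balanced_canonical])

lemma canonical_tens:
  "\<lbrakk>n \<in> carrier N; a \<in> carrier A\<rbrakk> \<Longrightarrow> canonical N (tens B N LA n a) = tens A N C n (x \<star> a)"
  using NA.tensor_lift_tens [OF balanced_canonical] by simp

text \<open>Gives a meaning to the product of \<open>n\<close> with an element of
  \<open>A \<otimes> A\<close>.\<close>

abbreviation "mu n \<equiv> tensor_lift (tensor B N LA) (\<lambda>a' a. tens B N LA (n \<triangleleft>\<^bsub>N\<^esub> a') a)"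

lemma mu_linear: "n \<in> carrier N \<Longrightarrow> linear_map B RA N (\<lambda>a'. n \<triangleleft>\<^bsub>N\<^esub> a')"
  using right_module_group [OF right_regular] N.M.abelian_group_axioms
  by (intro linear_mapI) (simp_all add: N.ract_closed N.ract_r_distr N.ract_assoc B_subset)

lemma mu_additive: "n \<in> carrier N \<Longrightarrow> add_hom (tensor B RA LA) (tensor B N LA) (mu n)"
  by (rule tensor_map_additive [OF AA.M NA.M A_left_B mu_linear])

lemma mu_tens: "\<lbrakk>n \<in> carrier N; a' \<in> carrier A; a \<in> carrier A\<rbrakk>
    \<Longrightarrow> mu n (tens B RA LA a' a) = tens B N LA (n \<triangleleft>\<^bsub>N\<^esub> a') a"
  using tensor_map_tens [OF AA.M NA.M A_left_B mu_linear] by simp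

abbreviation "beta_inv \<equiv> inv_into (carrier (tensor B RA LA)) galois_map"

lemma galois_bij: "bij_betw galois_map (carrier (tensor B RA LA)) (carrier C)"
  using galois by (simp add: galois_def)

lemma beta_inv: "c \<in> carrier C \<Longrightarrow> beta_inv c \<in> carrier (tensor B RA LA)"
  "c \<in> carrier C \<Longrightarrow> galois_map (beta_inv c) = c"
  using galois_bij by (simp_all add: bij_betw_def inv_into_into f_inv_into_f)

lemma beta_inv_eq: "u \<in> carrier (tensor B RA LA) \<Longrightarrow> beta_inv (galois_map u) = u"
  using galois_bij by (simp add: bij_betw_def)

lemma beta_inv_add: "\<lbrakk>c \<in> carrier C; d \<in> carrier C\<rbrakk>
    \<Longrightarrow> beta_inv (c \<oplus>\<^bsub>C\<^esub> d) = beta_inv c \<oplus>\<^bsub>tensor B RA LA\<^esub> beta_inv d"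
proof -
  assume cd: "c \<in> carrier C" "d \<in> carrier C"
  interpret G: abelian_group "tensor B RA LA" by (rule AA.abelian_group_tensor)
  have "galois_map (beta_inv c \<oplus>\<^bsub>tensor B RA LA\<^esub> beta_inv d) = c \<oplus>\<^bsub>C\<^esub> d"
    using cd beta_inv by (simp add: add_hom_add [OF galois_map_additive])
  then show ?thesis using beta_inv_eq [OF G.a_closed [OF beta_inv(1) [OF cd(1)] beta_inv(1) [OF cd(2)]]] by simp
qed

lemma balanced_theta: "balanced A N C (tensor B N LA) (\<lambda>n c. mu n (beta_inv c))"
proof (rule balancedI [OF NA.abelian_group_tensor])
  let ?GA = "tensor B RA LA" and ?GN = "tensor B N LA"
  interpret GN: abelian_group ?GN by (rule NA.abelian_group_tensor)
  fix n c assume n: "n \<in> carrier N" and c: "c \<in> carrier C"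
  note u = beta_inv(1) [OF c]
  show "mu n (beta_inv c) \<in> carrier ?GN" using add_hom_closed [OF mu_additive [OF n] u] .
  show "mu n (beta_inv (c \<oplus>\<^bsub>C\<^esub> d)) = mu n (beta_inv c) \<oplus>\<^bsub>?GN\<^esub> mu n (beta_inv d)" if "d \<in> carrier C" for d
    using c that beta_inv(1) by (simp add: beta_inv_add add_hom_add [OF mu_additive [OF n]])
  show "mu (n \<oplus>\<^bsub>N\<^esub> n') (beta_inv c) = mu n (beta_inv c) \<oplus>\<^bsub>?GN\<^esub> mu n' (beta_inv c)" if n': "n' \<in> carrier N" for n'
  proof (rule AA.add_hom_tensor_eq [OF mu_additive [OF N.M.a_closed [OF n n']] _ _ u])
    show "add_hom ?GA ?GN (\<lambda>u. mu n u \<oplus>\<^bsub>?GN\<^esub> mu n' u)"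
      using add_hom_closed [OF mu_additive [OF n]] add_hom_closed [OF mu_additive [OF n']]
      by (auto simp: add_hom_def AA.abelian_group_tensor GN.abelian_group_axioms GN.a_ac
          add_hom_add [OF mu_additive [OF n]] add_hom_add [OF mu_additive [OF n']])
    fix a' a assume "a' \<in> carrier RA" "a \<in> carrier LA"
    then show "mu (n \<oplus>\<^bsub>N\<^esub> n') (tens B RA LA a' a)
        = mu n (tens B RA LA a' a) \<oplus>\<^bsub>?GN\<^esub> mu n' (tens B RA LA a' a)"
      using n n' by (simp add: mu_tens N.ract_l_distr NA.tens_add_left N.ract_closed)
  qed
  show "mu (n \<triangleleft>\<^bsub>N\<^esub> r) (beta_inv c) = mu n (beta_inv (r \<bullet> c))" if r: "r \<in> carrier A" for r
  proof -
    let ?l = "tensor_map B RA LA (\<lambda>a'. r \<otimes> a')"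
    have rl: "linear_map B RA RA (\<lambda>a'. r \<otimes> a')"
      using r right_module_group [OF right_regular]
      by (intro linear_mapI) (simp_all add: L.R.r_distr L.R.m_assoc B_subset)
    note la = tensor_map_additive [OF AA.M AA.M A_left_B rl]
    have ra: "add_hom C C (\<lambda>c. r \<bullet> c)"
      using r by (auto simp: add_hom_def L.M.abelian_group_axioms L.lact_closed L.lact_r_distr)
    \<comment> \<open>The Galois map is left linear over \<open>A\<close>, hence so is its inverse;
      this moves \<open>r\<close> from \<open>n\<close> to \<open>c\<close>.\<close>
    have "galois_map (?l u) = r \<bullet> galois_map u" if u: "u \<in> carrier ?GA" for u
    proof (rule AA.add_hom_tensor_eq [OF add_hom_comp [OF la galois_map_additive]
          add_hom_comp [OF galois_map_additive ra] _ u])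
      fix a' a assume a: "a' \<in> carrier RA" "a \<in> carrier LA"
      then show "galois_map (?l (tens B RA LA a' a))
          = r \<bullet> galois_map (tens B RA LA a' a)"
        using r x_closed bimodule [of r a "a' \<bullet> x"]
        by (simp add: tensor_map_tens [OF AA.M AA.M A_left_B rl] galois_map_tens L.lact_assoc L.lact_closed)
    qed
    then have "beta_inv (r \<bullet> c) = ?l (beta_inv c)"
      using beta_inv_eq [OF add_hom_closed [OF la u]] beta_inv [OF c] by simp
    moreover have "mu (n \<triangleleft>\<^bsub>N\<^esub> r) u = mu n (?l u)" if u: "u \<in> carrier ?GA" for u
    proof (rule AA.add_hom_tensor_eq [OF mu_additive [OF N.ract_closed [OF r n]] add_hom_comp [OF la mu_additive [OF n]] _ u])
      fix a' a assume "a' \<in> carrier RA" "a \<in> carrier LA"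
      then show "mu (n \<triangleleft>\<^bsub>N\<^esub> r) (tens B RA LA a' a)
          = mu n (?l (tens B RA LA a' a))"
        using r n by (simp add: mu_tens N.ract_closed tensor_map_tens [OF AA.M AA.M A_left_B rl] N.ract_assoc)
    qed
    ultimately show ?thesis using u by simp
  qed
qed

lemma canonical_injective: "inj_on (canonical N) (carrier (tensor B N LA))"
proof (rule inj_on_inverseI [where g = "tensor_lift (tensor B N LA) (\<lambda>n c. mu n (beta_inv c))"])
  have id: "add_hom (tensor B N LA) (tensor B N LA) (\<lambda>t. t)"
    by (auto simp: add_hom_def NA.abelian_group_tensor)
  fix t assume t: "t \<in> carrier (tensor B N LA)"
  show "tensor_lift (tensor B N LA) (\<lambda>n c. mu n (beta_inv c)) (canonical N t) = t"
  proof (rule NA.add_hom_tensor_eq [OF add_hom_comp [OF canonical_additive NC.tensor_lift_additive [OF balanced_theta]] id _ t])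
    fix n a assume n: "n \<in> carrier N" and "a \<in> carrier LA"
    then have a: "a \<in> carrier A" by simp
    \<comment> \<open>\<open>x a\<close> is the image of \<open>1 \<otimes> a\<close> under the
      Galois map.\<close>
    have "beta_inv (x \<star> a) = tens B RA LA \<one> a"
      using beta_inv_eq [of "tens B RA LA \<one> a"] a x_closed
      by (simp add: galois_map_tens L.lact_one)
    then show "tensor_lift (tensor B N LA) (\<lambda>n c. mu n (beta_inv c)) (canonical N (tens B N LA n a))
        = tens B N LA n a"
      using n a by (simp add: canonical_tens NC.tensor_lift_tens [OF balanced_theta] xa_closed mu_tens N.ract_one)
  qed
qed

text \<open>\<open>n \<otimes> c\<close> is hit by \<open>n \<beta>\<^sup>-\<^sup>1(c)\<close>: for
  fixed \<open>n\<close> one compares on \<open>A \<otimes> A\<close> the map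
  \<open>a' \<otimes> a \<mapsto> n a' \<otimes> x a\<close> with
  \<open>a' \<otimes> a \<mapsto> n \<otimes> a' x a\<close>.\<close>

lemma canonical_surjective: "carrier (tensor A N C) \<subseteq> canonical N ` carrier (tensor B N LA)"
proof
  interpret GN: abelian_group "tensor B N LA" by (rule NA.abelian_group_tensor)
  have pure: "\<exists>u\<in>carrier (tensor B N LA). canonical N u = tens A N C n c"
    if n: "n \<in> carrier N" and c: "c \<in> carrier C" for n c
  proof (rule bexI)
    show "mu n (beta_inv c) \<in> carrier (tensor B N LA)"
      by (rule add_hom_closed [OF mu_additive [OF n] beta_inv(1) [OF c]])
    have "add_hom C (tensor A N C) (tens A N C n)"
      using n by (auto simp: add_hom_def L.M.abelian_group_axioms NC.abelian_group_tensor NC.tens_add_right)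
    from add_hom_comp [OF mu_additive [OF n] canonical_additive] add_hom_comp [OF galois_map_additive this] _ beta_inv(1) [OF c]
    have "canonical N (mu n (beta_inv c)) = tens A N C n (galois_map (beta_inv c))"
    proof (rule AA.add_hom_tensor_eq)
      fix a' a assume "a' \<in> carrier RA" "a \<in> carrier LA"
      then show "canonical N (mu n (tens B RA LA a' a))
          = tens A N C n (galois_map (tens B RA LA a' a))"
        using n x_closed NC.tens_balanced [of n a' "x \<star> a"] bimodule [of a' a x]
        by (simp add: mu_tens canonical_tens N.ract_closed galois_map_tens xa_closed)
    qed
    then show "canonical N (mu n (beta_inv c)) = tens A N C n c" using beta_inv(2) [OF c] by simp
  qed
  fix t assume "t \<in> carrier (tensor A N C)"
  then have "\<exists>u\<in>carrier (tensor B N LA). canonical N u = t"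
  proof (induction t rule: NC.tensor_hull_induct)
    case zero
    show ?case using add_hom_zero [OF canonical_additive] by (intro bexI [OF _ GN.zero_closed])
  next
    case (diff s t)
    then obtain u v where uv: "u \<in> carrier (tensor B N LA)" "canonical N u = s"
      "v \<in> carrier (tensor B N LA)" "canonical N v = t" by blast
    show ?case
      using add_hom_minus [OF canonical_additive uv(1,3)] uv
      by (intro bexI [OF _ GN.minus_closed [OF uv(1,3)]]) simp
  qed (rule pure)
  then show "t \<in> canonical N ` carrier (tensor B N LA)" by (auto simp: image_iff)
qed

end

text \<open>
  Write \<open>\<rho>(m) = \<Sum> m\<^sub>i \<otimes> \<^bold>x a\<^sub>i\<close>.  By coassociativity \<open>\<Sum> m\<^sub>i \<otimes> a\<^sub>i\<close> is annihilated by \<open>\<rho> - (- \<otimes> \<^bold>x)\<close>, so that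
  by flatness the \<open>m\<^sub>i\<close> may be taken coinvariant, and \<open>m = \<Sum> m\<^sub>i a\<^sub>i\<close>.
\<close>

lemma galois_flat_trace:
  fixes M :: "('a, 'c, 'm) comodule"
  assumes flat: "flat TYPE('u) B LA"
    and universe: "infinite (UNIV :: 'u set)" "carrier C \<lesssim> (UNIV :: 'u set)"
    and M: "comodule A C M" "carrier M \<lesssim> (UNIV :: 'u set)"
  shows "carrier M \<subseteq> trace T AT (dual_module M)"
proof
  fix m assume m: "m \<in> carrier M"
  let ?P = "dual_module M"
  note P = right_module_dual [OF M(1)] and MA = comodule.right [OF M(1)]
  interpret P: right_module T ?P by (rule P)
  interpret M: right_module A M by (rule MA)
  interpret MC: tensor_product A M C by (rule tensor_product_C [OF MA])
  have MB: "right_module B M" by (rule right_module_restrict_B [OF MA])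
  interpret MB: tensor_product B M LA by (rule tensor_productI [OF MB A_left_B])
  let ?N = "tensor_C A C M" and ?G = "tensor A M C"
  have N: "right_module A ?N" by (rule right_module_tensor_C [OF MA])
  have NB: "right_module B ?N" by (rule right_module_restrict_B [OF N])
  interpret N: right_module A ?N by (rule N)
  interpret NC: tensor_product A ?N C by (rule tensor_product_C [OF N])
  interpret G: abelian_group ?G by (rule MC.abelian_group_tensor)
  \<comment> \<open>The kernel of \<open>f\<close> consists of the coinvariants. The map is linear
    over \<open>B\<close>, whose elements commute with \<open>x\<close>.\<close>
  define f where "f n = coact M n \<ominus>\<^bsub>?G\<^esub> tens A M C n x" for n
  note cc = coact_closed [OF M(1)] and ca = coact_additive [OF M(1)]
  have tx: "add_hom M ?G (\<lambda>n. tens A M C n x)"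
    using x_closed by (auto simp: add_hom_def M.M.abelian_group_axioms MC.abelian_group_tensor MC.tens_add_left)
  have fc: "f n \<in> carrier ?G" if "n \<in> carrier M" for n
    using cc [OF that] that x_closed by (simp add: f_def)
  have fB: "linear_map B M ?N f"
  proof (rule linear_mapI [OF M.M.abelian_group_axioms N.M.abelian_group_axioms])
    fix n n' assume n: "n \<in> carrier M" "n' \<in> carrier M"
    have "(a \<oplus>\<^bsub>?G\<^esub> b) \<ominus>\<^bsub>?G\<^esub> (c \<oplus>\<^bsub>?G\<^esub> d) = (a \<ominus>\<^bsub>?G\<^esub> c) \<oplus>\<^bsub>?G\<^esub> (b \<ominus>\<^bsub>?G\<^esub> d)"
      if "a \<in> carrier ?G" "b \<in> carrier ?G" "c \<in> carrier ?G" "d \<in> carrier ?G" for a b c d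
      using that by (simp add: a_minus_def G.minus_add G.a_ac)
    then show "f (n \<oplus>\<^bsub>M\<^esub> n') = f n \<oplus>\<^bsub>?N\<^esub> f n'"
      using n cc x_closed by (simp add: f_def add_hom_add [OF ca] MC.tens_add_left)
  next
    fix b n assume b: "b \<in> carrier B" and n: "n \<in> carrier M"
    have bA: "b \<in> carrier A" by (rule B_subset [OF b])
    have act: "add_hom ?G ?G (\<lambda>t. t \<triangleleft>\<^bsub>?N\<^esub> b)" by (rule tensor_C_act_additive [OF MA bA])
    have "tens A M C (n \<triangleleft>\<^bsub>M\<^esub> b) x = tens A M C n x \<triangleleft>\<^bsub>?N\<^esub> b"
      using MC.tens_balanced [OF n bA x_closed] tensor_C_smult [OF MA bA n x_closed] B_commutes [OF b] by simp
    then show "f (n \<triangleleft>\<^bsub>M\<^esub> b) = f n \<triangleleft>\<^bsub>?N\<^esub> b"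
      using add_hom_minus [OF act cc [OF n], of "tens A M C n x"] n x_closed
        linear_map_smult [OF comodule_linear [OF M(1)] bA n] by (simp add: f_def)
  qed (simp add: fc)
  have "coact M m \<in> canonical M ` carrier (tensor B M LA)"
    by (rule subsetD [OF canonical_surjective [OF MA] cc [OF m]])
  then obtain t where t': "coact M m = canonical M t" and tc: "t \<in> carrier (tensor B M LA)"
    by (rule imageE)
  note t = tc t' [symmetric]
  let ?ft = "tensor_map B ?N LA f"
  have ftc: "?ft t \<in> carrier (tensor B ?N LA)"
    by (rule tensor_map_closed [OF MB NB A_left_B fB t(1)])
  \<comment> \<open>Since \<open>canonical ?N\<close> is injective, \<open>?ft t\<close> can be
    tested in \<open>(M \<otimes> C) \<otimes> C\<close>, where two evaluations, by \<open>h\<close>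
    and then by \<open>g\<close>, decide.\<close>
  have "canonical ?N (?ft t) = \<zero>\<^bsub>tensor A ?N C\<^esub>"
  proof (rule tensor_C_eqI [OF N])
    interpret NBA: tensor_product B ?N LA by (rule tensor_productI [OF NB A_left_B])
    show c0: "canonical ?N (?ft t) \<in> carrier (tensor A ?N C)"
      by (rule add_hom_closed [OF canonical_additive [OF N] ftc])
    show "\<zero>\<^bsub>tensor A ?N C\<^esub> \<in> carrier (tensor A ?N C)"
      by (rule NC.tensor_zero_closed)
    fix h assume h: "h \<in> carrier T"
    note hl = T_linear [OF h]
    have ev0: "eval_functional ?N h \<zero>\<^bsub>tensor A ?N C\<^esub> = \<zero>\<^bsub>?G\<^esub>"
      using add_hom_zero [OF NC.eval_additive [OF hl]] by simp
    show "eval_functional ?N h (canonical ?N (?ft t)) = eval_functional ?N h \<zero>\<^bsub>tensor A ?N C\<^esub>"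
      unfolding ev0
    proof (rule tensor_C_eqI [OF MA _ G.zero_closed])
      show "eval_functional ?N h (canonical ?N (?ft t)) \<in> carrier ?G"
        using add_hom_closed [OF NC.eval_additive [OF hl] c0] by simp
      fix g assume g: "g \<in> carrier T"
      note gl = T_linear [OF g] and hgl = T_linear [OF T_mult_closed [OF h g]]
      have NG: "add_hom (tensor A ?N C) ?G (eval_functional ?N h)"
        using NC.eval_additive [OF hl] MC.abelian_group_tensor by (simp add: add_hom_def)
      note lhs = add_hom_comp [OF add_hom_comp [OF add_hom_comp [OF
            tensor_map_additive [OF MB NB A_left_B fB] canonical_additive [OF N]] NG] MC.eval_additive [OF gl]]
      note r1 = add_hom_comp [OF add_hom_comp [OF add_hom_comp [OF
            canonical_additive [OF MA] MC.eval_additive [OF hl]] ca] MC.eval_additive [OF gl]]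
      note r2 = add_hom_comp [OF canonical_additive [OF MA] MC.eval_additive [OF hgl]]
      let ?r1 = "\<lambda>t. eval_functional M g (coact M (eval_functional M h (canonical M t)))"
        and ?r2 = "\<lambda>t. eval_functional M (h \<otimes>\<^bsub>T\<^esub> g) (canonical M t)"
      have rhs: "add_hom (tensor B M LA) M (\<lambda>t. ?r1 t \<ominus>\<^bsub>M\<^esub> ?r2 t)"
        unfolding add_hom_def
      proof (intro conjI MB.abelian_group_tensor M.M.abelian_group_axioms ballI Pi_I)
        fix s assume s: "s \<in> carrier (tensor B M LA)"
        show "?r1 s \<ominus>\<^bsub>M\<^esub> ?r2 s \<in> carrier M"
          using add_hom_closed [OF r1 s] add_hom_closed [OF r2 s] by simp
        fix s' assume s': "s' \<in> carrier (tensor B M LA)"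
        show "?r1 (s \<oplus>\<^bsub>tensor B M LA\<^esub> s') \<ominus>\<^bsub>M\<^esub> ?r2 (s \<oplus>\<^bsub>tensor B M LA\<^esub> s')
            = (?r1 s \<ominus>\<^bsub>M\<^esub> ?r2 s) \<oplus>\<^bsub>M\<^esub> (?r1 s' \<ominus>\<^bsub>M\<^esub> ?r2 s')"
          using add_hom_closed [OF r1 s] add_hom_closed [OF r2 s]
            add_hom_closed [OF r1 s'] add_hom_closed [OF r2 s']
          unfolding add_hom_add [OF r1 s s'] add_hom_add [OF r2 s s']
          by (simp add: a_minus_def M.M.minus_add M.M.a_ac)
      qed
      \<comment> \<open>On \<open>n \<otimes> a\<close>, evaluation under \<open>h\<close> leaves
        \<open>\<rho>(n h(x a)) - n \<otimes> x h(x a)\<close>. Under \<open>g\<close> the second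
        term yields \<open>n\<close> times the product of \<open>h\<close> and \<open>g\<close> at
        \<open>x a\<close>, by the formula for \<open>\<Delta>(x a)\<close>.\<close>
      have "eval_functional M g (eval_functional ?N h (canonical ?N (?ft t))) = ?r1 t \<ominus>\<^bsub>M\<^esub> ?r2 t"
      proof (rule MB.add_hom_tensor_eq [OF lhs rhs _ t(1)])
        fix n a assume n: "n \<in> carrier M" and aL: "a \<in> carrier LA"
        then have a: "a \<in> carrier A" by simp
        let ?a = "h (x \<star> a)"
        have ha: "?a \<in> carrier A" by (rule T_closed [OF h xa_closed [OF a]])
        have fN: "f n \<in> carrier ?N" using fc [OF n] by simp
        have "eval_functional ?N h (canonical ?N (?ft (tens B M LA n a))) = f n \<triangleleft>\<^bsub>?N\<^esub> ?a"
          unfolding tensor_map_tens [OF MB NB A_left_B fB n aL] canonical_tens [OF N fN a]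
          by (rule NC.eval_tens [OF hl fN xa_closed [OF a]])
        also have "\<dots> = coact M (n \<triangleleft>\<^bsub>M\<^esub> ?a) \<ominus>\<^bsub>?G\<^esub> tens A M C n (x \<star> ?a)"
          using add_hom_minus [OF tensor_C_act_additive [OF MA ha] cc [OF n], of "tens A M C n x"] n x_closed
            linear_map_smult [OF comodule_linear [OF M(1)] ha n] tensor_C_smult [OF MA ha n x_closed]
          by (simp add: f_def)
        finally have "eval_functional M g (eval_functional ?N h (canonical ?N (?ft (tens B M LA n a))))
            = eval_functional M g (coact M (n \<triangleleft>\<^bsub>M\<^esub> ?a)) \<ominus>\<^bsub>M\<^esub> n \<triangleleft>\<^bsub>M\<^esub> g (x \<star> ?a)"
          using add_hom_minus [OF MC.eval_additive [OF gl] cc [OF M.ract_closed [OF ha n]],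
              of "tens A M C n (x \<star> ?a)"] n xa_closed [OF ha]
          by (simp add: MC.eval_tens [OF gl])
        moreover have "g (x \<star> ?a) = (h \<otimes>\<^bsub>T\<^esub> g) (x \<star> a)"
          using h g a by (simp add: T_mult_act xa_closed actC_xa)
        ultimately show "eval_functional M g (eval_functional ?N h (canonical ?N (?ft (tens B M LA n a))))
            = ?r1 (tens B M LA n a) \<ominus>\<^bsub>M\<^esub> ?r2 (tens B M LA n a)"
          using n a xa_closed [OF a] by (simp add: canonical_tens [OF MA] MC.eval_tens [OF hl] MC.eval_tens [OF hgl])
      qed
      also have "\<dots> = (m \<triangleleft>\<^bsub>?P\<^esub> h) \<triangleleft>\<^bsub>?P\<^esub> g \<ominus>\<^bsub>M\<^esub> m \<triangleleft>\<^bsub>?P\<^esub> (h \<otimes>\<^bsub>T\<^esub> g)"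
        using t(2) by simp
      \<comment> \<open>Coassociativity enters here, as the module law for the action of the dual
        ring on \<open>m\<close>.\<close>
      also have "\<dots> = \<zero>\<^bsub>M\<^esub>"
        using P.ract_assoc [OF h g, of m] P.ract_closed [OF g P.ract_closed [OF h, of m]] m
        by (simp add: M.M.diff_eq_zero_iff del: dual_module_simps(4))
      also have "\<dots> = eval_functional M g \<zero>\<^bsub>?G\<^esub>"
        by (rule add_hom_zero [OF MC.eval_additive [OF gl], symmetric])
      finally show "eval_functional M g (eval_functional ?N h (canonical ?N (?ft t))) = eval_functional M g \<zero>\<^bsub>?G\<^esub>" .
    qed
  qed
  also have "\<dots> = canonical ?N \<zero>\<^bsub>tensor B ?N LA\<^esub>"
    by (rule add_hom_zero [OF canonical_additive [OF N], symmetric])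
  finally have ft0: "?ft t = \<zero>\<^bsub>tensor B ?N LA\<^esub>"
  proof (rule inj_onD [OF canonical_injective [OF N] _ ftc])
    interpret NBA: tensor_product B ?N LA by (rule tensor_productI [OF NB A_left_B])
    show "\<zero>\<^bsub>tensor B ?N LA\<^esub> \<in> carrier (tensor B ?N LA)"
      by (rule NBA.tensor_zero_closed)
  qed
  have N_small: "carrier ?N \<lesssim> (UNIV :: 'u set)"
    using MC.tensor_lepoll [OF universe(1) M(2) universe(2)] by simp
  obtain ps where ps: "set ps \<subseteq> {n \<in> carrier M. f n = \<zero>\<^bsub>?N\<^esub>} \<times> carrier LA"
    "t = lsum (tensor B M LA) (\<lambda>(n, a). tens B M LA n a) ps"
    by (rule flat_exact [OF flat MB NB N_small fB t(1) ft0])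
  have co: "n \<in> coinv_T ?P" "n \<in> carrier M" "a \<in> carrier A" if "(n, a) \<in> set ps" for n a
  proof -
    have n: "n \<in> carrier M" "f n = \<zero>\<^bsub>?G\<^esub>" "a \<in> carrier A" using that ps(1) by auto
    then have "coact M n = tens A M C n x"
      using cc [OF n(1)] x_closed by (simp add: f_def G.diff_eq_zero_iff)
    then show "n \<in> coinv_T ?P" "n \<in> carrier M" "a \<in> carrier A"
      using n coinv_eq_coinv_T [OF M(1)] by (auto simp: coinv_def)
  qed
  note el = MC.eval_additive [OF counit_linear_left]
  have td: "(\<lambda>(n, a). tens B M LA n a) p \<in> carrier (tensor B M LA)" if "p \<in> set ps" for p
    using co [of "fst p" "snd p"] that by (simp add: case_prod_beta)
  \<comment> \<open>Counitality recovers \<open>m\<close> from \<open>t\<close> as a sum of products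
    \<open>n a\<close>, because \<open>\<epsilon>(x a) = a\<close>.\<close>
  have "m = eval_functional M (counit C) (canonical M t)"
    using comodule.counital [OF M(1) m] t(2) by (simp add: eval_functional_def)
  also have "\<dots> = lsum M (\<lambda>p. eval_functional M (counit C) (canonical M ((\<lambda>(n, a). tens B M LA n a) p))) ps"
    unfolding ps(2) by (rule add_hom_lsum [OF add_hom_comp [OF canonical_additive [OF MA] el] td])
  also have "\<dots> = lsum ?P (\<lambda>p. fst p \<triangleleft>\<^bsub>?P\<^esub> iota (snd p)) ps"
  proof -
    have "lsum M (\<lambda>p. eval_functional M (counit C) (canonical M ((\<lambda>(n, a). tens B M LA n a) p))) ps
      = lsum M (\<lambda>p. fst p \<triangleleft>\<^bsub>?P\<^esub> iota (snd p)) ps"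
    proof (rule lsum_cong)
      fix p assume "p \<in> set ps"
      then have p: "fst p \<in> carrier M" "snd p \<in> carrier A" using co [of "fst p" "snd p"] by simp_all
      show "eval_functional M (counit C) (canonical M ((\<lambda>(n, a). tens B M LA n a) p)) = fst p \<triangleleft>\<^bsub>?P\<^esub> iota (snd p)"
        using p xa_closed [OF p(2)] x_closed
        by (simp add: case_prod_beta canonical_tens [OF MA] MC.eval_tens [OF counit_linear_left] counit_smult_right
            counit_x comodule_act_iota [OF M(1)] del: dual_module_simps(4))
    qed
    then show ?thesis using lsum_cong_structure [of M ?P] by simp
  qed
  also have "\<dots> \<in> trace T AT ?P"
  proof (rule closed_submodule_lsum [OF trace_closed_submodule [OF right_module_AT P]])
    fix p assume "p \<in> set ps"
    then have p: "fst p \<in> coinv_T ?P" "snd p \<in> carrier A" using co [of "fst p" "snd p"] by simp_all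
    have "(\<lambda>a\<in>carrier A. fst p \<triangleleft>\<^bsub>?P\<^esub> iota a) (snd p) \<in> trace T AT ?P"
      by (rule lin_hom_image_trace [OF coinv_T_hom [OF P p(1)]]) (simp_all add: p(2) P.M.abelian_group_axioms)
    then show "fst p \<triangleleft>\<^bsub>?P\<^esub> iota (snd p) \<in> trace T AT ?P" using p(2) by simp
  qed
  finally show "m \<in> trace T AT ?P" .
qed

end

end

section \<open>Generated and subgenerated modules over the dual ring\<close>

text \<open>An element of \<open>'u\<close> is encoded by the singleton of a two-valued indicator
  function. Thus the carrier type of the ambient module in \<open>subgenerated\<close> has room for
  the universe.\<close>

lemma lepoll_function_sets:
  fixes a b :: 'w assumes "a \<noteq> b"
  shows "(UNIV :: 'u set) \<lesssim> (UNIV :: ('u \<times> nat \<Rightarrow> 'w) set set)"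
  unfolding lepoll_def
proof (intro exI conjI)
  show "inj (\<lambda>u. {\<lambda>p :: 'u \<times> nat. if fst p = u then a else b})"
  proof (rule injI)
    fix u v
    assume "{\<lambda>p :: 'u \<times> nat. if fst p = u then a else b} = {\<lambda>p. if fst p = v then a else b}"
    then have "(\<lambda>p :: 'u \<times> nat. if fst p = u then a else b) = (\<lambda>p. if fst p = v then a else b)"
      by (rule singleton_inject)
    from fun_cong [OF this, of "(u, 0)"]
    show "u = v" using assms by (auto split: if_splits)
  qed
qed simp

lemma subgenerated_if_embeds:
  fixes W :: "('t, 'w, 'y) module_scheme" and M :: "('t, 'm, 'z) module_scheme" and Q :: "('t, 'q, 'v) module_scheme"
  assumes W: "right_module T W" and M: "right_module T M" and Q: "right_module T Q"
    and gen: "carrier Q \<subseteq> trace T W Q" and j: "linear_map T M Q j" "inj_on j (carrier M)"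
    and small: "carrier Q \<lesssim> (UNIV :: ('m \<times> nat \<Rightarrow> 'w) set set)"
  shows "subgenerated T W M"
proof -
  obtain h :: "'q \<Rightarrow> ('m \<times> nat \<Rightarrow> 'w) set" where h: "inj_on h (carrier Q)" using small by (auto simp: lepoll_def)
  let ?N = "transport h Q"
  have N: "right_module T ?N" by (rule right_module_transport [OF Q h])
  have hl: "linear_map T Q ?N h" by (rule linear_map_transport [OF right_module_group [OF Q] h])
  have "carrier ?N \<subseteq> trace T W ?N"
    using gen trace_linear_image [OF W Q N hl] by auto
  then have "generated T W ?N" using N by (simp add: generated_iff [OF W])
  moreover have "restrict (\<lambda>m. h (j m)) (carrier M) \<in> lin_hom T M ?N"
    by (rule restrict_lin_hom [OF linear_map_comp [OF j(1) hl]]) (simp add: M)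
  moreover have "inj_on (restrict (\<lambda>m. h (j m)) (carrier M)) (carrier M)"
    using j(2) h linear_map_closed [OF j(1)] by (auto simp: inj_on_def)
  ultimately show ?thesis unfolding subgenerated_def using M by blast
qed

context coring begin

text \<open>The ambient module is rational because it is generated by a rational one, and
  rationality passes to submodules.\<close>

lemma rational_if_subgenerated:
  fixes W :: "('c \<Rightarrow> 'a, 'w, 'y) module_scheme" and M :: "('c \<Rightarrow> 'a, 'm, 'z) module_scheme"
  assumes "dual_basis_coring A C" and W: "rational W" and M: "subgenerated T W M"
  shows "rational M"
proof -
  interpret dual_basis_coring A C by fact
  have WT: "right_module T W" by (rule rational_right_module [OF W])
  obtain N :: "('c \<Rightarrow> 'a, ('m \<times> nat \<Rightarrow> 'w) set) module" and j where
    N: "generated T W N" and j: "j \<in> lin_hom T M N" "inj_on j (carrier M)" and MT: "right_module T M"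
    using M by (auto simp: subgenerated_def)
  have NT: "right_module T N" and "carrier N \<subseteq> trace T W N" using N by (simp_all add: generated_iff [OF WT])
  then have "rational N" by (rule rational_if_generated [OF W])
  then show ?thesis
    by (rule rational_injective [OF MT _ lin_hom_linear [OF j(1) right_module_group [OF MT] right_module_group [OF NT]] j(2)])
qed

end

section \<open>Rational modules as subgenerated modules\<close>

context grouplike_coring begin

lemma rational_AT: "rational AT"
  by (rule rational_dual_module [OF comodule_AC])

text \<open>The module \<open>P\<close> is a comodule, and its coaction embeds it into
  \<open>P \<otimes> C\<close>, on which the dual ring acts through \<open>C\<close>.
  Coassociativity makes the coaction linear over the dual ring, the unit makes it injective, and
  \<open>P \<otimes> C\<close> is generated by \<open>C\<close>.\<close>

lemma rational_embeds:
  fixes P :: "('c \<Rightarrow> 'a, 'p, 'y) module_scheme"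
  assumes P: "rational P"
    and small: "infinite (UNIV :: 'u set)" "carrier P \<lesssim> (UNIV :: 'u set)" "carrier C \<lesssim> (UNIV :: 'u set)"
  obtains Q :: "('c \<Rightarrow> 'a, ('p \<times> 'c \<Rightarrow>\<^sub>0 int) set) module" and j
  where "right_module T Q" "carrier Q \<subseteq> trace T CT Q" "linear_map T P Q j" "inj_on j (carrier P)"
    "carrier Q \<lesssim> (UNIV :: 'u set)"
proof -
  have PT: "right_module T P" by (rule rational_right_module [OF P])
  interpret P: right_module T P by (rule PT)
  obtain M :: "('a, 'c, 'p) comodule" where M: "comodule A C M" and Mc: "carrier M = carrier P"
    and M0: "\<zero>\<^bsub>M\<^esub> = \<zero>\<^bsub>P\<^esub>" and Ma: "add M = add P"
    and act: "\<And>f p. \<lbrakk>f \<in> carrier T; p \<in> carrier P\<rbrakk> \<Longrightarrow> p \<triangleleft>\<^bsub>dual_module M\<^esub> f = p \<triangleleft>\<^bsub>P\<^esub> f"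
    using rational_comodule [OF P] by blast
  note MA = comodule.right [OF M]
  interpret MC: tensor_product A M C by (rule tensor_product_C [OF MA])
  let ?Q = "tensor_rmod A M C CT" and ?G = "tensor A M C"
  have bim: "(r \<bullet> n) \<triangleleft>\<^bsub>CT\<^esub> s = r \<bullet> (n \<triangleleft>\<^bsub>CT\<^esub> s)"
    if "r \<in> carrier A" "s \<in> carrier T" "n \<in> carrier C" for r s n
    using actC_left_linear that by (simp add: CT_act del: dual_module_simps(4))
  have Q: "right_module T ?Q"
    by (rule MC.right_module_tensor_rmod [OF right_module_CT]) (simp_all add: bim del: dual_module_simps(4))
  have Qt: "tens A M C m c \<triangleleft>\<^bsub>?Q\<^esub> f = tens A M C m (actC f c)" if "f \<in> carrier T" "m \<in> carrier M" "c \<in> carrier C" for f m c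
    using MC.rmod_act_tens [OF right_module_CT _ _ bim that] by (simp add: CT_act del: dual_module_simps(4))
  have Qa: "add_hom ?G ?G (\<lambda>t. t \<triangleleft>\<^bsub>?Q\<^esub> f)" if "f \<in> carrier T" for f
    by (rule MC.rmod_act_additive [OF right_module_CT _ _ bim that]) simp_all
  have Qs: "carrier ?Q = carrier ?G" "add ?Q = add ?G" "\<zero>\<^bsub>?Q\<^esub> = \<zero>\<^bsub>?G\<^esub>" by (simp_all add: tensor_rmod_def)
  have gen: "carrier ?Q \<subseteq> trace T CT ?Q"
    by (rule MC.rmod_trace [OF right_module_CT]) (simp_all add: bim del: dual_module_simps(4))
  have ev: "eval_functional M g (u \<triangleleft>\<^bsub>?Q\<^esub> f) = eval_functional M (f \<otimes>\<^bsub>T\<^esub> g) u"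
    if f: "f \<in> carrier T" and g: "g \<in> carrier T" and u: "u \<in> carrier ?G" for f g u
  proof (rule MC.add_hom_tensor_eq [OF add_hom_comp [OF Qa [OF f] MC.eval_additive [OF T_linear [OF g]]]
        MC.eval_additive [OF T_linear [OF T_mult_closed [OF f g]]] _ u])
    fix m c assume "m \<in> carrier M" "c \<in> carrier C"
    then show "eval_functional M g (tens A M C m c \<triangleleft>\<^bsub>?Q\<^esub> f) = eval_functional M (f \<otimes>\<^bsub>T\<^esub> g) (tens A M C m c)"
      using f g by (simp add: Qt MC.eval_tens [OF T_linear [OF g]] MC.eval_tens [OF T_linear [OF T_mult_closed [OF f g]]]
          actC_closed T_mult_act)
  qed
  have cc: "coact M p \<in> carrier ?G" if "p \<in> carrier P" for p using coact_closed [OF M] that Mc by simp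
  have evc: "eval_functional M g (coact M p) = p \<triangleleft>\<^bsub>P\<^esub> g" if "g \<in> carrier T" "p \<in> carrier P" for g p
    using act [OF that] by simp
  have j: "linear_map T P ?Q (coact M)"
  proof (rule linear_mapI [OF P.M.abelian_group_axioms right_module_group [OF Q]])
    fix p q assume "p \<in> carrier P" "q \<in> carrier P"
    then show "coact M (p \<oplus>\<^bsub>P\<^esub> q) = coact M p \<oplus>\<^bsub>?Q\<^esub> coact M q"
      using add_hom_add [OF coact_additive [OF M], of p q] by (simp add: Mc Ma Qs)
  next
    fix f p assume f: "f \<in> carrier T" and p: "p \<in> carrier P"
    show "coact M (p \<triangleleft>\<^bsub>P\<^esub> f) = coact M p \<triangleleft>\<^bsub>?Q\<^esub> f"
    \<comment> \<open>Evaluation under \<open>g\<close> turns both sides into the action of the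
      product of \<open>f\<close> and \<open>g\<close> on \<open>p\<close>.\<close>
    proof (rule tensor_C_eqI [OF MA cc [OF P.ract_closed [OF f p]] add_hom_closed [OF Qa [OF f] cc [OF p]]])
      fix g assume g: "g \<in> carrier T"
      show "eval_functional M g (coact M (p \<triangleleft>\<^bsub>P\<^esub> f)) = eval_functional M g (coact M p \<triangleleft>\<^bsub>?Q\<^esub> f)"
        using P.ract_assoc [OF f g p]
        by (simp only: ev [OF f g cc [OF p]] evc [OF g P.ract_closed [OF f p]] evc [OF T_mult_closed [OF f g] p])
    qed
  qed (use cc Qs in simp)
  have inj: "inj_on (coact M) (carrier P)"
  proof (rule inj_onI)
    fix p q assume "p \<in> carrier P" "q \<in> carrier P" "coact M p = coact M q"
    then show "p = q" using evc [OF T_one_closed] P.ract_one by metis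
  qed
  have "carrier ?Q \<lesssim> (UNIV :: 'u set)"
    unfolding Qs by (rule MC.tensor_lepoll [OF small(1) _ small(3)]) (simp add: Mc small(2))
  from that [OF Q gen j inj this] show thesis .
qed

text \<open>A rational module arises from a comodule on the same carrier with the same addition and
  action, so both have the same trace of \<open>A\<close>.\<close>

lemma generates_rationalI:
  assumes "\<And>M :: ('a, 'c, 'u) comodule. comodule A C M \<Longrightarrow> carrier M \<subseteq> trace T AT (dual_module M)"
  shows "generates_rational TYPE('u)"
  unfolding generates_rational_def
proof (intro allI impI)
  fix P :: "('c \<Rightarrow> 'a, 'u) module" assume P: "rational P"
  obtain M :: "('a, 'c, 'u) comodule" where M: "comodule A C M" and Mc: "carrier M = carrier P"
    and M0: "\<zero>\<^bsub>M\<^esub> = \<zero>\<^bsub>P\<^esub>" and Ma: "add M = add P"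
    and act: "\<And>f p. \<lbrakk>f \<in> carrier T; p \<in> carrier P\<rbrakk> \<Longrightarrow> p \<triangleleft>\<^bsub>dual_module M\<^esub> f = p \<triangleleft>\<^bsub>P\<^esub> f"
    using rational_comodule [OF P] by blast
  have "lin_hom T AT (dual_module M) = lin_hom T AT P"
    by (rule lin_hom_cong) (simp_all only: dual_module_simps(1-3) Mc Ma act)
  moreover have "lsum (dual_module M) = (lsum P :: _ \<Rightarrow> (('a \<Rightarrow> 'u) \<times> 'a) list \<Rightarrow> 'u)"
    by (intro ext lsum_cong_structure) (simp_all only: dual_module_simps(1-3) Ma M0)
  ultimately have "trace T AT (dual_module M) = trace T AT P" by (simp add: trace_def)
  then show "carrier P \<subseteq> trace T AT P" using assms [OF M] Mc by simp
qed

context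
  assumes one_neq_zero: "\<one> \<noteq> \<zero>"
    and universe: "infinite (UNIV :: 'u set)" "carrier A \<lesssim> (UNIV :: 'u set)" "carrier C \<lesssim> (UNIV :: 'u set)"
begin

lemma x_nonzero: "x \<noteq> \<zero>\<^bsub>C\<^esub>"
  using counit_x linear_map_zero [OF counit_linear_left] one_neq_zero by auto

lemma sigma_CT: "sigma_category TYPE('u) T CT = {P. rational P}"
proof -
  have "subgenerated T CT P" if P: "rational P" for P :: "('c \<Rightarrow> 'a, 'u) module"
  proof -
    obtain Q :: "('c \<Rightarrow> 'a, ('u \<times> 'c \<Rightarrow>\<^sub>0 int) set) module" and j where Q: "right_module T Q" "carrier Q \<subseteq> trace T CT Q"
      "linear_map T P Q j" "inj_on j (carrier P)" "carrier Q \<lesssim> (UNIV :: 'u set)"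
      using rational_embeds [OF P universe(1) _ universe(3)] subset_imp_lepoll [OF subset_UNIV] by metis
    show ?thesis
      by (rule subgenerated_if_embeds [OF right_module_CT rational_right_module [OF P] Q(1-4)
            lepoll_trans [OF Q(5) lepoll_function_sets [OF x_nonzero]]])
  qed
  then show ?thesis
    using rational_if_subgenerated [OF dual_basis_coring_axioms rational_dual_module [OF comodule_coring]]
    unfolding sigma_category_def by blast
qed

lemma Gen_AT: "Gen TYPE('u) T AT = {P. right_module T P \<and> carrier P \<subseteq> trace T AT P}"
  by (simp add: Gen_def generated_iff [OF right_module_AT])

text \<open>Modules generated by \<open>A\<close> are rational because \<open>A\<close> is; the
  equality therefore amounts to one inclusion.\<close>

lemma sigma_eq_Gen_iff:
  "sigma_category TYPE('u) T CT = Gen TYPE('u) T AT \<longleftrightarrow> generates_rational TYPE('u)"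
  unfolding sigma_CT Gen_AT generates_rational_def
  using rational_if_generated [OF rational_AT] rational_right_module by blast

text \<open>A rational module is generated by \<open>A\<close> and may serve as its own ambient
  module, after a move to the type prescribed for ambient modules.\<close>

lemma sigma_AT:
  assumes "generates_rational TYPE('u)"
  shows "sigma_category TYPE('u) T AT = {P. rational P}"
proof -
  have "subgenerated T AT P" if P: "rational P" for P :: "('c \<Rightarrow> 'a, 'u) module"
  proof -
    have PT: "right_module T P" by (rule rational_right_module [OF P])
    have id: "linear_map T P P (\<lambda>p. p)" by (intro linear_mapI right_module_group [OF PT]) simp_all
    have "carrier P \<lesssim> (UNIV :: 'u set)" by (rule subset_imp_lepoll) simp
    then show ?thesis
      using assms P
      by (intro subgenerated_if_embeds [OF right_module_AT PT PT _ id] lepoll_trans [OF _ lepoll_function_sets [OF one_neq_zero]])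
         (auto simp: generates_rational_def)
  qed
  then show ?thesis
    using rational_if_subgenerated [OF dual_basis_coring_axioms rational_AT]
    unfolding sigma_category_def by blast
qed

section \<open>Faithfulness and generators\<close>

text \<open>Every element of \<open>M\<close> is a sum of values of maps from \<open>A\<close>; two
  maps that agree after composition with all of these are equal.\<close>

lemma generates_rational_generator:
  assumes gen: "generates_rational TYPE('u)"
  shows "comodule_generator TYPE('u) A C AC"
  unfolding comodule_generator_def
proof (intro allI impI ballI, elim conjE, rule ccontr)
  fix M N :: "('a, 'c, 'u) comodule" and f g
  assume M: "comodule A C M" and N: "comodule A C N" and f: "f \<in> colin_hom A C M N" and g: "g \<in> colin_hom A C M N"
    and neq: "f \<noteq> g" and eq: "\<not> (\<exists>h\<in>colin_hom A C AC M. compose (carrier AC) f h \<noteq> compose (carrier AC) g h)"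
  note MT = right_module_dual [OF M] and NT = right_module_dual [OF N]
  have f': "f \<in> lin_hom T (dual_module M) (dual_module N)" and g': "g \<in> lin_hom T (dual_module M) (dual_module N)"
    using f g colin_hom_eq_lin_hom [OF M N] by auto
  note fa = linear_map_additive [OF lin_hom_linear [OF f' right_module_group [OF MT] right_module_group [OF NT]]]
    and ga = linear_map_additive [OF lin_hom_linear [OF g' right_module_group [OF MT] right_module_group [OF NT]]]
  have "f m = g m" if m: "m \<in> carrier M" for m
  proof -
    have "m \<in> trace T AT (dual_module M)"
      using generates_rationalD [OF gen rational_dual_module [OF M]] subset_imp_lepoll [OF subset_UNIV] m by auto
    then obtain ks where ks: "set ks \<subseteq> lin_hom T AT (dual_module M) \<times> carrier AT" "m = lsum (dual_module M) (\<lambda>(h, a). h a) ks"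
      by (auto simp: trace_def)
    have c: "(\<lambda>(h, a). h a) k \<in> carrier (dual_module M)" "f ((\<lambda>(h, a). h a) k) = g ((\<lambda>(h, a). h a) k)"
      if k: "k \<in> set ks" for k
    proof -
      have h: "fst k \<in> lin_hom T AT (dual_module M)" "snd k \<in> carrier A" using ks(1) k by auto
      then show "(\<lambda>(h, a). h a) k \<in> carrier (dual_module M)" using hom_T_closed [OF MT] by (simp add: case_prod_beta)
      have "compose (carrier AC) f (fst k) = compose (carrier AC) g (fst k)"
        using eq h(1) colin_hom_eq_lin_hom [OF comodule_AC M] by blast
      then have "compose (carrier AC) f (fst k) (snd k) = compose (carrier AC) g (fst k) (snd k)" by simp
      then show "f ((\<lambda>(h, a). h a) k) = g ((\<lambda>(h, a). h a) k)"
        using h(2) by (simp add: case_prod_beta compose_def)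
    qed
    have "f m = lsum (dual_module N) (\<lambda>k. f ((\<lambda>(h, a). h a) k)) ks"
      unfolding ks(2) by (rule add_hom_lsum [OF fa c(1)])
    also have "\<dots> = lsum (dual_module N) (\<lambda>k. g ((\<lambda>(h, a). h a) k)) ks" by (rule lsum_cong) (rule c(2))
    also have "\<dots> = g m" unfolding ks(2) by (rule add_hom_lsum [OF ga c(1), symmetric])
    finally show ?thesis .
  qed
  then show False using lin_hom_ext [OF f' g'] neq by simp
qed

text \<open>The projection onto the quotient by the trace and the zero map agree after composition
  with every map from \<open>A\<close>. A generator does not separate them, so they are equal and
  the trace is everything.\<close>

lemma generator_generates_rational:
  assumes gen: "comodule_generator TYPE('u) A C AC"
  shows "generates_rational TYPE('u)"
proof (rule generates_rationalI, rule subsetI)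
  fix M :: "('a, 'c, 'u) comodule" and p assume M: "comodule A C M" and pM: "p \<in> carrier M"
  define P where "P = dual_module M"
  have PT: "right_module T P" and P: "rational P" and p: "p \<in> carrier P"
    unfolding P_def using right_module_dual [OF M] rational_dual_module [OF M] pM by simp_all
  interpret P: right_module T P by (rule PT)
  let ?S = "trace T AT P"
  have S: "closed_submodule T P ?S" by (rule trace_closed_submodule [OF right_module_AT PT])
  note S' = additive_subgroup_closed_submodule [OF PT S]
  \<comment> \<open>The quotient is formed on representatives and keeps the type \<open>'u\<close>,
    so the comodule built from it is among those that the hypothesis covers.\<close>
  let ?Q = "quotient_module P ?S" and ?q = "coset_rep P ?S"
  have QT: "right_module T ?Q" and q: "linear_map T P ?Q ?q" using quotient_right_module [OF PT S] by auto
  interpret Q: right_module T ?Q by (rule QT)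
  have Q: "rational ?Q" by (rule rational_surjective_image [OF P QT q]) (simp add: quotient_simps [OF S'])
  obtain N :: "('a, 'c, 'u) comodule" where N: "comodule A C N" and Nc: "carrier N = carrier ?Q"
    and N0: "\<zero>\<^bsub>N\<^esub> = \<zero>\<^bsub>?Q\<^esub>" and Na: "add N = add ?Q"
    and Nact: "\<And>f p. \<lbrakk>f \<in> carrier T; p \<in> carrier ?Q\<rbrakk> \<Longrightarrow> p \<triangleleft>\<^bsub>dual_module N\<^esub> f = p \<triangleleft>\<^bsub>?Q\<^esub> f"
    using rational_comodule [OF Q] by blast
  have MN: "colin_hom A C M N = lin_hom T P ?Q"
    unfolding colin_hom_eq_lin_hom [OF M N] P_def [symmetric]
    by (rule lin_hom_cong) (simp_all only: dual_module_simps(1-3) Nc Na Nact)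
  have AM: "colin_hom A C AC M = lin_hom T AT P"
    unfolding colin_hom_eq_lin_hom [OF comodule_AC M] P_def ..
  let ?f = "restrict ?q (carrier P)" and ?g = "restrict (\<lambda>_. \<zero>\<^bsub>?Q\<^esub>) (carrier P)"
  have f: "?f \<in> lin_hom T P ?Q" by (rule restrict_lin_hom [OF q]) (simp add: PT)
  have "linear_map T P ?Q (\<lambda>_. \<zero>\<^bsub>?Q\<^esub>)"
    using Q.ract_zero_left by (intro linear_mapI P.M.abelian_group_axioms Q.M.abelian_group_axioms) (simp_all del: quotient_simps)
  then have g: "?g \<in> lin_hom T P ?Q" by (rule restrict_lin_hom) (simp add: PT)
  have "?f = ?g"
  proof (rule ccontr)
    assume "?f \<noteq> ?g"
    then obtain h where h: "h \<in> lin_hom T AT P" "compose (carrier AC) ?f h \<noteq> compose (carrier AC) ?g h"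
      using gen M N f g unfolding comodule_generator_def MN [symmetric] AM [symmetric] by blast
    have "?f (h a) = ?g (h a)" if a: "a \<in> carrier A" for a
    proof -
      have "h a \<in> ?S" by (rule lin_hom_image_trace [OF h(1) _ P.M.abelian_group_axioms]) (simp add: a)
      then show ?thesis
        using hom_T_closed [OF PT h(1) a] coset_rep_eq_zero_iff [OF S', of "h a"] by (simp del: quotient_simps)
    qed
    then have "compose (carrier AC) ?f h = compose (carrier AC) ?g h"
      unfolding compose_def by (intro restrict_ext) simp
    then show False using h(2) by blast
  qed
  then have "?f p = ?g p" by simp
  then show "p \<in> trace T AT (dual_module M)" unfolding P_def [symmetric] using p coset_rep_eq_zero_iff [OF S' p] by (simp del: quotient_simps)
qed

lemma faithful_iff_generator:
  "colin_hom_functor_faithful TYPE('u) A C x \<longleftrightarrow> comodule_generator TYPE('u) A C AC"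
proof -
  have eq: "hom_functor_map A (colin_hom A C AC M) f = hom_functor_map A (colin_hom A C AC M) g
      \<longleftrightarrow> (\<forall>h\<in>colin_hom A C AC M. compose (carrier AC) f h = compose (carrier AC) g h)"
    for M :: "('a, 'c, 'u) comodule" and f g :: "'u \<Rightarrow> 'u"
    unfolding hom_functor_map_def by (auto simp: fun_eq_iff restrict_def)
  show ?thesis
    unfolding colin_hom_functor_faithful_def comodule_generator_def inj_on_def eq by blast
qed

end

end

section \<open>Full faithfulness\<close>

text \<open>Keep only those maps from \<open>W\<close> that occur in chosen presentations of the
  elements of \<open>X\<close>. The image of the direct sum over these maps is generated, contains
  \<open>X\<close> and is small.\<close>

lemma small_generated_submodule:
  fixes W :: "('t, 'w, 'y) module_scheme" and N :: "('t, 'n) module"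
  assumes W: "right_module T W" and N: "right_module T N" and X: "X \<subseteq> trace T W N"
    and small: "infinite (UNIV :: 'u set)" "X \<lesssim> (UNIV :: 'u set)" "carrier W \<lesssim> (UNIV :: 'u set)"
  obtains V where "closed_submodule T N V" "X \<subseteq> V" "generated T W (N\<lparr>carrier := V\<rparr>)" "V \<lesssim> (UNIV :: 'u set)"
proof -
  interpret W: right_module T W by (rule W)
  interpret N: right_module T N by (rule N)
  have "\<forall>v\<in>X. \<exists>ks. set ks \<subseteq> lin_hom T W N \<times> carrier W \<and> v = lsum N (\<lambda>(h, w). h w) ks"
    using X by (auto simp: trace_def)
  then obtain ks where ks: "\<And>v. v \<in> X \<Longrightarrow> set (ks v) \<subseteq> lin_hom T W N \<times> carrier W"
    and sum: "\<And>v. v \<in> X \<Longrightarrow> v = lsum N (\<lambda>(h, w). h w) (ks v)"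
    by (metis (no_types, lifting) bchoice)
  define I where "I = (\<Union>v\<in>X. fst ` set (ks v))"
  have I: "linear_map T W N i" if i: "i \<in> I" for i
  proof -
    obtain v k where v: "v \<in> X" "k \<in> set (ks v)" "i = fst k" using i unfolding I_def by blast
    then have "i \<in> lin_hom T W N" using ks [OF v(1)] by auto
    then show ?thesis by (rule lin_hom_linear [OF _ W.M.abelian_group_axioms N.M.abelian_group_axioms])
  qed
  \<comment> \<open>Each element of \<open>X\<close> contributes the entries of one list, so the
    maps are indexed by \<open>X\<close> times the natural numbers.\<close>
  have "I \<subseteq> (\<lambda>(v, n). fst (ks v ! n)) ` (X \<times> (UNIV :: nat set))"
  proof
    fix i assume "i \<in> I"
    then obtain v k where v: "v \<in> X" "k \<in> set (ks v)" "i = fst k" unfolding I_def by blast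
    then obtain n where "ks v ! n = k" by (auto simp: in_set_conv_nth)
    then show "i \<in> (\<lambda>(v, n). fst (ks v ! n)) ` (X \<times> (UNIV :: nat set))"
      using v by (intro image_eqI [of _ _ "(v, n)"]) simp_all
  qed
  from subset_imp_lepoll [OF this] have I_small: "I \<lesssim> (UNIV :: 'u set)"
    by (rule lepoll_trans [OF _ lepoll_trans [OF image_lepoll times_lepoll_infinite [OF small(1,2)]]])
      (use small(1) in \<open>simp add: infinite_le_lepoll\<close>)
  let ?D = "direct_power I W" and ?p = "power_sum W I N (\<lambda>i. i)"
  define V where "V = ?p ` carrier ?D"
  have D: "right_module T ?D" by (rule direct_power_right_module [OF W])
  have p: "linear_map T ?D N ?p" by (rule linear_map_power_sum [OF W N I])
  have V: "closed_submodule T N V" unfolding V_def by (rule linear_image_closed_submodule [OF D N p])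
  have "v \<in> V" if v: "v \<in> X" for v
  proof -
    have "lsum N (\<lambda>(h, w). h w) (ks v) \<in> V"
    proof (rule closed_submodule_lsum [OF V])
      fix k assume k: "k \<in> set (ks v)"
      then have i: "fst k \<in> I" and w: "snd k \<in> carrier W" using ks [OF v] v by (auto simp: I_def)
      have "?p (power_single W I (fst k) (snd k)) = fst k (snd k)"
        by (rule power_sum_single [OF W.M.abelian_group_axioms linear_map_additive [OF I] N.M.abelian_group_axioms i w])
      then show "(\<lambda>(h, w). h w) k \<in> V"
        unfolding V_def case_prod_beta
        by (intro image_eqI [OF sym]) (auto intro: power_single_closed [OF W.M.abelian_group_axioms i w] simp del: direct_power_simps)
    qed
    then show ?thesis using sum [OF v] by simp
  qed
  then have XV: "X \<subseteq> V" by blast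
  have NV: "right_module T (N\<lparr>carrier := V\<rparr>)" by (rule right_module_submodule [OF N V])
  have "linear_map T ?D (N\<lparr>carrier := V\<rparr>) ?p"
    using linear_map_add [OF p] linear_map_smult [OF p]
    by (intro linear_mapI right_module_group [OF D] right_module_group [OF NV]) (simp_all add: V_def del: direct_power_simps)
  then have "restrict ?p (carrier ?D) \<in> lin_hom T ?D (N\<lparr>carrier := V\<rparr>)" by (rule restrict_lin_hom) (simp add: D)
  moreover have "restrict ?p (carrier ?D) ` carrier ?D = carrier (N\<lparr>carrier := V\<rparr>)"
    by (simp add: V_def del: direct_power_simps)
  ultimately have "generated T W (N\<lparr>carrier := V\<rparr>)"
    unfolding generated_def using NV by blast
  moreover have "V \<lesssim> (UNIV :: 'u set)"
    unfolding V_def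
    by (rule lepoll_trans [OF image_lepoll direct_power_lepoll [OF small(1) I_small small(3) W.M.abelian_group_axioms]])
  ultimately show thesis using that V XV by blast
qed

section \<open>Induced modules over the dual ring and their evaluation maps\<close>

context grouplike_coring begin

abbreviation "induced X \<equiv> tensor_rmod B X LA AT"

lemma induced_module_simps [simp]:
  "carrier (induced X) = carrier (tensor B X LA)" "add (induced X) = add (tensor B X LA)"
  "\<zero>\<^bsub>induced X\<^esub> = \<zero>\<^bsub>tensor B X LA\<^esub>"
  by (simp_all add: tensor_rmod_def)

lemma B_AT_bimodule:
  assumes "b \<in> carrier B" "f \<in> carrier T" "a \<in> carrier A"
  shows "(b \<otimes> a) \<triangleleft>\<^bsub>AT\<^esub> f = b \<otimes> (a \<triangleleft>\<^bsub>AT\<^esub> f)"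
  using linear_map_smult [OF B_act_linear [OF assms(1)] assms(2)] assms(3) by (simp del: dual_module_simps(4))

context
  fixes X :: "('a, 'n, 'y) module_scheme"
  assumes X: "right_module B X"
begin

interpretation XA: tensor_product B X LA by (rule tensor_productI [OF X A_left_B])

lemma right_module_induced: "right_module T (induced X)"
  by (rule XA.right_module_tensor_rmod [OF right_module_AT]) (simp_all add: B_AT_bimodule del: dual_module_simps(4))

lemma induced_act_tens:
  assumes "f \<in> carrier T" "y \<in> carrier X" "a \<in> carrier A"
  shows "tens B X LA y a \<triangleleft>\<^bsub>induced X\<^esub> f = tens B X LA y (a \<triangleleft>\<^bsub>AT\<^esub> f)"
  by (rule XA.rmod_act_tens [OF right_module_AT]) (simp_all add: B_AT_bimodule assms del: dual_module_simps(4))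

lemma induced_act_additive:
  "f \<in> carrier T \<Longrightarrow> add_hom (tensor B X LA) (tensor B X LA) (\<lambda>t. t \<triangleleft>\<^bsub>induced X\<^esub> f)"
  by (rule XA.rmod_act_additive [OF right_module_AT]) (simp_all add: B_AT_bimodule del: dual_module_simps(4))

lemma tens_linear:
  "y \<in> carrier X \<Longrightarrow> linear_map T AT (induced X) (tens B X LA y)"
  by (rule XA.rmod_tens_linear [OF right_module_AT]) (simp_all add: B_AT_bimodule del: dual_module_simps(4))

lemma induced_trace: "carrier (induced X) \<subseteq> trace T AT (induced X)"
  by (rule XA.rmod_trace [OF right_module_AT]) (simp_all add: B_AT_bimodule del: dual_module_simps(4))

lemma induced_linearI:
  assumes g: "add_hom (tensor B X LA) P g" and P: "right_module T P"
    and eq: "\<And>y a f. \<lbrakk>y \<in> carrier X; a \<in> carrier A; f \<in> carrier T\<rbrakk>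
      \<Longrightarrow> g (tens B X LA y (a \<triangleleft>\<^bsub>AT\<^esub> f)) = g (tens B X LA y a) \<triangleleft>\<^bsub>P\<^esub> f"
  shows "linear_map T (induced X) P g"
proof (rule linear_mapI [OF right_module_group [OF right_module_induced] right_module_group [OF P]])
  fix f t assume f: "f \<in> carrier T" and "t \<in> carrier (induced X)"
  then have t: "t \<in> carrier (tensor B X LA)" by simp
  show "g (t \<triangleleft>\<^bsub>induced X\<^esub> f) = g t \<triangleleft>\<^bsub>P\<^esub> f"
    by (rule XA.add_hom_tensor_eq [OF add_hom_comp [OF induced_act_additive [OF f] g]
        add_hom_comp [OF g right_module.additive_ract_left [OF P f]] _ t])
      (use f eq in \<open>simp add: induced_act_tens del: dual_module_simps(4)\<close>)
qed (simp_all add: add_hom_closed [OF g] add_hom_add [OF g])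

end

lemma tensor_map_induced_linear:
  assumes X: "right_module B X" and Y: "right_module B Y" and f: "linear_map B X Y f"
  shows "linear_map T (induced X) (induced Y) (tensor_map B Y LA f)"
proof (rule induced_linearI [OF X _ right_module_induced [OF Y]])
  have "add_hom (tensor B X LA) (tensor B Y LA) (tensor_map B Y LA f)"
    by (rule tensor_map_additive [OF X Y A_left_B f])
  then show "add_hom (tensor B X LA) (induced Y) (tensor_map B Y LA f)"
    using right_module_group [OF right_module_induced [OF Y]] by (simp add: add_hom_def)
  fix y a g assume "y \<in> carrier X" "a \<in> carrier A" "g \<in> carrier T"
  then show "tensor_map B Y LA f (tens B X LA y (a \<triangleleft>\<^bsub>AT\<^esub> g)) =
      tensor_map B Y LA f (tens B X LA y a) \<triangleleft>\<^bsub>induced Y\<^esub> g"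
    using right_module.ract_closed [OF right_module_AT, of g a] linear_map_closed [OF f]
    by (simp add: tensor_map_tens [OF X Y A_left_B f] induced_act_tens [OF Y] del: dual_module_simps(4))
qed

lemma eval_hom_linear:
  fixes P :: "('c \<Rightarrow> 'a, 'p) module"
  assumes P: "right_module T P"
  shows "linear_map T (induced (HomT P)) P (eval_hom P)"
proof -
  interpret HA: tensor_product B "HomT P" LA by (rule HomT_tensor_product [OF P])
  show ?thesis
  proof (rule induced_linearI [OF right_module_HomT [OF P] eval_hom_additive [OF P] P])
    fix h a f assume "h \<in> carrier (HomT P)" and af: "a \<in> carrier A" "f \<in> carrier T"
    then have h: "h \<in> lin_hom T AT P" by simp
    have "a \<triangleleft>\<^bsub>AT\<^esub> f \<in> carrier A" using right_module.ract_closed [OF right_module_AT af(2), of a] af by simp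
    then show "eval_hom P (tens B (HomT P) LA h (a \<triangleleft>\<^bsub>AT\<^esub> f)) =
        eval_hom P (tens B (HomT P) LA h a) \<triangleleft>\<^bsub>P\<^esub> f"
      using eval_hom_tens [OF P h] linear_map_smult [OF hom_T_linear [OF P h] af(2), of a] af
      by (simp del: dual_module_simps(4))
  qed
qed

lemma HomT_map_linear:
  fixes P :: "('c \<Rightarrow> 'a, 'p) module" and Q :: "('c \<Rightarrow> 'a, 'q) module"
  assumes P: "right_module T P" and Q: "right_module T Q" and f: "linear_map T P Q f"
  shows "linear_map B (HomT P) (HomT Q) (\<lambda>h. \<lambda>a\<in>carrier A. f (h a))"
proof (rule linear_mapI [OF right_module_group [OF right_module_HomT [OF P]] right_module_group [OF right_module_HomT [OF Q]]])
  fix h assume "h \<in> carrier (HomT P)"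
  then have h: "h \<in> lin_hom T AT P" by simp
  show "(\<lambda>a\<in>carrier A. f (h a)) \<in> carrier (HomT Q)"
    using restrict_lin_hom [OF linear_map_comp [OF hom_T_linear [OF P h] f]] right_module_AT
    by simp
  show "(\<lambda>a\<in>carrier A. f ((h \<oplus>\<^bsub>HomT P\<^esub> k) a)) = (\<lambda>a\<in>carrier A. f (h a)) \<oplus>\<^bsub>HomT Q\<^esub> (\<lambda>a\<in>carrier A. f (k a))"
    if "k \<in> carrier (HomT P)" for k
  proof -
    have k: "k \<in> lin_hom T AT P" using that by simp
    show ?thesis
      using hom_T_closed [OF P h] hom_T_closed [OF P k] linear_map_add [OF f]
      by (auto simp: intro!: restrict_ext)
  qed
  fix b assume "b \<in> carrier B"
  then have "b \<in> carrier A" by (rule B_subset)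
  then show "(\<lambda>a\<in>carrier A. f ((b \<odot>\<^bsub>HomT P\<^esub> h) a)) = b \<odot>\<^bsub>HomT Q\<^esub> (\<lambda>a\<in>carrier A. f (h a))"
    by (auto simp: intro!: restrict_ext)
qed

lemma eval_hom_natural:
  fixes P :: "('c \<Rightarrow> 'a, 'p) module" and Q :: "('c \<Rightarrow> 'a, 'q) module"
  assumes P: "right_module T P" and Q: "right_module T Q" and g: "add_hom P Q g"
    and \<phi>: "linear_map B (HomT P) (HomT Q) \<phi>" and eq: "\<And>h a. \<lbrakk>h \<in> lin_hom T AT P; a \<in> carrier A\<rbrakk> \<Longrightarrow> \<phi> h a = g (h a)"
    and t: "t \<in> carrier (tensor B (HomT P) LA)"
  shows "eval_hom Q (tensor_map B (HomT Q) LA \<phi> t) = g (eval_hom P t)"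
proof -
  interpret HA: tensor_product B "HomT P" LA by (rule HomT_tensor_product [OF P])
  interpret KA: tensor_product B "HomT Q" LA by (rule HomT_tensor_product [OF Q])
  note HP = right_module_HomT [OF P] and HQ = right_module_HomT [OF Q]
  show ?thesis
  proof (rule HA.add_hom_tensor_eq [OF
        add_hom_comp [OF tensor_map_additive [OF HP HQ A_left_B \<phi>] eval_hom_additive [OF Q]]
        add_hom_comp [OF eval_hom_additive [OF P] g] _ t])
    fix h a assume "h \<in> carrier (HomT P)" "a \<in> carrier LA"
    then have h: "h \<in> lin_hom T AT P" and a: "a \<in> carrier A" by simp_all
    have "\<phi> h \<in> lin_hom T AT Q" using linear_map_closed [OF \<phi>] h by simp
    then show "eval_hom Q (tensor_map B (HomT Q) LA \<phi> (tens B (HomT P) LA h a))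
        = g (eval_hom P (tens B (HomT P) LA h a))"
      using h a eq by (simp add: tensor_map_tens [OF HP HQ A_left_B \<phi>] HomT_simps eval_hom_tens [OF P] eval_hom_tens [OF Q])
  qed
qed

context
  assumes universe: "infinite (UNIV :: 'u set)" "carrier A \<lesssim> (UNIV :: 'u set)"
begin

lemma Gen_iff: "P \<in> Gen TYPE('u) T AT \<longleftrightarrow> right_module T P \<and> carrier P \<subseteq> trace T AT P"
  by (simp add: Gen_def generated_iff [OF right_module_AT])

text \<open>The natural map from \<open>Hom(A, V)\<close> to
  \<open>Hom(A, Hom(A, V) \<otimes> A)\<close> sends \<open>f\<close> to
  \<open>a \<mapsto> f \<otimes> a\<close>. By fullness it is induced by a map \<open>s\<close> from
  \<open>V\<close> to \<open>Hom(A, V) \<otimes> A\<close>, and \<open>s\<close> is a left inverse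
  of evaluation. The target is transported into the universe by \<open>h\<close>, where fullness can
  be used.\<close>

lemma fully_faithful_eval_injective:
  fixes V :: "('c \<Rightarrow> 'a, 'u) module"
  assumes ff: "dual_hom_functor_fully_faithful_on_Gen TYPE('u) A C x" and V: "V \<in> Gen TYPE('u) T AT"
  shows "inj_on (eval_hom V) (carrier (tensor B (HomT V) LA))"
proof -
  have VT: "right_module T V" using V Gen_iff by blast
  note HV = right_module_HomT [OF VT]
  interpret HA: tensor_product B "HomT V" LA by (rule HomT_tensor_product [OF VT])
  let ?I = "induced (HomT V)" and ?t = "tens B (HomT V) LA"
  have IT: "right_module T ?I" by (rule right_module_induced [OF HV])
  have "carrier (HomT V) \<lesssim> (UNIV :: 'u set)"
    by (rule lepoll_trans [OF HomT_lepoll [OF VT] subset_imp_lepoll [OF subset_UNIV]])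
  then have "carrier ?I \<lesssim> (UNIV :: 'u set)" using HA.tensor_lepoll [OF universe(1)] universe(2) by simp
  then obtain h :: "_ \<Rightarrow> 'u" where h: "inj_on h (carrier ?I)" by (auto simp: lepoll_def)
  let ?Y = "transport h ?I"
  have YT: "right_module T ?Y" by (rule right_module_transport [OF IT h])
  have hl: "linear_map T ?I ?Y h" by (rule linear_map_transport [OF right_module_group [OF IT] h])
  have "carrier ?Y \<subseteq> trace T AT ?Y"
    using induced_trace [OF HV] trace_linear_image [OF right_module_AT IT YT hl] by auto
  then have Y: "?Y \<in> Gen TYPE('u) T AT" using YT Gen_iff by blast
  define \<phi> where "\<phi> f = (\<lambda>a\<in>carrier A. h (?t f a))" for f
  have hadd: "h (s \<oplus>\<^bsub>?I\<^esub> t) = h s \<oplus>\<^bsub>?Y\<^esub> h t" if "s \<in> carrier ?I" "t \<in> carrier ?I" for s t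
    by (rule linear_map_add [OF hl that])
  have \<phi>: "linear_map B (HomT V) (HomT ?Y) \<phi>"
  proof (rule linear_mapI [OF right_module_group [OF HV] right_module_group [OF right_module_HomT [OF YT]]])
    fix f assume f: "f \<in> carrier (HomT V)"
    show "\<phi> f \<in> carrier (HomT ?Y)"
      using restrict_lin_hom [OF linear_map_comp [OF tens_linear [OF HV f] hl]] right_module_AT
      by (simp add: HomT_simps \<phi>_def)
    show "\<phi> (f \<oplus>\<^bsub>HomT V\<^esub> g) = \<phi> f \<oplus>\<^bsub>HomT ?Y\<^esub> \<phi> g" if g: "g \<in> carrier (HomT V)" for g
      unfolding HomT_simps(3) [where P = ?Y] \<phi>_def
    proof (rule restrict_ext)
      fix a assume a: "a \<in> carrier A"
      then show "h (?t (f \<oplus>\<^bsub>HomT V\<^esub> g) a) = (\<lambda>a\<in>carrier A. h (?t f a)) a \<oplus>\<^bsub>?Y\<^esub> (\<lambda>a\<in>carrier A. h (?t g a)) a"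
        using HA.tens_add_left [OF f g, of a] hadd [of "?t f a" "?t g a"] f g by (simp del: HomT_simps)
    qed
    fix b assume b: "b \<in> carrier B"
    show "\<phi> (b \<odot>\<^bsub>HomT V\<^esub> f) = b \<odot>\<^bsub>HomT ?Y\<^esub> \<phi> f"
      unfolding HomT_simps(4) [where P = ?Y] \<phi>_def
    proof (rule restrict_ext)
      fix a assume a: "a \<in> carrier A"
      then show "h (?t (b \<odot>\<^bsub>HomT V\<^esub> f) a) = (\<lambda>a\<in>carrier A. h (?t f a)) (b \<otimes> a)"
        using HA.tens_balanced [OF f b, of a] b B_subset by (simp del: HomT_simps)
    qed
  qed
  let ?\<phi> = "restrict \<phi> (carrier (HomT V))"
  have "bij_betw (hom_functor_map A (lin_hom T AT V)) (lin_hom T V ?Y) (lin_hom B (HomT V) (HomT ?Y))"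
    using ff V Y unfolding dual_hom_functor_fully_faithful_on_Gen_def Let_def by blast
  note surj = bij_betw_imp_surj_on [OF this]
  \<comment> \<open>Surjectivity on morphisms, that is fullness, produces \<open>s\<close>.\<close>
  have "?\<phi> \<in> hom_functor_map A (lin_hom T AT V) ` lin_hom T V ?Y"
    unfolding surj by (rule restrict_lin_hom [OF \<phi>]) (simp add: HV)
  then obtain s where s: "s \<in> lin_hom T V ?Y" "hom_functor_map A (lin_hom T AT V) s = ?\<phi>"
    by (rule imageE) (rule that, assumption, rule sym)
  have sl: "linear_map T V ?Y s" by (rule lin_hom_linear [OF s(1) right_module_group [OF VT] right_module_group [OF YT]])
  have sf: "s (f a) = h (?t f a)" if f: "f \<in> lin_hom T AT V" and a: "a \<in> carrier A" for f a
  proof -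
    have "hom_functor_map A (lin_hom T AT V) s f a = s (f a)" using f a by (simp add: hom_functor_map_def compose_def)
    then show ?thesis using f a unfolding s(2) by (simp add: HomT_simps \<phi>_def)
  qed
  have h': "add_hom (tensor B (HomT V) LA) ?Y h"
    using linear_map_additive [OF hl] HA.abelian_group_tensor by (simp add: add_hom_def)
  have st: "s (eval_hom V t) = h t" if t: "t \<in> carrier (tensor B (HomT V) LA)" for t
    by (rule HA.add_hom_tensor_eq [OF add_hom_comp [OF eval_hom_additive [OF VT]
          linear_map_additive [OF sl]] h' _ t])
      (simp add: eval_hom_tens [OF VT] sf)
  show ?thesis
  proof (rule inj_onI)
    fix t t' assume t: "t \<in> carrier (tensor B (HomT V) LA)" "t' \<in> carrier (tensor B (HomT V) LA)"
      and eq: "eval_hom V t = eval_hom V t'"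
    have "h t = h t'" by (rule trans [OF st [OF t(1), symmetric] trans [OF arg_cong [where f = s, OF eq] st [OF t(2)]]])
    then show "t = t'" by (rule inj_onD [OF h]) (use t in simp_all)
  qed
qed

text \<open>Write \<open>u\<close> as the evaluation of \<open>t\<close>. Its class in
  \<open>V / U\<close> is zero, so by injectivity of evaluation there the image of \<open>t\<close>
  in \<open>Hom(A, V / U) \<otimes> A\<close> is zero. Flatness rewrites \<open>t\<close> with maps
  whose composite to \<open>V / U\<close> vanishes, that is, with maps into
  \<open>U\<close>.\<close>

lemma fully_faithful_submodule_trace:
  fixes V :: "('c \<Rightarrow> 'a, 'u) module"
  assumes flat: "flat TYPE('u) B LA"
    and ff: "dual_hom_functor_fully_faithful_on_Gen TYPE('u) A C x"
    and V: "V \<in> Gen TYPE('u) T AT" and U: "closed_submodule T V U"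
  shows "U \<subseteq> trace T AT (V\<lparr>carrier := U\<rparr>)"
proof
  fix u assume u: "u \<in> U"
  have VT: "right_module T V" and Vtr: "carrier V \<subseteq> trace T AT V" using V Gen_iff by blast+
  interpret V: right_module T V by (rule VT)
  note U' = additive_subgroup_closed_submodule [OF VT U]
  have uV: "u \<in> carrier V" using u U by (auto simp: closed_submodule_def)
  let ?Q = "quotient_module V U" and ?q = "coset_rep V U"
  have QT: "right_module T ?Q" and q: "linear_map T V ?Q ?q" using quotient_right_module [OF VT U] by auto
  have "carrier ?Q \<subseteq> trace T AT ?Q"
    using Vtr trace_linear_image [OF right_module_AT VT QT q] by (auto simp: quotient_simps [OF U'])
  then have Q: "?Q \<in> Gen TYPE('u) T AT" using QT Gen_iff by blast
  note HV = right_module_HomT [OF VT] and HQ = right_module_HomT [OF QT]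
  interpret HA: tensor_product B "HomT V" LA by (rule HomT_tensor_product [OF VT])
  interpret QA: tensor_product B "HomT ?Q" LA by (rule HomT_tensor_product [OF QT])
  obtain t where t: "t \<in> carrier (tensor B (HomT V) LA)" "u = eval_hom V t"
    using subsetD [OF Vtr uV] unfolding HomT_eval_image [OF VT, symmetric] by (rule imageE) (rule that)
  let ?\<phi> = "\<lambda>h. \<lambda>a\<in>carrier A. ?q (h a)" and ?tm = "tensor_map B (HomT ?Q) LA"
  have \<phi>: "linear_map B (HomT V) (HomT ?Q) ?\<phi>" by (rule HomT_map_linear [OF VT QT q])
  have "eval_hom ?Q (?tm ?\<phi> t) = ?q (eval_hom V t)"
    by (rule eval_hom_natural [OF VT QT linear_map_additive [OF q] \<phi> _ t(1)]) simp
  also have "\<dots> = \<zero>\<^bsub>?Q\<^esub>" using u coset_rep_eq_zero_iff [OF U' uV] unfolding t(2) by simp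
  also have "\<dots> = eval_hom ?Q \<zero>\<^bsub>tensor B (HomT ?Q) LA\<^esub>"
    by (rule add_hom_zero [OF eval_hom_additive [OF QT], symmetric])
  finally have z: "?tm ?\<phi> t = \<zero>\<^bsub>tensor B (HomT ?Q) LA\<^esub>"
    by (rule inj_onD [OF fully_faithful_eval_injective [OF ff Q]])
      (use tensor_map_closed [OF HV HQ A_left_B \<phi> t(1)] QA.tensor_zero_closed in simp_all)
  have small: "carrier (HomT ?Q) \<lesssim> (UNIV :: 'u set)"
    by (rule lepoll_trans [OF HomT_lepoll [OF QT] subset_imp_lepoll [OF subset_UNIV]])
  obtain ps where ps: "set ps \<subseteq> {h \<in> carrier (HomT V). ?\<phi> h = \<zero>\<^bsub>HomT ?Q\<^esub>} \<times> carrier LA"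
    and tps: "t = lsum (tensor B (HomT V) LA) (\<lambda>(h, a). tens B (HomT V) LA h a) ps"
    by (rule flat_exact [OF flat HV HQ small \<phi> t(1) z])
  have p: "fst p \<in> lin_hom T AT V" "snd p \<in> carrier A" "\<And>a. a \<in> carrier A \<Longrightarrow> fst p a \<in> U" if "p \<in> set ps" for p
  proof -
    have p: "fst p \<in> carrier (HomT V)" "snd p \<in> carrier LA" "?\<phi> (fst p) = \<zero>\<^bsub>HomT ?Q\<^esub>"
      using ps that by auto
    then show h: "fst p \<in> lin_hom T AT V" "snd p \<in> carrier A" by simp_all
    fix a assume a: "a \<in> carrier A"
    have "?\<phi> (fst p) a = \<zero>\<^bsub>?Q\<^esub>" using a unfolding p(3) by simp
    then show "fst p a \<in> U" using a coset_rep_eq_zero_iff [OF U' hom_T_closed [OF VT h(1) a]] by simp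
  qed
  have "set ps \<subseteq> lin_hom T AT V \<times> carrier A" using p(1,2) by (auto simp: mem_Times_iff)
  then have "u = lsum V (\<lambda>(h, a). h a) ps" unfolding t(2) tps by (rule eval_hom_lsum [OF VT])
  also have "\<dots> = lsum (V\<lparr>carrier := U\<rparr>) (\<lambda>(h, a). h a) ps" by (rule lsum_cong_structure) simp_all
  also have "\<dots> \<in> trace T AT (V\<lparr>carrier := U\<rparr>)"
  proof (rule traceI, rule subsetI)
    fix k assume k: "k \<in> set ps"
    have "fst k \<in> lin_hom T AT (V\<lparr>carrier := U\<rparr>)"
      using p(1) [OF k] p(3) [OF k] unfolding lin_hom_def by (auto simp: PiE_iff simp del: dual_module_simps(4))
    then show "k \<in> lin_hom T AT (V\<lparr>carrier := U\<rparr>) \<times> carrier AT" using p(2) [OF k] by (simp add: mem_Times_iff)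
  qed
  finally show "u \<in> trace T AT (V\<lparr>carrier := U\<rparr>)" .
qed

text \<open>The ambient module \<open>N\<close> has a type of its own and may be too large for the
  hypotheses. A small generated submodule containing the image of \<open>P\<close> replaces it and
  is transported into the universe; there the result on submodules of generated modules
  applies.\<close>

lemma subgenerated_trace:
  fixes P :: "('c \<Rightarrow> 'a, 'u) module"
  assumes flat: "flat TYPE('u) B LA"
    and ff: "dual_hom_functor_fully_faithful_on_Gen TYPE('u) A C x"
    and P: "subgenerated T AT P"
  shows "carrier P \<subseteq> trace T AT P"
proof
  fix p assume p: "p \<in> carrier P"
  obtain N :: "('c \<Rightarrow> 'a, ('u \<times> nat \<Rightarrow> 'a) set) module" and j where N: "generated T AT N"
    and j: "j \<in> lin_hom T P N" "inj_on j (carrier P)" and PT: "right_module T P"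
    using P by (auto simp: subgenerated_def)
  have NT: "right_module T N" and Ntr: "carrier N \<subseteq> trace T AT N" using N by (simp_all add: generated_iff [OF right_module_AT])
  have jl: "linear_map T P N j" by (rule lin_hom_linear [OF j(1) right_module_group [OF PT] right_module_group [OF NT]])
  have X: "j ` carrier P \<subseteq> trace T AT N" using linear_map_closed [OF jl] Ntr by blast
  have Xs: "j ` carrier P \<lesssim> (UNIV :: 'u set)"
    by (rule lepoll_trans [OF image_lepoll subset_imp_lepoll [OF subset_UNIV]])
  have As: "carrier AT \<lesssim> (UNIV :: 'u set)" using universe(2) by simp
  obtain V where V: "closed_submodule T N V" "j ` carrier P \<subseteq> V" "generated T AT (N\<lparr>carrier := V\<rparr>)" "V \<lesssim> (UNIV :: 'u set)"
    by (rule small_generated_submodule [OF right_module_AT NT X universe(1) Xs As])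
  let ?V = "N\<lparr>carrier := V\<rparr>"
  have VT: "right_module T ?V" by (rule right_module_submodule [OF NT V(1)])
  obtain h :: "_ \<Rightarrow> 'u" where h: "inj_on h (carrier ?V)" using V(4) by (auto simp: lepoll_def)
  let ?W = "transport h ?V"
  have WT: "right_module T ?W" by (rule right_module_transport [OF VT h])
  have hl: "linear_map T ?V ?W h" by (rule linear_map_transport [OF right_module_group [OF VT] h])
  have "carrier ?W \<subseteq> trace T AT ?W"
    using V(3) trace_linear_image [OF right_module_AT VT WT hl] by (auto simp: generated_iff [OF right_module_AT])
  then have W: "?W \<in> Gen TYPE('u) T AT" using WT Gen_iff by blast
  have jV: "linear_map T P ?V j"
    using linear_map_add [OF jl] linear_map_smult [OF jl] V(2)
    by (intro linear_mapI right_module_group [OF PT] right_module_group [OF VT]) auto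
  let ?e = "\<lambda>p. h (j p)"
  have e: "linear_map T P ?W ?e" by (rule linear_map_comp [OF jV hl])
  have "inj_on h (j ` carrier P)" by (rule inj_on_subset [OF h]) (use V(2) in simp)
  from comp_inj_on [OF j(2) this] have ei: "inj_on ?e (carrier P)" by (simp add: comp_def)
  let ?U = "?e ` carrier P"
  have U: "closed_submodule T ?W ?U" by (rule linear_image_closed_submodule [OF PT WT e])
  have "?e p \<in> trace T AT (?W\<lparr>carrier := ?U\<rparr>)"
    using fully_faithful_submodule_trace [OF flat ff W U] p by blast
  from trace_linear_image [OF right_module_AT right_module_submodule [OF WT U] PT linear_map_inv_into [OF PT WT e ei] this]
  show "p \<in> trace T AT P" using inv_into_f_f [OF ei p] by simp
qed

text \<open>On generated modules evaluation is bijective. A map \<open>\<psi>\<close> between the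
  Hom modules therefore comes from \<open>\<psi> \<otimes> A\<close>, conjugated by the evaluation
  maps; faithfulness holds because values of maps from \<open>A\<close> span
  \<open>M\<close>.\<close>

lemma generates_rational_fully_faithful:
  assumes gen: "generates_rational TYPE('u)"
  shows "dual_hom_functor_fully_faithful_on_Gen TYPE('u) A C x"
  unfolding dual_hom_functor_fully_faithful_on_Gen_def Let_def
proof (intro ballI)
  fix M N :: "('c \<Rightarrow> 'a, 'u) module" assume M: "M \<in> Gen TYPE('u) T AT" and "N \<in> Gen TYPE('u) T AT"
  then have MT: "right_module T M" and NT: "right_module T N" and Mtr: "carrier M \<subseteq> trace T AT M" using Gen_iff by blast+
  note HM = right_module_HomT [OF MT] and HN = right_module_HomT [OF NT]
  interpret MA: tensor_product B "HomT M" LA by (rule HomT_tensor_product [OF MT])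
  let ?F = "hom_functor_map A (lin_hom T AT M)" and ?tM = "tensor B (HomT M) LA"
  have F: "?F f h a = f (h a)" if "h \<in> lin_hom T AT M" "a \<in> carrier A" for f :: "'u \<Rightarrow> 'u" and h a
    using that by (simp add: hom_functor_map_def compose_def)
  have fl: "linear_map T M N f" if "f \<in> lin_hom T M N" for f
    by (rule lin_hom_linear [OF that right_module_group [OF MT] right_module_group [OF NT]])
  have surj: "eval_hom M ` carrier ?tM = carrier M"
    using HomT_eval_image [OF MT] Mtr trace_closed_submodule [OF right_module_AT MT] by (auto simp: closed_submodule_def)
  have inj: "inj_on (eval_hom M) (carrier ?tM)" by (rule HomT_eval_injective [OF gen universe MT])
  show "bij_betw ?F (lin_hom T M N) (lin_hom B (HomT M) (HomT N))"
    unfolding bij_betw_def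
  proof (intro conjI equalityI subsetI)
    show "inj_on ?F (lin_hom T M N)"
    proof (rule inj_onI)
      fix f g assume f: "f \<in> lin_hom T M N" and g: "g \<in> lin_hom T M N" and eq: "?F f = ?F g"
      show "f = g"
      proof (rule lin_hom_ext [OF f g])
        fix m assume "m \<in> carrier M"
        then obtain t where t: "t \<in> carrier ?tM" "m = eval_hom M t" using surj by blast
        note ev = eval_hom_additive [OF MT]
        have "f (eval_hom M t) = g (eval_hom M t)"
        proof (rule MA.add_hom_tensor_eq [OF add_hom_comp [OF ev linear_map_additive [OF fl [OF f]]]
              add_hom_comp [OF ev linear_map_additive [OF fl [OF g]]] _ t(1)])
          fix h a assume "h \<in> carrier (HomT M)" "a \<in> carrier LA"
          then have h: "h \<in> lin_hom T AT M" and a: "a \<in> carrier A" by simp_all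
          show "f (eval_hom M (tens B (HomT M) LA h a)) = g (eval_hom M (tens B (HomT M) LA h a))"
            using F [OF h a, of f] F [OF h a, of g] eq by (simp add: eval_hom_tens [OF MT h a])
        qed
        then show "f m = g m" unfolding t(2) .
      qed
    qed
  next
    fix \<psi> assume "\<psi> \<in> ?F ` lin_hom T M N"
    then obtain f where f: "f \<in> lin_hom T M N" "\<psi> = ?F f" by blast
    have "?F f = restrict (\<lambda>h. \<lambda>a\<in>carrier A. f (h a)) (carrier (HomT M))"
      by (simp add: hom_functor_map_def compose_def HomT_simps)
    then show "\<psi> \<in> lin_hom B (HomT M) (HomT N)"
      unfolding f(2) using restrict_lin_hom [OF HomT_map_linear [OF MT NT fl [OF f(1)]]] HM by simp
  next
    fix \<psi> assume \<psi>: "\<psi> \<in> lin_hom B (HomT M) (HomT N)"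
    then have \<psi>l: "linear_map B (HomT M) (HomT N) \<psi>"
      by (rule lin_hom_linear [OF _ right_module_group [OF HM] right_module_group [OF HN]])
    let ?i = "inv_into (carrier (induced (HomT M))) (eval_hom M)"
    have "linear_map T (M\<lparr>carrier := eval_hom M ` carrier (induced (HomT M))\<rparr>) (induced (HomT M)) ?i"
      by (rule linear_map_inv_into [OF right_module_induced [OF HM] MT eval_hom_linear [OF MT]]) (use inj in simp)
    then have i: "linear_map T M (induced (HomT M)) ?i" using surj by simp
    \<comment> \<open>The inverse construction: express \<open>m\<close> as a tensor, apply
      \<open>\<psi>\<close> to the left factors, evaluate in \<open>N\<close>.\<close>
    let ?s = "\<lambda>m. eval_hom N (tensor_map B (HomT N) LA \<psi> (?i m))"
    have s: "linear_map T M N ?s"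
      by (rule linear_map_comp [OF i linear_map_comp [OF tensor_map_induced_linear [OF HM HN \<psi>l] eval_hom_linear [OF NT]]])
    have sh: "?s (h a) = \<psi> h a" if h: "h \<in> lin_hom T AT M" and a: "a \<in> carrier A" for h a
    proof -
      have hc: "h \<in> carrier (HomT M)" "a \<in> carrier LA" using h a by simp_all
      have "?i (eval_hom M (tens B (HomT M) LA h a)) = tens B (HomT M) LA h a"
        using inj hc by (intro inv_into_f_f) simp_all
      moreover have "\<psi> h \<in> lin_hom T AT N" using linear_map_closed [OF \<psi>l hc(1)] by simp
      ultimately show ?thesis
        using a by (simp add: eval_hom_tens [OF MT h a] tensor_map_tens [OF HM HN A_left_B \<psi>l hc] eval_hom_tens [OF NT])
    qed
    let ?f = "restrict ?s (carrier M)"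
    have f: "?f \<in> lin_hom T M N" by (rule restrict_lin_hom [OF s]) (simp add: MT)
    have "?F ?f \<in> lin_hom B (HomT M) (HomT N)"
    proof -
      have "?F ?f = restrict (\<lambda>h. \<lambda>a\<in>carrier A. ?f (h a)) (carrier (HomT M))"
        by (simp add: hom_functor_map_def compose_def HomT_simps)
      then show ?thesis using restrict_lin_hom [OF HomT_map_linear [OF MT NT fl [OF f]]] HM by simp
    qed
    then have "?F ?f = \<psi>"
    proof (rule lin_hom_ext [OF _ \<psi>])
      fix h assume "h \<in> carrier (HomT M)"
      then have h: "h \<in> lin_hom T AT M" by simp
      have \<psi>h: "\<psi> h \<in> lin_hom T AT N"
        using linear_map_closed [OF \<psi>l, of h] h by simp
      have Fh: "?F ?f h \<in> lin_hom T AT N"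
        using linear_map_closed [OF HomT_map_linear [OF MT NT fl [OF f]], of h] h
        by (simp add: hom_functor_map_def compose_def)
      show "?F ?f h = \<psi> h"
      proof (rule lin_hom_ext [OF Fh \<psi>h])
        fix a assume "a \<in> carrier AT"
        then have a: "a \<in> carrier A" by simp
        show "?F ?f h a = \<psi> h a" using F [OF h a, of ?f] sh [OF h a] hom_T_closed [OF MT h a] by simp
      qed
    qed
    then show "\<psi> \<in> ?F ` lin_hom T M N" by (rule image_eqI [OF sym f])
  qed
qed

end

end

text \<open>The map \<open>a \<mapsto> m a\<close> takes the value \<open>m\<close> at
  \<open>1\<close>.\<close>

lemma generated_regular:
  fixes M :: "('a, 'm, 'z) module_scheme"
  assumes M: "right_module A M"
  shows "generated A (right_regular A) M"
proof -
  interpret M: right_module A M by (rule M)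
  have R: "right_module A (right_regular A)" by (rule right_regular_module [OF M.R.ring_axioms])
  have "m \<in> trace A (right_regular A) M" if m: "m \<in> carrier M" for m
  proof -
    have "linear_map A (right_regular A) M (\<lambda>a. m \<triangleleft>\<^bsub>M\<^esub> a)"
      using m by (intro linear_mapI right_module_group [OF R] M.M.abelian_group_axioms)
        (simp_all add: M.ract_closed M.ract_r_distr M.ract_assoc)
    then have h: "restrict (\<lambda>a. m \<triangleleft>\<^bsub>M\<^esub> a) (carrier (right_regular A)) \<in> lin_hom A (right_regular A) M"
      by (rule restrict_lin_hom) (simp add: R)
    show ?thesis
      using lin_hom_image_trace [OF h _ M.M.abelian_group_axioms, of "\<one>\<^bsub>A\<^esub>"] m by (simp add: M.ract_one)
  qed
  then show ?thesis using M by (auto simp: generated_iff [OF R])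
qed

section \<open>The conditions against generation of rational modules\<close>

context grouplike_coring begin

context
  assumes universe: "infinite (UNIV :: 'u set)" "carrier A \<lesssim> (UNIV :: 'u set)" "carrier C \<lesssim> (UNIV :: 'u set)"
begin

lemma weak_structure_iff:
  "(\<forall>M :: ('a, 'c, 'u) comodule. comodule A C M \<longrightarrow> \<Psi>'_bijective A C x M) \<longleftrightarrow> generates_rational TYPE('u)"
proof
  show "\<forall>M :: ('a, 'c, 'u) comodule. comodule A C M \<longrightarrow> \<Psi>'_bijective A C x M" if "generates_rational TYPE('u)"
    using generates_rational_Psi' [OF that universe(1,2)] subset_imp_lepoll [OF subset_UNIV] by blast
qed (rule generates_rationalI, rule Psi'_bijective_trace, simp_all)

text \<open>One direction is the argument through the canonical isomorphism. In the other the Galois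
  map is the evaluation map of the comodule \<open>C\<close>, which is bijective like that of every
  small comodule.\<close>

lemma galois_flat_iff:
  "flat TYPE('u) B (left_regular A) \<and> galois A C x \<longleftrightarrow> generates_rational TYPE('u)"
proof
  assume "flat TYPE('u) B (left_regular A) \<and> galois A C x"
  then show "generates_rational TYPE('u)"
    by (intro generates_rationalI galois_flat_trace [OF _ _ universe(1,3)] subset_imp_lepoll) simp_all
next
  assume gen: "generates_rational TYPE('u)"
  have "carrier (coring_comodule C) \<lesssim> (UNIV :: 'u set)"
    using universe(3) by (simp add: coring_comodule_def with_coact_def rmod_def with_smult_def)
  then show "flat TYPE('u) B (left_regular A) \<and> galois A C x"
    unfolding galois_iff
    using generates_rational_flat [OF gen universe(1,2)] generates_rational_Psi' [OF gen universe(1,2) comodule_coring]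
    by blast
qed

text \<open>The equality of the two subgenerated classes makes a rational module subgenerated by
  \<open>A\<close>; flatness and full faithfulness then show it to be generated.\<close>

lemma fully_faithful_iff:
  assumes one_neq_zero: "\<one> \<noteq> \<zero>"
  shows "flat TYPE('u) B (left_regular A) \<and> sigma_category TYPE('u) T CT = sigma_category TYPE('u) T AT \<and>
      dual_hom_functor_fully_faithful_on_Gen TYPE('u) A C x \<longleftrightarrow> generates_rational TYPE('u)"
proof
  assume l: "flat TYPE('u) B (left_regular A) \<and> sigma_category TYPE('u) T CT = sigma_category TYPE('u) T AT \<and>
      dual_hom_functor_fully_faithful_on_Gen TYPE('u) A C x"
  then have s: "sigma_category TYPE('u) T AT = {P. rational P}" using sigma_CT [OF one_neq_zero universe] by simp
  show "generates_rational TYPE('u)"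
    unfolding generates_rational_def
  proof (intro allI impI)
    fix P :: "('c \<Rightarrow> 'a, 'u) module" assume "rational P"
    then have "P \<in> sigma_category TYPE('u) T AT" unfolding s by simp
    then have P: "subgenerated T AT P" by (simp add: sigma_category_def)
    from l show "carrier P \<subseteq> trace T AT P" by (elim conjE) (rule subgenerated_trace [OF universe(1,2) _ _ P])
  qed
next
  assume gen: "generates_rational TYPE('u)"
  then show "flat TYPE('u) B (left_regular A) \<and> sigma_category TYPE('u) T CT = sigma_category TYPE('u) T AT \<and>
      dual_hom_functor_fully_faithful_on_Gen TYPE('u) A C x"
    using generates_rational_flat [OF gen universe(1,2)] sigma_CT [OF one_neq_zero universe]
      sigma_AT [OF one_neq_zero universe gen] generates_rational_fully_faithful [OF universe(1,2) gen] by simp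
qed

end

end

theorem theorem2p3:
  fixes A :: "('a, 'x) ring_scheme" and C :: "('a, 'c) coring" and x :: 'c
  assumes A: "ring A" "\<one>\<^bsub>A\<^esub> \<noteq> \<zero>\<^bsub>A\<^esub>"
    and C: "coring A C"
    and x: "group_like A C x"
    and universe: "infinite (UNIV :: 'u set)"
      "carrier A \<lesssim> (UNIV :: 'u set)" "carrier C \<lesssim> (UNIV :: 'u set)"
    and locally_projective: "locally_projective TYPE('u) A C"
  defines "B \<equiv> coinv_ring A C x"
    and "T \<equiv> dual_ring A C"
    and "A\<^sub>T \<equiv> dual_module (base_comodule A C x)"
    and "C\<^sub>T \<equiv> dual_module (coring_comodule C)"
    and "BA_flat \<equiv> flat TYPE('u) (coinv_ring A C x) (left_regular A)"
  shows "all_equivalent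
    [weak_structure_theorem TYPE('u) A C x,
     BA_flat \<and> galois A C x,
     BA_flat \<and> \<Psi>'_iso A C x (coring_comodule C),
     BA_flat \<and> (\<forall>M :: ('a, 'c, 'u) comodule. comodule A C M \<and> generated A (right_regular A) M
       \<longrightarrow> \<Psi>'_bijective A C x M),
     \<forall>M :: ('a, 'c, 'u) comodule. comodule A C M \<longrightarrow> \<Psi>'_bijective A C x M,
     sigma_category TYPE('u) T C\<^sub>T = Gen TYPE('u) T A\<^sub>T,
     BA_flat \<and> sigma_category TYPE('u) T C\<^sub>T = sigma_category TYPE('u) T A\<^sub>T \<and>
       dual_hom_functor_fully_faithful_on_Gen TYPE('u) A C x,
     colin_hom_functor_faithful TYPE('u) A C x,
     comodule_generator TYPE('u) A C (base_comodule A C x)]"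
proof -
  \<comment> \<open>Local projectivity is traded for local dual bases.\<close>
  interpret dual_basis_coring A C
    by (rule dual_basis_coring.intro [OF C], unfold_locales)
       (rule locally_projective_dual_basis [OF locally_projective universe])
  interpret grouplike_coring A C x by unfold_locales (rule x)
  let ?H = "generates_rational TYPE('u)" and ?flat = "flat TYPE('u) (coinv_ring A C x) (left_regular A)"
  note c2 = galois_flat_iff [OF universe] and c5 = weak_structure_iff [OF universe]
  have c1: "weak_structure_theorem TYPE('u) A C x \<longleftrightarrow> ?H"
    unfolding c5 [symmetric] weak_structure_theorem_def using Psi_iso_iff by blast
  have c3: "?flat \<and> \<Psi>'_iso A C x (coring_comodule C) \<longleftrightarrow> ?H"
    unfolding c2 [symmetric] galois_iff Psi'_iso_iff [OF comodule_coring] ..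
  \<comment> \<open>Flatness is extracted from \<open>c2\<close>, and
    \<open>generated_regular\<close> supplies the generation premise for every comodule.\<close>
  have c4: "?flat \<and> (\<forall>M :: ('a, 'c, 'u) comodule. comodule A C M \<and> generated A (right_regular A) M
      \<longrightarrow> \<Psi>'_bijective A C x M) \<longleftrightarrow> ?H"
    using c2 unfolding c5 [symmetric] using generated_regular [OF comodule.right] by blast
  have c9: "comodule_generator TYPE('u) A C (base_comodule A C x) \<longleftrightarrow> ?H"
    using generates_rational_generator [OF A(2) universe] generator_generates_rational [OF A(2) universe] by blast
  note c8 = faithful_iff_generator [OF A(2) universe]
  show ?thesis
    unfolding all_equivalent_def BA_flat_def T_def A\<^sub>T_def C\<^sub>T_def
    by (simp only: c1 c2 c3 c4 c5 c8 c9 sigma_eq_Gen_iff [OF A(2) universe] fully_faithful_iff [OF universe A(2)]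
        list.set) simp
qed

end
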